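(* Assume the driver $f$ satisfies (f1)--(f5) and is increasing in $y$. Let $\varphi^n:C^d[0,T]\to\mathbb R$ be a sequence of bounded Lipschitz-continuous functions such that $\varphi^n\uparrow\varphi$ pointwise for a bounded function $\varphi:C^d[0,T]\to\mathbb R$. Let $(Y^n,Z^n)$ be the solution of the BSDE with driver $f$ and terminal condition $\xi^n=\varphi^n(W)$ such that $Z^n$ is bounded. Then $Y^n_t\uparrow Y_t$ a.s. for all $t$, where $(Y,Z,A)$ is a supersolution of the BSDE with driver $f$ and terminal condition $\xi=\varphi(W)$ satisfying bounded comparison from above such that $Y$ is bounded and $Z$ is a BMO process.
   Context: Setting. $T\in(0,\infty)$; $W$ is a $d$-dimensional Brownian motion on $(\Omega,\mathcal F,\mathbb P)$, $(\mathcal F_t)_{t\in[0,T]}$ its augmented filtration; (in)equalities between random variables hold a.s. $|\cdot|$ is the Euclidean norm, $C^d[0,T]$ the space of continuous $w:[0,T]\to\mathbb R^d$ with the supremum norm; Lipschitz is with respect to this norm. $\mathcal P$ is the predictable $\sigma$-algebra on $[0,T]\times C^d[0,T]$ for the filtration generated by the coordinate process. A driver is a $\mathcal P\otimes\mathcal B(\mathbb R)\otimes\mathcal B(\mathbb R^d)$-measurable function $f:[0,T]\times C^d[0,T]\times\mathbb R\times\mathbb R^d\to\mathbb R$. The BSDE with driver $f$ and ($\mathcal F_T$-measurable) terminal condition $\xi$ is $$Y_t=\xi+\int_t^Tf(s,W,Y_s,Z_s)ds-\int_t^TZ_s\,dW_s,\quad0\le t\le T,$$ where $Z_s\,dW_s=\sum_kZ^k_s\,dW^k_s$.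 A solution is a pair of predictable processes $(Y,Z)$ with values in $\mathbb R\times\mathbb R^d$ such that $\int_0^T|f(s,W,Y_s,Z_s)|ds<\infty$, $\int_0^T|Z_s|^2ds<\infty$ and the equation holds for all $t$. A supersolution is a triple of predictable processes $(Y,Z,A)$ with values in $\mathbb R\times\mathbb R^d\times\mathbb R$ such that $Y$ is RCLL (right-continuous with left limits), $A$ is increasing, RCLL and starts at $0$, the same integrability holds, and $Y_t=\xi+\int_t^Tf(s,W,Y_s,Z_s)ds-\int_t^TZ_s\,dW_s+A_T-A_t$ for all $t$. "Increasing" is in the weak sense. A supersolution $(Y,Z,A)$ of the BSDE with $(f,\xi)$ satisfies bounded comparison from above if for every supersolution $(Y',Z',A')$ of the BSDE with a driver $f'\ge f$ and terminal condition $\xi'\ge\xi$ such that $Y'$ is bounded, one has $Y'_t\ge Y_t$ for all $t$. A $d$-dimensional predictable process $\mu$ is BMO if there is $C\in\mathbb R_+$ with $\mathbb E[\int_\tau^T|\mu_s|^2ds\mid\mathcal F_\tau]\le C$ for all $[0,T]$-valued stopping times $\tau$. Conditions on $f$: (f1) $f(t,w,y,z)$ is convex in $z$. (f2) $\sup_{t,w}|f(t,w,0,0)|<\infty$. (f3) There is $K\in\mathbb R_+$ with $|f(t,w_1,y_1,z)-f(t,w_2,y_2,z)|\le K(\sup_{0\le s\le t}|w_1(s)-w_2(s)|+|y_1-y_2|)$ for all $t,w_1,w_2,y_1,y_2,z$. (f4) For every $a\in\mathbb R_+$ there is $b\in\mathbb R_+$ with $|f(t,w,y,z_1)-f(t,w,y,z_2)|\le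 b|z_1-z_2|$ for all $t,w,y$ and all $|z_1|\vee|z_2|\le a$. (f5) $\inf_{w\in C^d[0,T],\,y\in[-c,c],\,z\in\mathbb R^d,\,t\in[0,T]}f(t,w,y,z)>-\infty$ for all $c\in\mathbb R_+$. Under (f1)--(f4), for every terminal condition $\varphi(W)$ with $\varphi$ Lipschitz-continuous, the BSDE has a unique solution $(Y,Z)$ with $Z$ bounded; this is the solution $(Y^n,Z^n)$ referred to. *)

theory Defs
  imports "HOL-Probability.Probability"
begin

section \<open>Path space and predictability\<close>

text \<open>
  The space of continuous functions from \<open>{0..T}\<close> to a topological space, represented by functions
  that take the dummy value \<open>undefined\<close> outside \<open>{0..T}\<close>.
\<close>

definition path_space :: "real \<Rightarrow> (real \<Rightarrow> 'b::topological_space) set" where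
  "path_space T = {w \<in> extensional {0..T}. continuous_on {0..T} w}"

definition sample_path :: "real \<Rightarrow> (real \<Rightarrow> 'a \<Rightarrow> 'b) \<Rightarrow> 'a \<Rightarrow> real \<Rightarrow> 'b" where
  "sample_path T X \<omega> = (\<lambda>t\<in>{0..T}. X t \<omega>)"

definition natural_filtration ::
  "'a set \<Rightarrow> (real \<Rightarrow> 'a \<Rightarrow> 'b::topological_space) \<Rightarrow> real \<Rightarrow> 'a measure" where
  "natural_filtration \<Omega> X t = sigma \<Omega> (\<Union>s\<in>{0..t}. {X s -` B \<inter> \<Omega> | B. B \<in> sets borel})"

definition predictable_sigma :: "real \<Rightarrow> 'a set \<Rightarrow> (real \<Rightarrow> 'a measure) \<Rightarrow> (real \<times> 'a) measure" where
  "predictable_sigma T \<Omega> F = sigma ({0..T} \<times> \<Omega>)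
     ({{0} \<times> A | A. A \<in> sets (F 0)} \<union>
      {{s<..t} \<times> A | s t A. 0 \<le> s \<and> s < t \<and> t \<le> T \<and> A \<in> sets (F s)})"

section \<open>Brownian motion, its augmented filtration and processes\<close>

definition brownian_motion ::
  "'a measure \<Rightarrow> real \<Rightarrow> (real \<Rightarrow> 'a \<Rightarrow> real ^ 'd) \<Rightarrow> bool" where
  "brownian_motion M T W \<longleftrightarrow>
     (\<forall>t\<in>{0..T}. W t \<in> borel_measurable M) \<and>
     (\<forall>\<omega>\<in>space M. continuous_on {0..T} (\<lambda>t. W t \<omega>)) \<and>
     (AE \<omega> in M. W 0 \<omega> = 0) \<and>
     (\<forall>s t. 0 \<le> s \<and> s < t \<and> t \<le> T \<longrightarrow>
        distributed M lborel (\<lambda>\<omega>. W t \<omega> - W s \<omega>)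
          (\<lambda>x. \<Prod>k\<in>UNIV. normal_density 0 (sqrt (t - s)) (x $ k)) \<and>
        prob_space.indep_set M (sets (natural_filtration (space M) W s))
          (sets (vimage_algebra (space M) (\<lambda>\<omega>. W t \<omega> - W s \<omega>) borel)))"

text \<open>
  \<open>M\<close> need not be complete, so the natural filtration is augmented by the null sets of
  \<open>completion M\<close>; the resulting \<open>\<sigma>\<close>-algebras lie between the trivial one and \<open>completion M\<close>.
  The time index is capped at \<open>T\<close>, so that the library notions for filtrations indexed by the
  whole of \<open>real\<close> agree with those for the index set \<open>{0..T}\<close>.
\<close>

definition aug_filtration ::
  "'a measure \<Rightarrow> real \<Rightarrow> (real \<Rightarrow> 'a \<Rightarrow> real ^ 'd) \<Rightarrow> real \<Rightarrow> 'a measure" where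
  "aug_filtration M T W t = sigma (space M)
     (sets (natural_filtration (space M) W (min t T)) \<union> null_sets (completion M))"

lemma sets_natural_filtration:
  "sets (natural_filtration \<Omega> X t) =
     sigma_sets \<Omega> (\<Union>s\<in>{0..t}. {X s -` B \<inter> \<Omega> | B. B \<in> sets borel})"
  unfolding natural_filtration_def by (intro sets_measure_of) auto

lemma sets_aug_filtration:
  "sets (aug_filtration M T W t) =
     sigma_sets (space M) (sets (natural_filtration (space M) W (min t T)) \<union> null_sets (completion M))"
  unfolding aug_filtration_def
  by (intro sets_measure_of)
     (use sets.space_closed[of "completion M"] sets.space_closed[of "natural_filtration (space M) W (min t T)"]
       in \<open>auto simp: natural_filtration_def space_measure_of_conv\<close>)

lemma space_aug_filtration [simp]: "space (aug_filtration M T W t) = space M"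
  unfolding aug_filtration_def by (simp add: space_measure_of_conv)

lemma filtration_aug_filtration: "filtration (space M) (aug_filtration M T W)"
proof
  fix s t :: real assume "s \<le> t"
  then have "sets (natural_filtration (space M) W (min s T)) \<subseteq> sets (natural_filtration (space M) W (min t T))"
    unfolding sets_natural_filtration by (intro sigma_sets_mono') fastforce
  then show "sets (aug_filtration M T W s) \<subseteq> sets (aug_filtration M T W t)"
    unfolding sets_aug_filtration by (intro sigma_sets_mono') blast
qed simp

lemma subalgebra_aug_filtration:
  assumes "\<And>t. t \<in> {0..T} \<Longrightarrow> W t \<in> borel_measurable M"
  shows "subalgebra (completion M) (aug_filtration M T W t)"
proof -
  have "sigma_sets (space M) (\<Union>s\<in>{0..min t T}. {W s -` B \<inter> space M | B. B \<in> sets borel}) \<subseteq> sets M"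
    using assms by (intro sets.sigma_sets_subset) (fastforce intro: measurable_sets)
  then have "sets (natural_filtration (space M) W (min t T)) \<subseteq> sets (completion M)"
    unfolding sets_natural_filtration by (auto intro: sets_completionI_sets)
  then have "sigma_sets (space (completion M))
      (sets (natural_filtration (space M) W (min t T)) \<union> null_sets (completion M)) \<subseteq> sets (completion M)"
    by (intro sets.sigma_sets_subset) auto
  then show ?thesis
    by (simp add: subalgebra_def sets_aug_filtration)
qed

text \<open>In particular the conditional expectations in the definition of BMO processes below are
  taken with respect to a subalgebra, as \<open>nn_cond_exp\<close> requires.\<close>

lemma subalgebra_pre_sigma_aug_filtration:
  assumes W: "\<And>t. t \<in> {0..T} \<Longrightarrow> W t \<in> borel_measurable M"
    and \<tau>: "stopping_time (aug_filtration M T W) \<tau>" "\<tau> \<in> space M \<rightarrow> {0..T}"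
  shows "subalgebra (completion M) (filtration.pre_sigma (space M) (aug_filtration M T W) \<tau>)"
proof -
  interpret filtration "space M" "aug_filtration M T W"
    by (rule filtration_aug_filtration)
  have sub: "sets (aug_filtration M T W T) \<subseteq> sets (completion M)"
    using subalgebra_aug_filtration[OF W] by (auto simp: subalgebra_def)
  have "A \<in> sets (completion M)" if A: "A \<in> sets (pre_sigma \<tau>)" for A
  proof -
    have "A \<subseteq> space M"
      using sets.sets_into_space[OF A] by (simp add: space_pre_sigma)
    then have "{\<omega> \<in> A. \<tau> \<omega> \<le> T} = A"
      using \<tau>(2) by auto
    then show ?thesis
      using sets_pre_sigmaD[OF \<tau>(1) A, of T] sub by auto
  qed
  then show ?thesis
    by (auto simp: subalgebra_def space_pre_sigma)
qed

definition predictable ::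
  "'a measure \<Rightarrow> real \<Rightarrow> (real \<Rightarrow> 'a \<Rightarrow> real ^ 'd) \<Rightarrow> (real \<Rightarrow> 'a \<Rightarrow> 'b::topological_space) \<Rightarrow> bool" where
  "predictable M T W X \<longleftrightarrow>
     (\<lambda>(t, \<omega>). X t \<omega>) \<in> borel_measurable (predictable_sigma T (space M) (aug_filtration M T W))"

definition bounded_process ::
  "'a measure \<Rightarrow> real \<Rightarrow> (real \<Rightarrow> 'a \<Rightarrow> 'b::real_normed_vector) \<Rightarrow> bool" where
  "bounded_process M T X \<longleftrightarrow> (\<exists>C. \<forall>t\<in>{0..T}. AE \<omega> in M. norm (X t \<omega>) \<le> C)"

definition rcll_on :: "real \<Rightarrow> (real \<Rightarrow> real) \<Rightarrow> bool" where
  "rcll_on T x \<longleftrightarrow>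
     (\<forall>t\<in>{0..<T}. (x \<longlongrightarrow> x t) (at_right t)) \<and>
     (\<forall>t\<in>{0<..T}. \<exists>l. (x \<longlongrightarrow> l) (at_left t))"

definition BMO_process ::
  "'a measure \<Rightarrow> real \<Rightarrow> (real \<Rightarrow> 'a \<Rightarrow> real ^ 'd) \<Rightarrow> (real \<Rightarrow> 'a \<Rightarrow> real ^ 'd) \<Rightarrow> bool" where
  "BMO_process M T W \<mu> \<longleftrightarrow> predictable M T W \<mu> \<and>
     (\<exists>C\<ge>0. \<forall>\<tau>. stopping_time (aug_filtration M T W) \<tau> \<and> \<tau> \<in> space M \<rightarrow> {0..T} \<longrightarrow>
        (AE \<omega> in M. nn_cond_exp (completion M)
             (filtration.pre_sigma (space M) (aug_filtration M T W) \<tau>)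
             (\<lambda>\<omega>. \<integral>\<^sup>+ s \<in> {\<tau> \<omega>..T}. ennreal ((norm (\<mu> s \<omega>))\<^sup>2) \<partial>lborel) \<omega> \<le> ennreal C))"

section \<open>Stochastic integral\<close>

definition simple_integrand ::
  "'a measure \<Rightarrow> real \<Rightarrow> (real \<Rightarrow> 'a \<Rightarrow> real ^ 'd) \<Rightarrow> nat \<Rightarrow> (nat \<Rightarrow> real) \<Rightarrow> (nat \<Rightarrow> 'a \<Rightarrow> real ^ 'd) \<Rightarrow> bool"
where
  "simple_integrand M T W m p h \<longleftrightarrow>
     0 \<le> p 0 \<and> p m \<le> T \<and> (\<forall>i<m. p i \<le> p (Suc i)) \<and>
     (\<forall>i<m. h i \<in> borel_measurable (aug_filtration M T W (p i)) \<and> bounded (h i ` space M))"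

definition simple_process ::
  "nat \<Rightarrow> (nat \<Rightarrow> real) \<Rightarrow> (nat \<Rightarrow> 'a \<Rightarrow> real ^ 'd) \<Rightarrow> real \<Rightarrow> 'a \<Rightarrow> real ^ 'd" where
  "simple_process m p h t \<omega> = (\<Sum>i<m. indicator {p i<..p (Suc i)} t *\<^sub>R h i \<omega>)"

definition simple_integral ::
  "(real \<Rightarrow> 'a \<Rightarrow> real ^ 'd) \<Rightarrow> nat \<Rightarrow> (nat \<Rightarrow> real) \<Rightarrow> (nat \<Rightarrow> 'a \<Rightarrow> real ^ 'd) \<Rightarrow> real \<Rightarrow> 'a \<Rightarrow> real" where
  "simple_integral W m p h t \<omega> = (\<Sum>i<m. h i \<omega> \<bullet> (W (min t (p (Suc i))) \<omega> - W (min t (p i)) \<omega>))"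

definition tendsto_0_in_prob :: "'a measure \<Rightarrow> (nat \<Rightarrow> 'a \<Rightarrow> ennreal) \<Rightarrow> bool" where
  "tendsto_0_in_prob M X \<longleftrightarrow>
     (\<forall>n. X n \<in> borel_measurable M) \<and>
     (\<forall>\<epsilon>>0. (\<lambda>n. measure M {\<omega> \<in> space M. X n \<omega> > ennreal \<epsilon>}) \<longlonglongrightarrow> 0)"

text \<open>
  \<open>has_ito_integral M T W Z I\<close> states that the process \<open>I\<close> is (a version of) the Ito integral
  process \<open>(\<integral>\<^sub>0\<^sup>t Z\<^sub>s dW\<^sub>s)\<close> for \<open>t\<close> in \<open>{0..T}\<close>, for a predictable \<open>Z\<close> which is almost surely square
  integrable in time: the continuous adapted process obtained as limit, uniformly in time in
  probability, of the integrals of simple processes that approximate \<open>Z\<close> in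
  \<open>L\<^sup>2(0,T)\<close> in probability. Such an \<open>I\<close> exists and is unique up to
  indistinguishability, and does not depend on the approximating sequence.
\<close>

definition has_ito_integral ::
  "'a measure \<Rightarrow> real \<Rightarrow> (real \<Rightarrow> 'a \<Rightarrow> real ^ 'd) \<Rightarrow> (real \<Rightarrow> 'a \<Rightarrow> real ^ 'd) \<Rightarrow> (real \<Rightarrow> 'a \<Rightarrow> real) \<Rightarrow> bool"
where
  "has_ito_integral M T W Z I \<longleftrightarrow>
     (\<forall>t\<in>{0..T}. I t \<in> borel_measurable (aug_filtration M T W t)) \<and>
     (AE \<omega> in M. continuous_on {0..T} (\<lambda>t. I t \<omega>)) \<and>
     (\<exists>m p h. (\<forall>n. simple_integrand M T W (m n) (p n) (h n)) \<and>
        tendsto_0_in_prob (completion M) (\<lambda>n \<omega>. \<integral>\<^sup>+ s \<in> {0..T}.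
           ennreal ((norm (simple_process (m n) (p n) (h n) s \<omega> - Z s \<omega>))\<^sup>2) \<partial>lborel) \<and>
        tendsto_0_in_prob (completion M) (\<lambda>n \<omega>. \<Squnion>t\<in>{0..T}.
           ennreal \<bar>simple_integral W (m n) (p n) (h n) t \<omega> - I t \<omega>\<bar>))"

section \<open>Backward stochastic differential equations\<close>

type_synonym 'd driver = "real \<Rightarrow> (real \<Rightarrow> real ^ 'd) \<Rightarrow> real \<Rightarrow> real ^ 'd \<Rightarrow> real"

definition driver :: "real \<Rightarrow> 'd::finite driver \<Rightarrow> bool" where
  "driver T f \<longleftrightarrow> (\<lambda>(((t, w), y), z). f t w y z) \<in> borel_measurable
     ((predictable_sigma T (path_space T) (natural_filtration (path_space T) (\<lambda>t w. w t))
        \<Otimes>\<^sub>M borel) \<Otimes>\<^sub>M borel)"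

definition bsde_integrable ::
  "'a measure \<Rightarrow> real \<Rightarrow> (real \<Rightarrow> 'a \<Rightarrow> real ^ 'd) \<Rightarrow> 'd driver \<Rightarrow>
   (real \<Rightarrow> 'a \<Rightarrow> real) \<Rightarrow> (real \<Rightarrow> 'a \<Rightarrow> real ^ 'd) \<Rightarrow> bool" where
  "bsde_integrable M T W f Y Z \<longleftrightarrow>
     (AE \<omega> in M. (\<integral>\<^sup>+ s \<in> {0..T}. ennreal \<bar>f s (sample_path T W \<omega>) (Y s \<omega>) (Z s \<omega>)\<bar> \<partial>lborel) < \<infinity>) \<and>
     (AE \<omega> in M. (\<integral>\<^sup>+ s \<in> {0..T}. ennreal ((norm (Z s \<omega>))\<^sup>2) \<partial>lborel) < \<infinity>)"

definition bsde_solution ::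
  "'a measure \<Rightarrow> real \<Rightarrow> (real \<Rightarrow> 'a \<Rightarrow> real ^ 'd) \<Rightarrow> 'd driver \<Rightarrow> ('a \<Rightarrow> real) \<Rightarrow>
   (real \<Rightarrow> 'a \<Rightarrow> real) \<Rightarrow> (real \<Rightarrow> 'a \<Rightarrow> real ^ 'd) \<Rightarrow> bool" where
  "bsde_solution M T W f \<xi> Y Z \<longleftrightarrow>
     driver T f \<and> \<xi> \<in> borel_measurable (aug_filtration M T W T) \<and>
     predictable M T W Y \<and> predictable M T W Z \<and>
     bsde_integrable M T W f Y Z \<and>
     (\<exists>I. has_ito_integral M T W Z I \<and>
       (\<forall>t\<in>{0..T}. AE \<omega> in M.
          Y t \<omega> = \<xi> \<omega> + (LINT s:{t..T}|lborel. f s (sample_path T W \<omega>) (Y s \<omega>) (Z s \<omega>))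
            - (I T \<omega> - I t \<omega>)))"

definition bsde_supersolution ::
  "'a measure \<Rightarrow> real \<Rightarrow> (real \<Rightarrow> 'a \<Rightarrow> real ^ 'd) \<Rightarrow> 'd driver \<Rightarrow> ('a \<Rightarrow> real) \<Rightarrow>
   (real \<Rightarrow> 'a \<Rightarrow> real) \<Rightarrow> (real \<Rightarrow> 'a \<Rightarrow> real ^ 'd) \<Rightarrow> (real \<Rightarrow> 'a \<Rightarrow> real) \<Rightarrow> bool" where
  "bsde_supersolution M T W f \<xi> Y Z A \<longleftrightarrow>
     driver T f \<and> \<xi> \<in> borel_measurable (aug_filtration M T W T) \<and>
     predictable M T W Y \<and> predictable M T W Z \<and> predictable M T W A \<and>
     (AE \<omega> in M. rcll_on T (\<lambda>t. Y t \<omega>)) \<and>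
     (AE \<omega> in M. mono_on {0..T} (\<lambda>t. A t \<omega>) \<and> rcll_on T (\<lambda>t. A t \<omega>) \<and> A 0 \<omega> = 0) \<and>
     bsde_integrable M T W f Y Z \<and>
     (\<exists>I. has_ito_integral M T W Z I \<and>
       (\<forall>t\<in>{0..T}. AE \<omega> in M.
          Y t \<omega> = \<xi> \<omega> + (LINT s:{t..T}|lborel. f s (sample_path T W \<omega>) (Y s \<omega>) (Z s \<omega>))
            - (I T \<omega> - I t \<omega>) + A T \<omega> - A t \<omega>))"

text \<open>The property of a supersolution \<open>(Y, Z, A)\<close> of the equation with data \<open>f\<close> and \<open>\<xi>\<close>
  depends on its first component only.\<close>

definition bounded_comparison_from_above ::
  "'a measure \<Rightarrow> real \<Rightarrow> (real \<Rightarrow> 'a \<Rightarrow> real ^ 'd) \<Rightarrow> 'd driver \<Rightarrow> ('a \<Rightarrow> real) \<Rightarrow>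
   (real \<Rightarrow> 'a \<Rightarrow> real) \<Rightarrow> bool" where
  "bounded_comparison_from_above M T W f \<xi> Y \<longleftrightarrow>
     (\<forall>f' \<xi>' Y' Z' A'.
        (\<forall>t\<in>{0..T}. \<forall>w\<in>path_space T. \<forall>y z. f t w y z \<le> f' t w y z) \<and>
        (AE \<omega> in M. \<xi> \<omega> \<le> \<xi>' \<omega>) \<and>
        bsde_supersolution M T W f' \<xi>' Y' Z' A' \<and> bounded_process M T Y' \<longrightarrow>
        (\<forall>t\<in>{0..T}. AE \<omega> in M. Y t \<omega> \<le> Y' t \<omega>))"

section \<open>Conditions on the driver and the terminal condition\<close>

definition f1 :: "real \<Rightarrow> 'd::finite driver \<Rightarrow> bool" where
  "f1 T f \<longleftrightarrow> (\<forall>t\<in>{0..T}. \<forall>w\<in>path_space T. \<forall>y. convex_on UNIV (f t w y))"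

definition f2 :: "real \<Rightarrow> 'd::finite driver \<Rightarrow> bool" where
  "f2 T f \<longleftrightarrow> bdd_above ((\<lambda>(t, w). \<bar>f t w 0 0\<bar>) ` ({0..T} \<times> path_space T))"

definition f3 :: "real \<Rightarrow> 'd::finite driver \<Rightarrow> bool" where
  "f3 T f \<longleftrightarrow> (\<exists>K\<ge>0. \<forall>t\<in>{0..T}. \<forall>w1\<in>path_space T. \<forall>w2\<in>path_space T. \<forall>y1 y2 z.
     \<bar>f t w1 y1 z - f t w2 y2 z\<bar> \<le> K * ((\<Squnion>s\<in>{0..t}. norm (w1 s - w2 s)) + \<bar>y1 - y2\<bar>))"

definition f4 :: "real \<Rightarrow> 'd::finite driver \<Rightarrow> bool" where
  "f4 T f \<longleftrightarrow> (\<forall>a\<ge>0. \<exists>b\<ge>0. \<forall>t\<in>{0..T}. \<forall>w\<in>path_space T. \<forall>y z1 z2.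
     max (norm z1) (norm z2) \<le> a \<longrightarrow> \<bar>f t w y z1 - f t w y z2\<bar> \<le> b * norm (z1 - z2))"

definition f5 :: "real \<Rightarrow> 'd::finite driver \<Rightarrow> bool" where
  "f5 T f \<longleftrightarrow> (\<forall>c\<ge>0. bdd_below ((\<lambda>(t, w, y, z). f t w y z) ` ({0..T} \<times> path_space T \<times> {-c..c} \<times> UNIV)))"

definition increasing_in_y :: "real \<Rightarrow> 'd::finite driver \<Rightarrow> bool" where
  "increasing_in_y T f \<longleftrightarrow> (\<forall>t\<in>{0..T}. \<forall>w\<in>path_space T. \<forall>z. mono (\<lambda>y. f t w y z))"

definition lipschitz_functional :: "real \<Rightarrow> ((real \<Rightarrow> real ^ 'd) \<Rightarrow> real) \<Rightarrow> bool" where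
  "lipschitz_functional T \<phi> \<longleftrightarrow> (\<exists>L\<ge>0. \<forall>w1\<in>path_space T. \<forall>w2\<in>path_space T.
     \<bar>\<phi> w1 - \<phi> w2\<bar> \<le> L * (\<Squnion>t\<in>{0..T}. norm (w1 t - w2 t)))"

end

theory Submission
  imports Defs
begin

text \<open>
  The proof uses neither the Ito formula nor Girsanov's theorem nor martingale representation. For simple
  integrands \<open>exp (c \<integral> h dW - c\<^sup>2/2 \<integral> \<bar>h\<bar>\<^sup>2 ds)\<close> has conditional mean one. This gives a Bernstein inequality
  and with it the Ito integral of general integrands, and it replaces Girsanov's theorem in the comparison
  of solutions: let \<open>D\<close> be bounded from above with \<open>D\<^sub>T \<le> 0\<close> and
  \<open>D\<^sub>s \<le> D\<^sub>t + \<integral> (K D\<^sup>+ + b \<bar>Z\<bar>) dr - \<integral> Z dW\<close>. Since \<open>l b \<bar>Z\<bar> \<le> l\<^sup>2 \<bar>Z\<bar>\<^sup>2/2 + b\<^sup>2/2\<close>, the exponential identity with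
  parameter \<open>l \<longrightarrow> \<infinity>\<close> turns a bound \<open>D\<^sub>t \<le> c exp (a (T - t))\<close> into the same bound with \<open>c/2\<close>, and iteration yields
  \<open>D \<le> 0\<close>. The difference of \<open>Y\<^sup>n\<close> and a supersolution is of this form because \<open>Z\<^sup>n\<close> is bounded and \<open>f\<close> is convex
  in \<open>z\<close>.

  Because \<open>f\<close> is bounded below, \<open>\<integral> f ds\<close> is increasing up to a linear term, and the uniform bound on \<open>Y\<^sup>n\<close>
  gives a uniform bound on the conditional energies of \<open>Z\<^sup>n\<close>. Hence convex combinations of the \<open>Z\<^sup>n\<close> converge
  in \<open>L\<^sup>2\<close>. By convexity, monotonicity in \<open>y\<close> and Fatou's lemma, \<open>Y\<^sub>s \<ge> Y\<^sub>t + \<integral> f dr - \<integral> Z dW\<close> in the limit, which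
  makes \<open>A\<close> increasing. Thus \<open>Y\<close> is a decreasing process plus a continuous one and an increasing limit of
  continuous processes, so it is right-continuous.
\<close>

section \<open>Predictable processes\<close>

text \<open>The exponential identity is used with non-negative weights known at time t, so every
  estimate is conditional on \<open>F t\<close>. On B = {D_t > R + \<epsilon>} it gives P(B) as the
  integral of the exponential over B, while the hypotheses bound the exponent by c - l \<epsilon>
  with c independent of l; letting l grow forces P(B) = 0. The obstacle is that the identity is
  proved for simple integrands and its L2 control requires bounded energy, so approximants are
  stopped before their energy exceeds a level k. A stopped path may end at a time s < T, where D_s
  is only known to be bounded from above; the price is a factor exp (l M0) on an event whose
  probability vanishes as k grows. This is why the hypothesis of the exponential step concerns all
  intermediate times. Weak compactness is replaced by selecting nearly norm-minimal elements from
  decreasing midpoint-closed families, where the parallelogram law gives the Cauchy property. Each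
  element carries its own integral, process and drift, so the inequalities reach the limit without
  explicit coefficients of convex combinations.\<close>

lemma sets_predictable_sigma:
  assumes "\<And>s. 0 \<le> s \<Longrightarrow> s \<le> T \<Longrightarrow> sets (F s) \<subseteq> Pow \<Omega>" "0 < T"
  shows "sets (predictable_sigma T \<Omega> F) = sigma_sets ({0..T} \<times> \<Omega>)
     ({{0} \<times> A | A. A \<in> sets (F 0)} \<union>
      {{s<..t} \<times> A | s t A. 0 \<le> s \<and> s < t \<and> t \<le> T \<and> A \<in> sets (F s)})"
  unfolding predictable_sigma_def
proof (rule sets_measure_of, intro subsetI PowI)
  fix G x assume G: "G \<in> {{0} \<times> A |A. A \<in> sets (F 0)} \<union>
      {{s<..t} \<times> A |s t A. 0 \<le> s \<and> s < t \<and> t \<le> T \<and> A \<in> sets (F s)}" and x: "x \<in> G"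
  from G show "x \<in> {0..T} \<times> \<Omega>"
  proof
    assume "G \<in> {{0} \<times> A |A. A \<in> sets (F 0)}"
    then show ?thesis using x assms(1)[of 0] assms(2) by auto
  next
    assume "G \<in> {{s<..t} \<times> A |s t A. 0 \<le> s \<and> s < t \<and> t \<le> T \<and> A \<in> sets (F s)}"
    then obtain s t A where "G = {s<..t} \<times> A" "0 \<le> s" "s < t" "t \<le> T" "A \<in> sets (F s)" by auto
    then show ?thesis using x assms(1)[of s] by auto
  qed
qed

lemma space_predictable_sigma [simp]: "space (predictable_sigma T \<Omega> F) = {0..T} \<times> \<Omega>"
  unfolding predictable_sigma_def by (simp add: space_measure_of_conv)

text \<open>Events of the augmented filtration are measurable only for \<open>completion M\<close>,
  so integrals are taken under \<open>P\<close>, whereas almost sure statements stay over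
  \<open>M\<close>; \<open>AE_P\<close> moves between the two.\<close>

locale brownian_setup = prob_space M for M :: "'a measure" +
  fixes T :: real and W :: "real \<Rightarrow> 'a \<Rightarrow> real ^ 'd"
  assumes T_pos: "0 < T" and bm: "brownian_motion M T W"
begin

abbreviation "F \<equiv> aug_filtration M T W"
abbreviation "P \<equiv> completion M"
abbreviation nn_expectation :: "('a \<Rightarrow> ennreal) \<Rightarrow> ennreal" (binder "\<E>" 10) where
  "nn_expectation X \<equiv> integral\<^sup>N P X"
abbreviation "pred \<equiv> predictable_sigma T (space M) F"

sublocale P: prob_space P
  by (rule prob_space_completion)

lemma W_measurable: "t \<in> {0..T} \<Longrightarrow> W t \<in> borel_measurable M"
  using bm by (auto simp: brownian_motion_def)

lemma W_cont: "w \<in> space M \<Longrightarrow> continuous_on {0..T} (\<lambda>t. W t w)"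
  using bm by (auto simp: brownian_motion_def)

lemma sub_F: "subalgebra P (F t)"
  by (rule subalgebra_aug_filtration) (rule W_measurable)

lemma F_sub_P: "A \<in> sets (F t) \<Longrightarrow> A \<in> sets P"
  using sub_F[of t] by (auto simp: subalgebra_def)

lemma F_mono: "s \<le> t \<Longrightarrow> sets (F s) \<subseteq> sets (F t)"
proof -
  interpret filtration "space M" F by (rule filtration_aug_filtration)
  show "s \<le> t \<Longrightarrow> sets (F s) \<subseteq> sets (F t)" by (rule sets_F_mono)
qed

lemma measurable_F_P: "X \<in> measurable (F t) N \<Longrightarrow> X \<in> measurable P N"
  using measurable_from_subalg[OF sub_F] .

lemma measurable_F_mono: "X \<in> measurable (F s) N \<Longrightarrow> s \<le> t \<Longrightarrow> X \<in> measurable (F t) N"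
  using F_mono[of s t] by (auto simp: measurable_def)

lemma null_in_F: "N \<in> null_sets P \<Longrightarrow> N \<in> sets (F t)"
  unfolding sets_aug_filtration by (rule sigma_sets.Basic) auto

lemma W_in_F: "0 \<le> u \<Longrightarrow> u \<le> s \<Longrightarrow> s \<le> T \<Longrightarrow> W u \<in> borel_measurable (F s)"
proof (rule measurableI)
  fix B :: "(real^'d) set" assume "0 \<le> u" "u \<le> s" "s \<le> T" "B \<in> sets borel"
  then have "W u -` B \<inter> space M \<in> sets (natural_filtration (space M) W (min s T))"
    unfolding sets_natural_filtration by (intro sigma_sets.Basic UN_I[of u]) auto
  then show "W u -` B \<inter> space (F s) \<in> sets (F s)"
    unfolding sets_aug_filtration by (auto intro: sigma_sets.Basic)
qed simp

lemma AE_P: "(AE w in P. Q w) \<longleftrightarrow> (AE w in M. Q w)"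
  by (rule AE_completion_iff)

text \<open>Adaptedness survives changes on null sets because the filtration contains all of them:
  \<open>B\<close> differs from \<open>A\<close> only inside a null set, and subsets of null sets
  are null in the completion.\<close>

lemma F_AE_set:
  assumes A: "A \<in> sets (F t)" and "B \<subseteq> space M" and eq: "AE w in M. w \<in> A \<longleftrightarrow> w \<in> B"
  shows "B \<in> sets (F t)"
proof -
  define N where "N = {w\<in>space P. \<not> (w \<in> A \<longleftrightarrow> w \<in> B)}"
  have N: "N \<in> null_sets P"
    unfolding N_def using eq completion.AE_iff_null_sets[of "\<lambda>w. w \<in> A \<longleftrightarrow> w \<in> B" M]
    by (simp add: AE_completion_iff)
  have AN: "B \<inter> N \<in> null_sets P"
    by (rule completion.complete2[OF _ N]) auto
  have sA: "A \<subseteq> space M" using sets.sets_into_space[OF A] by simp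
  have "B = (A - N) \<union> (B \<inter> N)"
    using sA assms(2) by (auto simp: N_def)
  moreover have "(A - N) \<union> (B \<inter> N) \<in> sets (F t)"
    using A null_in_F[OF N] null_in_F[OF AN] by auto
  ultimately show ?thesis by simp
qed

lemma F_AE_cong:
  fixes X Y :: "'a \<Rightarrow> 'b::topological_space"
  assumes X: "X \<in> borel_measurable (F t)" and eq: "AE w in M. X w = Y w"
  shows "Y \<in> borel_measurable (F t)"
proof (rule measurableI)
  fix B :: "'b set" assume B: "B \<in> sets borel"
  show "Y -` B \<inter> space (F t) \<in> sets (F t)"
  proof (rule F_AE_set)
    show "X -` B \<inter> space (F t) \<in> sets (F t)" using X B by (rule measurable_sets)
    show "AE w in M. (w \<in> X -` B \<inter> space (F t)) = (w \<in> Y -` B \<inter> space (F t))"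
      using eq by eventually_elim auto
  qed auto
qed auto

section \<open>Progressive measurability of predictable processes\<close>

lemma sets_pred: "sets pred = sigma_sets ({0..T} \<times> space M)
     ({{0} \<times> A | A. A \<in> sets (F 0)} \<union>
      {{s<..t} \<times> A | s t A. 0 \<le> s \<and> s < t \<and> t \<le> T \<and> A \<in> sets (F s)})"
  by (rule sets_predictable_sigma) (use T_pos sets.space_closed[of "F _"] in auto)

text \<open>Checked on the generating rectangles: \<open>{s<..u} \<times> A\<close> meets
  \<open>{0..t} \<times> space M\<close> only if \<open>s < t\<close>, and then \<open>A\<close> is
  already in \<open>F t\<close>. Complements are taken relative to
  \<open>{0..t} \<times> space M\<close>.\<close>

lemma progressive_sets:
  assumes G: "G \<in> sets pred" and t: "t \<le> T"
  shows "G \<inter> ({0..t} \<times> space M) \<in> sets (borel \<Otimes>\<^sub>M F t)"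
proof (cases "0 \<le> t")
  case False then show ?thesis by simp
next
  case t0: True
  have sq: "{0..t} \<times> space M \<in> sets (borel \<Otimes>\<^sub>M F t)"
    by (rule pair_measureI) (use sets.top[of "F t"] in auto)
  from G[unfolded sets_pred] show ?thesis
  proof (induction rule: sigma_sets.induct)
    case (Basic G)
    then show ?case
    proof
      assume "G \<in> {{0} \<times> A |A. A \<in> sets (F 0)}"
      then obtain A where A: "G = {0} \<times> A" "A \<in> sets (F 0)" by auto
      have "A \<subseteq> space M" using sets.sets_into_space[OF A(2)] by simp
      then have "G \<inter> ({0..t} \<times> space M) = {0} \<times> A" using t0 A by auto
      also have "\<dots> \<in> sets (borel \<Otimes>\<^sub>M F t)"
        by (rule pair_measureI) (use A(2) F_mono[OF t0] in auto)
      finally show ?thesis .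
    next
      assume "G \<in> {{s<..t} \<times> A |s t A. 0 \<le> s \<and> s < t \<and> t \<le> T \<and> A \<in> sets (F s)}"
      then obtain s u A where A: "G = {s<..u} \<times> A" "0 \<le> s" "A \<in> sets (F s)" by auto
      have sA: "A \<subseteq> space M" using sets.sets_into_space[OF A(3)] by simp
      show ?thesis
      proof (cases "s < t")
        case True
        have "G \<inter> ({0..t} \<times> space M) = {s<..min u t} \<times> A" using A sA by auto
        also have "\<dots> \<in> sets (borel \<Otimes>\<^sub>M F t)"
          by (rule pair_measureI) (use A(3) F_mono[of s t] True in auto)
        finally show ?thesis .
      next
        case False
        then have "G \<inter> ({0..t} \<times> space M) = {}" using A by auto
        then show ?thesis by simp
      qed
    qed
  next
    case Empty then show ?case by simp
  next
    case (Compl G)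
    have "({0..T} \<times> space M - G) \<inter> ({0..t} \<times> space M) = {0..t} \<times> space M - G \<inter> ({0..t} \<times> space M)"
      using t by auto
    then show ?case using Compl.IH sq by auto
  next
    case (Union G)
    have "(\<Union>i. G i) \<inter> ({0..t} \<times> space M) = (\<Union>i. G i \<inter> ({0..t} \<times> space M))" by auto
    also have "\<dots> \<in> sets (borel \<Otimes>\<^sub>M F t)" using Union.IH by (intro sets.countable_UN) auto
    finally show ?case .
  qed
qed

text \<open>Predictability says nothing about times outside \<open>{0..T}\<close>, so the process is
  continued by a constant \<open>c\<close> outside \<open>{0..t}\<close> to obtain a measurable
  function for all real times. The same device recurs in \<open>joint_measurable\<close> and
  \<open>section_measurable\<close>.\<close>

lemma progressive:
  assumes X: "(\<lambda>(s, w). X s w) \<in> measurable pred N" and t: "t \<le> T" and c: "c \<in> space N"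
  shows "(\<lambda>(s, w). if s \<in> {0..t} then X s w else c) \<in> measurable (borel \<Otimes>\<^sub>M F t) N"
proof (rule measurableI)
  fix x :: "real \<times> 'a" assume "x \<in> space (borel \<Otimes>\<^sub>M F t)"
  then obtain s w where x: "x = (s, w)" "w \<in> space M" by (auto simp: space_pair_measure)
  show "(case x of (s, w) \<Rightarrow> if s \<in> {0..t} then X s w else c) \<in> space N"
    using measurable_space[OF X, of "(s, w)"] x t c by auto
next
  fix B assume B: "B \<in> sets N"
  define G where "G = (\<lambda>(s, w). X s w) -` B \<inter> space pred"
  have G: "G \<in> sets pred" unfolding G_def using X B by (rule measurable_sets)
  have sq: "(if c \<in> B then (- {0..t}) \<times> space M else {}) \<in> sets (borel \<Otimes>\<^sub>M F t)"
    using pair_measureI[of "- {0..t}" borel "space M" "F t"] sets.top[of "F t"] by auto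
  have "(\<lambda>(s, w). if s \<in> {0..t} then X s w else c) -` B \<inter> space (borel \<Otimes>\<^sub>M F t)
      = G \<inter> ({0..t} \<times> space M) \<union> (if c \<in> B then (- {0..t}) \<times> space M else {})"
    using t by (auto simp: G_def space_pair_measure split: if_splits)
  also have "\<dots> \<in> sets (borel \<Otimes>\<^sub>M F t)"
    using progressive_sets[OF G t] sq by (rule sets.Un)
  finally show "(\<lambda>(s, w). if s \<in> {0..t} then X s w else c) -` B \<inter> space (borel \<Otimes>\<^sub>M F t) \<in> sets (borel \<Otimes>\<^sub>M F t)" .
qed

lemma adapted:
  assumes X: "(\<lambda>(s, w). X s w) \<in> measurable pred N" and t: "t \<in> {0..T}"
  shows "X t \<in> measurable (F t) N"
proof -
  \<comment> \<open>The value at one arbitrary point serves as the constant \<open>c\<close>; at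
    time \<open>t\<close> itself the constant is never taken.\<close>
  obtain w0 where "w0 \<in> space M" using not_empty by auto
  then have c: "X 0 w0 \<in> space N"
    using measurable_space[OF X, of "(0, w0)"] T_pos by auto
  have "(\<lambda>w. (t, w)) \<in> measurable (F t) (borel \<Otimes>\<^sub>M F t)" by simp
  from measurable_compose[OF this progressive[OF X _ c]] show ?thesis
    using t by simp
qed

lemma joint_measurable:
  assumes X: "(\<lambda>(s, w). X s w) \<in> measurable pred N" and c: "c \<in> space N"
  shows "(\<lambda>(s, w). if s \<in> {0..T} then X s w else c) \<in> measurable (lborel \<Otimes>\<^sub>M P) N"
proof -
  have "(\<lambda>(s, w). if s \<in> {0..T} then X s w else c) \<in> measurable (borel \<Otimes>\<^sub>M F T) N"
    by (rule progressive[OF X order_refl c])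
  moreover have "sets (borel \<Otimes>\<^sub>M F T) \<subseteq> sets (lborel \<Otimes>\<^sub>M P)"
  proof -
    have "id \<in> measurable (lborel \<Otimes>\<^sub>M P) (borel \<Otimes>\<^sub>M F T)"
    proof (rule measurable_pair)
      show "fst \<circ> id \<in> measurable (lborel \<Otimes>\<^sub>M P) borel" by simp
      have "(\<lambda>w. w) \<in> measurable P (F T)"
        using measurable_F_P[of "\<lambda>w. w" T "F T"] by simp
      then show "snd \<circ> id \<in> measurable (lborel \<Otimes>\<^sub>M P) (F T)"
        by (simp add: comp_def)
    qed
    then have "A \<in> sets (lborel \<Otimes>\<^sub>M P)" if "A \<in> sets (borel \<Otimes>\<^sub>M F T)" for A
      using measurable_sets[OF \<open>id \<in> _\<close> that] sets.sets_into_space[OF that]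
      by (simp add: space_pair_measure Int_absorb2)
    then show ?thesis by auto
  qed
  ultimately show ?thesis by (auto simp: measurable_def space_pair_measure)
qed

lemma section_measurable:
  assumes X: "(\<lambda>(s, w). X s w) \<in> measurable pred N" and c: "c \<in> space N" and w: "w \<in> space M"
  shows "(\<lambda>s. if s \<in> {0..T} then X s w else c) \<in> measurable lborel N"
proof -
  have "(\<lambda>s. (s, w)) \<in> measurable lborel (lborel \<Otimes>\<^sub>M P)" using w by simp
  from measurable_compose[OF this joint_measurable[OF X c]] show ?thesis by simp
qed

text \<open>Progressive measurability, and not mere joint measurability, makes the integral up to
  \<open>b\<close> measurable at time \<open>b\<close>.\<close>

lemma nn_integral_adapted:
  fixes g :: "real \<Rightarrow> 'a \<Rightarrow> ennreal"
  assumes g: "(\<lambda>(s, w). g s w) \<in> borel_measurable pred" and "0 \<le> a" "b \<le> T"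
  shows "(\<lambda>w. \<integral>\<^sup>+ s \<in> {a..b}. g s w \<partial>lborel) \<in> borel_measurable (F b)"
proof -
  have "(\<lambda>x. (case (snd x, fst x) of (s, w) \<Rightarrow> if s \<in> {0..b} then g s w else 0) * indicator {a..b} (snd x))
      \<in> borel_measurable (F b \<Otimes>\<^sub>M lborel)"
    by (intro borel_measurable_times_ennreal measurable_compose[OF _ progressive[OF g \<open>b \<le> T\<close>]]) auto
  then have "(\<lambda>(w, s). (if s \<in> {0..b} then g s w else 0) * indicator {a..b} s)
      \<in> borel_measurable (F b \<Otimes>\<^sub>M lborel)"
    by (simp add: split_beta' cong: if_cong)
  from lborel.borel_measurable_nn_integral[OF this]
  have "(\<lambda>w. \<integral>\<^sup>+ s. (if s \<in> {0..b} then g s w else 0) * indicator {a..b} s \<partial>lborel) \<in> borel_measurable (F b)" .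
  moreover have "(if s \<in> {0..b} then g s w else 0) * indicator {a..b} s = g s w * indicator {a..b} s" for s w
    using \<open>0 \<le> a\<close> by (auto simp: indicator_def)
  ultimately show ?thesis by simp
qed

lemma lebesgue_integral_adapted:
  fixes g :: "real \<Rightarrow> 'a \<Rightarrow> real"
  assumes g: "(\<lambda>(s, w). g s w) \<in> borel_measurable pred" and "0 \<le> a" "b \<le> T"
  shows "(\<lambda>w. LINT s:{a..b}|lborel. g s w) \<in> borel_measurable (F b)"
proof -
  have "(\<lambda>x. indicator {a..b} (snd x) *\<^sub>R (case (snd x, fst x) of (s, w) \<Rightarrow> if s \<in> {0..b} then g s w else 0))
      \<in> borel_measurable (F b \<Otimes>\<^sub>M lborel)"
    by (intro borel_measurable_scaleR measurable_compose[OF _ progressive[OF g \<open>b \<le> T\<close>]]) auto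
  then have "(\<lambda>(w, s). indicator {a..b} s *\<^sub>R (if s \<in> {0..b} then g s w else 0))
      \<in> borel_measurable (F b \<Otimes>\<^sub>M lborel)"
    by (simp add: split_beta' cong: if_cong)
  from lborel.borel_measurable_lebesgue_integral[OF this]
  have "(\<lambda>w. LINT s|lborel. indicator {a..b} s *\<^sub>R (if s \<in> {0..b} then g s w else 0)) \<in> borel_measurable (F b)" .
  moreover have "indicator {a..b} s *\<^sub>R (if s \<in> {0..b} then g s w else 0) = indicator {a..b} s *\<^sub>R g s w" for s w
    using \<open>0 \<le> a\<close> by (auto simp: indicator_def)
  ultimately show ?thesis unfolding set_lebesgue_integral_def by (simp only:)
qed

section \<open>Drivers evaluated along Brownian paths\<close>

lemma sample_path_in: "w \<in> space M \<Longrightarrow> sample_path T W w \<in> path_space T"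
  using W_cont[of w]
  by (auto simp: sample_path_def path_space_def elim!: continuous_on_eq)

lemma sample_path_measurable:
  assumes "s \<in> {0..T}"
  shows "sample_path T W \<in> measurable (F s) (natural_filtration (path_space T) (\<lambda>t w. w t) s)"
  unfolding natural_filtration_def
proof (rule measurable_measure_of)
  show "sample_path T W \<in> space (F s) \<rightarrow> path_space T" using sample_path_in by auto
next
  fix G :: "(real \<Rightarrow> real^'d) set"
  assume "G \<in> (\<Union>u\<in>{0..s}. {(\<lambda>w. w u) -` B \<inter> path_space T |B. B \<in> sets borel})"
  then obtain u B where u: "u \<in> {0..s}" "B \<in> sets borel" "G = (\<lambda>w. w u) -` B \<inter> path_space T" by auto
  have "sample_path T W -` G \<inter> space (F s) = W u -` B \<inter> space (F s)"
    using u assms sample_path_in by (auto simp: sample_path_def)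
  then show "sample_path T W -` G \<inter> space (F s) \<in> sets (F s)"
    using measurable_sets[OF W_in_F[of u s] u(2)] u assms by auto
qed auto

text \<open>The map leaves the time unchanged, so the preimage of a generating rectangle is a
  rectangle over the same set of times, and its base lies in \<open>F s\<close> by
  \<open>sample_path_measurable\<close>.\<close>

lemma path_pred_measurable:
  "(\<lambda>(s, w). (s, sample_path T W w)) \<in> measurable pred
     (predictable_sigma T (path_space T) (natural_filtration (path_space T) (\<lambda>t w. w t)))"
  unfolding predictable_sigma_def[of T "path_space T"]
proof (rule measurable_measure_of)
  let ?N = "natural_filtration (path_space T) (\<lambda>t w. w t) :: real \<Rightarrow> (real \<Rightarrow> real^'d) measure"
  have sp: "A \<subseteq> path_space T" if "A \<in> sets (?N s)" for A s
    using sets.sets_into_space[OF that] by (simp add: natural_filtration_def space_measure_of_conv)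
  show "{{0} \<times> A |A. A \<in> sets (?N 0)} \<union> {{s<..t} \<times> A |s t A. 0 \<le> s \<and> s < t \<and> t \<le> T \<and> A \<in> sets (?N s)}
    \<subseteq> Pow ({0..T} \<times> path_space T)"
    using sp T_pos by fastforce
  show "(\<lambda>(s, w). (s, sample_path T W w)) \<in> space pred \<rightarrow> {0..T} \<times> path_space T"
    using sample_path_in by auto
  fix G assume "G \<in> {{0} \<times> A |A. A \<in> sets (?N 0)} \<union> {{s<..t} \<times> A |s t A. 0 \<le> s \<and> s < t \<and> t \<le> T \<and> A \<in> sets (?N s)}"
  then show "(\<lambda>(s, w). (s, sample_path T W w)) -` G \<inter> space pred \<in> sets pred"
  proof
    assume "G \<in> {{0} \<times> A |A. A \<in> sets (?N 0)}"
    then obtain A where A: "G = {0} \<times> A" "A \<in> sets (?N 0)" by auto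
    have "sample_path T W -` A \<inter> space (F 0) \<in> sets (F 0)"
      using sample_path_measurable[of 0] A(2) T_pos by (intro measurable_sets) auto
    then have "{0} \<times> (sample_path T W -` A \<inter> space (F 0)) \<in> sets pred"
      unfolding sets_pred by (intro sigma_sets.Basic) auto
    moreover have "(\<lambda>(s, w). (s, sample_path T W w)) -` G \<inter> space pred = {0} \<times> (sample_path T W -` A \<inter> space (F 0))"
      using A T_pos by auto
    ultimately show ?thesis by simp
  next
    assume "G \<in> {{s<..t} \<times> A |s t A. 0 \<le> s \<and> s < t \<and> t \<le> T \<and> A \<in> sets (?N s)}"
    then obtain s t A where A: "G = {s<..t} \<times> A" "0 \<le> s" "s < t" "t \<le> T" "A \<in> sets (?N s)" by auto
    have "sample_path T W -` A \<inter> space (F s) \<in> sets (F s)"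
      using sample_path_measurable[of s] A by (intro measurable_sets) auto
    then have "{s<..t} \<times> (sample_path T W -` A \<inter> space (F s)) \<in> sets pred"
      unfolding sets_pred using A by (intro sigma_sets.Basic) auto
    moreover have "(\<lambda>(s, w). (s, sample_path T W w)) -` G \<inter> space pred = {s<..t} \<times> (sample_path T W -` A \<inter> space (F s))"
      using A by auto
    ultimately show ?thesis by simp
  qed
qed

lemma driver_pred:
  assumes f: "driver T f" and Y: "predictable M T W Y" and Z: "predictable M T W Z"
  shows "(\<lambda>(s, w). f s (sample_path T W w) (Y s w) (Z s w)) \<in> borel_measurable pred"
proof -
  have "(\<lambda>x. (((\<lambda>(s, w). (s, sample_path T W w)) x, (\<lambda>(s, w). Y s w) x), (\<lambda>(s, w). Z s w) x))
      \<in> measurable pred ((predictable_sigma T (path_space T) (natural_filtration (path_space T) (\<lambda>t w. w t))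
        \<Otimes>\<^sub>M borel) \<Otimes>\<^sub>M borel)"
    by (intro measurable_Pair path_pred_measurable Y[unfolded predictable_def] Z[unfolded predictable_def])
  from measurable_compose[OF this f[unfolded driver_def]] show ?thesis
    by (simp add: split_def)
qed

section \<open>Criteria for predictability\<close>

lemma predictable_step:
  fixes Y :: "'a \<Rightarrow> 'b::real_normed_vector"
  assumes Y: "Y \<in> borel_measurable (F a)" and "0 \<le> a" "a < b" "b \<le> T"
  shows "predictable M T W (\<lambda>t w. indicator {a<..b} t *\<^sub>R Y w)"
  unfolding predictable_def
proof (rule measurableI)
  fix B :: "'b set" assume B: "B \<in> sets borel"
  have "{a<..b} \<times> (Y -` B \<inter> space M) \<in> sets pred" "{a<..b} \<times> space M \<in> sets pred"
    unfolding sets_pred using measurable_sets[OF Y B] sets.top[of "F a"] assms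
    by (force intro!: sigma_sets.Basic)+
  then have "{a<..b} \<times> (Y -` B \<inter> space M) \<union> (if 0 \<in> B then space pred - {a<..b} \<times> space M else {}) \<in> sets pred"
    by (auto simp del: space_predictable_sigma)
  moreover have "(\<lambda>(t, w). indicator {a<..b} t *\<^sub>R Y w) -` B \<inter> space pred
    = {a<..b} \<times> (Y -` B \<inter> space M) \<union> (if 0 \<in> B then space pred - {a<..b} \<times> space M else {})"
    using assms by (auto split: split_indicator if_splits split_indicator_asm)
  ultimately show "(\<lambda>(t, w). indicator {a<..b} t *\<^sub>R Y w) -` B \<inter> space pred \<in> sets pred"
    by simp
qed simp

lemma predictable_init:
  fixes Y :: "'a \<Rightarrow> 'b::real_normed_vector"
  assumes Y: "Y \<in> borel_measurable (F 0)"
  shows "predictable M T W (\<lambda>t w. indicator {0} t *\<^sub>R Y w)"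
  unfolding predictable_def
proof (rule measurableI)
  fix B :: "'b set" assume B: "B \<in> sets borel"
  have gen: "{0} \<times> A \<in> sets pred" if "A \<in> sets (F 0)" for A
    unfolding sets_pred by (rule sigma_sets.Basic) (use that in blast)
  have "{0} \<times> (Y -` B \<inter> space M) \<in> sets pred" "{0} \<times> space M \<in> sets pred"
    using gen[OF measurable_sets[OF Y B]] gen[OF sets.top] by simp_all
  then have "{0} \<times> (Y -` B \<inter> space M) \<union> (if 0 \<in> B then space pred - {0} \<times> space M else {}) \<in> sets pred"
    by (cases "0 \<in> B") (simp_all only: if_True if_False Un_empty_right sets.Un sets.compl_sets)
  moreover have "(\<lambda>(t, w). indicator {0} t *\<^sub>R Y w) -` B \<inter> space pred
    = {0} \<times> (Y -` B \<inter> space M) \<union> (if 0 \<in> B then space pred - {0} \<times> space M else {})"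
  proof (rule set_eqI)
    fix x :: "real \<times> 'a"
    obtain t w where x: "x = (t, w)" by (cases x)
    show "x \<in> (\<lambda>(t, w). indicator {0} t *\<^sub>R Y w) -` B \<inter> space pred \<longleftrightarrow>
      x \<in> {0} \<times> (Y -` B \<inter> space M) \<union> (if 0 \<in> B then space pred - {0} \<times> space M else {})"
      unfolding x using T_pos by (cases "t = 0") auto
  qed
  ultimately show "(\<lambda>(t, w). indicator {0} t *\<^sub>R Y w) -` B \<inter> space pred \<in> sets pred"
    by simp
qed simp

text \<open>Left-endpoint step processes on the grid of mesh \<open>T / real (Suc n)\<close> are
  predictable, and continuity makes them converge at every point. The cells are open on the left, so
  time 0 is carried by a separate term.\<close>

lemma predictable_continuous:
  fixes X :: "real \<Rightarrow> 'a \<Rightarrow> real"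
  assumes X: "\<And>t. t \<in> {0..T} \<Longrightarrow> X t \<in> borel_measurable (F t)"
    and cont: "\<And>w. w \<in> space M \<Longrightarrow> continuous_on {0..T} (\<lambda>t. X t w)"
  shows "predictable M T W X"
proof -
  define g where "g n i = T * real i / real (Suc n)" for n i :: nat
  define Xn where "Xn n t w = indicator {0} t *\<^sub>R X 0 w
      + (\<Sum>i\<le>n. indicator {g n i<..g n (Suc i)} t *\<^sub>R X (g n i) w)" for n t w
  have g: "0 \<le> g n i" "g n i < g n (Suc i)" "i \<le> n \<Longrightarrow> g n (Suc i) \<le> T" for n i
    using T_pos by (auto simp: g_def divide_simps mult_left_mono)
  have gT: "g n i \<in> {0..T}" if "i \<le> n" for n i
    using g(1,2)[of n i] g(3)[OF that] by auto
  have m: "(\<lambda>x. Xn n (fst x) (snd x)) \<in> borel_measurable pred" for n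
  proof -
    have "(\<lambda>x. indicator {0} (fst x) *\<^sub>R X 0 (snd x)) \<in> borel_measurable pred"
      using predictable_init[OF X[of 0]] T_pos by (simp add: predictable_def split_beta')
    moreover have "(\<lambda>x. indicator {g n i<..g n (Suc i)} (fst x) *\<^sub>R X (g n i) (snd x)) \<in> borel_measurable pred"
      if "i \<le> n" for i
      using predictable_step[OF X[OF gT[OF that]], of "g n (Suc i)"] g(1,2)[of n i] g(3)[OF that]
      by (simp add: predictable_def split_beta')
    ultimately show ?thesis
      unfolding Xn_def by (intro borel_measurable_add borel_measurable_sum) auto
  qed
  have l: "(\<lambda>n. Xn n (fst x) (snd x)) \<longlonglongrightarrow> X (fst x) (snd x)" if x0: "x \<in> space pred" for x
  proof -
    obtain t w where x: "x = (t, w)" "t \<in> {0..T}" "w \<in> space M" using x0 by (cases x) auto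
    show ?thesis
    proof (cases "t = 0")
      case True
      have "Xn n t w = X t w" for n
        using True g(1)[of n] by (simp add: Xn_def indicator_def not_less[symmetric] g(1) not_le)
      then show ?thesis using x by simp
    next
      case False
      then have t: "0 < t" "t \<le> T" using x by auto
      \<comment> \<open>The cells are open on the left: a grid point belongs to the cell that ends
        there, hence the ceiling minus one.\<close>
      define k where "k n = nat (\<lceil>t * real (Suc n) / T\<rceil> - 1)" for n
      have k: "k n \<le> n" "g n (k n) < t" "t \<le> g n (Suc (k n))" for n
      proof -
        let ?y = "t * real (Suc n) / T"
        have y: "0 < ?y" "?y \<le> real (Suc n)" using t T_pos by (auto simp: divide_simps)
        then have c: "1 \<le> \<lceil>?y\<rceil>" "\<lceil>?y\<rceil> \<le> int (Suc n)" by (auto simp: ceiling_le_iff)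
        then show "k n \<le> n" unfolding k_def by linarith
        have kk: "real (k n) = of_int \<lceil>?y\<rceil> - 1" using c unfolding k_def by simp
        have "real (k n) < ?y" "?y \<le> real (k n) + 1" unfolding kk by linarith+
        then show "g n (k n) < t" "t \<le> g n (Suc (k n))"
          using T_pos by (auto simp: g_def field_simps)
      qed
      have uniq: "i = k n" if "g n i < t" "t \<le> g n (Suc i)" for i n
      proof -
        have "g n i < g n (Suc (k n))" "g n (k n) < g n (Suc i)" using that k[of n] by auto
        then have "real i < real (Suc (k n))" "real (k n) < real (Suc i)"
          using T_pos by (auto simp: g_def divide_simps mult_less_cancel_left_pos)
        then show ?thesis by auto
      qed
      have eq: "Xn n t w = X (g n (k n)) w" for n
      proof -
        have "(\<Sum>i\<le>n. indicator {g n i<..g n (Suc i)} t *\<^sub>R X (g n i) w)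
            = (\<Sum>i\<le>n. if i = k n then X (g n i) w else 0)"
        proof (rule sum.cong[OF refl])
          fix i
          have "t \<in> {g n i<..g n (Suc i)} \<longleftrightarrow> i = k n"
            using k(2,3)[of n] uniq[of n i] by auto
          then show "indicator {g n i<..g n (Suc i)} t *\<^sub>R X (g n i) w = (if i = k n then X (g n i) w else 0)"
            by (simp only: indicator_def of_bool_def) simp
        qed
        also have "\<dots> = X (g n (k n)) w"
          using k(1)[of n] by (subst sum.delta) auto
        finally have e: "(\<Sum>i\<le>n. indicator {g n i<..g n (Suc i)} t *\<^sub>R X (g n i) w) = X (g n (k n)) w" .
        have i0: "indicator {0} t = (0::real)" using False by simp
        show ?thesis unfolding Xn_def e i0 by simp
      qed
      have l0: "(\<lambda>n. T / real (Suc n)) \<longlonglongrightarrow> 0"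
        using tendsto_mult_right_zero[OF LIMSEQ_inverse_real_of_nat, of T] by (simp add: divide_inverse)
      have "\<bar>g n (k n) - t\<bar> \<le> T / real (Suc n)" for n
      proof -
        have "g n (Suc (k n)) = g n (k n) + T / real (Suc n)"
          by (simp add: g_def distrib_left add_divide_distrib add.commute)
        then show ?thesis using k(2,3)[of n] by linarith
      qed
      then have lim: "(\<lambda>n. g n (k n)) \<longlonglongrightarrow> t"
        by (intro LIM_zero_cancel[OF Lim_null_comparison[OF _ l0]]) auto
      have "(\<lambda>n. X (g n (k n)) w) \<longlonglongrightarrow> X t w"
        by (rule continuous_on_tendsto_compose[OF cont[OF x(3)] lim x(2)])
           (use gT[OF k(1)] in auto)
      then show ?thesis using x eq by simp
    qed
  qed
  have "(\<lambda>x. X (fst x) (snd x)) \<in> borel_measurable pred"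
    by (rule borel_measurable_LIMSEQ_real[OF l m])
  then show ?thesis by (simp add: predictable_def split_def)
qed

end

section \<open>The exponential identity for simple integrands\<close>

text \<open>Completing the square turns the integrand into a multiple of the normal density with
  mean \<open>c * \<sigma>\<^sup>2\<close>, whose total mass is one.\<close>

lemma nn_integral_normal_exp:
  assumes "0 < \<sigma>"
  shows "(\<integral>\<^sup>+ y. ennreal (normal_density 0 \<sigma> y * exp (c * y)) \<partial>lborel) = ennreal (exp (c\<^sup>2 * \<sigma>\<^sup>2 / 2))"
proof -
  have "normal_density 0 \<sigma> y * exp (c * y) = exp (c\<^sup>2 * \<sigma>\<^sup>2 / 2) * normal_density (c * \<sigma>\<^sup>2) \<sigma> y" for y
  proof -
    have "- (y - 0)\<^sup>2 / (2 * \<sigma>\<^sup>2) + c * y = c\<^sup>2 * \<sigma>\<^sup>2 / 2 + - (y - c * \<sigma>\<^sup>2)\<^sup>2 / (2 * \<sigma>\<^sup>2)"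
      using assms by (simp add: field_simps power2_eq_square)
    then have "exp (- (y - 0)\<^sup>2 / (2 * \<sigma>\<^sup>2)) * exp (c * y) = exp (c\<^sup>2 * \<sigma>\<^sup>2 / 2) * exp (- (y - c * \<sigma>\<^sup>2)\<^sup>2 / (2 * \<sigma>\<^sup>2))"
      by (simp only: exp_add[symmetric])
    then show ?thesis unfolding normal_density_def by simp
  qed
  then have "(\<integral>\<^sup>+ y. ennreal (normal_density 0 \<sigma> y * exp (c * y)) \<partial>lborel)
    = ennreal (exp (c\<^sup>2 * \<sigma>\<^sup>2 / 2)) * (\<integral>\<^sup>+ y. ennreal (normal_density (c * \<sigma>\<^sup>2) \<sigma> y) \<partial>lborel)"
    by (simp add: ennreal_mult nn_integral_cmult)
  also have "(\<integral>\<^sup>+ y. ennreal (normal_density (c * \<sigma>\<^sup>2) \<sigma> y) \<partial>lborel) = 1"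
    using prob_space.emeasure_space_1[OF prob_space_normal_density[OF assms, of "c * \<sigma>\<^sup>2"]]
    by (simp add: emeasure_density)
  finally show ?thesis by simp
qed

lemma prod_Basis_vec:
  fixes g :: "(real ^ 'd) \<Rightarrow> 'b::comm_monoid_mult"
  shows "(\<Prod>b\<in>Basis. g b) = (\<Prod>k\<in>UNIV. g (axis k 1))"
proof -
  have e: "(Basis :: (real^'d) set) = (\<lambda>k. axis k 1) ` UNIV"
    by (auto simp: Basis_vec_def)
  have i: "inj (\<lambda>k::'d. axis k (1::real))"
    by (auto simp: inj_def axis_eq_axis)
  show ?thesis unfolding e by (subst prod.reindex[OF i]) (simp add: comp_def)
qed

text \<open>In coordinates both the density and the exponential are products, so the integral
  factorises into one-dimensional ones.\<close>

lemma nn_integral_normal_exp_vec: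
  fixes c :: "real ^ 'd"
  assumes "0 < \<sigma>"
  shows "(\<integral>\<^sup>+ x. ennreal (\<Prod>k\<in>UNIV. normal_density 0 \<sigma> (x $ k)) * ennreal (exp (c \<bullet> x)) \<partial>lborel)
    = ennreal (exp ((norm c)\<^sup>2 * \<sigma>\<^sup>2 / 2))"
proof -
  let ?g = "\<lambda>(b::real^'d) y. ennreal (normal_density 0 \<sigma> y * exp ((c \<bullet> b) * y))"
  have "ennreal (\<Prod>k\<in>UNIV. normal_density 0 \<sigma> (x $ k)) * ennreal (exp (c \<bullet> x)) = (\<Prod>b\<in>Basis. ?g b (x \<bullet> b))" for x
  proof -
    have "c \<bullet> x = (\<Sum>k\<in>UNIV. c $ k * x $ k)" by (simp add: inner_vec_def)
    then show ?thesis
      by (simp add: prod_Basis_vec inner_axis prod_ennreal exp_sum prod.distrib ennreal_mult[symmetric] prod_nonneg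
          cong: prod.cong)
  qed
  then have "(\<integral>\<^sup>+ x. ennreal (\<Prod>k\<in>UNIV. normal_density 0 \<sigma> (x $ k)) * ennreal (exp (c \<bullet> x)) \<partial>lborel)
    = (\<Prod>b\<in>Basis. \<integral>\<^sup>+ y. ?g b y \<partial>lborel)"
    by (simp only:) (rule nn_integral_lborel_prod; simp)
  also have "\<dots> = (\<Prod>b\<in>Basis. ennreal (exp ((c \<bullet> b)\<^sup>2 * \<sigma>\<^sup>2 / 2)))"
    by (simp add: nn_integral_normal_exp[OF assms])
  also have "\<dots> = ennreal (exp (\<Sum>b\<in>Basis. (c \<bullet> b)\<^sup>2 * \<sigma>\<^sup>2 / 2))"
    by (simp add: prod_ennreal exp_sum)
  also have "(\<Sum>b\<in>Basis. (c \<bullet> b)\<^sup>2 * \<sigma>\<^sup>2 / 2) = (norm c)\<^sup>2 * \<sigma>\<^sup>2 / 2"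
    unfolding power2_norm_eq_inner[of c] euclidean_inner[of c c]
    by (simp add: sum_distrib_right sum_divide_distrib power2_eq_square)
  finally show ?thesis .
qed

section \<open>Independent increments and the exponential identity\<close>

context brownian_setup
begin

text \<open>Independence of increments is given for the natural filtration only. Every augmented
  event agrees almost surely with a natural one: this holds for null sets, with the empty set as
  partner, and passes to complements and countable unions.\<close>

lemma F_natural:
  assumes A: "A \<in> sets (F s)" and "s \<le> T"
  shows "\<exists>A'\<in>sets (natural_filtration (space M) W s). AE w in M. w \<in> A \<longleftrightarrow> w \<in> A'"
  using A unfolding sets_aug_filtration
proof (induction rule: sigma_sets.induct)
  case (Basic A)
  then show ?case
  proof
    assume "A \<in> sets (natural_filtration (space M) W (min s T))"
    then show ?thesis using \<open>s \<le> T\<close> by (intro bexI[of _ A]) auto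
  next
    assume "A \<in> null_sets P"
    then have "AE w in P. w \<notin> A" by (rule AE_not_in)
    then show ?thesis by (intro bexI[of _ "{}"]) (auto simp: AE_P)
  qed
next
  case Empty then show ?case by (intro bexI[of _ "{}"]) auto
next
  case (Compl A)
  then obtain A' where A': "A' \<in> sets (natural_filtration (space M) W s)" "AE w in M. w \<in> A \<longleftrightarrow> w \<in> A'" by auto
  have "space M - A' \<in> sets (natural_filtration (space M) W s)"
    using sets.compl_sets[OF A'(1)] by (simp add: natural_filtration_def space_measure_of_conv)
  moreover have "AE w in M. w \<in> space M - A \<longleftrightarrow> w \<in> space M - A'"
    using A'(2) by eventually_elim auto
  ultimately show ?case by blast
next
  case (Union A)
  then obtain A' where A': "\<And>i. A' i \<in> sets (natural_filtration (space M) W s)"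
    "\<And>i. AE w in M. w \<in> A i \<longleftrightarrow> w \<in> A' i" by metis
  have "(\<Union>i. A' i) \<in> sets (natural_filtration (space M) W s)" using A'(1) by auto
  moreover have "AE w in M. \<forall>i. w \<in> A i \<longleftrightarrow> w \<in> A' i" using A'(2) by (simp add: AE_all_countable)
  then have "AE w in M. w \<in> (\<Union>i. A i) \<longleftrightarrow> w \<in> (\<Union>i. A' i)" by eventually_elim auto
  ultimately show ?case by (rule bexI[rotated])
qed

lemma natural_sub_M: "s \<le> T \<Longrightarrow> A \<in> sets (natural_filtration (space M) W s) \<Longrightarrow> A \<in> sets M"
proof -
  assume s: "s \<le> T" and A: "A \<in> sets (natural_filtration (space M) W s)"
  have "sigma_sets (space M) (\<Union>u\<in>{0..s}. {W u -` B \<inter> space M | B. B \<in> sets borel}) \<subseteq> sets M"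
    using W_measurable s by (intro sets.sigma_sets_subset) (fastforce intro: measurable_sets)
  then show ?thesis using A unfolding sets_natural_filtration by auto
qed

lemma increment_measurable:
  assumes "0 \<le> s" "s \<le> t" "t \<le> T"
  shows "(\<lambda>w. W t w - W s w) \<in> borel_measurable M"
  using W_measurable[of s] W_measurable[of t] assms by (intro borel_measurable_diff) auto

lemma indep_increment:
  assumes st: "0 \<le> s" "s < t" "t \<le> T" and A: "A \<in> sets (F s)" and B: "B \<in> sets borel"
  shows "emeasure P (A \<inter> {w\<in>space M. W t w - W s w \<in> B}) = emeasure P A * emeasure M {w\<in>space M. W t w - W s w \<in> B}"
proof -
  let ?D = "\<lambda>w. W t w - W s w"
  let ?B = "{w\<in>space M. W t w - W s w \<in> B}"
  obtain A' where A': "A' \<in> sets (natural_filtration (space M) W s)" "AE w in M. w \<in> A \<longleftrightarrow> w \<in> A'"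
    using F_natural[OF A] st by auto
  have A'M: "A' \<in> sets M" using natural_sub_M[OF _ A'(1)] st by auto
  have BM: "?B \<in> sets M"
    using measurable_sets[OF increment_measurable, of s t B] st B by (simp add: vimage_def Int_def conj_commute)
  have ind: "indep_set (sets (natural_filtration (space M) W s)) (sets (vimage_algebra (space M) ?D borel))"
    using bm st by (auto simp: brownian_motion_def)
  have "?B \<in> sets (vimage_algebra (space M) ?D borel)"
    using in_vimage_algebra[OF B, of ?D "space M"] by (simp add: vimage_def Int_def conj_commute)
  from indep_setD[OF ind A'(1) this] have eq: "prob (A' \<inter> ?B) = prob A' * prob ?B" .
  have AP: "A \<in> sets P" using F_sub_P[OF A] .
  have "emeasure P (A \<inter> ?B) = emeasure P (A' \<inter> ?B)"
  proof (rule emeasure_eq_AE)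
    show "AE w in P. (w \<in> A \<inter> ?B) = (w \<in> A' \<inter> ?B)"
      unfolding AE_P using A'(2) by eventually_elim auto
  qed (use AP BM A'M in auto)
  also have "\<dots> = emeasure M (A' \<inter> ?B)" using A'M BM by simp
  also have "\<dots> = emeasure M A' * emeasure M ?B"
    using eq by (simp add: emeasure_eq_measure ennreal_mult)
  also have "emeasure M A' = emeasure P A'" using A'M by simp
  also have "\<dots> = emeasure P A"
  proof (rule emeasure_eq_AE)
    show "AE w in P. (w \<in> A') = (w \<in> A)"
      unfolding AE_P using A'(2) by eventually_elim auto
  qed (use AP A'M in auto)
  finally show ?thesis .
qed

text \<open>Since \<open>h\<close> and \<open>X\<close> are known at time \<open>s\<close> and the
  increment is independent of \<open>F s\<close>, the increment can be integrated out first with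
  \<open>h\<close> frozen, and the Gaussian integral is one. Values in \<open>ennreal\<close> spare
  all questions of integrability.\<close>

lemma exp_increment:
  assumes st: "0 \<le> s" "s \<le> t" "t \<le> T"
    and X: "X \<in> borel_measurable (F s)" and h: "h \<in> borel_measurable (F s)"
  shows "(\<E> w. X w * ennreal (exp (h w \<bullet> (W t w - W s w) - (norm (h w))\<^sup>2 * (t - s) / 2))) = (\<E> w. X w)"
proof (cases "s = t")
  case True then show ?thesis by simp
next
  case False
  then have st': "s < t" using st by simp
  let ?D = "\<lambda>w. W t w - W s w"
  define \<nu> where "\<nu> = distr M borel ?D"
  \<comment> \<open>The restriction of \<open>P\<close> to \<open>F s\<close>, written as an image
    measure under the identity so that it lives on the smaller \<sigma>-algebra.\<close>
  define PF where "PF = distr P (F s) (\<lambda>w. w)"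
  have DM: "?D \<in> borel_measurable M" using increment_measurable st by auto
  have idF: "(\<lambda>w. w) \<in> measurable P (F s)"
    using measurable_F_P[of "\<lambda>w. w" s "F s"] by simp
  have DP: "?D \<in> borel_measurable P" using DM by (rule measurable_completion)
  interpret \<nu>: prob_space \<nu> unfolding \<nu>_def by (rule prob_space_distr[OF DM])
  interpret PF: prob_space PF unfolding PF_def by (rule P.prob_space_distr[OF idF])
  have dens: "\<nu> = density lborel (\<lambda>x. ennreal (\<Prod>k\<in>UNIV. normal_density 0 (sqrt (t - s)) (x $ k)))"
  proof -
    have "distributed M lborel ?D (\<lambda>x. ennreal (\<Prod>k\<in>UNIV. normal_density 0 (sqrt (t - s)) (x $ k)))"
      using bm st st' by (auto simp: brownian_motion_def)
    from distributed_distr_eq_density[OF this] show ?thesis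
      unfolding \<nu>_def by (simp cong: distr_cong)
  qed
  have sqrt0: "0 < sqrt (t - s)" using st' by simp
  have mgf: "(\<integral>\<^sup>+ x. ennreal (exp (c \<bullet> x - (norm c)\<^sup>2 * (t - s) / 2)) \<partial>\<nu>) = 1" for c :: "real^'d"
  proof -
    have "(\<integral>\<^sup>+ x. ennreal (exp (c \<bullet> x)) \<partial>\<nu>) = ennreal (exp ((norm c)\<^sup>2 * (t - s) / 2))"
      unfolding dens using nn_integral_normal_exp_vec[OF sqrt0, of c] st'
      by (subst nn_integral_density) (auto simp: real_sqrt_pow2)
    then have "(\<integral>\<^sup>+ x. ennreal (exp (- ((norm c)\<^sup>2 * (t - s) / 2))) * ennreal (exp (c \<bullet> x)) \<partial>\<nu>)
      = ennreal (exp (- ((norm c)\<^sup>2 * (t - s) / 2))) * ennreal (exp ((norm c)\<^sup>2 * (t - s) / 2))"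
      by (subst nn_integral_cmult) (auto simp: \<nu>_def)
    also have "\<dots> = 1"
      by (simp add: ennreal_mult[symmetric] exp_add[symmetric])
    finally have 1: "(\<integral>\<^sup>+ x. ennreal (exp (- ((norm c)\<^sup>2 * (t - s) / 2))) * ennreal (exp (c \<bullet> x)) \<partial>\<nu>) = 1" .
    have "ennreal (exp (- ((norm c)\<^sup>2 * (t - s) / 2))) * ennreal (exp (c \<bullet> x))
      = ennreal (exp (c \<bullet> x - (norm c)\<^sup>2 * (t - s) / 2))" for x
      by (simp add: ennreal_mult[symmetric] exp_add[symmetric])
    with 1 show ?thesis by (simp only:)
  qed
  \<comment> \<open>Independence as a statement about laws: the pair of the point, seen through
    \<open>F s\<close>, and the increment has a product law. It suffices to compare
    rectangles.\<close>
  have prod: "PF \<Otimes>\<^sub>M \<nu> = distr P (F s \<Otimes>\<^sub>M borel) (\<lambda>w. (w, ?D w))"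
  proof (rule pair_measure_eqI)
    show "sigma_finite_measure PF" "sigma_finite_measure \<nu>" by unfold_locales
    show "sets (PF \<Otimes>\<^sub>M \<nu>) = sets (distr P (F s \<Otimes>\<^sub>M borel) (\<lambda>w. (w, ?D w)))"
      by (simp add: PF_def \<nu>_def cong: sets_pair_measure_cong)
    fix A B assume "A \<in> sets PF" "B \<in> sets \<nu>"
    then have AB: "A \<in> sets (F s)" "B \<in> sets borel" by (auto simp: PF_def \<nu>_def)
    have sA: "A \<subseteq> space M" using sets.sets_into_space[OF AB(1)] by simp
    have "emeasure PF A = emeasure P A" unfolding PF_def using AB sA
      by (subst emeasure_distr[OF idF]) (auto intro!: arg_cong[where f="emeasure P"])
    moreover have "emeasure \<nu> B = emeasure M {w\<in>space M. ?D w \<in> B}" unfolding \<nu>_def using AB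
      by (subst emeasure_distr[OF DM]) (auto intro!: arg_cong[where f="emeasure M"])
    moreover have "emeasure (distr P (F s \<Otimes>\<^sub>M borel) (\<lambda>w. (w, ?D w))) (A \<times> B) = emeasure P (A \<inter> {w\<in>space M. ?D w \<in> B})"
      using AB sA by (subst emeasure_distr[OF measurable_Pair[OF idF DP]]) (auto intro!: arg_cong[where f="emeasure P"])
    ultimately show "emeasure PF A * emeasure \<nu> B = emeasure (distr P (F s \<Otimes>\<^sub>M borel) (\<lambda>w. (w, ?D w))) (A \<times> B)"
      using indep_increment[OF st(1) st' st(3) AB] by simp
  qed
  let ?G = "\<lambda>(w, x). X w * ennreal (exp (h w \<bullet> x - (norm (h w))\<^sup>2 * (t - s) / 2))"
  have G: "?G \<in> borel_measurable (F s \<Otimes>\<^sub>M borel)"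
    using X h by measurable
  have sp: "sets (PF \<Otimes>\<^sub>M \<nu>) = sets (F s \<Otimes>\<^sub>M borel)"
    by (simp add: PF_def \<nu>_def cong: sets_pair_measure_cong)
  have G': "?G \<in> borel_measurable (PF \<Otimes>\<^sub>M \<nu>)"
    using G by (simp add: measurable_cong_sets[OF sp refl])
  have "(\<E> w. X w * ennreal (exp (h w \<bullet> ?D w - (norm (h w))\<^sup>2 * (t - s) / 2)))
      = (\<integral>\<^sup>+ z. ?G z \<partial>distr P (F s \<Otimes>\<^sub>M borel) (\<lambda>w. (w, ?D w)))"
    by (subst nn_integral_distr[OF measurable_Pair[OF idF DP]]) (use G in simp_all)
  also have "\<dots> = (\<integral>\<^sup>+ z. ?G z \<partial>(PF \<Otimes>\<^sub>M \<nu>))" by (simp only: prod)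
  also have "\<dots> = (\<integral>\<^sup>+ w. \<integral>\<^sup>+ x. ?G (w, x) \<partial>\<nu> \<partial>PF)"
    by (rule \<nu>.nn_integral_fst[OF G', symmetric])
  also have "\<dots> = (\<integral>\<^sup>+ w. X w \<partial>PF)"
  proof (rule nn_integral_cong)
    fix w
    have "(\<integral>\<^sup>+ x. ?G (w, x) \<partial>\<nu>) = X w * (\<integral>\<^sup>+ x. ennreal (exp (h w \<bullet> x - (norm (h w))\<^sup>2 * (t - s) / 2)) \<partial>\<nu>)"
      by (simp, subst nn_integral_cmult) (auto simp: \<nu>_def)
    then show "(\<integral>\<^sup>+ x. ?G (w, x) \<partial>\<nu>) = X w" using mgf[of "h w"] by simp
  qed
  also have "\<dots> = (\<E> w. X w)"
    unfolding PF_def by (subst nn_integral_distr[OF idF]) (use X in simp_all)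
  finally show ?thesis .
qed

text \<open>Peels off the last factor: the product of \<open>X\<close> and the earlier factors is
  measurable at \<open>p m\<close> and can serve as the weight in
  \<open>exp_increment\<close>.\<close>

lemma exp_steps:
  assumes "0 \<le> p 0" "p m \<le> T" "\<And>i. i < m \<Longrightarrow> p i \<le> p (Suc i)"
    and h: "\<And>i. i < m \<Longrightarrow> h i \<in> borel_measurable (F (p i))"
    and X: "X \<in> borel_measurable (F (p 0))"
  shows "(\<E> w. X w * ennreal (exp (\<Sum>i<m. h i w \<bullet> (W (p (Suc i)) w - W (p i) w)
      - (norm (h i w))\<^sup>2 * (p (Suc i) - p i) / 2))) = (\<E> w. X w)"
  using assms
proof (induction m)
  case 0 then show ?case by simp
next
  case (Suc m)
  let ?e = "\<lambda>i w. h i w \<bullet> (W (p (Suc i)) w - W (p i) w) - (norm (h i w))\<^sup>2 * (p (Suc i) - p i) / 2"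
  have mono: "p i \<le> p j" if "i \<le> j" "j \<le> Suc m" for i j
    using that Suc.prems(3) by (induction j) (auto simp: le_Suc_eq intro: order_trans)
  have pos: "0 \<le> p i" if "i \<le> Suc m" for i using mono[of 0 i] that Suc.prems(1) by auto
  have em: "?e i \<in> borel_measurable (F (p m))" if "i < m" for i
  proof -
    have "W (p (Suc i)) \<in> borel_measurable (F (p m))" "W (p i) \<in> borel_measurable (F (p m))"
      using that mono[of i m] mono[of "Suc i" m] mono[of m "Suc m"] pos[of i] pos[of "Suc i"] Suc.prems(2)
      by (auto intro!: W_in_F)
    moreover have "h i \<in> borel_measurable (F (p m))"
      using measurable_F_mono[OF Suc.prems(4)[of i] mono[of i m]] that by auto
    ultimately show ?thesis by measurable
  qed
  have Y: "(\<lambda>w. X w * ennreal (exp (\<Sum>i<m. ?e i w))) \<in> borel_measurable (F (p m))"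
    using measurable_F_mono[OF Suc.prems(5) mono[of 0 m]] em
    by (intro borel_measurable_times_ennreal measurable_compose[OF _ measurable_ennreal] borel_measurable_exp[THEN measurable_compose[rotated]]
       borel_measurable_sum) auto
  have "(\<E> w. X w * ennreal (exp (\<Sum>i<Suc m. ?e i w)))
      = (\<E> w. (X w * ennreal (exp (\<Sum>i<m. ?e i w))) * ennreal (exp (?e m w)))"
    by (intro nn_integral_cong) (simp add: exp_add ennreal_mult mult.assoc)
  also have "\<dots> = (\<E> w. X w * ennreal (exp (\<Sum>i<m. ?e i w)))"
    using pos[of m] mono[of m "Suc m"] Suc.prems(2) Suc.prems(4)[of m] Y by (intro exp_increment) auto
  also have "\<dots> = (\<E> w. X w)"
  proof (rule Suc.IH)
    show "p m \<le> T" using mono[of m "Suc m"] Suc.prems(2) by simp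
  qed (use Suc.prems in auto)
  finally show ?case .
qed

end

text \<open>The energy of a simple integrand up to \<open>t\<close>, that is the time integral of
  its squared norm; see \<open>nn_integral_simple\<close>. It is the compensator in the exponential
  identity.\<close>

definition sqv :: "nat \<Rightarrow> (nat \<Rightarrow> real) \<Rightarrow> (nat \<Rightarrow> 'a \<Rightarrow> real ^ 'd) \<Rightarrow> real \<Rightarrow> 'a \<Rightarrow> real" where
  "sqv m p h t w = (\<Sum>i<m. (norm (h i w))\<^sup>2 * (min t (p (Suc i)) - min t (p i)))"

context brownian_setup
begin

abbreviation "simple \<equiv> simple_integrand M T W"
abbreviation "sint \<equiv> simple_integral W"
abbreviation "sproc \<equiv> simple_process"
abbreviation "sint_inc m p h t s w \<equiv> sint m p h s w - sint m p h t w"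
abbreviation "sqv_inc m p h t s w \<equiv> sqv m p h s w - sqv m p h t w"

lemma simple_mono: "simple m p h \<Longrightarrow> i \<le> j \<Longrightarrow> j \<le> m \<Longrightarrow> p i \<le> p j"
proof (induction j)
  case (Suc j)
  show ?case
  proof (cases "i = Suc j")
    case False
    then have "p i \<le> p j" using Suc by auto
    also have "p j \<le> p (Suc j)" using Suc.prems by (auto simp: simple_integrand_def)
    finally show ?thesis .
  qed simp
qed simp

lemma simple_range: "simple m p h \<Longrightarrow> i \<le> m \<Longrightarrow> p i \<in> {0..T}"
  using simple_mono[of m p h 0 i] simple_mono[of m p h i m] by (auto simp: simple_integrand_def)

lemma simple_h: "simple m p h \<Longrightarrow> i < m \<Longrightarrow> h i \<in> borel_measurable (F (p i))"
  by (auto simp: simple_integrand_def)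

lemma simple_scale: "simple m p h \<Longrightarrow> simple m p (\<lambda>i w. c *\<^sub>R h i w)"
  unfolding simple_integrand_def
  by (auto intro!: borel_measurable_scaleR bounded_scaleR_comp)

lemma simple_integral_scale: "simple_integral W m p (\<lambda>i w. c *\<^sub>R h i w) t w = c * simple_integral W m p h t w"
  by (simp add: simple_integral_def sum_distrib_left)

lemma simple_integral_adapted:
  assumes S: "simple m p h" and t: "t \<in> {0..T}"
  shows "sint m p h t \<in> borel_measurable (F t)"
  unfolding simple_integral_def
proof (rule borel_measurable_sum)
  fix i assume i: "i \<in> {..<m}"
  have r: "p i \<in> {0..T}" "p (Suc i) \<in> {0..T}" "p i \<le> p (Suc i)"
    using simple_range[OF S, of i] simple_range[OF S, of "Suc i"] simple_mono[OF S, of i "Suc i"] i by auto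
  show "(\<lambda>w. h i w \<bullet> (W (min t (p (Suc i))) w - W (min t (p i)) w)) \<in> borel_measurable (F t)"
  proof (cases "p i \<le> t")
    case True
    have "h i \<in> borel_measurable (F t)" using measurable_F_mono[OF simple_h[OF S] True] i by auto
    moreover have "W (min t (p (Suc i))) \<in> borel_measurable (F t)" "W (min t (p i)) \<in> borel_measurable (F t)"
      using r t by (auto intro!: W_in_F)
    ultimately show ?thesis by measurable
  next
    case False
    then show ?thesis using r by (simp add: min_def)
  qed
qed

lemma simple_qv_adapted:
  assumes S: "simple m p h" and t: "t \<in> {0..T}"
  shows "sqv m p h t \<in> borel_measurable (F t)"
  unfolding sqv_def
proof (rule borel_measurable_sum)
  fix i assume i: "i \<in> {..<m}"
  have r: "p i \<in> {0..T}" "p (Suc i) \<in> {0..T}" "p i \<le> p (Suc i)"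
    using simple_range[OF S, of i] simple_range[OF S, of "Suc i"] simple_mono[OF S, of i "Suc i"] i by auto
  show "(\<lambda>w. (norm (h i w))\<^sup>2 * (min t (p (Suc i)) - min t (p i))) \<in> borel_measurable (F t)"
  proof (cases "p i \<le> t")
    case True
    have "h i \<in> borel_measurable (F t)" using measurable_F_mono[OF simple_h[OF S] True] i by auto
    then show ?thesis by measurable
  next
    case False
    then show ?thesis using r by (simp add: min_def)
  qed
qed

text \<open>A conditional statement in disguise: the weight \<open>X\<close> is an arbitrary
  non-negative variable known at time \<open>t\<close>, and only the part of the integral after
  \<open>t\<close> enters.\<close>

lemma exp_simple:
  assumes S: "simple m p h" and t: "t \<in> {0..T}" and X: "X \<in> borel_measurable (F t)"
  shows "(\<E> w. X w * ennreal (exp (c * (sint_inc m p h t T w)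
      - c\<^sup>2 * (sqv_inc m p h t T w) / 2))) = (\<E> w. X w)"
proof -
  \<comment> \<open>Lifting the grid points to at least \<open>t\<close> makes the cells before
    \<open>t\<close> degenerate and keeps every \<open>h i\<close> measurable at the start of its
    cell.\<close>
  define q where "q i = max t (p i)" for i
  have S': "simple m p (\<lambda>i w. c *\<^sub>R h i w)" (is "simple m p ?g") using S by (rule simple_scale)
  have "(\<E> w. X w * ennreal (exp (\<Sum>i<m. ?g i w \<bullet> (W (q (Suc i)) w - W (q i) w)
      - (norm (?g i w))\<^sup>2 * (q (Suc i) - q i) / 2))) = (\<E> w. X w)"
  proof (rule exp_steps)
    show "0 \<le> q 0" "q m \<le> T" using t simple_range[OF S, of m] by (auto simp: q_def)
    show "q i \<le> q (Suc i)" if "i < m" for i using simple_mono[OF S, of i "Suc i"] that by (auto simp: q_def)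
    show "?g i \<in> borel_measurable (F (q i))" if "i < m" for i
      using measurable_F_mono[OF simple_h[OF S' that]] by (simp add: q_def)
    show "X \<in> borel_measurable (F (q 0))" using measurable_F_mono[OF X] by (simp add: q_def)
  qed
  moreover have "(\<Sum>i<m. ?g i w \<bullet> (W (q (Suc i)) w - W (q i) w) - (norm (?g i w))\<^sup>2 * (q (Suc i) - q i) / 2)
    = c * (sint_inc m p h t T w) - c\<^sup>2 * (sqv_inc m p h t T w) / 2" for w
  proof -
    have w: "W (q j) w = W (min T (p j)) w - W (min t (p j)) w + W t w"
      "q j = min T (p j) - min t (p j) + t" if "j \<le> m" for j
      using simple_range[OF S that] by (auto simp: q_def max_def min_def)
    have "(\<Sum>i<m. ?g i w \<bullet> (W (q (Suc i)) w - W (q i) w) - (norm (?g i w))\<^sup>2 * (q (Suc i) - q i) / 2)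
      = (\<Sum>i<m. c * (h i w \<bullet> (W (min T (p (Suc i))) w - W (min T (p i)) w) - h i w \<bullet> (W (min t (p (Suc i))) w - W (min t (p i)) w))
         - c\<^sup>2 * ((norm (h i w))\<^sup>2 * (min T (p (Suc i)) - min T (p i)) - (norm (h i w))\<^sup>2 * (min t (p (Suc i)) - min t (p i))) / 2)"
    proof (rule sum.cong[OF refl])
      fix i assume i: "i \<in> {..<m}"
      have w1: "W (q (Suc i)) w - W (q i) w = (W (min T (p (Suc i))) w - W (min T (p i)) w) - (W (min t (p (Suc i))) w - W (min t (p i)) w)"
        "q (Suc i) - q i = (min T (p (Suc i)) - min T (p i)) - (min t (p (Suc i)) - min t (p i))"
        using w[of i] w[of "Suc i"] i by auto
      show "?g i w \<bullet> (W (q (Suc i)) w - W (q i) w) - (norm (?g i w))\<^sup>2 * (q (Suc i) - q i) / 2 =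
         c * (h i w \<bullet> (W (min T (p (Suc i))) w - W (min T (p i)) w) - h i w \<bullet> (W (min t (p (Suc i))) w - W (min t (p i)) w))
         - c\<^sup>2 * ((norm (h i w))\<^sup>2 * (min T (p (Suc i)) - min T (p i)) - (norm (h i w))\<^sup>2 * (min t (p (Suc i)) - min t (p i))) / 2"
        unfolding w1 norm_scaleR power_mult_distrib power2_abs inner_diff_right inner_scaleR_left
        by (simp only: right_diff_distrib mult.assoc)
    qed
    also have "\<dots> = c * (sint_inc m p h t T w) - c\<^sup>2 * (sqv_inc m p h t T w) / 2"
      unfolding simple_integral_def sqv_def
      by (simp only: sum_subtractf[symmetric] sum_distrib_left sum_divide_distrib)
    finally show ?thesis .
  qed
  ultimately show ?thesis by simp
qed

end

declare emeasure_completion [simp del]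

section \<open>Nested dyadic grids containing both end points\<close>

definition dyadic_grid :: "real \<Rightarrow> real \<Rightarrow> nat \<Rightarrow> real set" where
  "dyadic_grid a b n = (\<lambda>k. a + (b - a) * real k / 2 ^ n) ` {..2 ^ n}"

lemma finite_dyadic_grid [simp]: "finite (dyadic_grid a b n)"
  by (simp add: dyadic_grid_def)

lemma dyadic_grid_subset: "a \<le> b \<Longrightarrow> dyadic_grid a b n \<subseteq> {a..b}"
proof (clarsimp simp: dyadic_grid_def)
  fix k :: nat assume "a \<le> b" "k \<le> 2 ^ n"
  then have "real k \<le> 2 ^ n" by (metis of_nat_le_iff of_nat_numeral of_nat_power)
  then have "real k / 2 ^ n \<le> 1" by simp
  then have "(b - a) * (real k / 2 ^ n) \<le> (b - a) * 1" using \<open>a \<le> b\<close> by (intro mult_left_mono) auto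
  then show "a + (b - a) * real k / 2 ^ n \<le> b" by simp
qed

lemma dyadic_grid_mono: "n \<le> n' \<Longrightarrow> dyadic_grid a b n \<subseteq> dyadic_grid a b n'"
proof (induction n' rule: dec_induct)
  case (step n')
  have "dyadic_grid a b n' \<subseteq> dyadic_grid a b (Suc n')"
  proof (clarsimp simp: dyadic_grid_def)
    fix k :: nat assume "k \<le> 2 ^ n'"
    then show "a + (b - a) * real k / 2 ^ n' \<in> (\<lambda>k. a + (b - a) * real k / (2 * 2 ^ n')) ` {..2 * 2 ^ n'}"
      by (intro image_eqI[of _ _ "2 * k"]) auto
  qed
  then show ?case using step by auto
qed simp

text \<open>The points approach \<open>s\<close> from above, which is what right-continuous
  functions need; rounding up keeps the index at most \<open>2 ^ n\<close> because
  \<open>s \<le> b\<close>.\<close>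

lemma dyadic_grid_dense:
  assumes s: "s \<in> {a..b}"
  obtains x where "\<And>n. x n \<in> dyadic_grid a b n" "x \<longlonglongrightarrow> s" "\<And>n. s \<le> x n"
proof (cases "a = b")
  case True
  have "a \<in> dyadic_grid a b n" for n unfolding dyadic_grid_def by (intro image_eqI[of _ _ 0]) auto
  then show ?thesis using that[of "\<lambda>n. a"] s True by auto
next
  case False
  then have ab: "a < b" using s by auto
  define k where "k n = nat \<lceil>(s - a) / (b - a) * 2 ^ n\<rceil>" for n :: nat
  define x where "x n = a + (b - a) * real (k n) / 2 ^ n" for n
  let ?u = "(s - a) / (b - a)"
  have u: "0 \<le> ?u" "?u \<le> 1" using s ab by (auto simp: divide_simps)
  have uk: "?u * 2 ^ n \<le> real (k n)" "real (k n) \<le> ?u * 2 ^ n + 1" for n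
  proof -
    have "0 \<le> ?u * 2 ^ n" by (rule mult_nonneg_nonneg[OF u(1)]) simp
    then have "0 \<le> \<lceil>?u * 2 ^ n\<rceil>" by linarith
    then have "real (k n) = of_int \<lceil>?u * 2 ^ n\<rceil>" unfolding k_def by simp
    then show "?u * 2 ^ n \<le> real (k n)" "real (k n) \<le> ?u * 2 ^ n + 1" by linarith+
  qed
  have k2: "k n \<le> 2 ^ n" for n
  proof -
    have "?u * 2 ^ n \<le> 2 ^ n" using u mult_right_mono[of ?u 1 "2 ^ n"] by simp
    then have "\<lceil>?u * 2 ^ n\<rceil> \<le> 2 ^ n" by (simp add: ceiling_le_iff)
    then show ?thesis unfolding k_def by (simp add: nat_le_iff)
  qed
  have s_eq: "s = a + (b - a) * ?u" using ab by simp
  have b1: "s \<le> x n" "x n \<le> s + (b - a) * (1 / 2) ^ n" for n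
  proof -
    have "?u \<le> real (k n) / 2 ^ n" "real (k n) / 2 ^ n \<le> ?u + (1 / 2) ^ n"
      using uk[of n] by (auto simp: field_simps)
    then have "(b - a) * ?u \<le> (b - a) * (real (k n) / 2 ^ n)"
      "(b - a) * (real (k n) / 2 ^ n) \<le> (b - a) * (?u + (1 / 2) ^ n)"
      using ab by (intro mult_left_mono; simp)+
    then show "s \<le> x n" "x n \<le> s + (b - a) * (1 / 2) ^ n"
      unfolding x_def using s_eq by (auto simp: distrib_left)
  qed
  have "(\<lambda>n. s + (b - a) * (1 / 2) ^ n) \<longlonglongrightarrow> s + (b - a) * 0"
    by (intro tendsto_intros LIMSEQ_power_zero) auto
  then have "x \<longlonglongrightarrow> s"
    using b1 by (intro tendsto_sandwich[OF _ _ tendsto_const, of s x sequentially "\<lambda>n. s + (b - a) * (1 / 2) ^ n"]) auto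
  moreover have "x n \<in> dyadic_grid a b n" for n
    unfolding x_def dyadic_grid_def using k2[of n] by auto
  ultimately show ?thesis using that[of x] b1 by auto
qed

lemma dyadic_grid_ex:
  fixes G :: "real \<Rightarrow> real"
  assumes "continuous_on {a..b} G" and s: "s \<in> {a..b}" "c < G s"
  shows "\<exists>n. \<exists>s\<in>dyadic_grid a b n. c < G s"
proof -
  obtain x where x: "\<And>n. x n \<in> dyadic_grid a b n" "x \<longlonglongrightarrow> s" using dyadic_grid_dense[OF s(1)] by blast
  have "x n \<in> {a..b}" for n using x(1)[of n] dyadic_grid_subset[of a b n] s(1) by auto
  then have "(\<lambda>n. G (x n)) \<longlonglongrightarrow> G s"
    using s(1) by (intro continuous_on_tendsto_compose[OF assms(1) x(2)]) simp_all
  from order_tendstoD(1)[OF this s(2)] obtain n where "c < G (x n)"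
    by (auto simp: eventually_sequentially)
  then show ?thesis using x(1) by blast
qed

section \<open>Truncation and the maximal inequality for simple integrals\<close>

context brownian_setup
begin

lemma sint_continuous:
  assumes S: "simple m p h" and w: "w \<in> space M"
  shows "continuous_on {0..T} (\<lambda>t. sint m p h t w)"
proof -
  have "continuous_on {0..T} (\<lambda>t. W (min t x) w)" if "x \<in> {0..T}" for x
    using that T_pos
    by (intro continuous_on_compose2[OF W_cont[OF w], of "{0..T}" "\<lambda>t. min t x"]) (auto intro!: continuous_intros)
  then show ?thesis
    unfolding simple_integral_def using simple_range[OF S]
    by (intro continuous_on_sum continuous_on_inner continuous_on_const continuous_on_diff) auto
qed

lemma sint_0: "simple m p h \<Longrightarrow> sint m p h 0 w = 0"
  unfolding simple_integral_def using simple_range[of m p h]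
  by (intro sum.neutral) (force simp: min_def)

lemma qv_0: "simple m p h \<Longrightarrow> sqv m p h 0 w = 0"
  unfolding sqv_def using simple_range[of m p h]
  by (intro sum.neutral) (force simp: min_def)

lemma qv_mono:
  assumes S: "simple m p h" and "s \<le> t"
  shows "sqv m p h s w \<le> sqv m p h t w"
  unfolding sqv_def
proof (rule sum_mono)
  fix i assume "i \<in> {..<m}"
  then have "p i \<le> p (Suc i)" using simple_mono[OF S, of i "Suc i"] by auto
  then show "(norm (h i w))\<^sup>2 * (min s (p (Suc i)) - min s (p i)) \<le> (norm (h i w))\<^sup>2 * (min t (p (Suc i)) - min t (p i))"
    using assms(2) by (intro mult_left_mono) (auto simp: min_def)
qed

text \<open>Since \<open>p j \<le> T\<close>, the time \<open>max t (p j)\<close> equals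
  \<open>min T (p j) - min t (p j) + t\<close>, and the values of \<open>W\<close> satisfy the same
  relation. Increments after \<open>t\<close> thus become sums over the grid lifted to
  \<open>t\<close>.\<close>

lemma window:
  assumes S: "simple m p h" and t: "t \<in> {0..T}"
  shows "sint_inc m p h t T w = (\<Sum>i<m. h i w \<bullet> (W (max t (p (Suc i))) w - W (max t (p i)) w))"
    and "sqv_inc m p h t T w = (\<Sum>i<m. (norm (h i w))\<^sup>2 * (max t (p (Suc i)) - max t (p i)))"
proof -
  have w: "W (max t (p j)) w = W (min T (p j)) w - W (min t (p j)) w + W t w"
      "max t (p j) = min T (p j) - min t (p j) + t" if "j \<le> m" for j
    using simple_range[OF S that] by (auto simp: max_def min_def)
  show "sint_inc m p h t T w = (\<Sum>i<m. h i w \<bullet> (W (max t (p (Suc i))) w - W (max t (p i)) w))"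
    unfolding simple_integral_def sum_subtractf[symmetric] inner_diff_right[symmetric]
    by (intro sum.cong refl arg_cong2[where f=inner]) (simp add: w(1))
  show "sqv_inc m p h t T w = (\<Sum>i<m. (norm (h i w))\<^sup>2 * (max t (p (Suc i)) - max t (p i)))"
    unfolding sqv_def sum_subtractf[symmetric] right_diff_distrib[symmetric]
    by (intro sum.cong refl arg_cong2[where f=times]) (simp add: w(2))
qed

text \<open>Stopping before the energy after \<open>t\<close> exceeds \<open>N\<close>. As
  \<open>h i\<close> is known at the start of its cell, so is the energy through the end of that
  cell; a cell that would overshoot is dropped as a whole, and the bound \<open>N\<close> holds
  exactly. The stopped integral is the original one evaluated at a random time \<open>s\<close>, and
  where the budget suffices nothing is changed.\<close>

lemma simple_truncate:
  assumes S: "simple m p h" and t: "t \<in> {0..T}" and N: "0 \<le> N"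
  obtains g where "simple m p g"
    "\<And>w. sqv_inc m p g t T w \<le> N"
    "\<And>w. \<exists>s\<in>{t..T}. sint_inc m p g t T w = sint_inc m p h t s w \<and>
       sqv_inc m p g t T w = sqv_inc m p h t s w \<and>
       (sqv_inc m p h t T w \<le> N \<longrightarrow> s = T)"
    "\<And>w i. sqv_inc m p h t T w \<le> N \<Longrightarrow> i < m \<Longrightarrow> g i w = h i w"
proof -
  define d where "d j = max t (p (Suc j)) - max t (p j)" for j
  \<comment> \<open>Energy spent after \<open>t\<close> through the end of cell \<open>i\<close>; it
    involves only the values up to \<open>h i\<close> and is therefore known at time
    \<open>p i\<close>.\<close>
  define A where "A i w = (\<Sum>j\<le>i. (norm (h j w))\<^sup>2 * d j)" for i w
  define g where "g i w = (if A i w \<le> N then h i w else 0)" for i w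
  have d0: "0 \<le> d j" if "j < m" for j
    using simple_mono[OF S, of j "Suc j"] that by (auto simp: d_def)
  have Amono: "A i w \<le> A j w" if "i \<le> j" "j < m" for i j w
    unfolding A_def using that d0 by (intro sum_mono2) auto
  have A_meas: "A i \<in> borel_measurable (F (p i))" if "i < m" for i
    unfolding A_def
  proof (rule borel_measurable_sum)
    fix j assume "j \<in> {..i}"
    then have "h j \<in> borel_measurable (F (p i))"
      using measurable_F_mono[OF simple_h[OF S, of j] simple_mono[OF S, of j i]] that by auto
    then show "(\<lambda>w. (norm (h j w))\<^sup>2 * d j) \<in> borel_measurable (F (p i))" by measurable
  qed
  have g_meas: "g i \<in> borel_measurable (F (p i))" if "i < m" for i
    unfolding g_def using A_meas[OF that] simple_h[OF S that] by measurable
  have gb: "bounded (g i ` space M)" if "i < m" for i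
  proof -
    have "bounded (h i ` space M)" using S that by (auto simp: simple_integrand_def)
    then obtain B where B: "\<forall>x\<in>h i ` space M. norm x \<le> B" unfolding bounded_iff by blast
    have "norm (g i w) \<le> \<bar>B\<bar>" if "w \<in> space M" for w
      using B that by (auto simp: g_def intro: order_trans[OF _ abs_ge_self])
    then show ?thesis unfolding bounded_iff by blast
  qed
  have Sg: "simple m p g"
    using S g_meas gb by (simp add: simple_integrand_def)
  \<comment> \<open>The first cell that would exceed the budget, or \<open>m\<close>. Since
    \<open>A i w\<close> increases with \<open>i\<close>, killing individual cells is the same as
    stopping at \<open>k w\<close>.\<close>
  define k where "k w = (LEAST k. k = m \<or> N < A k w)" for w
  have k: "k w = m \<or> N < A (k w) w" "k w \<le> m" "\<And>i. i < k w \<Longrightarrow> A i w \<le> N" for w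
  proof -
    show "k w = m \<or> N < A (k w) w" unfolding k_def by (rule LeastI[of _ m]) simp
    show "k w \<le> m" unfolding k_def by (rule Least_le) simp
    fix i assume "i < k w"
    from not_less_Least[OF this[unfolded k_def]] show "A i w \<le> N" by auto
  qed
  have g_eq: "g i w = (if i < k w then h i w else 0)" if "i < m" for i w
  proof (cases "i < k w")
    case True then show ?thesis using k(3) by (simp add: g_def)
  next
    case False
    then have "N < A (k w) w" using k(1)[of w] that by auto
    also have "\<dots> \<le> A i w" using Amono[of "k w" i w] False that by auto
    finally show ?thesis using False by (simp add: g_def)
  qed
  have wT: "sqv_inc m p h t T w = (\<Sum>i<m. (norm (h i w))\<^sup>2 * d i)" for w
    using window(2)[OF S t] by (simp add: d_def)
  have gq: "sqv_inc m p g t T w = (\<Sum>i<k w. (norm (h i w))\<^sup>2 * d i)" for w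
  proof -
    have "sqv_inc m p g t T w = (\<Sum>i<m. (norm (g i w))\<^sup>2 * d i)"
      using window(2)[OF Sg t] by (simp add: d_def)
    also have "\<dots> = (\<Sum>i<m. if i < k w then (norm (h i w))\<^sup>2 * d i else 0)"
      by (intro sum.cong) (auto simp: g_eq)
    also have "\<dots> = (\<Sum>i<k w. (norm (h i w))\<^sup>2 * d i)"
      using k(2)[of w] by (intro sum.mono_neutral_cong_right) auto
    finally show ?thesis .
  qed
  have gi: "sint_inc m p g t T w = (\<Sum>i<k w. h i w \<bullet> (W (max t (p (Suc i))) w - W (max t (p i)) w))" for w
  proof -
    have "sint_inc m p g t T w = (\<Sum>i<m. g i w \<bullet> (W (max t (p (Suc i))) w - W (max t (p i)) w))"
      using window(1)[OF Sg t] by simp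
    also have "\<dots> = (\<Sum>i<m. if i < k w then h i w \<bullet> (W (max t (p (Suc i))) w - W (max t (p i)) w) else 0)"
      by (intro sum.cong) (auto simp: g_eq)
    also have "\<dots> = (\<Sum>i<k w. h i w \<bullet> (W (max t (p (Suc i))) w - W (max t (p i)) w))"
      using k(2)[of w] by (intro sum.mono_neutral_cong_right) auto
    finally show ?thesis .
  qed
  have full: "k w = m" if "sqv_inc m p h t T w \<le> N" for w
  proof (rule ccontr)
    assume "k w \<noteq> m"
    then have lt: "k w < m" "N < A (k w) w" using k(1,2)[of w] by auto
    have "A (k w) w \<le> (\<Sum>i<m. (norm (h i w))\<^sup>2 * d i)"
      unfolding A_def using lt d0 by (intro sum_mono2) auto
    then show False using that lt wT[of w] by simp
  qed
  show thesis
  proof (rule that[OF Sg])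
    fix w
    show "sqv_inc m p g t T w \<le> N"
    proof (cases "k w")
      case 0 then show ?thesis using gq N by simp
    next
      case (Suc j)
      then show ?thesis using gq[of w] k(3)[of j w] by (simp add: A_def lessThan_Suc_atMost)
    qed
    let ?s = "max t (p (k w))"
    have s: "?s \<in> {t..T}" using simple_range[OF S k(2)] t by auto
    \<comment> \<open>Stated for an arbitrary \<phi>, so that it yields both the integral and the
      energy at the stopping time.\<close>
    have red: "(\<Sum>i<m. \<phi> i (min ?s (p (Suc i))) - \<phi> i (min ?s (p i))) - (\<Sum>i<m. \<phi> i (min t (p (Suc i))) - \<phi> i (min t (p i)))
      = (\<Sum>i<k w. \<phi> i (max t (p (Suc i))) - \<phi> i (max t (p i)))" for \<phi> :: "nat \<Rightarrow> real \<Rightarrow> real"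
    proof -
      have "(\<Sum>i<m. \<phi> i (min ?s (p (Suc i))) - \<phi> i (min ?s (p i))) - (\<Sum>i<m. \<phi> i (min t (p (Suc i))) - \<phi> i (min t (p i)))
        = (\<Sum>i<m. if i < k w then \<phi> i (max t (p (Suc i))) - \<phi> i (max t (p i)) else 0)"
        unfolding sum_subtractf[symmetric]
      proof (rule sum.cong[OF refl])
        fix i assume i: "i \<in> {..<m}"
        show "\<phi> i (min ?s (p (Suc i))) - \<phi> i (min ?s (p i)) - (\<phi> i (min t (p (Suc i))) - \<phi> i (min t (p i)))
           = (if i < k w then \<phi> i (max t (p (Suc i))) - \<phi> i (max t (p i)) else 0)"
        proof (cases "t = ?s")
          case True
          have "i < k w \<longrightarrow> p (Suc i) \<le> t \<and> p i \<le> t"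
            using True simple_mono[OF S, of "Suc i" "k w"] simple_mono[OF S, of i "Suc i"] k(2)[of w] i by auto
          then show ?thesis unfolding True[symmetric] by (auto simp: max_def)
        next
          case False
          then have s': "?s = p (k w)" "t < p (k w)" by (auto simp: max_def split: if_splits)
          show ?thesis
          proof (cases "i < k w")
            case True
            then have "p i \<le> p (Suc i)" "p (Suc i) \<le> p (k w)"
              using simple_mono[OF S, of "Suc i" "k w"] simple_mono[OF S, of i "Suc i"] k(2)[of w] i by auto
            then show ?thesis unfolding s'(1) using True s'(2) by (auto simp: min_def max_def)
          next
            case False
            then have "p (k w) \<le> p i" "p i \<le> p (Suc i)"
              using simple_mono[OF S, of "k w" i] simple_mono[OF S, of i "Suc i"] i by auto
            then show ?thesis unfolding s'(1) using False s'(2) by (auto simp: min_def)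
          qed
        qed
      qed
      also have "\<dots> = (\<Sum>i<k w. \<phi> i (max t (p (Suc i))) - \<phi> i (max t (p i)))"
        using k(2)[of w] by (intro sum.mono_neutral_cong_right) auto
      finally show ?thesis .
    qed
    have e1: "sint_inc m p h t ?s w = sint_inc m p g t T w"
      unfolding gi unfolding simple_integral_def inner_diff_right by (rule red[of "\<lambda>i x. h i w \<bullet> W x w"])
    have e2: "sqv_inc m p h t ?s w = sqv_inc m p g t T w"
      unfolding gq unfolding d_def sqv_def right_diff_distrib by (rule red[of "\<lambda>i x. (norm (h i w))\<^sup>2 * x"])
    show "\<exists>s\<in>{t..T}. sint_inc m p g t T w = sint_inc m p h t s w \<and>
       sqv_inc m p g t T w = sqv_inc m p h t s w \<and>
       (sqv_inc m p h t T w \<le> N \<longrightarrow> s = T)"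
    \<comment> \<open>If the budget suffices, the conclusion demands \<open>s = T\<close>, whereas
      \<open>?s\<close> is only \<open>max t (p m)\<close>. In this case \<open>g\<close> agrees
      with \<open>h\<close>, and \<open>T\<close> itself can be taken.\<close>
    proof (cases "sqv_inc m p h t T w \<le> N")
      case True
      have "g i w = h i w" if "i < m" for i using g_eq[OF that] full[OF True] that by simp
      then have "sint m p g s w = sint m p h s w" "sqv m p g s w = sqv m p h s w" for s
        unfolding simple_integral_def sqv_def by auto
      then show ?thesis using t by (intro bexI[of _ T]) auto
    next
      case False
      then show ?thesis using e1 e2 s by (intro bexI[of _ ?s]) auto
    qed
  next
    fix w i assume "sqv_inc m p h t T w \<le> N" "i < m"
    then show "g i w = h i w" using g_eq[of i w] full[of w] by simp
  qed
qed

text \<open>Doob's maximal inequality for the exponential martingale, combined with the bound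
  \<delta> on the energy. It is shown along finite sets of times by decomposing at the first
  exceedance; continuity of paths then makes the events along dyadic grids increase to the event for
  all times.\<close>

lemma exp_maximal:
  assumes S: "simple m p h" and t: "t \<in> {0..T}" and B: "B \<in> sets (F t)" and \<delta>: "0 < \<delta>" and a: "0 < a"
    and bd: "\<And>w. sqv_inc m p h t T w \<le> \<delta>"
  shows "emeasure P {w\<in>B. \<exists>s\<in>{t..T}. a < sint_inc m p h t s w} \<le> ennreal (exp (- a\<^sup>2 / (2 * \<delta>))) * emeasure P B"
proof -
  \<comment> \<open>This choice minimises the exponent
    \<open>c\<^sup>2 * \<delta> / 2 - c * a\<close>, with minimum
    \<open>- a\<^sup>2 / (2 * \<delta>)\<close>.\<close>
  define c where "c = a / \<delta>"
  have c: "0 < c" using a \<delta> by (simp add: c_def)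
  define X where "X s w = exp (c * (sint_inc m p h t s w) - c\<^sup>2 * (sqv_inc m p h t s w) / 2)" for s w
  define G where "G s w = sint_inc m p h t s w" for s w
  have BP: "B \<in> sets P" and Bs: "B \<subseteq> space M" using F_sub_P[OF B] sets.sets_into_space[OF B] by auto
  have adG: "G s \<in> borel_measurable (F s')" if "s \<in> {t..T}" "s \<le> s'" for s s'
  proof -
    have "sint m p h s \<in> borel_measurable (F s')" "sint m p h t \<in> borel_measurable (F s')"
      using measurable_F_mono[OF simple_integral_adapted[OF S], of s s'] measurable_F_mono[OF simple_integral_adapted[OF S], of t s'] that t by auto
    then show ?thesis unfolding G_def by measurable
  qed
  have adX: "X s \<in> borel_measurable (F s)" if "s \<in> {t..T}" for s
  proof -
    have "sqv m p h s \<in> borel_measurable (F s)" "sqv m p h t \<in> borel_measurable (F s)"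
      using measurable_F_mono[OF simple_qv_adapted[OF S], of s s] measurable_F_mono[OF simple_qv_adapted[OF S], of t s] that t by auto
    with adG[OF that order_refl] show ?thesis unfolding X_def G_def[symmetric] by measurable
  qed
  \<comment> \<open>The martingale property from \<open>s\<close> to \<open>T\<close>, tested on
    events of \<open>F s\<close>.\<close>
  have XT: "(\<E> w. indicator E w * ennreal (X s w)) = (\<E> w. indicator E w * ennreal (X T w))"
    if s: "s \<in> {t..T}" and E: "E \<in> sets (F s)" for s E
  proof -
    have "(\<E> w. (indicator E w * ennreal (X s w)) * ennreal (exp (c * (sint_inc m p h s T w)
      - c\<^sup>2 * (sqv_inc m p h s T w) / 2))) = (\<E> w. indicator E w * ennreal (X s w))"
      using s t E adX[OF s] by (intro exp_simple[OF S]) auto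
    moreover have "(indicator E w * ennreal (X s w)) * ennreal (exp (c * (sint_inc m p h s T w)
      - c\<^sup>2 * (sqv_inc m p h s T w) / 2)) = indicator E w * ennreal (X T w)" for w
    proof -
      have "X s w * exp (c * (sint_inc m p h s T w) - c\<^sup>2 * (sqv_inc m p h s T w) / 2) = X T w"
        unfolding X_def exp_add[symmetric] by (simp add: field_simps)
      then show ?thesis by (simp add: mult.assoc ennreal_mult[symmetric] X_def)
    qed
    ultimately show ?thesis by simp
  qed
  have fin: "emeasure P {w\<in>B. \<exists>s\<in>D. a < G s w} \<le> ennreal (exp (- a\<^sup>2 / (2 * \<delta>))) * emeasure P B"
    if D: "finite D" "D \<subseteq> {t..T}" for D
  proof -
    \<comment> \<open>First exceedance at \<open>s\<close>: these events are disjoint, and each is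
      decided at time \<open>s\<close>.\<close>
    define E where "E s = {w\<in>B. a < G s w \<and> (\<forall>r\<in>{r\<in>D. r < s}. \<not> a < G r w)}" for s
    have E: "E s \<in> sets (F s)" if s: "s \<in> D" for s
    proof -
      have "s \<in> {t..T}" using s D by auto
      then have [measurable]: "B \<in> sets (F s)" "G s \<in> borel_measurable (F s)"
        using F_mono[of t s] B adG[of s s] by auto
      have m: "{w\<in>space (F s). a < G r w} \<in> sets (F s)" if "r \<in> {r\<in>D. r \<le> s}" for r
      proof -
        have "G r \<in> borel_measurable (F s)" using adG[of r s] that D by auto
        then show ?thesis by measurable
      qed
      have "(B \<inter> {w\<in>space (F s). a < G s w}) - (\<Union>r\<in>{r\<in>D. r < s}. {w\<in>space (F s). a < G r w}) \<in> sets (F s)"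
        using D m s \<open>B \<in> sets (F s)\<close> by (intro sets.Diff sets.Int sets.finite_UN) (auto simp del: space_aug_filtration)
      also have "(B \<inter> {w\<in>space (F s). a < G s w}) - (\<Union>r\<in>{r\<in>D. r < s}. {w\<in>space (F s). a < G r w}) = E s"
        using Bs by (auto simp: E_def)
      finally show ?thesis .
    qed
    have un: "{w\<in>B. \<exists>s\<in>D. a < G s w} = (\<Union>s\<in>D. E s)"
    proof (intro set_eqI iffI)
      fix w assume w: "w \<in> {w\<in>B. \<exists>s\<in>D. a < G s w}"
      define H where "H = {s\<in>D. a < G s w}"
      have H: "finite H" "H \<noteq> {}" using D w by (auto simp: H_def)
      then have "Min H \<in> H" by (rule Min_in)
      moreover have "\<not> a < G r w" if "r \<in> D" "r < Min H" for r
        using Min_le[OF H(1), of r] that by (auto simp: H_def)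
      ultimately show "w \<in> (\<Union>s\<in>D. E s)" using w by (auto simp: E_def H_def)
    qed (auto simp: E_def)
    have disj: "disjoint_family_on E D"
      by (auto simp: disjoint_family_on_def E_def) (metis linorder_neqE_linordered_idom)
    \<comment> \<open>Lower bound for the exponential on \<open>E s\<close>, where the integral
      exceeds \<open>a\<close> and the energy is at most \<delta>.\<close>
    define L where "L = exp (c * a - c\<^sup>2 * \<delta> / 2)"
    have "ennreal L * emeasure P (E s) \<le> (\<E> w. indicator (E s) w * ennreal (X T w))" if s: "s \<in> D" for s
    proof -
      have sT: "s \<in> {t..T}" using s D by auto
      have "ennreal L * emeasure P (E s) = (\<E> w. ennreal L * indicator (E s) w)"
        using F_sub_P[OF E[OF s]] by (simp add: nn_integral_cmult_indicator)
      also have "\<dots> \<le> (\<E> w. indicator (E s) w * ennreal (X s w))"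
      proof (rule nn_integral_mono)
        fix w
        have "L \<le> X s w" if "w \<in> E s"
        proof -
          have "sqv_inc m p h t s w \<le> \<delta>"
            using bd[of w] qv_mono[OF S, of s T w] sT by auto
          then have "c\<^sup>2 * (sqv_inc m p h t s w) \<le> c\<^sup>2 * \<delta>" by (intro mult_left_mono) auto
          moreover have "c * a \<le> c * G s w" using that c by (auto simp: E_def)
          ultimately show ?thesis unfolding L_def X_def G_def by simp
        qed
        then show "ennreal L * indicator (E s) w \<le> indicator (E s) w * ennreal (X s w)"
          by (auto simp: indicator_def intro!: ennreal_leI)
      qed
      also have "\<dots> = (\<E> w. indicator (E s) w * ennreal (X T w))"
        by (rule XT[OF sT E[OF s]])
      finally show ?thesis .
    qed
    then have "(\<Sum>s\<in>D. ennreal L * emeasure P (E s)) \<le> (\<Sum>s\<in>D. (\<E> w. indicator (E s) w * ennreal (X T w)))"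
      by (rule sum_mono)
    also have "\<dots> = (\<E> w. (\<Sum>s\<in>D. indicator (E s) w * ennreal (X T w)))"
      using F_sub_P[OF E] measurable_F_P[OF adX[of T]] t by (intro nn_integral_sum[symmetric]) auto
    also have "\<dots> \<le> (\<E> w. indicator B w * ennreal (X T w))"
    proof (rule nn_integral_mono)
      fix w
      have "(\<Sum>s\<in>D. indicator (E s) w :: ennreal) = indicator (\<Union>s\<in>D. E s) w"
        by (rule indicator_UN_disjoint[OF D(1) disj, symmetric])
      also have "\<dots> \<le> indicator B w" by (auto simp: E_def indicator_def)
      finally show "(\<Sum>s\<in>D. indicator (E s) w * ennreal (X T w)) \<le> indicator B w * ennreal (X T w)"
        unfolding sum_distrib_right[symmetric] by (rule mult_right_mono) simp
    qed
    also have "\<dots> = (\<E> w. indicator B w * ennreal (X t w))"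
      using t B by (intro XT[symmetric]) auto
    also have "\<dots> = emeasure P B" using BP by (simp add: X_def)
    finally have "ennreal L * emeasure P {w\<in>B. \<exists>s\<in>D. a < G s w} \<le> emeasure P B"
      unfolding un sum_distrib_left[symmetric]
      using F_sub_P[OF E] by (subst (asm) sum_emeasure[OF _ disj D(1)]) auto
    then have "ennreal (exp (- a\<^sup>2 / (2 * \<delta>))) * (ennreal L * emeasure P {w\<in>B. \<exists>s\<in>D. a < G s w})
       \<le> ennreal (exp (- a\<^sup>2 / (2 * \<delta>))) * emeasure P B" by (intro mult_left_mono) auto
    moreover have "exp (- a\<^sup>2 / (2 * \<delta>)) * L = 1"
      unfolding L_def c_def exp_add[symmetric] using \<delta> by (simp add: field_simps power2_eq_square)
    ultimately show ?thesis by (simp add: mult.assoc[symmetric] ennreal_mult[symmetric] L_def)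
  qed
  define EV where "EV n = {w\<in>B. \<exists>s\<in>dyadic_grid t T n. a < G s w}" for n
  have tT: "t \<le> T" "0 \<le> t" using t by auto
  have EVm: "EV n \<in> sets P" for n
  proof -
    have m: "G s \<in> borel_measurable P" if "s \<in> dyadic_grid t T n" for s
      using that dyadic_grid_subset[OF tT(1), of n] by (intro measurable_F_P[OF adG[OF _ order_refl]]) auto
    have "{w\<in>space P. a < G s w} \<in> sets P" if "s \<in> dyadic_grid t T n" for s
      using m[OF that] by (rule borel_measurable_less[OF borel_measurable_const])
    then have "B \<inter> (\<Union>s\<in>dyadic_grid t T n. {w\<in>space P. a < G s w}) \<in> sets P"
      using BP by (intro sets.Int sets.finite_UN) auto
    also have "B \<inter> (\<Union>s\<in>dyadic_grid t T n. {w\<in>space P. a < G s w}) = EV n"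
      using Bs by (auto simp: EV_def)
    finally show ?thesis .
  qed
  have EVmono: "incseq EV" unfolding EV_def incseq_def using dyadic_grid_mono by blast
  have "{w\<in>B. \<exists>s\<in>{t..T}. a < sint_inc m p h t s w} = (\<Union>n. EV n)"
  proof (intro set_eqI iffI)
    fix w assume w: "w \<in> {w\<in>B. \<exists>s\<in>{t..T}. a < sint_inc m p h t s w}"
    then obtain s where s: "s \<in> {t..T}" "a < G s w" by (auto simp: G_def)
    have "continuous_on {t..T} (\<lambda>s. G s w)"
      unfolding G_def using continuous_on_subset[OF sint_continuous[OF S], of w "{t..T}"] w Bs t
      by (intro continuous_intros) auto
    from dyadic_grid_ex[OF this s] show "w \<in> (\<Union>n. EV n)" using w by (auto simp: EV_def)
  next
    fix w assume "w \<in> (\<Union>n. EV n)"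
    then show "w \<in> {w\<in>B. \<exists>s\<in>{t..T}. a < sint_inc m p h t s w}"
      using dyadic_grid_subset[OF tT(1)] by (fastforce simp: EV_def G_def)
  qed
  moreover have "emeasure P (\<Union>n. EV n) \<le> ennreal (exp (- a\<^sup>2 / (2 * \<delta>))) * emeasure P B"
  proof -
    have "emeasure P (\<Union>n. EV n) = (SUP n. emeasure P (EV n))"
      using EVm by (intro SUP_emeasure_incseq[OF _ EVmono, symmetric]) auto
    also have "\<dots> \<le> ennreal (exp (- a\<^sup>2 / (2 * \<delta>))) * emeasure P B"
      unfolding EV_def using fin[OF finite_dyadic_grid dyadic_grid_subset[OF tT(1)]] by (intro SUP_least) auto
    finally show ?thesis .
  qed
  ultimately show ?thesis by simp
qed

end

section \<open>Convergence in probability\<close>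

context prob_space
begin

lemma tip_meas: "tendsto_0_in_prob M X \<Longrightarrow> X n \<in> borel_measurable M"
  by (auto simp: tendsto_0_in_prob_def)

lemma tip_lim: "tendsto_0_in_prob M X \<Longrightarrow> 0 < \<epsilon> \<Longrightarrow> (\<lambda>n. prob {w\<in>space M. ennreal \<epsilon> < X n w}) \<longlonglongrightarrow> 0"
  by (auto simp: tendsto_0_in_prob_def)

lemma tip_mono:
  assumes Y: "tendsto_0_in_prob M Y" and X: "\<And>n. X n \<in> borel_measurable M"
    and le: "\<And>n. AE w in M. X n w \<le> Y n w"
  shows "tendsto_0_in_prob M X"
  unfolding tendsto_0_in_prob_def
proof (intro conjI allI impI X)
  fix \<epsilon> :: real assume \<epsilon>: "0 < \<epsilon>"
  have [measurable]: "X n \<in> borel_measurable M" "Y n \<in> borel_measurable M" for n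
    using X tip_meas[OF Y] by auto
  have "prob {w\<in>space M. ennreal \<epsilon> < X n w} \<le> prob {w\<in>space M. ennreal \<epsilon> < Y n w}" for n
    using le[of n] by (intro finite_measure_mono_AE) (auto elim!: eventually_mono)
  then show "(\<lambda>n. prob {w\<in>space M. ennreal \<epsilon> < X n w}) \<longlonglongrightarrow> 0"
    by (intro tendsto_sandwich[OF _ _ tendsto_const tip_lim[OF Y \<epsilon>]]) auto
qed

lemma tip_add:
  assumes X: "tendsto_0_in_prob M X" and Y: "tendsto_0_in_prob M Y"
  shows "tendsto_0_in_prob M (\<lambda>n w. X n w + Y n w)"
  unfolding tendsto_0_in_prob_def
proof (intro conjI allI impI)
  have [measurable]: "X n \<in> borel_measurable M" "Y n \<in> borel_measurable M" for n
    using tip_meas[OF X] tip_meas[OF Y] by auto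
  show "(\<lambda>w. X n w + Y n w) \<in> borel_measurable M" for n by measurable
  fix \<epsilon> :: real assume \<epsilon>: "0 < \<epsilon>"
  have le: "prob {w\<in>space M. ennreal \<epsilon> < X n w + Y n w}
    \<le> prob {w\<in>space M. ennreal (\<epsilon>/2) < X n w} + prob {w\<in>space M. ennreal (\<epsilon>/2) < Y n w}" for n
  proof -
    have "{w\<in>space M. ennreal \<epsilon> < X n w + Y n w}
      \<subseteq> {w\<in>space M. ennreal (\<epsilon>/2) < X n w} \<union> {w\<in>space M. ennreal (\<epsilon>/2) < Y n w}"
    proof (rule subsetI, rule ccontr)
      fix w assume a: "w \<in> {w\<in>space M. ennreal \<epsilon> < X n w + Y n w}"
        "w \<notin> {w\<in>space M. ennreal (\<epsilon>/2) < X n w} \<union> {w\<in>space M. ennreal (\<epsilon>/2) < Y n w}"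
      then have "X n w + Y n w \<le> ennreal (\<epsilon>/2) + ennreal (\<epsilon>/2)" by (intro add_mono) (auto simp: not_less)
      also have "\<dots> = ennreal \<epsilon>" using \<epsilon> by (simp add: ennreal_plus[symmetric] del: ennreal_plus)
      finally show False using a by auto
    qed
    then have "prob {w\<in>space M. ennreal \<epsilon> < X n w + Y n w}
      \<le> prob ({w\<in>space M. ennreal (\<epsilon>/2) < X n w} \<union> {w\<in>space M. ennreal (\<epsilon>/2) < Y n w})"
      by (intro finite_measure_mono) auto
    also have "\<dots> \<le> prob {w\<in>space M. ennreal (\<epsilon>/2) < X n w} + prob {w\<in>space M. ennreal (\<epsilon>/2) < Y n w}"
      by (rule measure_Un_le) auto
    finally show ?thesis .
  qed
  have "(\<lambda>n. prob {w\<in>space M. ennreal (\<epsilon>/2) < X n w} + prob {w\<in>space M. ennreal (\<epsilon>/2) < Y n w}) \<longlonglongrightarrow> 0 + 0"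
    using \<epsilon> by (intro tendsto_add tip_lim X Y) auto
  then show "(\<lambda>n. prob {w\<in>space M. ennreal \<epsilon> < X n w + Y n w}) \<longlonglongrightarrow> 0"
    unfolding add_0_right by (rule tendsto_sandwich[OF _ _ tendsto_const, rotated 2]) (simp_all add: le)
qed

lemma tip_cmult:
  assumes X: "tendsto_0_in_prob M X" and c: "0 \<le> c"
  shows "tendsto_0_in_prob M (\<lambda>n w. ennreal c * X n w)"
  unfolding tendsto_0_in_prob_def
proof (intro conjI allI impI)
  have [measurable]: "X n \<in> borel_measurable M" for n
    using tip_meas[OF X] by auto
  show "(\<lambda>w. ennreal c * X n w) \<in> borel_measurable M" for n by measurable
  fix \<epsilon> :: real assume \<epsilon>: "0 < \<epsilon>"
  have "prob {w\<in>space M. ennreal \<epsilon> < ennreal c * X n w} \<le> prob {w\<in>space M. ennreal (\<epsilon>/(c+1)) < X n w}" for n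
  proof (rule finite_measure_mono, rule subsetI, rule ccontr)
    fix w assume a: "w \<in> {w\<in>space M. ennreal \<epsilon> < ennreal c * X n w}"
      "w \<notin> {w\<in>space M. ennreal (\<epsilon>/(c+1)) < X n w}"
    then have "ennreal c * X n w \<le> ennreal (c + 1) * ennreal (\<epsilon>/(c+1))"
      by (intro mult_mono) (auto simp: not_less intro!: ennreal_leI)
    also have "\<dots> = ennreal \<epsilon>" using c \<epsilon> by (simp add: ennreal_mult[symmetric] del: ennreal_plus)
    finally show False using a by auto
  qed auto
  then show "(\<lambda>n. prob {w\<in>space M. ennreal \<epsilon> < ennreal c * X n w}) \<longlonglongrightarrow> 0"
    using \<epsilon> c by (intro tendsto_sandwich[OF _ _ tendsto_const tip_lim[OF X, of "\<epsilon>/(c+1)"]]) auto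
qed

text \<open>For fixed \<epsilon> the level \<open>1 / real (Suc n)\<close> eventually drops below
  it. Serves the diagonal selection in \<open>ito_closed\<close>.\<close>

lemma tip_diag:
  assumes X: "\<And>n. X n \<in> borel_measurable M"
    and b: "\<And>n. prob {w\<in>space M. ennreal (1 / real (Suc n)) < X n w} \<le> 1 / real (Suc n)"
  shows "tendsto_0_in_prob M X"
  unfolding tendsto_0_in_prob_def
proof (intro conjI allI impI X)
  fix \<epsilon> :: real assume \<epsilon>: "0 < \<epsilon>"
  have [measurable]: "X n \<in> borel_measurable M" for n using X by auto
  have l: "(\<lambda>n. 1 / real (Suc n)) \<longlonglongrightarrow> 0" using LIMSEQ_inverse_real_of_nat by (simp add: divide_inverse)
  have "\<forall>\<^sub>F n in sequentially. prob {w\<in>space M. ennreal \<epsilon> < X n w} \<le> 1 / real (Suc n)"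
    using order_tendstoD(2)[OF l \<epsilon>]
  proof eventually_elim
    case (elim n)
    have "prob {w\<in>space M. ennreal \<epsilon> < X n w} \<le> prob {w\<in>space M. ennreal (1 / real (Suc n)) < X n w}"
    proof (rule finite_measure_mono)
      have "ennreal (1 / real (Suc n)) \<le> ennreal \<epsilon>" using elim by (intro ennreal_leI) simp
      then show "{w\<in>space M. ennreal \<epsilon> < X n w} \<subseteq> {w\<in>space M. ennreal (1 / real (Suc n)) < X n w}"
        by (auto intro: le_less_trans simp del: of_nat_Suc)
    qed measurable
    with b[of n] show ?case by simp
  qed
  then show "(\<lambda>n. prob {w\<in>space M. ennreal \<epsilon> < X n w}) \<longlonglongrightarrow> 0"
    by (intro tendsto_sandwich[OF _ _ tendsto_const l]) auto
qed

lemma tip_ex_small: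
  assumes X: "tendsto_0_in_prob M X" and "0 < \<epsilon>" "0 < \<delta>"
  shows "\<forall>\<^sub>F n in sequentially. prob {w\<in>space M. ennreal \<epsilon> < X n w} < \<delta>"
  using order_tendstoD(2)[OF tip_lim[OF X \<open>0 < \<epsilon>\<close>] \<open>0 < \<delta>\<close>] .

text \<open>Borel-Cantelli: the probabilities are dominated by a convergent geometric
  series.\<close>

lemma AE_eventually_small:
  assumes X: "\<And>n. X n \<in> borel_measurable M"
    and b: "\<And>n. prob {w\<in>space M. ennreal (e n) < X n w} \<le> c * (1/2) ^ n"
  shows "AE w in M. \<forall>\<^sub>F n in sequentially. X n w \<le> ennreal (e n)"
proof -
  have [measurable]: "X n \<in> borel_measurable M" for n using X by auto
  have "summable (\<lambda>n. prob {w\<in>space M. ennreal (e n) < X n w})"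
    by (rule summable_comparison_test'[of "\<lambda>n. c * (1/2) ^ n" 0])
       (use b in \<open>auto intro!: summable_mult summable_geometric\<close>)
  then have "AE w in M. \<forall>\<^sub>F n in sequentially. w \<in> space M - {w\<in>space M. ennreal (e n) < X n w}"
    by (intro borel_cantelli_AE1) (auto simp: emeasure_eq_measure)
  then show ?thesis by eventually_elim (auto elim!: eventually_mono simp: not_less)
qed

lemma tip_subseq_fast:
  assumes X: "tendsto_0_in_prob M X" and e: "\<And>n. 0 < e n"
  obtains r where "strict_mono r" "\<And>n. prob {w\<in>space M. ennreal (e n) < X (r n) w} \<le> (1/2) ^ n"
proof -
  have "\<exists>N. \<forall>n\<ge>N. prob {w\<in>space M. ennreal (e k) < X n w} < (1/2) ^ k" for k
    using tip_ex_small[OF X e[of k], of "(1/2)^k"] by (auto simp: eventually_sequentially)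
  then obtain N where N: "\<And>k n. N k \<le> n \<Longrightarrow> prob {w\<in>space M. ennreal (e k) < X n w} < (1/2) ^ k" by metis
  \<comment> \<open>Each index lies beyond its predecessor, for strict monotonicity, and beyond the
    threshold \<open>N k\<close> of the current accuracy.\<close>
  define r where "r = rec_nat (N 0) (\<lambda>k x. max (Suc x) (N (Suc k)))"
  have r: "r 0 = N 0" "r (Suc k) = max (Suc (r k)) (N (Suc k))" for k by (simp_all add: r_def)
  have "N k \<le> r k" for k using r by (cases k) auto
  moreover have "strict_mono r" by (rule strict_mono_Suc_iff[THEN iffD2]) (simp add: r less_max_iff_disj)
  ultimately show thesis using N by (intro that[of r]) (auto intro: less_imp_le)
qed

lemma tip_subseq_AE:
  assumes X: "tendsto_0_in_prob M X"
  obtains r where "strict_mono r" "AE w in M. (\<lambda>n. X (r n) w) \<longlonglongrightarrow> 0"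
proof -
  obtain r where r: "strict_mono r" "\<And>n. prob {w\<in>space M. ennreal ((1/2)^n) < X (r n) w} \<le> (1/2) ^ n"
    using tip_subseq_fast[OF X, of "\<lambda>n. (1/2)^n"] by auto
  have "AE w in M. \<forall>\<^sub>F n in sequentially. X (r n) w \<le> ennreal ((1/2)^n)"
    using r(2) by (intro AE_eventually_small[where c=1]) (auto intro: tip_meas[OF X])
  then have "AE w in M. (\<lambda>n. X (r n) w) \<longlonglongrightarrow> 0"
  proof eventually_elim
    case (elim w)
    have "(\<lambda>n. ennreal ((1/2)^n)) \<longlonglongrightarrow> ennreal 0"
      by (intro tendsto_ennrealI LIMSEQ_power_zero) auto
    then show ?case using elim by (intro tendsto_sandwich[OF _ elim tendsto_const]) auto
  qed
  with r(1) show thesis by (rule that)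
qed

lemma tip_AE:
  assumes X: "\<And>n. X n \<in> borel_measurable M" and l: "AE w in M. (\<lambda>n. X n w) \<longlonglongrightarrow> 0"
  shows "tendsto_0_in_prob M X"
  unfolding tendsto_0_in_prob_def
proof (intro conjI allI impI X)
  fix \<epsilon> :: real assume \<epsilon>: "0 < \<epsilon>"
  have [measurable]: "X n \<in> borel_measurable M" for n using X by auto
  define E where "E n = {w\<in>space M. ennreal \<epsilon> < X n w}" for n
  have Em[measurable]: "E n \<in> sets M" for n unfolding E_def by measurable
  have "(\<lambda>n. \<integral>w. indicator (E n) w \<partial>M) \<longlonglongrightarrow> (\<integral>w. 0 \<partial>M :: real)"
  proof (rule integral_dominated_convergence[where w="\<lambda>_. 1"])
    show "AE w in M. (\<lambda>n. indicator (E n) w :: real) \<longlonglongrightarrow> 0"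
      using l
    proof eventually_elim
      case (elim w)
      have "\<forall>\<^sub>F n in sequentially. X n w < ennreal \<epsilon>"
        using order_tendstoD(2)[OF elim, of "ennreal \<epsilon>"] \<epsilon> by simp
      then have "\<forall>\<^sub>F n in sequentially. (indicator (E n) w :: real) = 0"
        by eventually_elim (auto simp: E_def indicator_def dest: less_asym)
      then show ?case by (rule tendsto_eventually)
    qed
  qed auto
  then show "(\<lambda>n. prob {w\<in>space M. ennreal \<epsilon> < X n w}) \<longlonglongrightarrow> 0"
    by (simp add: E_def[symmetric])
qed

end

section \<open>Algebra of simple integrands\<close>

context brownian_setup
begin

text \<open>For a continuous path the uncountable union reduces to dyadic times. Paths are
  continuous only almost surely, so the event agrees with a countable union up to a null set, and
  measurability rests on the completeness of \<open>P\<close>.\<close>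

lemma ex_event:
  fixes G :: "real \<Rightarrow> 'a \<Rightarrow> real"
  assumes G: "\<And>s. s \<in> {a..b} \<Longrightarrow> G s \<in> borel_measurable P" and ab: "a \<le> b"
    and cont: "AE w in M. continuous_on {a..b} (\<lambda>s. G s w)"
  shows "{w\<in>space M. \<exists>s\<in>{a..b}. (c::real) < G s w} \<in> sets P"
proof (rule completion.in_sets_AE)
  show "(\<Union>n. \<Union>s\<in>dyadic_grid a b n. {w\<in>space P. c < G s w}) \<in> sets P"
  proof (rule sets.countable_UN, rule image_subsetI, rule sets.finite_UN)
    fix n s assume "s \<in> dyadic_grid a b n"
    then have "G s \<in> borel_measurable P" using G dyadic_grid_subset[OF ab, of n] by auto
    then show "{w\<in>space P. c < G s w} \<in> sets P" by (rule borel_measurable_less[OF borel_measurable_const])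
  qed simp
  show "AE w in P. (w \<in> (\<Union>n. \<Union>s\<in>dyadic_grid a b n. {w\<in>space P. c < G s w})) = (w \<in> {w\<in>space M. \<exists>s\<in>{a..b}. c < G s w})"
    unfolding AE_P using cont
  proof eventually_elim
    case (elim w)
    have "(\<exists>n. \<exists>s\<in>dyadic_grid a b n. c < G s w) \<longleftrightarrow> (\<exists>s\<in>{a..b}. c < G s w)"
      using dyadic_grid_ex[OF elim, of _ c] dyadic_grid_subset[OF ab] by blast
    then show ?case by auto
  qed
qed auto

text \<open>The supremum exceeds \<open>y\<close> strictly exactly if some time does, so the strict
  level sets fall under \<open>ex_event\<close>.\<close>

lemma sup_measurable:
  fixes G :: "real \<Rightarrow> 'a \<Rightarrow> real"
  assumes G: "\<And>s. s \<in> {a..b} \<Longrightarrow> G s \<in> borel_measurable P" and ab: "a \<le> b"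
    and cont: "AE w in M. continuous_on {a..b} (\<lambda>s. G s w)"
  shows "(\<lambda>w. \<Squnion>s\<in>{a..b}. ennreal \<bar>G s w\<bar>) \<in> borel_measurable P"
proof (rule borel_measurableI_greater)
  fix y :: ennreal
  show "{w\<in>space P. y < (\<Squnion>s\<in>{a..b}. ennreal \<bar>G s w\<bar>)} \<in> sets P"
  proof (cases y)
    case (real c)
    have "{w\<in>space M. \<exists>s\<in>{a..b}. c < \<bar>G s w\<bar>} \<in> sets P"
    proof (rule ex_event[OF _ ab])
      show "(\<lambda>w. \<bar>G s w\<bar>) \<in> borel_measurable P" if "s \<in> {a..b}" for s
        using G[OF that] by (rule borel_measurable_abs)
      show "AE w in M. continuous_on {a..b} (\<lambda>s. \<bar>G s w\<bar>)"
        using cont by eventually_elim (rule continuous_on_rabs)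
    qed
    moreover have "y < (\<Squnion>s\<in>{a..b}. ennreal \<bar>G s w\<bar>) \<longleftrightarrow> (\<exists>s\<in>{a..b}. c < \<bar>G s w\<bar>)" for w
      unfolding less_SUP_iff by (rule bex_cong[OF refl]) (simp only: real ennreal_less_iff)
    then have "{w\<in>space P. y < (\<Squnion>s\<in>{a..b}. ennreal \<bar>G s w\<bar>)} = {w\<in>space M. \<exists>s\<in>{a..b}. c < \<bar>G s w\<bar>}"
      by (simp only: space_completion)
    ultimately show ?thesis by (simp only:)
  next
    case top
    then have "{w\<in>space P. y < (\<Squnion>s\<in>{a..b}. ennreal \<bar>G s w\<bar>)} = {}" by simp
    then show ?thesis by (simp only: sets.empty_sets)
  qed
qed

lemma simple_process_eq:
  assumes S: "simple m p h" and i: "i < m" and s: "p i < s" "s \<le> p (Suc i)"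
  shows "sproc m p h s w = h i w"
proof -
  have u: "j = i" if "j < m" "p j < s" "s \<le> p (Suc j)" for j
  proof (rule linorder_cases[of i j])
    assume "i < j" then have "p (Suc i) \<le> p j" using simple_mono[OF S, of "Suc i" j] that by auto
    then show ?thesis using that s by auto
  next
    assume "j < i" then have "p (Suc j) \<le> p i" using simple_mono[OF S, of "Suc j" i] that i by auto
    then show ?thesis using that s by auto
  qed auto
  have "sproc m p h s w = (\<Sum>j<m. if j = i then h j w else 0)"
    unfolding simple_process_def
  proof (rule sum.cong[OF refl])
    fix j assume "j \<in> {..<m}"
    then have "s \<in> {p j<..p (Suc j)} \<longleftrightarrow> j = i" using u[of j] s by auto
    then show "indicator {p j<..p (Suc j)} s *\<^sub>R h j w = (if j = i then h j w else 0)" by (cases "j = i") auto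
  qed
  then show ?thesis using i by simp
qed

text \<open>The cells are disjoint, so no cross terms arise when the sum is squared.\<close>

lemma norm_simple_process:
  assumes S: "simple m p h"
  shows "ennreal ((norm (sproc m p h s w))\<^sup>2) = (\<Sum>i<m. ennreal ((norm (h i w))\<^sup>2) * indicator {p i<..p (Suc i)} s)"
proof (cases "\<exists>i<m. s \<in> {p i<..p (Suc i)}")
  case True
  then obtain i where i: "i < m" "p i < s" "s \<le> p (Suc i)" by auto
  have u: "j = i" if "j < m" "p j < s" "s \<le> p (Suc j)" for j
  proof (rule linorder_cases[of i j])
    assume "i < j" then have "p (Suc i) \<le> p j" using simple_mono[OF S, of "Suc i" j] that by auto
    then show ?thesis using that i by auto
  next
    assume "j < i" then have "p (Suc j) \<le> p i" using simple_mono[OF S, of "Suc j" i] that i by auto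
    then show ?thesis using that i by auto
  qed auto
  have "(\<Sum>j<m. ennreal ((norm (h j w))\<^sup>2) * indicator {p j<..p (Suc j)} s) = (\<Sum>j<m. if j = i then ennreal ((norm (h j w))\<^sup>2) else 0)"
  proof (rule sum.cong[OF refl])
    fix j assume "j \<in> {..<m}"
    then have "s \<in> {p j<..p (Suc j)} \<longleftrightarrow> j = i" using u[of j] i by auto
    then show "ennreal ((norm (h j w))\<^sup>2) * indicator {p j<..p (Suc j)} s = (if j = i then ennreal ((norm (h j w))\<^sup>2) else 0)"
      by (cases "j = i") auto
  qed
  then show ?thesis using i simple_process_eq[OF S i] by simp
next
  case False
  have "sproc m p h s w = 0" unfolding simple_process_def using False by (intro sum.neutral) auto
  moreover have "(\<Sum>i<m. ennreal ((norm (h i w))\<^sup>2) * indicator {p i<..p (Suc i)} s) = 0"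
    using False by (intro sum.neutral) auto
  ultimately show ?thesis by simp
qed

lemma nn_integral_simple:
  assumes S: "simple m p h" and ab: "a \<le> b"
  shows "(\<integral>\<^sup>+ s \<in> {a..b}. ennreal ((norm (sproc m p h s w))\<^sup>2) \<partial>lborel)
    = ennreal (sqv_inc m p h a b w)"
proof -
  have "(\<integral>\<^sup>+ s \<in> {a..b}. ennreal ((norm (sproc m p h s w))\<^sup>2) \<partial>lborel)
    = (\<integral>\<^sup>+ s. (\<Sum>i<m. ennreal ((norm (h i w))\<^sup>2) * indicator ({p i<..p (Suc i)} \<inter> {a..b}) s) \<partial>lborel)"
    unfolding norm_simple_process[OF S] sum_distrib_right
    by (intro nn_integral_cong sum.cong refl) (auto simp: indicator_def)
  also have "\<dots> = (\<Sum>i<m. ennreal ((norm (h i w))\<^sup>2) * emeasure lborel ({p i<..p (Suc i)} \<inter> {a..b}))"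
    by (subst nn_integral_sum) (auto simp: nn_integral_cmult_indicator)
  also have "\<dots> = (\<Sum>i<m. ennreal ((norm (h i w))\<^sup>2 * ((min b (p (Suc i)) - min b (p i)) - (min a (p (Suc i)) - min a (p i)))))"
  proof (rule sum.cong[OF refl])
    fix i assume "i \<in> {..<m}"
    then have pi: "p i \<le> p (Suc i)" using simple_mono[OF S, of i "Suc i"] by auto
    have "emeasure lborel ({p i<..p (Suc i)} \<inter> {a..b}) = emeasure lborel ({p i<..p (Suc i)} \<inter> {a<..b})"
    proof (rule emeasure_eq_AE)
      have "AE s in lborel. s \<noteq> a" by (rule AE_lborel_singleton)
      then show "AE s in lborel. (s \<in> {p i<..p (Suc i)} \<inter> {a..b}) = (s \<in> {p i<..p (Suc i)} \<inter> {a<..b})"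
        by eventually_elim auto
    qed auto
    also have "{p i<..p (Suc i)} \<inter> {a<..b} = {max (p i) a<..min (p (Suc i)) b}" by auto
    also have "emeasure lborel {max (p i) a<..min (p (Suc i)) b} = ennreal ((min b (p (Suc i)) - min b (p i)) - (min a (p (Suc i)) - min a (p i)))"
    proof (cases "max (p i) a \<le> min (p (Suc i)) b")
      case True
      have "min (p (Suc i)) b - max (p i) a = (min b (p (Suc i)) - min b (p i)) - (min a (p (Suc i)) - min a (p i))"
      proof -
        have "a \<le> p (Suc i)" "p i \<le> b" using True by auto
        then show ?thesis using ab by (auto simp: min_def max_def)
      qed
      then show ?thesis using True by simp
    next
      case False
      then have "(min b (p (Suc i)) - min b (p i)) - (min a (p (Suc i)) - min a (p i)) = 0"
        using ab pi by (auto simp: min_def max_def split: if_splits)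
      then show ?thesis using False by simp
    qed
    finally show "ennreal ((norm (h i w))\<^sup>2) * emeasure lborel ({p i<..p (Suc i)} \<inter> {a..b}) =
      ennreal ((norm (h i w))\<^sup>2 * ((min b (p (Suc i)) - min b (p i)) - (min a (p (Suc i)) - min a (p i))))"
      by (simp add: ennreal_mult')
  qed
  also have "\<dots> = ennreal (\<Sum>i<m. (norm (h i w))\<^sup>2 * ((min b (p (Suc i)) - min b (p i)) - (min a (p (Suc i)) - min a (p i))))"
  proof (rule sum_ennreal)
    fix i assume "i \<in> {..<m}"
    then have pi: "p i \<le> p (Suc i)" using simple_mono[OF S, of i "Suc i"] by auto
    then show "0 \<le> (norm (h i w))\<^sup>2 * ((min b (p (Suc i)) - min b (p i)) - (min a (p (Suc i)) - min a (p i)))"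
      using ab by (intro mult_nonneg_nonneg) (auto simp: min_def)
  qed
  finally show ?thesis
    by (simp add: sqv_def right_diff_distrib sum_subtractf)
qed

lemma simple_process_predictable:
  assumes S: "simple m p h"
  shows "predictable M T W (sproc m p h)"
proof -
  have st: "(\<lambda>x. indicator {p i<..p (Suc i)} (fst x) *\<^sub>R h i (snd x)) \<in> borel_measurable pred"
    if "i \<in> {..<m}" for i
  proof (cases "p i < p (Suc i)")
    case True
    have im: "i < m" using that by simp
    have r: "0 \<le> p i" "p (Suc i) \<le> T"
      using simple_range[OF S less_imp_le[OF im]] simple_range[OF S Suc_leI[OF im]] by simp_all
    have "predictable M T W (\<lambda>t w. indicator {p i<..p (Suc i)} t *\<^sub>R h i w)"
      by (rule predictable_step[OF simple_h[OF S im] r(1) True r(2)])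
    then show ?thesis by (simp only: predictable_def split_beta')
  next
    case False
    then have "{p i<..p (Suc i)} = {}" by simp
    then have "(\<lambda>x. indicator {p i<..p (Suc i)} (fst x) *\<^sub>R h i (snd x)) = (\<lambda>x. 0)" by simp
    then show ?thesis by (simp only: borel_measurable_const)
  qed
  show ?thesis
    unfolding predictable_def simple_process_def split_beta' by (rule borel_measurable_sum) (rule st)
qed

text \<open>Truncation at energy \<delta> makes \<open>exp_maximal\<close> applicable to the
  integrand and to its negative, hence the factor 2; outside the event that the energy exceeds
  \<delta> the truncation changes nothing.\<close>

lemma bernstein_simple:
  assumes S: "simple m p h" and t: "t \<in> {0..T}" and B: "B \<in> sets (F t)" and \<delta>: "0 < \<delta>" and a: "0 < a"
  shows "measure P {w\<in>B. \<exists>s\<in>{t..T}. a < \<bar>sint_inc m p h t s w\<bar>}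
    \<le> 2 * exp (- a\<^sup>2 / (2 * \<delta>)) * measure P B + measure P {w\<in>space M. \<delta> < sqv_inc m p h t T w}"
proof -
  have \<delta>': "0 \<le> \<delta>" using \<delta> by simp
  obtain g where g: "simple m p g"
    "\<And>w. sqv_inc m p g t T w \<le> \<delta>"
    "\<And>w i. sqv_inc m p h t T w \<le> \<delta> \<Longrightarrow> i < m \<Longrightarrow> g i w = h i w"
    using simple_truncate[OF S t \<delta>'] by metis
  have tT: "t \<le> T" using t by simp
  have BP: "B \<in> sets P" and Bs: "B \<subseteq> space M" using F_sub_P[OF B] sets.sets_into_space[OF B] by auto
  define E where "E m p h = {w\<in>B. \<exists>s\<in>{t..T}. a < sint_inc m p h t s w}" for m :: nat and p h
  have Em: "E m p g \<in> sets P" if S: "simple m p g" for g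
  proof -
    have "{w\<in>space M. \<exists>s\<in>{t..T}. a < sint_inc m p g t s w} \<in> sets P"
    proof (rule ex_event[OF _ tT])
      fix s assume "s \<in> {t..T}"
      then show "(\<lambda>w. sint_inc m p g t s w) \<in> borel_measurable P"
        using t by (intro borel_measurable_diff measurable_F_P[OF simple_integral_adapted[OF S]]) auto
    next
      show "AE w in M. continuous_on {t..T} (\<lambda>s. sint_inc m p g t s w)"
        using t by (intro AE_I2 continuous_intros continuous_on_subset[OF sint_continuous[OF S]]) auto
    qed
    moreover have "E m p g = B \<inter> {w\<in>space M. \<exists>s\<in>{t..T}. a < sint_inc m p g t s w}"
      using Bs by (auto simp: E_def)
    ultimately show ?thesis using BP by simp
  qed
  have mx: "measure P (E m p g) \<le> exp (- a\<^sup>2 / (2 * \<delta>)) * measure P B"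
    if S: "simple m p g" and b: "\<And>w. sqv_inc m p g t T w \<le> \<delta>" for g
    using exp_maximal[OF S t B \<delta> a b] Em[OF S] BP
    by (simp add: E_def[symmetric] P.emeasure_eq_measure ennreal_mult[symmetric])
  let ?g = "\<lambda>i w. (-1) *\<^sub>R g i w"
  have g': "simple m p ?g" by (rule simple_scale[OF g(1)])
  have q': "sqv_inc m p ?g t T w \<le> \<delta>" for w
    using g(2)[of w] by (simp add: sqv_def)
  define Q where "Q = {w\<in>space M. \<delta> < sqv_inc m p h t T w}"
  have Qm: "Q \<in> sets P"
  proof -
    have "sqv m p h T \<in> borel_measurable P" "sqv m p h t \<in> borel_measurable P"
      using t T_pos by (auto intro!: measurable_F_P[OF simple_qv_adapted[OF S]])
    then have "(\<lambda>w. sqv_inc m p h t T w) \<in> borel_measurable P" by measurable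
    from borel_measurable_less[OF borel_measurable_const this, of \<delta>] show ?thesis by (simp add: Q_def)
  qed
  have sub: "{w\<in>B. \<exists>s\<in>{t..T}. a < \<bar>sint_inc m p h t s w\<bar>} \<subseteq> E m p g \<union> E m p ?g \<union> Q"
  proof (rule subsetI, rule ccontr)
    fix w assume w: "w \<in> {w\<in>B. \<exists>s\<in>{t..T}. a < \<bar>sint_inc m p h t s w\<bar>}" "w \<notin> E m p g \<union> E m p ?g \<union> Q"
    then have "sqv_inc m p h t T w \<le> \<delta>" using Bs by (auto simp: Q_def)
    then have "g i w = h i w" if "i < m" for i using g(3) that by auto
    then have eq: "sint m p h s w = sint m p g s w" "sint m p ?g s w = - sint m p g s w" for s
      by (auto simp: simple_integral_def sum_negf)
    have n: "\<not> a < sint_inc m p g t s w" "\<not> a < sint_inc m p ?g t s w" if "s \<in> {t..T}" for s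
      using w that unfolding E_def by blast+
    obtain s where "s \<in> {t..T}" "a < \<bar>sint_inc m p h t s w\<bar>" using w by blast
    then show False using n[of s] unfolding eq by linarith
  qed
  have "measure P {w\<in>B. \<exists>s\<in>{t..T}. a < \<bar>sint_inc m p h t s w\<bar>} \<le> measure P (E m p g \<union> E m p ?g \<union> Q)"
    using Em[OF g(1)] Em[OF g'] Qm by (intro P.finite_measure_mono[OF sub]) auto
  also have "\<dots> \<le> measure P (E m p g \<union> E m p ?g) + measure P Q"
    using Em[OF g(1)] Em[OF g'] Qm by (intro measure_Un_le) auto
  also have "measure P (E m p g \<union> E m p ?g) \<le> measure P (E m p g) + measure P (E m p ?g)"
    using Em[OF g(1)] Em[OF g'] by (intro measure_Un_le) auto
  finally show ?thesis
    using mx[OF g(1) g(2)] mx[OF g' q'] by (simp add: Q_def)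
qed

section \<open>Refinement of grids and addition of simple integrands\<close>

lemma telescope_subinterval:
  fixes \<phi> :: "real \<Rightarrow> 'b::ab_group_add" and r :: "nat \<Rightarrow> real"
  assumes r: "\<And>i j. i < j \<Longrightarrow> j \<le> k \<Longrightarrow> r i < r j" and a: "a \<le> k" "b \<le> k" "r a \<le> r b"
  shows "(\<Sum>i<k. if r a \<le> r i \<and> r i < r b then \<phi> (r (Suc i)) - \<phi> (r i) else 0) = \<phi> (r b) - \<phi> (r a)"
proof -
  have ord: "r i < r j \<longleftrightarrow> i < j" if "i \<le> k" "j \<le> k" for i j
  proof (cases i j rule: linorder_cases)
    case less then show ?thesis using r[of i j] that by simp
  next
    case greater then have "r j < r i" using r[of j i] that by simp
    then show ?thesis using greater by simp
  qed simp
  have ab: "a \<le> b" using ord[of b a] a by auto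
  have "(\<Sum>i<k. if r a \<le> r i \<and> r i < r b then \<phi> (r (Suc i)) - \<phi> (r i) else 0) = (\<Sum>i\<in>{a..<b}. \<phi> (r (Suc i)) - \<phi> (r i))"
  proof (rule sum.mono_neutral_cong_right)
    show "\<forall>i\<in>{..<k} - {a..<b}. (if r a \<le> r i \<and> r i < r b then \<phi> (r (Suc i)) - \<phi> (r i) else 0) = 0"
    proof
      fix i assume i: "i \<in> {..<k} - {a..<b}"
      then have "\<not> (r a \<le> r i \<and> r i < r b)" using ord[of i a] ord[of i b] a by auto
      then show "(if r a \<le> r i \<and> r i < r b then \<phi> (r (Suc i)) - \<phi> (r i) else 0) = 0" by (rule if_not_P)
    qed
    fix i assume i: "i \<in> {a..<b}"
    then have "r a \<le> r i \<and> r i < r b" using ord[of i a] ord[of i b] a by auto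
    then show "(if r a \<le> r i \<and> r i < r b then \<phi> (r (Suc i)) - \<phi> (r i) else 0) = \<phi> (r (Suc i)) - \<phi> (r i)" by (rule if_P)
  qed (use a in auto)
  also have "\<dots> = \<phi> (r b) - \<phi> (r a)" using ab by (rule sum_Suc_diff')
  finally show ?thesis .
qed

text \<open>Rewriting an integrand on a finer grid changes neither process nor integral; two
  integrands can then be added cell by cell on the union of their grids.\<close>

lemma simple_refine:
  assumes S: "simple m p h" and R: "finite R" "R \<subseteq> {0..T}" "p ` {..m} \<subseteq> R"
  defines "r \<equiv> (!) (sorted_list_of_set R)" and "k \<equiv> card R - 1"
  obtains h' where "simple k r h'" "\<And>t w. sint k r h' t w = sint m p h t w"
    "\<And>t w. sproc k r h' t w = sproc m p h t w"
proof -
  \<comment> \<open>The value on the cell that starts at \<open>r i\<close>. An old cell with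
    coinciding end points satisfies the condition for no \<open>i\<close>, so repeated grid points
    are harmless.\<close>
  define h' where "h' i w = (\<Sum>j<m. if p j \<le> r i \<and> r i < p (Suc j) then h j w else 0)" for i w
  have "R \<noteq> {}" using R by auto
  then have "0 < card R" using R(1) by (simp add: card_gt_0_iff)
  then have len: "length (sorted_list_of_set R) = Suc k" by (simp add: k_def)
  have setR: "r ` {..k} = R"
  proof -
    have "r ` {..k} = set (sorted_list_of_set R)"
      unfolding r_def set_conv_nth len by (auto simp: less_Suc_eq_le)
    then show ?thesis using R(1) by simp
  qed
  have rmono: "r i < r j" if "i < j" "j \<le> k" for i j
    using sorted_wrt_nth_less[OF strict_sorted_list_of_set[of R], of i j] that len unfolding r_def by simp
  have rR: "r i \<in> {0..T}" if "i \<le> k" for i using setR R(2) that by auto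
  have idx: "\<exists>a\<le>k. r a = p j" if "j \<le> m" for j
  proof -
    have "p j \<in> r ` {..k}" using setR R(3) that by auto
    then show ?thesis by auto
  qed
  have pm: "p j \<le> p (Suc j)" if "j < m" for j using simple_mono[OF S, of j "Suc j"] that by auto
  \<comment> \<open>Over an arbitrary commutative group, because it is applied to real integrals and
    to vector-valued processes.\<close>
  have tel: "(\<Sum>i<k. if p j \<le> r i \<and> r i < p (Suc j) then \<phi> (r (Suc i)) - \<phi> (r i) else 0) = \<phi> (p (Suc j)) - \<phi> (p j)"
    if j: "j < m" for j and \<phi> :: "real \<Rightarrow> 'z::ab_group_add"
  proof -
    obtain a b where ab: "a \<le> k" "r a = p j" "b \<le> k" "r b = p (Suc j)" using idx[of j] idx[of "Suc j"] j by auto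
    show ?thesis using telescope_subinterval[of k r a b \<phi>, OF rmono] ab pm[OF j] by simp
  qed
  have "simple k r h'"
    unfolding simple_integrand_def
  proof (intro conjI allI impI)
    show "0 \<le> r 0" "r k \<le> T" using rR[of 0] rR[of k] by auto
    fix i assume i: "i < k"
    show "r i \<le> r (Suc i)" using rmono[of i "Suc i"] i by auto
    show "h' i \<in> borel_measurable (F (r i))"
      unfolding h'_def
    proof (rule borel_measurable_sum)
      fix j assume j: "j \<in> {..<m}"
      show "(\<lambda>w. if p j \<le> r i \<and> r i < p (Suc j) then h j w else 0) \<in> borel_measurable (F (r i))"
        using measurable_F_mono[OF simple_h[OF S, of j], of "r i"] j by (cases "p j \<le> r i \<and> r i < p (Suc j)") auto
    qed
    have "\<exists>B. \<forall>w\<in>space M. norm (h j w) \<le> B" if "j < m" for j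
      using S that unfolding simple_integrand_def bounded_iff by auto
    then obtain B where B: "\<And>j w. j < m \<Longrightarrow> w \<in> space M \<Longrightarrow> norm (h j w) \<le> B j" by metis
    show "bounded (h' i ` space M)"
      unfolding bounded_iff
    proof (intro exI ballI)
      fix x assume "x \<in> h' i ` space M"
      then obtain w where w: "w \<in> space M" "x = h' i w" by auto
      have "norm x \<le> (\<Sum>j<m. norm (if p j \<le> r i \<and> r i < p (Suc j) then h j w else 0))"
        unfolding w h'_def by (rule norm_sum)
      also have "\<dots> \<le> (\<Sum>j<m. \<bar>B j\<bar>)"
      proof (rule sum_mono)
        fix j assume "j \<in> {..<m}"
        then have "norm (h j w) \<le> B j" using B[OF _ w(1)] by auto
        then show "norm (if p j \<le> r i \<and> r i < p (Suc j) then h j w else 0) \<le> \<bar>B j\<bar>"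
          using abs_ge_self[of "B j"] by (cases "p j \<le> r i \<and> r i < p (Suc j)") (simp_all del: abs_ge_self)
      qed
      finally show "norm x \<le> (\<Sum>j<m. \<bar>B j\<bar>)" .
    qed
  qed
  moreover have "sint k r h' t w = sint m p h t w" for t w
  proof -
    have "sint k r h' t w = (\<Sum>i<k. \<Sum>j<m. if p j \<le> r i \<and> r i < p (Suc j) then h j w \<bullet> W (min t (r (Suc i))) w - h j w \<bullet> W (min t (r i)) w else 0)"
      unfolding simple_integral_def h'_def inner_sum_left
      by (intro sum.cong refl) (auto simp: inner_diff_right)
    also have "\<dots> = (\<Sum>j<m. \<Sum>i<k. if p j \<le> r i \<and> r i < p (Suc j) then h j w \<bullet> W (min t (r (Suc i))) w - h j w \<bullet> W (min t (r i)) w else 0)"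
      by (rule sum.swap)
    also have "\<dots> = sint m p h t w"
      unfolding simple_integral_def inner_diff_right
      by (intro sum.cong refl tel[of _ "\<lambda>x. h _ w \<bullet> W (min t x) w"]) auto
    finally show ?thesis .
  qed
  moreover have "sproc k r h' s w = sproc m p h s w" for s w
  proof -
    \<comment> \<open>Writing the indicator of a half-open cell as a difference of step functions,
      one for each end point, turns the process into a telescoping sum as well.\<close>
    have ind: "indicator {u<..v} s *\<^sub>R x = (if s \<le> v then x else 0) - (if s \<le> u then x else 0)" if "u \<le> v" for u v and x :: "real^'d"
      using that by (auto simp: indicator_def)
    have "sproc k r h' s w = (\<Sum>i<k. \<Sum>j<m. if p j \<le> r i \<and> r i < p (Suc j) then (if s \<le> r (Suc i) then h j w else 0) - (if s \<le> r i then h j w else 0) else 0)"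
      unfolding simple_process_def h'_def scaleR_sum_right
    proof (intro sum.cong refl)
      fix i j assume "i \<in> {..<k}"
      then have "r i \<le> r (Suc i)" using rmono[of i "Suc i"] by auto
      from ind[OF this] show "indicator {r i<..r (Suc i)} s *\<^sub>R (if p j \<le> r i \<and> r i < p (Suc j) then h j w else 0)
        = (if p j \<le> r i \<and> r i < p (Suc j) then (if s \<le> r (Suc i) then h j w else 0) - (if s \<le> r i then h j w else 0) else 0)"
        by simp
    qed
    also have "\<dots> = (\<Sum>j<m. \<Sum>i<k. if p j \<le> r i \<and> r i < p (Suc j) then (if s \<le> r (Suc i) then h j w else 0) - (if s \<le> r i then h j w else 0) else 0)"
      by (rule sum.swap)
    also have "\<dots> = (\<Sum>j<m. (if s \<le> p (Suc j) then h j w else 0) - (if s \<le> p j then h j w else 0))"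
      by (intro sum.cong refl tel[of _ "\<lambda>x. if s \<le> x then h _ w else 0"]) auto
    also have "\<dots> = sproc m p h s w"
      unfolding simple_process_def using ind[OF pm] by (intro sum.cong refl) auto
    finally show ?thesis .
  qed
  ultimately show thesis by (rule that)
qed

lemma simple_add:
  assumes S1: "simple m p h" and S2: "simple n q g"
  obtains k r l where "simple k r l" "\<And>t w. sint k r l t w = sint m p h t w + sint n q g t w"
    "\<And>t w. sproc k r l t w = sproc m p h t w + sproc n q g t w"
proof -
  define R where "R = p ` {..m} \<union> q ` {..n}"
  have R: "finite R" "R \<subseteq> {0..T}" "p ` {..m} \<subseteq> R" "q ` {..n} \<subseteq> R"
    using simple_range[OF S1] simple_range[OF S2] by (auto simp: R_def)
  define r where "r = (!) (sorted_list_of_set R)"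
  define k where "k = card R - 1"
  obtain h' where h': "simple k r h'" "\<And>t w. sint k r h' t w = sint m p h t w"
    "\<And>t w. sproc k r h' t w = sproc m p h t w"
    using simple_refine[OF S1 R(1-3)] unfolding r_def k_def by blast
  obtain g' where g': "simple k r g'" "\<And>t w. sint k r g' t w = sint n q g t w"
    "\<And>t w. sproc k r g' t w = sproc n q g t w"
    using simple_refine[OF S2 R(1,2,4)] unfolding r_def k_def by blast
  show thesis
  proof (rule that[of k r "\<lambda>i w. h' i w + g' i w"])
    show "simple k r (\<lambda>i w. h' i w + g' i w)"
      using h'(1) g'(1) unfolding simple_integrand_def
      by (auto intro!: borel_measurable_add bounded_plus_comp)
    show "sint k r (\<lambda>i w. h' i w + g' i w) t w = sint m p h t w + sint n q g t w" for t w
      unfolding h'(2)[symmetric] g'(2)[symmetric] by (simp add: simple_integral_def inner_add_left sum.distrib)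
    show "sproc k r (\<lambda>i w. h' i w + g' i w) t w = sproc m p h t w + sproc n q g t w" for t w
      unfolding h'(3)[symmetric] g'(3)[symmetric] by (simp only: simple_process_def scaleR_add_right sum.distrib)
  qed
qed

end

section \<open>Ito integrals\<close>

abbreviation sqnorm :: "'b::real_normed_vector \<Rightarrow> ennreal" where
  "sqnorm v \<equiv> ennreal ((norm v)\<^sup>2)"

lemma norm_add_sq_le: "(norm (x + y :: 'b::real_normed_vector))\<^sup>2 \<le> 2 * (norm x)\<^sup>2 + 2 * (norm y)\<^sup>2"
proof -
  have "(norm (x + y))\<^sup>2 \<le> (norm x + norm y)\<^sup>2" by (intro power_mono norm_triangle_ineq) simp
  also have "\<dots> \<le> 2 * (norm x)\<^sup>2 + 2 * (norm y)\<^sup>2"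
    using zero_le_power2[of "norm x - norm y"] by (simp add: power2_eq_square algebra_simps)
  finally show ?thesis .
qed

text \<open>The main term keeps a factor close to one. The factor 2 of \<open>norm_add_sq_le\<close>
  would be fatal where the energy enters the exponential identity with an exact constant.\<close>

lemma norm_add_sq_le':
  assumes "0 < \<eta>"
  shows "(norm (x + y :: 'b::real_normed_vector))\<^sup>2 \<le> (1 + \<eta>) * (norm x)\<^sup>2 + (1 + 1 / \<eta>) * (norm y)\<^sup>2"
proof -
  have "(norm (x + y))\<^sup>2 \<le> (norm x + norm y)\<^sup>2" by (intro power_mono norm_triangle_ineq) simp
  also have "\<dots> \<le> (1 + \<eta>) * (norm x)\<^sup>2 + (1 + 1 / \<eta>) * (norm y)\<^sup>2"
  proof -
    have "0 \<le> (\<eta> * norm x - norm y)\<^sup>2 / \<eta>" using assms by simp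
    also have "\<dots> = \<eta> * (norm x)\<^sup>2 - 2 * norm x * norm y + (norm y)\<^sup>2 / \<eta>"
      using assms by (simp add: power2_eq_square field_simps)
    finally show ?thesis by (simp add: power2_eq_square algebra_simps)
  qed
  finally show ?thesis .
qed

lemma ennreal_linear:
  "0 \<le> a \<Longrightarrow> 0 \<le> b \<Longrightarrow> 0 \<le> x \<Longrightarrow> 0 \<le> y \<Longrightarrow>
    ennreal (a * x + b * y) = ennreal a * ennreal x + ennreal b * ennreal y"
  by (simp add: ennreal_mult)

lemma tendsto_0_ennrealI:
  assumes "\<And>\<epsilon>. 0 < \<epsilon> \<Longrightarrow> \<forall>\<^sub>F n in F. X n \<le> ennreal \<epsilon>"
  shows "(X \<longlongrightarrow> 0) F"
proof (rule order_tendstoI)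
  fix y :: ennreal assume "0 < y"
  then obtain x where x: "0 < x" "x < y" using dense by blast
  then obtain e where e: "x = ennreal e" "0 < e" by (cases x) auto
  from assms[OF e(2)] show "\<forall>\<^sub>F n in F. X n < y"
    by eventually_elim (use x e in auto)
qed simp

lemma exp_minus_le_inverse: "0 < x \<Longrightarrow> exp (- x) \<le> 1 / (x::real)"
proof -
  assume x: "0 < x"
  have "x \<le> exp x" using exp_ge_add_one_self[of x] by linarith
  then have "inverse (exp x) \<le> inverse x" using x by (intro le_imp_inverse_le)
  then show ?thesis by (simp add: exp_minus divide_inverse)
qed

section \<open>Energies of predictable integrands and their Ito integrals\<close>

context brownian_setup
begin

lemma predictable_add:
  fixes X Y :: "real \<Rightarrow> 'a \<Rightarrow> 'b::{real_normed_vector, second_countable_topology}"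
  shows "predictable M T W X \<Longrightarrow> predictable M T W Y \<Longrightarrow> predictable M T W (\<lambda>t w. X t w + Y t w)"
  unfolding predictable_def split_beta' by (rule borel_measurable_add)

lemma predictable_diff:
  fixes X Y :: "real \<Rightarrow> 'a \<Rightarrow> 'b::{real_normed_vector, second_countable_topology}"
  shows "predictable M T W X \<Longrightarrow> predictable M T W Y \<Longrightarrow> predictable M T W (\<lambda>t w. X t w - Y t w)"
  unfolding predictable_def split_beta' by (rule borel_measurable_diff)

lemma predictable_scale:
  fixes X :: "real \<Rightarrow> 'a \<Rightarrow> 'b::{real_normed_vector, second_countable_topology}"
  shows "predictable M T W X \<Longrightarrow> predictable M T W (\<lambda>t w. c *\<^sub>R X t w)"
  unfolding predictable_def split_beta' by (rule borel_measurable_scaleR[OF borel_measurable_const])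

lemma predictable_const: "predictable M T W (\<lambda>t w. c)"
  unfolding predictable_def split_beta' by simp

text \<open>The energy of \<open>Z\<close> over \<open>{t..u}\<close>, with values in
  \<open>ennreal\<close> so that it makes sense before square integrability is known.\<close>

definition qv :: "(real \<Rightarrow> 'a \<Rightarrow> real ^ 'd) \<Rightarrow> real \<Rightarrow> real \<Rightarrow> 'a \<Rightarrow> ennreal" where
  "qv Z t u w = (\<integral>\<^sup>+ s \<in> {t..u}. sqnorm (Z s w) \<partial>lborel)"

abbreviation "sqint Z \<equiv> qv Z 0 T"
abbreviation "qv_from Z t \<equiv> qv Z t T"

lemma predictable_norm2:
  assumes "predictable M T W Z"
  shows "(\<lambda>(s, w). sqnorm (Z s w)) \<in> borel_measurable pred"
  using assms unfolding predictable_def split_beta' by measurable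

lemma qv_from_measurable: "predictable M T W Z \<Longrightarrow> 0 \<le> t \<Longrightarrow> qv_from Z t \<in> borel_measurable P"
  unfolding qv_def by (rule measurable_F_P[OF nn_integral_adapted[OF predictable_norm2]]) auto

lemma sqint_measurable: "predictable M T W Z \<Longrightarrow> sqint Z \<in> borel_measurable P"
  by (rule qv_from_measurable) auto

lemma qv_mono_interval: "{t..u} \<subseteq> {s..v} \<Longrightarrow> qv Z t u w \<le> qv Z s v w"
  unfolding qv_def by (intro nn_integral_mono mult_left_mono) (auto simp: indicator_def)

lemma section_norm2:
  assumes "predictable M T W Z" "w \<in> space M" and A: "A \<in> sets borel" "A \<subseteq> {0..T}"
  shows "(\<lambda>s. sqnorm (Z s w) * indicator A s) \<in> borel_measurable lborel"
proof -
  have "(\<lambda>s. (if s \<in> {0..T} then sqnorm (Z s w) else 0) * indicator A s) \<in> borel_measurable lborel"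
    using section_measurable[OF predictable_norm2[OF assms(1)], of 0 w] assms(2) A
    by (intro borel_measurable_times_ennreal) auto
  also have "(\<lambda>s. (if s \<in> {0..T} then sqnorm (Z s w) else 0) * indicator A s)
    = (\<lambda>s. sqnorm (Z s w) * indicator A s)"
  proof (rule ext)
    fix s
    show "(if s \<in> {0..T} then sqnorm (Z s w) else 0) * indicator A s = sqnorm (Z s w) * indicator A s"
      using subsetD[OF A(2), of s] by (cases "s \<in> A") simp_all
  qed
  finally show ?thesis .
qed

lemma qv_from_le: "0 \<le> t \<Longrightarrow> qv_from Z t w \<le> sqint Z w"
  by (rule qv_mono_interval) simp

text \<open>Integrates a pointwise quadratic estimate over time; the triangle inequalities for
  energies are instances of it.\<close>

lemma qv_le_linear:
  assumes X: "predictable M T W X" and Y: "predictable M T W Y" and w: "w \<in> space M" and tu: "0 \<le> t" "u \<le> T"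
    and ab: "0 \<le> a" "0 \<le> b" and le: "\<And>r. (norm (Z r w))\<^sup>2 \<le> a * (norm (X r w))\<^sup>2 + b * (norm (Y r w))\<^sup>2"
  shows "qv Z t u w \<le> ennreal a * qv X t u w + ennreal b * qv Y t u w"
proof -
  have "qv Z t u w \<le> (\<integral>\<^sup>+ r. ennreal a * (sqnorm (X r w) * indicator {t..u} r) + ennreal b * (sqnorm (Y r w) * indicator {t..u} r) \<partial>lborel)"
    unfolding qv_def
  proof (rule nn_integral_mono)
    fix r
    have "sqnorm (Z r w) \<le> ennreal a * sqnorm (X r w) + ennreal b * sqnorm (Y r w)"
      using ennreal_leI[OF le[of r]] ab by (subst (asm) ennreal_linear) auto
    then show "sqnorm (Z r w) * indicator {t..u} r
      \<le> ennreal a * (sqnorm (X r w) * indicator {t..u} r) + ennreal b * (sqnorm (Y r w) * indicator {t..u} r)"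
      by (cases "r \<in> {t..u}") simp_all
  qed
  also have "\<dots> = ennreal a * qv X t u w + ennreal b * qv Y t u w"
    unfolding qv_def using section_norm2[OF X w, of "{t..u}"] section_norm2[OF Y w, of "{t..u}"] tu
    by (subst nn_integral_add) (auto simp: nn_integral_cmult)
  finally show ?thesis .
qed

lemma sqint_add_le:
  assumes "predictable M T W X" "predictable M T W Y" "w \<in> space M"
  shows "sqint (\<lambda>t w. X t w + Y t w) w \<le> 2 * sqint X w + 2 * sqint Y w"
proof -
  have "sqint (\<lambda>t w. X t w + Y t w) w \<le> ennreal 2 * sqint X w + ennreal 2 * sqint Y w"
    by (rule qv_le_linear[OF assms]) (simp_all only: norm_add_sq_le order_refl zero_le_numeral)
  then show ?thesis by simp
qed

lemma qv_diff_le: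
  assumes "predictable M T W X" "predictable M T W Y" "w \<in> space M" "0 < \<eta>" "0 \<le> t" "u \<le> T"
  shows "qv Y t u w \<le> ennreal (1 + \<eta>) * qv X t u w + ennreal (1 + 1 / \<eta>) * qv (\<lambda>s w. X s w - Y s w) t u w"
proof (rule qv_le_linear[OF assms(1) predictable_diff[OF assms(1,2)] assms(3,5,6)])
  show "(norm (Y r w))\<^sup>2 \<le> (1 + \<eta>) * (norm (X r w))\<^sup>2 + (1 + 1 / \<eta>) * (norm (X r w - Y r w))\<^sup>2" for r
    using norm_add_sq_le'[OF assms(4), of "X r w" "Y r w - X r w"] by (simp add: norm_minus_commute)
qed (use assms in auto)

lemma sqint_minus_commute: "qv (\<lambda>s w. X s w - Y s w) t u w = qv (\<lambda>s w. Y s w - X s w) t u w"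
  by (simp add: qv_def norm_minus_commute)

lemma simple_process_scale: "sproc m p (\<lambda>i w. c *\<^sub>R h i w) t w = c *\<^sub>R sproc m p h t w"
  unfolding simple_process_def scaleR_sum_right by (intro sum.cong refl) (simp add: mult.commute)

lemma sqint_simple: "simple m p h \<Longrightarrow> sqint (sproc m p h) w = ennreal (sqv m p h T w)"
  unfolding qv_def using T_pos by (subst nn_integral_simple) (auto simp: qv_0)

abbreviation "ito \<equiv> has_ito_integral M T W"
abbreviation "supdist X Y w \<equiv> \<Squnion>t\<in>{0..T}. ennreal \<bar>X t w - Y t w\<bar>"

lemma ito_meas: "ito Z I \<Longrightarrow> t \<in> {0..T} \<Longrightarrow> I t \<in> borel_measurable (F t)"
  by (auto simp: has_ito_integral_def)

lemma ito_cont: "ito Z I \<Longrightarrow> AE w in M. continuous_on {0..T} (\<lambda>t. I t w)"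
  by (auto simp: has_ito_integral_def)

lemma ito_approx:
  assumes "ito Z I"
  obtains m p h where "\<And>n. simple (m n) (p n) (h n)"
    "tendsto_0_in_prob P (\<lambda>n. sqint (\<lambda>s w. sproc (m n) (p n) (h n) s w - Z s w))"
    "tendsto_0_in_prob P (\<lambda>n w. supdist (sint (m n) (p n) (h n)) I w)"
  using assms unfolding has_ito_integral_def qv_def by blast

lemma itoI:
  assumes "\<And>t. t \<in> {0..T} \<Longrightarrow> I t \<in> borel_measurable (F t)"
    "AE w in M. continuous_on {0..T} (\<lambda>t. I t w)"
    "\<And>n. simple (m n) (p n) (h n)"
    "tendsto_0_in_prob P (\<lambda>n. sqint (\<lambda>s w. sproc (m n) (p n) (h n) s w - Z s w))"
    "tendsto_0_in_prob P (\<lambda>n w. supdist (sint (m n) (p n) (h n)) I w)"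
  shows "ito Z I"
  using assms unfolding has_ito_integral_def qv_def by blast

lemma supdist_measurable:
  assumes "\<And>t. t \<in> {0..T} \<Longrightarrow> X t \<in> borel_measurable P" "\<And>t. t \<in> {0..T} \<Longrightarrow> Y t \<in> borel_measurable P"
    "AE w in M. continuous_on {0..T} (\<lambda>t. X t w)" "AE w in M. continuous_on {0..T} (\<lambda>t. Y t w :: real)"
  shows "(\<lambda>w. supdist X Y w) \<in> borel_measurable P"
proof (rule sup_measurable)
  show "AE w in M. continuous_on {0..T} (\<lambda>s. X s w - Y s w)"
    using assms(3,4) by eventually_elim (rule continuous_on_diff)
qed (use assms(1,2) T_pos in auto)

lemma sint_P: "simple m p h \<Longrightarrow> t \<in> {0..T} \<Longrightarrow> sint m p h t \<in> borel_measurable P"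
  by (rule measurable_F_P[OF simple_integral_adapted])

lemma ito_P: "ito Z I \<Longrightarrow> t \<in> {0..T} \<Longrightarrow> I t \<in> borel_measurable P"
  by (rule measurable_F_P[OF ito_meas])

lemma sint_AE_cont: "simple m p h \<Longrightarrow> AE w in M. continuous_on {0..T} (\<lambda>t. sint m p h t w)"
  by (rule AE_I2) (rule sint_continuous)

text \<open>The approximating simple integrands are combined on a common grid. The errors add up,
  weighted by twice the squared coefficients for the energy and by their absolute values for the
  supremum.\<close>

lemma ito_linear:
  assumes 1: "ito Z1 I1" "predictable M T W Z1" and 2: "ito Z2 I2" "predictable M T W Z2"
  shows "ito (\<lambda>t w. a *\<^sub>R Z1 t w + b *\<^sub>R Z2 t w) (\<lambda>t w. a * I1 t w + b * I2 t w)"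
proof -
  obtain m1 p1 h1 where a1: "\<And>n. simple (m1 n) (p1 n) (h1 n)"
    "tendsto_0_in_prob P (\<lambda>n. sqint (\<lambda>s w. sproc (m1 n) (p1 n) (h1 n) s w - Z1 s w))"
    "tendsto_0_in_prob P (\<lambda>n w. supdist (sint (m1 n) (p1 n) (h1 n)) I1 w)"
    using ito_approx[OF 1(1)] by blast
  obtain m2 p2 h2 where a2: "\<And>n. simple (m2 n) (p2 n) (h2 n)"
    "tendsto_0_in_prob P (\<lambda>n. sqint (\<lambda>s w. sproc (m2 n) (p2 n) (h2 n) s w - Z2 s w))"
    "tendsto_0_in_prob P (\<lambda>n w. supdist (sint (m2 n) (p2 n) (h2 n)) I2 w)"
    using ito_approx[OF 2(1)] by blast
  have "\<exists>k r l. simple k r l \<and> (\<forall>t w. sint k r l t w = a * sint (m1 n) (p1 n) (h1 n) t w + b * sint (m2 n) (p2 n) (h2 n) t w)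
    \<and> (\<forall>t w. sproc k r l t w = a *\<^sub>R sproc (m1 n) (p1 n) (h1 n) t w + b *\<^sub>R sproc (m2 n) (p2 n) (h2 n) t w)" for n
    by (rule simple_add[OF simple_scale[OF a1(1)[of n], where c=a] simple_scale[OF a2(1)[of n], where c=b], unfolded simple_integral_scale simple_process_scale]) blast
  then obtain k r l where s: "\<And>n. simple (k n) (r n) (l n)"
    "\<And>n t w. sint (k n) (r n) (l n) t w = a * sint (m1 n) (p1 n) (h1 n) t w + b * sint (m2 n) (p2 n) (h2 n) t w"
    "\<And>n t w. sproc (k n) (r n) (l n) t w = a *\<^sub>R sproc (m1 n) (p1 n) (h1 n) t w + b *\<^sub>R sproc (m2 n) (p2 n) (h2 n) t w"
    by metis
  let ?Z = "\<lambda>t w. a *\<^sub>R Z1 t w + b *\<^sub>R Z2 t w" and ?I = "\<lambda>t w. a * I1 t w + b * I2 t w"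
  show ?thesis
  proof (rule itoI[OF _ _ s(1)])
    show "?I t \<in> borel_measurable (F t)" if "t \<in> {0..T}" for t
      using ito_meas[OF 1(1) that] ito_meas[OF 2(1) that] by measurable
    show c: "AE w in M. continuous_on {0..T} (\<lambda>t. ?I t w)"
      using ito_cont[OF 1(1)] ito_cont[OF 2(1)] by eventually_elim (intro continuous_intros)
    have pd: "predictable M T W (\<lambda>s w. sproc (m1 n) (p1 n) (h1 n) s w - Z1 s w)"
       "predictable M T W (\<lambda>s w. sproc (m2 n) (p2 n) (h2 n) s w - Z2 s w)"
       "predictable M T W (\<lambda>s w. sproc (k n) (r n) (l n) s w - ?Z s w)" for n
      by (intro predictable_diff predictable_add predictable_scale simple_process_predictable a1(1) a2(1) s(1) 1 2)+
    show "tendsto_0_in_prob P (\<lambda>n. sqint (\<lambda>t w. sproc (k n) (r n) (l n) t w - ?Z t w))"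
    proof (rule P.tip_mono[OF P.tip_add[OF P.tip_cmult[OF a1(2), of "2 * a\<^sup>2"] P.tip_cmult[OF a2(2), of "2 * b\<^sup>2"]] sqint_measurable[OF pd(3)]])
      fix n
      show "AE w in P. sqint (\<lambda>t w. sproc (k n) (r n) (l n) t w - ?Z t w) w
         \<le> ennreal (2 * a\<^sup>2) * sqint (\<lambda>s w. sproc (m1 n) (p1 n) (h1 n) s w - Z1 s w) w +
            ennreal (2 * b\<^sup>2) * sqint (\<lambda>s w. sproc (m2 n) (p2 n) (h2 n) s w - Z2 s w) w"
      proof (intro AE_I2 qv_le_linear pd)
        fix t w
        show "(norm (sproc (k n) (r n) (l n) t w - ?Z t w))\<^sup>2 \<le> 2 * a\<^sup>2 * (norm (sproc (m1 n) (p1 n) (h1 n) t w - Z1 t w))\<^sup>2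
          + 2 * b\<^sup>2 * (norm (sproc (m2 n) (p2 n) (h2 n) t w - Z2 t w))\<^sup>2"
          using norm_add_sq_le[of "a *\<^sub>R (sproc (m1 n) (p1 n) (h1 n) t w - Z1 t w)" "b *\<^sub>R (sproc (m2 n) (p2 n) (h2 n) t w - Z2 t w)"]
          unfolding s(3) scaleR_diff_right add_diff_add by (simp add: scaleR_diff_right[symmetric] power_mult_distrib)
      qed auto
    qed auto
    show "tendsto_0_in_prob P (\<lambda>n w. supdist (sint (k n) (r n) (l n)) ?I w)"
    proof (rule P.tip_mono[OF P.tip_add[OF P.tip_cmult[OF a1(3), of "\<bar>a\<bar>"] P.tip_cmult[OF a2(3), of "\<bar>b\<bar>"]]])
      show "supdist (sint (k n) (r n) (l n)) ?I \<in> borel_measurable P" for n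
      proof (rule supdist_measurable)
        show "?I t \<in> borel_measurable P" if "t \<in> {0..T}" for t
          using ito_P[OF 1(1) that] ito_P[OF 2(1) that] by measurable
      qed (auto intro!: sint_P sint_AE_cont s(1) c)
      fix n
      show "AE w in P. supdist (sint (k n) (r n) (l n)) ?I w
         \<le> ennreal \<bar>a\<bar> * supdist (sint (m1 n) (p1 n) (h1 n)) I1 w + ennreal \<bar>b\<bar> * supdist (sint (m2 n) (p2 n) (h2 n)) I2 w"
      proof (rule AE_I2, rule SUP_least)
        fix w t assume t: "t \<in> {0..T}"
        have "\<bar>sint (k n) (r n) (l n) t w - ?I t w\<bar>
          \<le> \<bar>a\<bar> * \<bar>sint (m1 n) (p1 n) (h1 n) t w - I1 t w\<bar> + \<bar>b\<bar> * \<bar>sint (m2 n) (p2 n) (h2 n) t w - I2 t w\<bar>"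
          unfolding s(2) abs_mult[symmetric] right_diff_distrib by linarith
        then have "ennreal \<bar>sint (k n) (r n) (l n) t w - ?I t w\<bar>
          \<le> ennreal \<bar>a\<bar> * ennreal \<bar>sint (m1 n) (p1 n) (h1 n) t w - I1 t w\<bar> + ennreal \<bar>b\<bar> * ennreal \<bar>sint (m2 n) (p2 n) (h2 n) t w - I2 t w\<bar>"
          by (simp add: ennreal_leI flip: ennreal_mult ennreal_plus)
        also have "\<dots> \<le> ennreal \<bar>a\<bar> * supdist (sint (m1 n) (p1 n) (h1 n)) I1 w + ennreal \<bar>b\<bar> * supdist (sint (m2 n) (p2 n) (h2 n)) I2 w"
          by (intro add_mono mult_left_mono SUP_upper t) simp_all
        finally show "ennreal \<bar>sint (k n) (r n) (l n) t w - ?I t w\<bar>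
          \<le> ennreal \<bar>a\<bar> * supdist (sint (m1 n) (p1 n) (h1 n)) I1 w + ennreal \<bar>b\<bar> * supdist (sint (m2 n) (p2 n) (h2 n)) I2 w" .
      qed
    qed auto
  qed
qed

lemma ito_diff:
  assumes "ito Z1 I1" "predictable M T W Z1" "ito Z2 I2" "predictable M T W Z2"
  shows "ito (\<lambda>t w. Z1 t w - Z2 t w) (\<lambda>t w. I1 t w - I2 t w)"
  using ito_linear[OF assms, of 1 "-1"] by simp

lemma ito_zero: "ito (\<lambda>t w. 0) (\<lambda>t w. 0)"
proof (rule itoI[where m="\<lambda>n. 0" and p="\<lambda>n i. 0" and h="\<lambda>n i w. 0"])
  show "simple 0 (\<lambda>i. 0) (\<lambda>i w. 0)" using T_pos by (simp add: simple_integrand_def)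
qed (use T_pos in \<open>auto intro!: P.tip_AE sqint_measurable[OF predictable_const] simp: simple_process_def simple_integral_def qv_def\<close>)

lemma ito_0:
  assumes "ito Z I"
  shows "AE w in M. I 0 w = 0"
proof -
  obtain m p h where a: "\<And>n. simple (m n) (p n) (h n)"
    "tendsto_0_in_prob P (\<lambda>n w. supdist (sint (m n) (p n) (h n)) I w)"
    by (rule ito_approx[OF assms]) (rule that)
  obtain r where "AE w in P. (\<lambda>n. supdist (sint (m (r n)) (p (r n)) (h (r n))) I w) \<longlonglongrightarrow> 0"
    using P.tip_subseq_AE[OF a(2)] by blast
  then show ?thesis
    unfolding AE_P
  proof eventually_elim
    case (elim w)
    have "ennreal \<bar>I 0 w\<bar> \<le> supdist (sint (m (r n)) (p (r n)) (h (r n))) I w" for n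
      using SUP_upper[of 0 "{0..T}" "\<lambda>t. ennreal \<bar>sint (m (r n)) (p (r n)) (h (r n)) t w - I t w\<bar>"] T_pos a(1)
      by (simp add: sint_0)
    then have "ennreal \<bar>I 0 w\<bar> \<le> 0" using LIMSEQ_le_const[OF elim] by blast
    then show ?case by simp
  qed
qed

lemma sqv_inc_le:
  assumes S: "simple m p h" and Z: "predictable M T W Z" and w: "w \<in> space M" and t: "t \<in> {0..T}"
    and a: "sqint (\<lambda>s w. sproc m p h s w - Z s w) w \<le> ennreal a" "0 \<le> a" and b: "sqint Z w \<le> ennreal b" "0 \<le> b"
  shows "sqv_inc m p h t T w \<le> 2 * a + 2 * b"
proof -
  have "ennreal (sqv m p h T w) = sqint (\<lambda>s w. (sproc m p h s w - Z s w) + Z s w) w"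
    by (simp add: sqint_simple[OF S])
  also have "\<dots> \<le> 2 * sqint (\<lambda>s w. sproc m p h s w - Z s w) w + 2 * sqint Z w"
    by (intro sqint_add_le predictable_diff simple_process_predictable S Z w)
  also have "\<dots> \<le> 2 * ennreal a + 2 * ennreal b"
    by (intro add_mono mult_left_mono a b) auto
  also have "\<dots> = ennreal (2 * a + 2 * b)"
    using a b by (subst ennreal_linear) auto
  finally have "sqv m p h T w \<le> 2 * a + 2 * b" using a b by (subst (asm) ennreal_le_iff) auto
  moreover have "0 \<le> sqv m p h t w" using qv_mono[OF S, of 0 t w] t by (simp add: qv_0[OF S])
  ultimately show ?thesis by simp
qed

text \<open>Passes from simple integrands to the limit. The level is halved, because the
  approximation is within \<open>a / 4\<close> at both end points, and the energy is quadrupled,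
  because the approximant has energy at most \<open>2 * \<delta> + 2 * \<delta>\<close>; so
  \<open>(a / 2)\<^sup>2 / (2 * (4 * \<delta>)) = a\<^sup>2 / (32 * \<delta>)\<close> explains the
  constant.\<close>

lemma bernstein_ito:
  assumes I: "ito Z I" "predictable M T W Z" and t: "t \<in> {0..T}" and B: "B \<in> sets (F t)" and \<delta>: "0 < \<delta>" and a: "0 < a"
  shows "measure P {w\<in>B. \<exists>s\<in>{t..T}. a < \<bar>I s w - I t w\<bar>}
    \<le> 2 * exp (- a\<^sup>2 / (32 * \<delta>)) * measure P B + measure P {w\<in>space M. ennreal \<delta> < sqint Z w}"
proof -
  obtain m p h where ap: "\<And>n. simple (m n) (p n) (h n)"
    "tendsto_0_in_prob P (\<lambda>n. sqint (\<lambda>s w. sproc (m n) (p n) (h n) s w - Z s w))"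
    "tendsto_0_in_prob P (\<lambda>n w. supdist (sint (m n) (p n) (h n)) I w)"
    using ito_approx[OF I(1)] by blast
  let ?D = "\<lambda>n. sqint (\<lambda>s w. sproc (m n) (p n) (h n) s w - Z s w)"
  let ?S = "\<lambda>n w. supdist (sint (m n) (p n) (h n)) I w"
  have tT: "t \<le> T" "0 \<le> t" using t by auto
  have BP: "B \<in> sets P" and Bs: "B \<subseteq> space M" using F_sub_P[OF B] sets.sets_into_space[OF B] by auto
  define E0 where "E0 = {w\<in>B. \<exists>s\<in>{t..T}. a < \<bar>I s w - I t w\<bar>}"
  define E1 where "E1 n = {w\<in>B. \<exists>s\<in>{t..T}. a / 2 < \<bar>sint_inc (m n) (p n) (h n) t s w\<bar>}" for n
  define E2 where "E2 n = {w\<in>space P. ennreal (a / 4) < ?S n w}" for n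
  define E3 where "E3 n = {w\<in>space P. ennreal \<delta> < ?D n w}" for n
  define E4 where "E4 = {w\<in>space P. ennreal \<delta> < sqint Z w}"
  define E5 where "E5 n = {w\<in>space M. 4 * \<delta> < sqv_inc (m n) (p n) (h n) t T w}" for n
  have [measurable]: "?D n \<in> borel_measurable P" "?S n \<in> borel_measurable P" "sqint Z \<in> borel_measurable P" for n
    using P.tip_meas[OF ap(2)] P.tip_meas[OF ap(3)] sqint_measurable[OF I(2)] by auto
  have m2: "E2 n \<in> sets P" "E3 n \<in> sets P" "E4 \<in> sets P" for n
    unfolding E2_def E3_def E4_def by measurable
  have ev: "{w\<in>B. \<exists>s\<in>{t..T}. c < \<bar>G s w - G t w\<bar>} \<in> sets P"
    if G: "\<And>s. s \<in> {0..T} \<Longrightarrow> G s \<in> borel_measurable P" "AE w in M. continuous_on {0..T} (\<lambda>s. G s w)" for c and G :: "real \<Rightarrow> 'a \<Rightarrow> real"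
  proof -
    have "{w\<in>space M. \<exists>s\<in>{t..T}. c < \<bar>G s w - G t w\<bar>} \<in> sets P"
    proof (rule ex_event[OF _ tT(1)])
      fix s assume "s \<in> {t..T}"
      then show "(\<lambda>w. \<bar>G s w - G t w\<bar>) \<in> borel_measurable P"
        using G(1)[of s] G(1)[of t] t by (intro borel_measurable_abs borel_measurable_diff) auto
    next
      show "AE w in M. continuous_on {t..T} (\<lambda>s. \<bar>G s w - G t w\<bar>)"
        using G(2)
      proof eventually_elim
        case (elim w)
        have "continuous_on {t..T} (\<lambda>s. G s w)" using tT by (intro continuous_on_subset[OF elim]) auto
        then show ?case by (intro continuous_intros)
      qed
    qed
    from sets.Int[OF BP this]
    have "B \<inter> {w\<in>space M. \<exists>s\<in>{t..T}. c < \<bar>G s w - G t w\<bar>} \<in> sets P" .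
    also have "B \<inter> {w\<in>space M. \<exists>s\<in>{t..T}. c < \<bar>G s w - G t w\<bar>} = {w\<in>B. \<exists>s\<in>{t..T}. c < \<bar>G s w - G t w\<bar>}"
      using Bs by blast
    finally show ?thesis .
  qed
  have E1m: "E1 n \<in> sets P" for n unfolding E1_def by (rule ev[OF sint_P[OF ap(1)] sint_AE_cont[OF ap(1)]])
  have sub1: "E0 \<subseteq> E1 n \<union> E2 n" for n
  proof (rule subsetI, rule ccontr)
    fix w assume w: "w \<in> E0" "w \<notin> E1 n \<union> E2 n"
    then obtain s where s: "s \<in> {t..T}" "a < \<bar>I s w - I t w\<bar>" "w \<in> B" by (auto simp: E0_def)
    have "?S n w \<le> ennreal (a / 4)" using w Bs s by (auto simp: E2_def)
    then have le: "\<bar>sint (m n) (p n) (h n) u w - I u w\<bar> \<le> a / 4" if "u \<in> {0..T}" for u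
      using that a by (auto simp: SUP_le_iff ennreal_le_iff)
    have "\<not> a / 2 < \<bar>sint_inc (m n) (p n) (h n) t s w\<bar>"
      using w s by (auto simp: E1_def)
    moreover have "\<bar>sint (m n) (p n) (h n) s w - I s w\<bar> \<le> a / 4" "\<bar>sint (m n) (p n) (h n) t w - I t w\<bar> \<le> a / 4"
      using le[of s] le[of t] s t by auto
    ultimately show False using s(2) by linarith
  qed
  have sub2: "E5 n \<subseteq> E3 n \<union> E4" for n
  proof (rule subsetI, rule ccontr)
    fix w assume w: "w \<in> E5 n" "w \<notin> E3 n \<union> E4"
    then have wM: "w \<in> space M" by (auto simp: E5_def)
    have "sqv_inc (m n) (p n) (h n) t T w \<le> 2 * \<delta> + 2 * \<delta>"
      using w wM \<delta> by (intro sqv_inc_le[OF ap(1) I(2) wM t]) (auto simp: E3_def E4_def not_less)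
    then show False using w by (auto simp: E5_def)
  qed
  have bound: "measure P E0 \<le> 2 * exp (- a\<^sup>2 / (32 * \<delta>)) * measure P B + measure P E4 + (measure P (E3 n) + measure P (E2 n))" for n
  proof -
    have "measure P E0 \<le> measure P (E1 n \<union> E2 n)"
      using E1m m2 by (intro P.finite_measure_mono[OF sub1]) auto
    also have "\<dots> \<le> measure P (E1 n) + measure P (E2 n)" using E1m m2 by (intro measure_Un_le) auto
    also have "measure P (E1 n) \<le> 2 * exp (- (a / 2)\<^sup>2 / (2 * (4 * \<delta>))) * measure P B + measure P (E5 n)"
      unfolding E1_def E5_def using a \<delta> by (intro bernstein_simple ap(1) t B) auto
    also have "- (a / 2)\<^sup>2 / (2 * (4 * \<delta>)) = - a\<^sup>2 / (32 * \<delta>)" by (simp add: power_divide)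
    also have "measure P (E5 n) \<le> measure P (E3 n \<union> E4)"
      using m2 by (intro P.finite_measure_mono[OF sub2]) auto
    also have "measure P (E3 n \<union> E4) \<le> measure P (E3 n) + measure P E4" using m2 by (intro measure_Un_le) auto
    finally show ?thesis by simp
  qed
  have "(\<lambda>n. 2 * exp (- a\<^sup>2 / (32 * \<delta>)) * measure P B + measure P E4 + (measure P (E3 n) + measure P (E2 n)))
     \<longlonglongrightarrow> 2 * exp (- a\<^sup>2 / (32 * \<delta>)) * measure P B + measure P E4 + (0 + 0)"
    unfolding E2_def E3_def using a \<delta> by (intro tendsto_add tendsto_const P.tip_lim[OF ap(2)] P.tip_lim[OF ap(3)]) auto
  from LIMSEQ_le_const[OF this] bound have "measure P E0 \<le> 2 * exp (- a\<^sup>2 / (32 * \<delta>)) * measure P B + measure P E4"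
    by auto
  then show ?thesis by (simp add: E0_def E4_def)
qed

text \<open>Applied to the difference of the integrals, the Bernstein inequality bounds the tail by
  a term that is small for small \<delta> and a probability that tends to zero for fixed
  \<delta>.\<close>

lemma ito_stability:
  assumes In: "\<And>n. ito (Zn n) (In n)" "\<And>n. predictable M T W (Zn n)" and I: "ito Z I" "predictable M T W Z"
    and lim: "tendsto_0_in_prob P (\<lambda>n. sqint (\<lambda>s w. Zn n s w - Z s w))"
  shows "tendsto_0_in_prob P (\<lambda>n w. supdist (In n) I w)"
  unfolding tendsto_0_in_prob_def
proof (intro conjI allI impI)
  have D: "ito (\<lambda>s w. Zn n s w - Z s w) (\<lambda>s w. In n s w - I s w)" "predictable M T W (\<lambda>s w. Zn n s w - Z s w)" for n
    by (intro ito_diff predictable_diff In I)+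
  show m: "(\<lambda>w. supdist (In n) I w) \<in> borel_measurable P" for n
    by (intro supdist_measurable ito_P[OF In(1)] ito_P[OF I(1)] ito_cont[OF In(1)] ito_cont[OF I(1)])
  fix \<epsilon> :: real assume \<epsilon>: "0 < \<epsilon>"
  have le: "measure P {w\<in>space P. ennreal \<epsilon> < supdist (In n) I w}
    \<le> 2 * exp (- \<epsilon>\<^sup>2 / (32 * \<delta>)) + measure P {w\<in>space P. ennreal \<delta> < sqint (\<lambda>s w. Zn n s w - Z s w) w}" if \<delta>: "0 < \<delta>" for n \<delta>
  proof -
    let ?G = "\<lambda>s w. In n s w - I s w"
    have B: "space M \<in> sets (F 0)" using sets.top[of "F 0"] by simp
    have "measure P {w\<in>space P. ennreal \<epsilon> < supdist (In n) I w} = measure P {w\<in>space M. \<exists>s\<in>{0..T}. \<epsilon> < \<bar>?G s w - ?G 0 w\<bar>}"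
    proof (rule P.finite_measure_eq_AE)
      show "AE w in P. (w \<in> {w\<in>space P. ennreal \<epsilon> < supdist (In n) I w}) = (w \<in> {w\<in>space M. \<exists>s\<in>{0..T}. \<epsilon> < \<bar>?G s w - ?G 0 w\<bar>})"
        unfolding AE_P using ito_0[OF D(1)[of n]]
      proof eventually_elim
        case (elim w)
        have "ennreal \<epsilon> < ennreal \<bar>x\<bar> \<longleftrightarrow> \<epsilon> < \<bar>x\<bar>" for x using \<epsilon> by (simp add: ennreal_less_iff)
        then show ?case using elim by (simp add: less_SUP_iff)
      qed
      show "{w\<in>space P. ennreal \<epsilon> < supdist (In n) I w} \<in> sets P" using m[of n] by measurable
      have "{w\<in>space M. \<exists>s\<in>{0..T}. \<epsilon> < \<bar>?G s w - ?G 0 w\<bar>} \<in> sets P"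
      proof (rule ex_event)
        show "(\<lambda>w. \<bar>?G s w - ?G 0 w\<bar>) \<in> borel_measurable P" if "s \<in> {0..T}" for s
          using that T_pos by (intro borel_measurable_abs borel_measurable_diff ito_P[OF In(1)] ito_P[OF I(1)]) auto
        show "AE w in M. continuous_on {0..T} (\<lambda>s. \<bar>?G s w - ?G 0 w\<bar>)"
          using ito_cont[OF D(1)[of n]]
          by eventually_elim (rule continuous_on_rabs, rule continuous_on_diff[OF _ continuous_on_const])
      qed (use T_pos in simp)
      then show "{w\<in>space M. \<exists>s\<in>{0..T}. \<epsilon> < \<bar>?G s w - ?G 0 w\<bar>} \<in> sets P" .
    qed
    also have "\<dots> \<le> 2 * exp (- \<epsilon>\<^sup>2 / (32 * \<delta>)) * measure P (space M) + measure P {w\<in>space M. ennreal \<delta> < sqint (\<lambda>s w. Zn n s w - Z s w) w}"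
      using T_pos by (intro bernstein_ito D \<delta> \<epsilon> B) auto
    finally show ?thesis using P.prob_space by simp
  qed
  show "(\<lambda>n. measure P {w\<in>space P. ennreal \<epsilon> < supdist (In n) I w}) \<longlonglongrightarrow> 0"
  proof (rule LIMSEQ_I)
    fix r :: real assume r: "0 < r"
    \<comment> \<open>Chosen so that \<open>exp (- x) \<le> 1 / x\<close> gives \<open>2 * exp (-
      \<epsilon>\<^sup>2 / (32 * \<delta>)) \<le> 64 * \<delta> / \<epsilon>\<^sup>2 = r /
      2\<close>.\<close>
    define \<delta> where "\<delta> = \<epsilon>\<^sup>2 * r / 128"
    have \<delta>: "0 < \<delta>" using \<epsilon> r by (simp add: \<delta>_def)
    have x: "0 < \<epsilon>\<^sup>2 / (32 * \<delta>)" "1 / (\<epsilon>\<^sup>2 / (32 * \<delta>)) = r / 4" using \<epsilon> r by (auto simp: \<delta>_def)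
    have e: "2 * exp (- \<epsilon>\<^sup>2 / (32 * \<delta>)) \<le> r / 2"
      using exp_minus_le_inverse[OF x(1)] unfolding x(2) by simp
    obtain N where N: "\<And>n. N \<le> n \<Longrightarrow> measure P {w\<in>space P. ennreal \<delta> < sqint (\<lambda>s w. Zn n s w - Z s w) w} < r / 2"
      using P.tip_ex_small[OF lim \<delta>, of "r / 2"] r by (auto simp: eventually_sequentially)
    show "\<exists>N. \<forall>n\<ge>N. norm (measure P {w\<in>space P. ennreal \<epsilon> < supdist (In n) I w} - 0) < r"
    proof (intro exI allI impI)
      fix n assume "N \<le> n"
      from N[OF this] le[OF \<delta>, of n] e
      show "norm (measure P {w\<in>space P. ennreal \<epsilon> < supdist (In n) I w} - 0) < r" by simp
    qed
  qed
qed

text \<open>Along a fast subsequence the integrals of successive approximants differ uniformly by at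
  most \<open>(1/2) ^ n\<close> outside events of summable probability, so almost surely they
  converge uniformly in time and the limit is continuous.\<close>

lemma ito_exists:
  assumes S: "\<And>n. simple (m n) (p n) (h n)" and Z: "predictable M T W Z"
    and lim: "tendsto_0_in_prob P (\<lambda>n. sqint (\<lambda>s w. sproc (m n) (p n) (h n) s w - Z s w))"
  shows "\<exists>I. ito Z I"
proof -
  \<comment> \<open>The energy error \<open>(1/8) ^ n\<close> is small against the squared level
    \<open>(1/4) ^ n\<close> of the increments; the quotient \<open>2 ^ n\<close> appears in the
    exponent of the Bernstein inequality.\<close>
  obtain r where r: "strict_mono r"
    "\<And>n. measure P {w\<in>space P. ennreal ((1/8)^n) < sqint (\<lambda>s w. sproc (m (r n)) (p (r n)) (h (r n)) s w - Z s w) w} \<le> (1/2) ^ n"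
    using P.tip_subseq_fast[OF lim, of "\<lambda>n. (1/8)^n"] by auto
  define H where "H n = sproc (m (r n)) (p (r n)) (h (r n))" for n
  define J where "J n = sint (m (r n)) (p (r n)) (h (r n))" for n
  have Hp: "predictable M T W (H n)" for n unfolding H_def by (rule simple_process_predictable[OF S])
  have HZp: "predictable M T W (\<lambda>s w. H n s w - Z s w)" for n by (intro predictable_diff Hp Z)
  have Jm: "J n t \<in> borel_measurable (F t)" if "t \<in> {0..T}" for n t
    unfolding J_def by (rule simple_integral_adapted[OF S that])
  have JP: "J n t \<in> borel_measurable P" if "t \<in> {0..T}" for n t
    by (rule measurable_F_P[OF Jm[OF that]])
  have Jc: "continuous_on {0..T} (\<lambda>t. J n t w)" if "w \<in> space M" for n w
    unfolding J_def by (rule sint_continuous[OF S that])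
  have Jc': "AE w in M. continuous_on {0..T} (\<lambda>t. J n t w)" for n using Jc by (rule AE_I2)
  define X where "X n w = supdist (J (Suc n)) (J n) w" for n w
  have Xm: "X n \<in> borel_measurable P" for n
    unfolding X_def by (intro supdist_measurable JP Jc')
  define E where "E n = {w\<in>space P. ennreal ((1/8)^n) < sqint (\<lambda>s w. H n s w - Z s w) w}" for n
  have Em: "E n \<in> sets P" for n
    unfolding E_def using sqint_measurable[OF HZp[of n]] by measurable
  have E2: "measure P (E n) \<le> (1/2)^n" for n using r(2) by (simp add: E_def H_def)
  \<comment> \<open>The exponential term contributes \<open>2 * 8 * (1/2) ^ n\<close>, the two
    energy events contribute \<open>(3/2) * (1/2) ^ n\<close>.\<close>
  have Xb: "measure P {w\<in>space P. ennreal ((1/2)^n) < X n w} \<le> 18 * (1/2)^n" for n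
  proof -
    obtain k q l where s: "simple k q l"
      "\<And>t w. sint k q l t w = sint (m (r (Suc n))) (p (r (Suc n))) (h (r (Suc n))) t w + sint (m (r n)) (p (r n)) (\<lambda>i w. (-1) *\<^sub>R h (r n) i w) t w"
      "\<And>t w. sproc k q l t w = sproc (m (r (Suc n))) (p (r (Suc n))) (h (r (Suc n))) t w + sproc (m (r n)) (p (r n)) (\<lambda>i w. (-1) *\<^sub>R h (r n) i w) t w"
      using simple_add[OF S[of "r (Suc n)"] simple_scale[OF S[of "r n"], of "-1"]] by blast
    have sJ: "sint k q l t w = J (Suc n) t w - J n t w" for t w
      unfolding s(2) J_def simple_integral_scale by simp
    have sH: "sproc k q l t w = H (Suc n) t w - H n t w" for t w
      unfolding s(3) H_def by (simp add: simple_process_def sum_negf)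
    have B: "space M \<in> sets (F 0)" using sets.top[of "F 0"] by simp
    let ?\<delta> = "4 * (1/8 :: real)^n"
    have "measure P {w\<in>space P. ennreal ((1/2)^n) < X n w} = measure P {w\<in>space M. \<exists>t\<in>{0..T}. (1/2)^n < \<bar>sint_inc k q l 0 t w\<bar>}"
      unfolding X_def unfolding sint_0[OF s(1)] unfolding sJ
      by (intro arg_cong[where f="measure P"]) (auto simp: less_SUP_iff ennreal_less_iff)
    also have "\<dots> \<le> 2 * exp (- ((1/2)^n)\<^sup>2 / (2 * ?\<delta>)) * measure P (space M) + measure P {w\<in>space M. ?\<delta> < sqv_inc k q l 0 T w}"
      using T_pos by (intro bernstein_simple s(1) B) auto
    also have "- ((1/2)^n)\<^sup>2 / (2 * ?\<delta>) = - (2 ^ n / 8)"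
    proof -
      have "((1/2::real)^n)\<^sup>2 = 2 ^ n * (1/8)^n"
        unfolding power2_eq_square power_mult_distrib[symmetric] by simp
      then show ?thesis by simp
    qed
    also have "exp (- (2 ^ n / 8)) \<le> 1 / (2 ^ n / 8 :: real)" by (rule exp_minus_le_inverse) simp
    also have "1 / (2 ^ n / 8 :: real) = 8 * (1/2)^n" by (simp add: power_one_over)
    also have "measure P {w\<in>space M. ?\<delta> < sqv_inc k q l 0 T w} \<le> measure P (E (Suc n) \<union> E n)"
    proof (rule P.finite_measure_mono)
      show "{w\<in>space M. ?\<delta> < sqv_inc k q l 0 T w} \<subseteq> E (Suc n) \<union> E n"
      proof (rule subsetI, rule ccontr)
        fix w assume w: "w \<in> {w\<in>space M. ?\<delta> < sqv_inc k q l 0 T w}" "w \<notin> E (Suc n) \<union> E n"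
        then have wM: "w \<in> space M" by auto
        have "ennreal (sqv k q l T w) \<le> ennreal 2 * sqint (\<lambda>s w. H (Suc n) s w - Z s w) w + ennreal 2 * sqint (\<lambda>s w. H n s w - Z s w) w"
          unfolding sqint_simple[OF s(1), symmetric]
        proof (rule qv_le_linear[OF HZp HZp wM])
          show "(norm (sproc k q l t w))\<^sup>2 \<le> 2 * (norm (H (Suc n) t w - Z t w))\<^sup>2 + 2 * (norm (H n t w - Z t w))\<^sup>2" for t
            using norm_add_sq_le[of "H (Suc n) t w - Z t w" "Z t w - H n t w"] unfolding sH by (simp add: norm_minus_commute)
        qed auto
        also have "\<dots> \<le> ennreal 2 * ennreal ((1/8)^n) + ennreal 2 * ennreal ((1/8)^n)"
        proof (intro add_mono mult_left_mono)
          have "sqint (\<lambda>s w. H (Suc n) s w - Z s w) w \<le> ennreal ((1/8)^(Suc n))" using w wM unfolding E_def by (auto simp: not_less)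
          also have "\<dots> \<le> ennreal ((1/8)^n)" by (intro ennreal_leI) simp
          finally show "sqint (\<lambda>s w. H (Suc n) s w - Z s w) w \<le> ennreal ((1/8)^n)" .
          show "sqint (\<lambda>s w. H n s w - Z s w) w \<le> ennreal ((1/8)^n)" using w wM unfolding E_def by (auto simp: not_less)
        qed auto
        also have "\<dots> = ennreal ?\<delta>" by (simp add: ennreal_mult distrib_right[symmetric])
        finally have "sqv k q l T w \<le> ?\<delta>" by (simp add: ennreal_le_iff)
        then show False using w qv_0[OF s(1), of w] by auto
      qed
    qed (use Em in auto)
    also have "measure P (E (Suc n) \<union> E n) \<le> measure P (E (Suc n)) + measure P (E n)" using Em by (intro measure_Un_le) auto
    also have "\<dots> \<le> (1/2)^(Suc n) + (1/2)^n" by (intro add_mono E2)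
    finally have b: "measure P {w\<in>space P. ennreal ((1/2)^n) < X n w} * 2 \<le> 35 * (1/2)^n"
      using P.prob_space by simp
    have "0 \<le> (1/2 :: real)^n" by simp
    with b show ?thesis by linarith
  qed
  have small: "AE w in M. \<forall>\<^sub>F n in sequentially. X n w \<le> ennreal ((1/2)^n)"
    by (rule AE_P[THEN iffD1, OF P.AE_eventually_small[OF Xm Xb]])
  \<comment> \<open>The limit is taken at each time separately, so that \<open>I t\<close> is
    measurable for \<open>F t\<close>; uniformity in time enters for continuity and for the supremum
    distance.\<close>
  define I where "I t w = lim (\<lambda>n. J n t w)" for t w
  have unif: "AE w in M. uniform_limit {0..T} (\<lambda>n t. J n t w) (\<lambda>t. I t w) sequentially"
    using small
  proof eventually_elim
    case (elim w)
    have "\<forall>\<^sub>F n in sequentially. \<forall>t\<in>{0..T}. norm (J (Suc n) t w - J n t w) \<le> (1/2)^n"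
      using elim by eventually_elim (auto simp: X_def SUP_le_iff ennreal_le_iff)
    then have "uniform_limit {0..T} (\<lambda>n t. \<Sum>i<n. J (Suc i) t w - J i t w) (\<lambda>t. \<Sum>i. J (Suc i) t w - J i t w) sequentially"
      by (rule Weierstrass_m_test_ev) (simp add: summable_geometric)
    moreover have "(\<Sum>i<n. J (Suc i) t w - J i t w) = J n t w - J 0 t w" for n t
      by (rule sum_lessThan_telescope[of "\<lambda>i. J i t w"])
    ultimately have "uniform_limit {0..T} (\<lambda>n t. J n t w - J 0 t w) (\<lambda>t. \<Sum>i. J (Suc i) t w - J i t w) sequentially"
      by (simp only:)
    moreover have "uniform_limit {0..T} (\<lambda>n t. J 0 t w) (\<lambda>t. J 0 t w) sequentially"
      by (rule uniform_limit_const)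
    ultimately have "uniform_limit {0..T} (\<lambda>n t. (J n t w - J 0 t w) + J 0 t w) (\<lambda>t. (\<Sum>i. J (Suc i) t w - J i t w) + J 0 t w) sequentially"
      by (rule uniform_limit_add)
    then have u: "uniform_limit {0..T} (\<lambda>n t. J n t w) (\<lambda>t. (\<Sum>i. J (Suc i) t w - J i t w) + J 0 t w) sequentially"
      by simp
    have eq: "I t w = (\<Sum>i. J (Suc i) t w - J i t w) + J 0 t w" if "t \<in> {0..T}" for t
      unfolding I_def using tendsto_uniform_limitI[OF u that] by (rule limI)
    show ?case by (rule uniform_limit_cong'[THEN iffD2, OF refl eq u])
  qed
  have Ic: "AE w in M. continuous_on {0..T} (\<lambda>t. I t w)"
    using unif AE_space
  proof eventually_elim
    case (elim w)
    then show ?case using Jc[OF elim(2)]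
      by (intro uniform_limit_theorem[OF _ elim(1)]) (auto intro!: always_eventually)
  qed
  have Im: "I t \<in> borel_measurable (F t)" if "t \<in> {0..T}" for t
    unfolding I_def using Jm[OF that] by (rule borel_measurable_lim_metric)
  have "ito Z I"
  proof (rule itoI[OF Im Ic, of "\<lambda>n. m (r n)" "\<lambda>n. p (r n)" "\<lambda>n. h (r n)"])
    show "tendsto_0_in_prob P (\<lambda>n. sqint (\<lambda>s w. sproc (m (r n)) (p (r n)) (h (r n)) s w - Z s w))"
      unfolding tendsto_0_in_prob_def
    proof (intro conjI allI impI)
      fix \<epsilon> :: real assume "0 < \<epsilon>"
      from LIMSEQ_subseq_LIMSEQ[OF P.tip_lim[OF lim this] r(1)]
      show "(\<lambda>n. measure P {w\<in>space P. ennreal \<epsilon> < sqint (\<lambda>s w. sproc (m (r n)) (p (r n)) (h (r n)) s w - Z s w) w}) \<longlonglongrightarrow> 0"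
        by (simp add: comp_def)
    qed (rule P.tip_meas[OF lim])
    show "tendsto_0_in_prob P (\<lambda>n w. \<Squnion>t\<in>{0..T}. ennreal \<bar>sint (m (r n)) (p (r n)) (h (r n)) t w - I t w\<bar>)"
    proof (rule P.tip_AE)
      show "(\<lambda>w. \<Squnion>t\<in>{0..T}. ennreal \<bar>sint (m (r n)) (p (r n)) (h (r n)) t w - I t w\<bar>) \<in> borel_measurable P" for n
        unfolding J_def[symmetric] by (intro supdist_measurable JP Jc' Ic measurable_F_P[OF Im])
      show "AE w in P. (\<lambda>n. \<Squnion>t\<in>{0..T}. ennreal \<bar>sint (m (r n)) (p (r n)) (h (r n)) t w - I t w\<bar>) \<longlonglongrightarrow> 0"
        unfolding AE_P using unif
      proof eventually_elim
        case (elim w)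
        show ?case
        proof (rule tendsto_0_ennrealI)
          fix \<epsilon> :: real assume "0 < \<epsilon>"
          from uniform_limitD[OF elim this]
          show "\<forall>\<^sub>F n in sequentially. (\<Squnion>t\<in>{0..T}. ennreal \<bar>sint (m (r n)) (p (r n)) (h (r n)) t w - I t w\<bar>) \<le> ennreal \<epsilon>"
            by eventually_elim (intro SUP_least ennreal_leI, simp add: J_def dist_real_def less_imp_le)
        qed
      qed
    qed
  qed (assumption | rule S)+
  then show ?thesis by blast
qed

text \<open>A diagonal choice of a simple integrand near each \<open>Zn n\<close> gives simple
  approximants of \<open>Z\<close> and hence an integral; its distance to \<open>In n\<close> is
  then controlled by \<open>ito_stability\<close>.\<close>

lemma ito_closed:
  assumes In: "\<And>n. ito (Zn n) (In n)" "\<And>n. predictable M T W (Zn n)" and Z: "predictable M T W Z"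
    and lim: "tendsto_0_in_prob P (\<lambda>n. sqint (\<lambda>s w. Zn n s w - Z s w))"
  obtains I where "ito Z I" "tendsto_0_in_prob P (\<lambda>n w. supdist (In n) I w)"
proof -
  define R where "R n m p h \<longleftrightarrow> simple m p h \<and> measure P {w\<in>space P. ennreal (1 / real (Suc n)) < sqint (\<lambda>s w. sproc m p h s w - Zn n s w) w} \<le> 1 / real (Suc n)" for n m p h
  have "\<exists>m p h. R n m p h" for n
  proof -
    obtain m p h where ap: "\<And>n. simple (m n) (p n) (h n)"
      "tendsto_0_in_prob P (\<lambda>k. sqint (\<lambda>s w. sproc (m k) (p k) (h k) s w - Zn n s w))"
      by (rule ito_approx[OF In(1)[of n]]) (rule that)
    have "\<forall>\<^sub>F k in sequentially. measure P {w\<in>space P. ennreal (1 / real (Suc n)) < sqint (\<lambda>s w. sproc (m k) (p k) (h k) s w - Zn n s w) w} < 1 / real (Suc n)"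
      by (rule P.tip_ex_small[OF ap(2)]) auto
    then obtain k where "measure P {w\<in>space P. ennreal (1 / real (Suc n)) < sqint (\<lambda>s w. sproc (m k) (p k) (h k) s w - Zn n s w) w} < 1 / real (Suc n)"
      using eventually_happens'[OF sequentially_bot] by blast
    then have "R n (m k) (p k) (h k)" unfolding R_def using ap(1)[of k] by (intro conjI less_imp_le)
    then show ?thesis by (intro exI)
  qed
  then obtain m p h where R: "\<And>n. R n (m n) (p n) (h n)" by metis
  then have ap: "\<And>n. simple (m n) (p n) (h n)"
     "\<And>n. measure P {w\<in>space P. ennreal (1 / real (Suc n)) < sqint (\<lambda>s w. sproc (m n) (p n) (h n) s w - Zn n s w) w} \<le> 1 / real (Suc n)"
    unfolding R_def by blast+
  have pd: "predictable M T W (\<lambda>s w. sproc (m n) (p n) (h n) s w - Zn n s w)"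
    "predictable M T W (\<lambda>s w. Zn n s w - Z s w)" "predictable M T W (\<lambda>s w. sproc (m n) (p n) (h n) s w - Z s w)" for n
    by (intro predictable_diff simple_process_predictable ap(1) In(2) Z)+
  have l1: "tendsto_0_in_prob P (\<lambda>n. sqint (\<lambda>s w. sproc (m n) (p n) (h n) s w - Zn n s w))"
    by (rule P.tip_diag[OF sqint_measurable[OF pd(1)] ap(2)])
  have "tendsto_0_in_prob P (\<lambda>n. sqint (\<lambda>s w. sproc (m n) (p n) (h n) s w - Z s w))"
  proof (rule P.tip_mono[OF P.tip_add[OF P.tip_cmult[OF l1, of 2] P.tip_cmult[OF lim, of 2]] sqint_measurable[OF pd(3)]])
    fix n
    show "AE w in P. sqint (\<lambda>s w. sproc (m n) (p n) (h n) s w - Z s w) w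
       \<le> ennreal 2 * sqint (\<lambda>s w. sproc (m n) (p n) (h n) s w - Zn n s w) w + ennreal 2 * sqint (\<lambda>s w. Zn n s w - Z s w) w"
      using sqint_add_le[OF pd(1,2), of _ n n] by (intro AE_I2) simp
  qed auto
  from ito_exists[OF ap(1) Z this] obtain I where I: "ito Z I" by blast
  show thesis by (rule that[OF I ito_stability[OF In I Z lim]])
qed

end

section \<open>Comparison\<close>

lemma continuous_on_at_right:
  fixes g :: "real \<Rightarrow> real"
  assumes "continuous_on {0..T} g" "t \<in> {0..<T}"
  shows "(g \<longlongrightarrow> g t) (at_right t)"
proof -
  have "(g \<longlongrightarrow> g t) (at t within {0..T})" using assms by (auto simp: continuous_on_def)
  then have "(g \<longlongrightarrow> g t) (at t within {t..T})" using assms by (elim tendsto_within_subset) auto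
  then show ?thesis using assms by (simp add: at_within_Icc_at_right)
qed

text \<open>Points off the grids are approached by grid points from the right. The end point
  \<open>T\<close>, where right-continuity says nothing, is itself a grid point.\<close>

lemma right_continuous_le:
  fixes f h :: "real \<Rightarrow> real"
  assumes f: "\<And>t. t \<in> {0..<T} \<Longrightarrow> (f \<longlongrightarrow> f t) (at_right t)" and h: "\<And>t. t \<in> {0..<T} \<Longrightarrow> (h \<longlongrightarrow> h t) (at_right t)"
    and le: "\<And>n x. x \<in> dyadic_grid 0 T n \<Longrightarrow> f x \<le> h x" and t: "t \<in> {0..T}"
  shows "f t \<le> h t"
proof (cases "\<exists>n. t \<in> dyadic_grid 0 T n")
  case True then show ?thesis using le by blast
next
  case False
  have "T \<in> dyadic_grid 0 T 0" unfolding dyadic_grid_def by (intro image_eqI[of _ _ 1]) auto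
  with False t have t': "t \<in> {0..<T}" by (cases "t = T") auto
  obtain x where x: "\<And>n. x n \<in> dyadic_grid 0 T n" "x \<longlonglongrightarrow> t" "\<And>n. t \<le> x n"
    using dyadic_grid_dense[OF t] by blast
  have "x n \<noteq> t" for n using x(1)[of n] False by auto
  with x(3) have "t < x n" for n by (simp add: less_le) metis
  then have fl: "filterlim x (at_right t) sequentially"
    by (intro tendsto_imp_filterlim_at_right[OF x(2)]) simp
  show ?thesis
    using filterlim_compose[OF f[OF t'] fl] filterlim_compose[OF h[OF t'] fl] le[OF x(1)]
    by (intro LIMSEQ_le) auto
qed

context brownian_setup
begin

abbreviation "sexp m p h t c w \<equiv> exp (c * (sint_inc m p h t T w) - c\<^sup>2 * (sqv_inc m p h t T w) / 2)"

lemma sexp_measurable: "simple m p h \<Longrightarrow> t \<in> {0..T} \<Longrightarrow> sexp m p h t c \<in> borel_measurable P"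
  using sint_P[of m p h T] sint_P[of m p h t] measurable_F_P[OF simple_qv_adapted, of m p h T] measurable_F_P[OF simple_qv_adapted, of m p h t] T_pos
  by auto

text \<open>The square of the exponential with parameter \<open>c\<close> is the exponential with
  parameter \<open>2 * c\<close> times \<open>exp (c\<^sup>2 * q)\<close>, where \<open>q\<close> is
  the energy after \<open>t\<close>. This second moment controls the exponential on events of small
  probability.\<close>

lemma sexp_square:
  assumes S: "simple m p h" and t: "t \<in> {0..T}" and K: "\<And>w. sqv_inc m p h t T w \<le> K"
  shows "(\<E> w. ennreal ((sexp m p h t c w)\<^sup>2)) \<le> ennreal (exp (c\<^sup>2 * K))"
proof -
  have "(sexp m p h t c w)\<^sup>2 \<le> exp (c\<^sup>2 * K) * sexp m p h t (2 * c) w" for w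
  proof -
    have "c\<^sup>2 * (sqv_inc m p h t T w) \<le> c\<^sup>2 * K" by (intro mult_left_mono K) simp
    then show ?thesis
      unfolding power2_eq_square[of "exp _"] exp_add[symmetric] by (simp add: power_mult_distrib)
  qed
  then have "(\<E> w. ennreal ((sexp m p h t c w)\<^sup>2)) \<le> (\<E> w. ennreal (exp (c\<^sup>2 * K)) * ennreal (sexp m p h t (2 * c) w))"
    by (intro nn_integral_mono) (auto simp: ennreal_mult[symmetric] intro!: ennreal_leI)
  also have "\<dots> = ennreal (exp (c\<^sup>2 * K)) * (\<E> w. ennreal (sexp m p h t (2 * c) w))"
    by (intro nn_integral_cmult measurable_compose[OF sexp_measurable[OF S t]] measurable_ennreal)
  also have "(\<E> w. ennreal (sexp m p h t (2 * c) w)) = 1"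
    using exp_simple[OF S t, of "\<lambda>_. 1" "2 * c"] P.emeasure_space_1 by simp
  finally show ?thesis by simp
qed

text \<open>Here \<open>d\<close> is the value at time \<open>t\<close> of the process to be
  bounded, and the hypothesis bounds the exponent with parameter \<open>l\<close> at every later
  time. At \<open>s = T\<close> the exponent is at most \<open>c0 - l * \<epsilon>\<close> wherever
  \<open>d > R + \<epsilon>\<close>, so the exponential identity gives
  \<open>measure P B \<le> exp (c0 - l * \<epsilon>) * measure P B\<close> for that event, and a
  large \<open>l\<close> makes it null. Intermediate times enter because the approximating
  integrands have to be stopped.\<close>

lemma exponential_step:
  assumes I: "ito Z N" "predictable M T W Z" and t: "t \<in> {0..T}" and d: "d \<in> borel_measurable (F t)"
    and M0: "0 \<le> M0" and fin: "AE w in M. sqint Z w < \<infinity>"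
    and H: "AE w in M. \<forall>s\<in>{t..T}. \<forall>l>0. \<forall>q\<ge>0. qv Z t s w \<le> ennreal q \<longrightarrow>
      l * (d w + (N s w - N t w)) \<le> l * (R + (if s = T then 0 else M0)) + l\<^sup>2 * q / 2 + c0"
  shows "AE w in M. d w \<le> R"
proof -
  obtain m p h where ap: "\<And>n. simple (m n) (p n) (h n)"
    "tendsto_0_in_prob P (\<lambda>n. sqint (\<lambda>s w. sproc (m n) (p n) (h n) s w - Z s w))"
    "tendsto_0_in_prob P (\<lambda>n w. supdist (sint (m n) (p n) (h n)) N w)"
    using ito_approx[OF I(1)] by blast
  let ?D = "\<lambda>n. sqint (\<lambda>s w. sproc (m n) (p n) (h n) s w - Z s w)"
  let ?S = "\<lambda>n w. supdist (sint (m n) (p n) (h n)) N w"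
  have tT: "t \<le> T" "0 \<le> t" using t by auto
  have Sm[measurable]: "?S n \<in> borel_measurable P" and Dm[measurable]: "?D n \<in> borel_measurable P" and Zm[measurable]: "sqint Z \<in> borel_measurable P" for n
    using P.tip_meas[OF ap(2)] P.tip_meas[OF ap(3)] sqint_measurable[OF I(2)] by auto
  have main: "measure P {w\<in>space M. R + \<epsilon> < d w} \<le> exp (c0 - l * \<epsilon>) * measure P {w\<in>space M. R + \<epsilon> < d w}"
    if l: "0 < l" for l \<epsilon>
  proof -
    define B where "B = {w\<in>space M. R + \<epsilon> < d w}"
    have B: "B \<in> sets (F t)"
      using borel_measurable_less[OF borel_measurable_const d, of "R + \<epsilon>"] by (simp add: B_def)
    have BP: "B \<in> sets P" by (rule F_sub_P[OF B])
    \<comment> \<open>Outside this event, and with approximation error at most 1, the approximant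
      has energy at most \<open>2 * 1 + 2 * ((real k - 2) / 2) = real k\<close> and is not stopped
      before \<open>T\<close>.\<close>
    define E4 where "E4 k = {w\<in>space P. ennreal ((real k - 2) / 2) < sqint Z w}" for k :: nat
    have E4m: "E4 k \<in> sets P" for k unfolding E4_def by measurable
    \<comment> \<open>The exponent \<open>c0 - l * \<epsilon>\<close> plus the approximation errors
      at level \<open>k\<close>: \<open>l\<close> times twice the uniform distance of the integrals,
      and \<open>l\<^sup>2 / 2\<close> times the error in the energy.\<close>
    define \<kappa> where "\<kappa> k = 2 * l * (1 / real k) - l * \<epsilon> + l\<^sup>2 / 2 * (1 / real k + 2 / (real k)\<^sup>2) + c0" for k :: nat
    have step: "measure P B \<le> exp (\<kappa> k) * (measure P B + exp (l * M0) * measure P (E4 k)) + 2 / real k" if k: "2 \<le> k" for k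
    proof -
      have k0: "0 < real k" using k by simp
      \<comment> \<open>\<rho> bounds the distance of the integrals. The weight \<eta> times an
        energy up to \<open>k\<close> is at most \<open>1 / real k\<close>, and \<delta> is so small
        that even \<open>(1 + 1 / \<eta>) * \<delta>\<close> is at most
        \<open>2 / (real k)\<^sup>2\<close>.\<close>
      define \<rho> where "\<rho> = 1 / real k"
      define \<eta> where "\<eta> = 1 / (real k)\<^sup>2"
      define \<delta> where "\<delta> = 1 / (real k)^4"
      have pos: "0 < \<rho>" "0 < \<eta>" "0 < \<delta>" using k0 by (auto simp: \<rho>_def \<eta>_def \<delta>_def)
      have \<delta>1: "\<delta> \<le> 1" using k unfolding \<delta>_def by (simp add: one_le_power)
      \<comment> \<open>On the bad event the exponential is estimated by
        \<open>K + X\<^sup>2 / K\<close>. This \<open>K\<close> makes the second term contribute at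
        most \<open>1 / real k\<close>; afterwards \<open>n\<close> is taken so large that the bad
        event has probability below \<open>1 / (K * real k)\<close>.\<close>
      define K where "K = exp (l\<^sup>2 * real k) * real k"
      have K: "0 < K" using k0 by (simp add: K_def)
      define E2 where "E2 n = {w\<in>space P. ennreal \<rho> < ?S n w}" for n
      define E3 where "E3 n = {w\<in>space P. ennreal \<delta> < ?D n w}" for n
      have E23m: "E2 n \<in> sets P" "E3 n \<in> sets P" for n unfolding E2_def E3_def by measurable
      have "(\<lambda>n. measure P (E2 n) + measure P (E3 n)) \<longlonglongrightarrow> 0 + 0"
        unfolding E2_def E3_def using pos by (intro tendsto_add P.tip_lim ap)
      then have "\<forall>\<^sub>F n in sequentially. measure P (E2 n) + measure P (E3 n) < 1 / (K * real k)"
        using K k0 by (intro order_tendstoD) auto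
      then obtain n where n: "measure P (E2 n) + measure P (E3 n) < 1 / (K * real k)"
        using eventually_happens'[OF sequentially_bot] by blast
      let ?m = "m n" and ?p = "p n" and ?h = "h n"
      obtain g where g: "simple ?m ?p g"
        "\<And>w. sqv_inc ?m ?p g t T w \<le> real k"
        "\<And>w. \<exists>s\<in>{t..T}. sint_inc ?m ?p g t T w = sint_inc ?m ?p ?h t s w \<and>
           sqv_inc ?m ?p g t T w = sqv_inc ?m ?p ?h t s w \<and>
           (sqv_inc ?m ?p ?h t T w \<le> real k \<longrightarrow> s = T)"
        by (rule simple_truncate[OF ap(1)[of n] t of_nat_0_le_iff[of k]]) (rule that)
      define X where "X = sexp ?m ?p g t l"
      have [measurable]: "X \<in> borel_measurable P" unfolding X_def by (rule sexp_measurable[OF g(1) t])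
      have EB: "(\<E> w. indicator B w * ennreal (X w)) = emeasure P B"
        unfolding X_def using exp_simple[OF g(1) t, of "indicator B" l] B BP by simp
      have EX2: "(\<E> w. ennreal ((X w)\<^sup>2)) \<le> ennreal (exp (l\<^sup>2 * real k))"
        unfolding X_def by (rule sexp_square[OF g(1) t g(2)])
      \<comment> \<open>The four terms belong to good paths that reach \<open>T\<close>, to paths
        stopped early, where only the bound \<open>M0\<close> is available, and, the last two, to
        paths on which the approximation fails.\<close>
      have pt: "AE w in P. indicator B w * ennreal (X w) \<le> ennreal (exp (\<kappa> k)) * indicator B w
          + ennreal (exp (\<kappa> k) * exp (l * M0)) * indicator (E4 k) w
          + (ennreal K * indicator (E2 n \<union> E3 n) w + ennreal (1 / K) * ennreal ((X w)\<^sup>2))"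
        unfolding AE_P using H
      proof eventually_elim
        case (elim w)
        have X0: "0 \<le> X w" by (simp add: X_def)
        show ?case
        proof (cases "w \<in> B")
          case False then show ?thesis by simp
        next
          case wB: True
          then have wM: "w \<in> space M" "R + \<epsilon> < d w" by (auto simp: B_def)
          show ?thesis
          proof (cases "w \<in> E2 n \<union> E3 n")
            case True
            have "X w * K \<le> K * K + X w * X w"
              using zero_le_square[of "X w - K"] mult_nonneg_nonneg[OF X0 less_imp_le[OF K]] by (simp add: algebra_simps)
            then have "X w \<le> K + (X w)\<^sup>2 / K" using K by (simp add: field_simps power2_eq_square)
            then have "ennreal (X w) \<le> ennreal (K + (X w)\<^sup>2 / K)" by (rule ennreal_leI)
            also have "\<dots> = ennreal K * indicator (E2 n \<union> E3 n) w + ennreal (1 / K) * ennreal ((X w)\<^sup>2)"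
              using True K by (simp add: ennreal_mult[symmetric])
            finally show ?thesis using wB by (simp add: add_increasing)
          next
            case False
            then have SD: "?S n w \<le> ennreal \<rho>" "?D n w \<le> ennreal \<delta>" using wM by (auto simp: E2_def E3_def not_less)
            have S: "\<bar>sint ?m ?p ?h u w - N u w\<bar> \<le> \<rho>" if "u \<in> {0..T}" for u
            proof -
              have "ennreal \<bar>sint ?m ?p ?h u w - N u w\<bar> \<le> ennreal \<rho>"
                using SD(1) that by (meson SUP_upper order_trans)
              then show ?thesis using pos by (simp add: ennreal_le_iff)
            qed
            obtain s where s: "s \<in> {t..T}" "sint_inc ?m ?p g t T w = sint_inc ?m ?p ?h t s w"
               "sqv_inc ?m ?p g t T w = sqv_inc ?m ?p ?h t s w"
               "sqv_inc ?m ?p ?h t T w \<le> real k \<longrightarrow> s = T"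
              using g(3)[of w] by blast
            define v where "v = sqv_inc ?m ?p ?h t s w"
            have v: "0 \<le> v" "v \<le> real k"
              using qv_mono[OF ap(1)[of n], of t s w] s g(2)[of w] by (auto simp: v_def)
            define q where "q = (1 + \<eta>) * v + (1 + 1 / \<eta>) * \<delta>"
            have q0: "0 \<le> q" using v pos by (auto simp: q_def)
            have qle: "qv Z t s w \<le> ennreal q"
            proof -
              let ?H = "sproc ?m ?p ?h"
              have "qv Z t s w \<le> ennreal (1 + \<eta>) * qv ?H t s w + ennreal (1 + 1 / \<eta>) * qv (\<lambda>s w. ?H s w - Z s w) t s w"
                using s(1) tT by (intro qv_diff_le[OF simple_process_predictable[OF ap(1)] I(2) wM(1) pos(2)]) auto
              also have "qv ?H t s w = ennreal v"
                unfolding v_def qv_def using s(1) by (intro nn_integral_simple[OF ap(1)]) auto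
              also have "qv (\<lambda>s w. ?H s w - Z s w) t s w \<le> ennreal \<delta>"
                using s(1) tT by (intro order_trans[OF qv_mono_interval SD(2)]) auto
              also have "ennreal (1 + \<eta>) * ennreal v + ennreal (1 + 1 / \<eta>) * ennreal \<delta> = ennreal q"
                using pos v unfolding q_def by (intro ennreal_linear[symmetric]) auto
              finally show ?thesis by (simp add: mult_left_mono add_left_mono)
            qed
            have main_ineq: "l * (d w + (N s w - N t w)) \<le> l * (R + (if s = T then 0 else M0)) + l\<^sup>2 * q / 2 + c0"
              using elim s(1) l q0 qle by blast
            have J: "sint_inc ?m ?p ?h t s w \<le> N s w - N t w + 2 * \<rho>"
              using S[of s] S[of t] s tT by auto
            have "l * (sint_inc ?m ?p ?h t s w) \<le> l * (N s w - N t w + 2 * \<rho>)"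
              using J l by (intro mult_left_mono) auto
            moreover have "l * (R + \<epsilon>) \<le> l * d w" using wM(2) l by (intro mult_left_mono) auto
            moreover have "l\<^sup>2 * q \<le> l\<^sup>2 * (v + (1 / real k + 2 / (real k)\<^sup>2))"
            proof (rule mult_left_mono)
              have "\<eta> * v \<le> \<eta> * real k" using v pos by (intro mult_left_mono) auto
              also have "\<dots> = 1 / real k" using k0 by (simp add: \<eta>_def power2_eq_square)
              finally have 1: "\<eta> * v \<le> 1 / real k" .
              have "(1 + 1 / \<eta>) * \<delta> = 1 / (real k)^4 + 1 / (real k)\<^sup>2"
                using k0 by (simp add: \<eta>_def \<delta>_def field_simps power_add[symmetric])
              also have "1 / (real k)^4 \<le> 1 / (real k)\<^sup>2"
                using k by (intro divide_left_mono power_increasing) auto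
              finally have 2: "(1 + 1 / \<eta>) * \<delta> \<le> 2 / (real k)\<^sup>2" by simp
              show "q \<le> v + (1 / real k + 2 / (real k)\<^sup>2)" using 1 2 by (simp add: q_def distrib_right)
            qed simp
            ultimately have "l * (sint_inc ?m ?p ?h t s w) - l\<^sup>2 * v / 2
               \<le> \<kappa> k + l * (if s = T then 0 else M0)"
              using main_ineq unfolding \<kappa>_def \<rho>_def by (simp add: algebra_simps)
            then have Xle: "X w \<le> exp (\<kappa> k) * exp (l * (if s = T then 0 else M0))"
              unfolding X_def s(2,3) v_def[symmetric] exp_add[symmetric] by simp
            have "ennreal (X w) \<le> ennreal (exp (\<kappa> k)) * indicator B w + ennreal (exp (\<kappa> k) * exp (l * M0)) * indicator (E4 k) w"
            proof (cases "s = T")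
              case True
              then have "ennreal (X w) \<le> ennreal (exp (\<kappa> k))" using Xle by (intro ennreal_leI) simp
              then show ?thesis using wB by (simp add: add_increasing2)
            next
              case sT: False
              have "w \<in> E4 k"
              proof (rule ccontr)
                assume "w \<notin> E4 k"
                then have z: "sqint Z w \<le> ennreal ((real k - 2) / 2)" using wM by (auto simp: E4_def not_less)
                then have "sqv_inc ?m ?p ?h t T w \<le> 2 * 1 + 2 * ((real k - 2) / 2)"
                  using k order_trans[OF SD(2) ennreal_leI[OF \<delta>1]] by (intro sqv_inc_le[OF ap(1) I(2) wM(1) t]) auto
                then show False using s(4) sT by (simp add: field_simps)
              qed
              then have "ennreal (X w) \<le> ennreal (exp (\<kappa> k) * exp (l * M0)) * indicator (E4 k) w"
                using Xle sT by (simp add: ennreal_leI)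
              then show ?thesis by (simp add: add_increasing)
            qed
            then show ?thesis using wB by (simp add: add_increasing2)
          qed
        qed
      qed
      have "emeasure P B \<le> (\<E> w. (ennreal (exp (\<kappa> k)) * indicator B w
          + ennreal (exp (\<kappa> k) * exp (l * M0)) * indicator (E4 k) w)
          + (ennreal K * indicator (E2 n \<union> E3 n) w + ennreal (1 / K) * ennreal ((X w)\<^sup>2)))"
        unfolding EB[symmetric] by (rule nn_integral_mono_AE[OF pt])
      also have "\<dots> = (ennreal (exp (\<kappa> k)) * emeasure P B + ennreal (exp (\<kappa> k) * exp (l * M0)) * emeasure P (E4 k))
          + (ennreal K * emeasure P (E2 n \<union> E3 n) + ennreal (1 / K) * (\<E> w. ennreal ((X w)\<^sup>2)))"
        using BP E4m E23m by (simp add: nn_integral_add nn_integral_cmult)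
      also have "\<dots> \<le> (ennreal (exp (\<kappa> k)) * emeasure P B + ennreal (exp (\<kappa> k) * exp (l * M0)) * emeasure P (E4 k))
          + (ennreal K * ennreal (1 / (K * real k)) + ennreal (1 / K) * ennreal (exp (l\<^sup>2 * real k)))"
      proof (intro add_mono order_refl mult_left_mono EX2)
        have "measure P (E2 n \<union> E3 n) \<le> measure P (E2 n) + measure P (E3 n)" using E23m by (intro measure_Un_le) auto
        then show "emeasure P (E2 n \<union> E3 n) \<le> ennreal (1 / (K * real k))"
          unfolding P.emeasure_eq_measure using n by (intro ennreal_leI) simp
      qed auto
      also have "\<dots> = ennreal (exp (\<kappa> k) * (measure P B + exp (l * M0) * measure P (E4 k)) + 2 / real k)"
      proof -
        have "K * (1 / (K * real k)) = 1 / real k" using K by simp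
        moreover have "1 / K * exp (l\<^sup>2 * real k) = 1 / real k" using k0 by (simp add: K_def)
        ultimately show ?thesis unfolding P.emeasure_eq_measure using K k0
          by (simp add: ennreal_mult[symmetric] ennreal_plus[symmetric] distrib_left mult.assoc del: ennreal_plus)
      qed
      finally show ?thesis
        unfolding P.emeasure_eq_measure using k0 by (subst (asm) ennreal_le_iff) auto
    qed
    have E4lim: "(\<lambda>k. measure P (E4 k)) \<longlonglongrightarrow> 0"
    proof -
      have "(\<lambda>k. \<integral>w. indicator (E4 k) w \<partial>P) \<longlonglongrightarrow> (\<integral>w. 0 \<partial>P :: real)"
      proof (rule integral_dominated_convergence[where w="\<lambda>_. 1"])
        show "AE w in P. (\<lambda>k. indicator (E4 k) w :: real) \<longlonglongrightarrow> 0"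
          unfolding AE_P using fin
        proof eventually_elim
          case (elim w)
          then obtain x where x: "sqint Z w = ennreal x" "0 \<le> x" by (cases "sqint Z w") auto
          obtain K :: nat where "2 * x + 2 < real K" using reals_Archimedean2 by blast
          then have "w \<notin> E4 k" if "K \<le> k" for k
          proof -
            have "real K \<le> real k" using that by simp
            then have "x \<le> (real k - 2) / 2" using \<open>2 * x + 2 < real K\<close> by simp
            then show ?thesis using x by (auto simp: E4_def not_less intro!: ennreal_leI)
          qed
          then have "\<forall>\<^sub>F k in sequentially. (indicator (E4 k) w :: real) = 0"
            by (auto simp: eventually_sequentially intro!: exI[of _ K])
          then show ?case by (rule tendsto_eventually)
        qed
      qed (use E4m in auto)
      then show ?thesis using E4m sets.sets_into_space[OF E4m] by (simp add: Int_absorb2)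
    qed
    have k1: "(\<lambda>k. 1 / real k) \<longlonglongrightarrow> 0" by (rule lim_1_over_n)
    have k2: "(\<lambda>k. 2 / (real k)\<^sup>2) \<longlonglongrightarrow> 0"
      using tendsto_mult[OF tendsto_mult[OF tendsto_const[of 2] k1] k1] by (simp add: power2_eq_square)
    have "\<kappa> \<longlonglongrightarrow> 2 * l * 0 - l * \<epsilon> + l\<^sup>2 / 2 * (0 + 0) + c0"
      unfolding \<kappa>_def by (intro tendsto_intros k1 k2)
    then have kl: "\<kappa> \<longlonglongrightarrow> c0 - l * \<epsilon>" by simp
    have "(\<lambda>k. 2 / real k) \<longlonglongrightarrow> 0" using tendsto_mult[OF tendsto_const[of 2] k1] by simp
    then have "(\<lambda>k. exp (\<kappa> k) * (measure P B + exp (l * M0) * measure P (E4 k)) + 2 / real k)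
       \<longlonglongrightarrow> exp (c0 - l * \<epsilon>) * (measure P B + exp (l * M0) * 0) + 0"
      by (intro tendsto_intros kl E4lim)
    then show ?thesis unfolding B_def[symmetric]
      using step by (intro LIMSEQ_le_const) (auto intro!: exI[of _ 2])
  qed
  have zero: "measure P {w\<in>space M. R + \<epsilon> < d w} = 0" if \<epsilon>: "0 < \<epsilon>" for \<epsilon>
  proof (rule ccontr)
    define a where "a = measure P {w\<in>space M. R + \<epsilon> < d w}"
    assume "measure P {w\<in>space M. R + \<epsilon> < d w} \<noteq> 0"
    then have a: "0 < a" unfolding a_def by (simp add: zero_less_measure_iff)
    \<comment> \<open>Makes \<open>c0 - l * \<epsilon>\<close> at most -1.\<close>
    define l where "l = (\<bar>c0\<bar> + 1) / \<epsilon>"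
    have l: "0 < l" "c0 - l * \<epsilon> < 0" using \<epsilon> by (auto simp: l_def)
    have "a \<le> exp (c0 - l * \<epsilon>) * a" using main[OF l(1), of \<epsilon>] by (simp add: a_def)
    also have "\<dots> < 1 * a" using l(2) a by (intro mult_strict_right_mono) auto
    finally show False by simp
  qed
  have dP: "d \<in> borel_measurable P" by (rule measurable_F_P[OF d])
  have "AE w in P. \<forall>n. d w \<le> R + 1 / real (Suc n)"
  proof (rule AE_all_countable[THEN iffD2], rule allI)
    fix n
    let ?E = "{w\<in>space P. R + 1 / real (Suc n) < d w}"
    have "?E \<in> sets P" by (rule borel_measurable_less[OF borel_measurable_const dP])
    then have "?E \<in> null_sets P"
      using zero[of "1 / real (Suc n)"] by (auto simp: P.emeasure_eq_measure null_sets_def simp del: of_nat_Suc)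
    from AE_not_in[OF this] show "AE w in P. d w \<le> R + 1 / real (Suc n)"
      using AE_space by eventually_elim (auto simp del: of_nat_Suc)
  qed
  then show ?thesis
    unfolding AE_P
  proof eventually_elim
    case (elim w)
    have "(\<lambda>n. R + 1 / real (Suc n)) \<longlonglongrightarrow> R + 0"
      using LIMSEQ_inverse_real_of_nat by (intro tendsto_intros) (simp add: divide_inverse)
    from LIMSEQ_le_const[OF this] elim show ?case by auto
  qed
qed

end

lemma integral_exp_decreasing:
  fixes a :: real
  assumes "s \<le> t" "0 < a"
  shows "set_integrable lborel {s..t} (\<lambda>r. a * exp (a * (T - r)))"
    and "(LINT r:{s..t}|lborel. a * exp (a * (T - r))) = exp (a * (T - s)) - exp (a * (T - t))"
proof -
  show "set_integrable lborel {s..t} (\<lambda>r. a * exp (a * (T - r)))"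
    unfolding set_integrable_def by (rule borel_integrable_compact) (auto intro!: continuous_intros)
  have "(LBINT r. indicator {s..t} r *\<^sub>R (a * exp (a * (T - r)))) = - exp (a * (T - t)) - - exp (a * (T - s))"
  proof (rule integral_FTC_Icc[OF assms(1)])
    fix x
    show "((\<lambda>r. - exp (a * (T - r))) has_vector_derivative a * exp (a * (T - x))) (at x within {s..t})"
      unfolding has_real_derivative_iff_has_vector_derivative[symmetric]
      by (auto intro!: derivative_eq_intros)
  qed (auto intro!: continuous_intros)
  then show "(LINT r:{s..t}|lborel. a * exp (a * (T - r))) = exp (a * (T - s)) - exp (a * (T - t))"
    unfolding set_lebesgue_integral_def by linarith
qed

section \<open>Comparison by iterating the exponential step\<close>

context brownian_setup
begin

lemma pred_section_measurable:
  fixes \<phi> :: "real \<Rightarrow> 'a \<Rightarrow> real"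
  assumes "(\<lambda>(s, w). \<phi> s w) \<in> borel_measurable pred" "w \<in> space M" "A \<in> sets borel" "A \<subseteq> {0..T}"
  shows "(\<lambda>s. indicator A s *\<^sub>R \<phi> s w) \<in> borel_measurable lborel"
proof -
  have "(\<lambda>s. indicator A s *\<^sub>R (if s \<in> {0..T} then \<phi> s w else 0)) \<in> borel_measurable lborel"
    using section_measurable[OF assms(1), of 0 w] assms by (intro borel_measurable_scaleR) auto
  also have "(\<lambda>s. indicator A s *\<^sub>R (if s \<in> {0..T} then \<phi> s w else 0)) = (\<lambda>s. indicator A s *\<^sub>R \<phi> s w)"
  proof (rule ext)
    fix s show "indicator A s *\<^sub>R (if s \<in> {0..T} then \<phi> s w else 0) = indicator A s *\<^sub>R \<phi> s w"
      using subsetD[OF assms(4), of s] by (cases "s \<in> A") simp_all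
  qed
  finally show ?thesis .
qed

text \<open>Inserting \<open>D \<le> c * exp (a * (T - t))\<close> into the term with
  \<open>K\<close> and integrating yields at most half of the same expression. The remaining terms
  fit the hypothesis of \<open>exponential_step\<close>, which returns the bound with
  \<open>c / 2\<close>. The iteration starts from \<open>max M0 0\<close>.\<close>

lemma comparison:
  assumes I: "ito Z N" "predictable M T W Z" and fin: "AE w in M. sqint Z w < \<infinity>"
    and K: "0 \<le> K" and C: "0 \<le> C"
    and D: "\<And>t. t \<in> {0..T} \<Longrightarrow> D t \<in> borel_measurable (F t)"
    and bd: "AE w in M. \<forall>t\<in>{0..T}. D t w \<le> M0"
    and rc: "AE w in M. \<forall>t\<in>{0..<T}. ((\<lambda>s. D s w) \<longlongrightarrow> D t w) (at_right t)"
    and DT: "AE w in M. D T w \<le> 0"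
    and H: "AE w in M. \<exists>g. set_integrable lborel {0..T} g \<and>
      (AE r in lborel. r \<in> {0..T} \<longrightarrow> g r \<le> K * max 0 (D r w) + C * norm (Z r w)) \<and>
      (\<forall>s t. 0 \<le> s \<longrightarrow> s \<le> t \<longrightarrow> t \<le> T \<longrightarrow> D s w \<le> D t w + (LINT r:{s..t}|lborel. g r) - (N t w - N s w))"
  shows "AE w in M. \<forall>t\<in>{0..T}. D t w \<le> 0"
proof -
  \<comment> \<open>Ensures \<open>K \<le> a / 2\<close>, the source of the factor one half, and
    \<open>0 < a\<close> also when \<open>K = 0\<close>.\<close>
  define a where "a = 2 * K + 1"
  have a: "0 < a" "K \<le> a / 2" using K by (auto simp: a_def)
  define M1 where "M1 = max M0 0"
  have M1: "0 \<le> M1" by (simp add: M1_def)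
  have half: "AE w in M. \<forall>t\<in>{0..T}. D t w \<le> (c / 2) * exp (a * (T - t))"
    if hyp: "AE w in M. \<forall>t\<in>{0..T}. D t w \<le> c * exp (a * (T - t))" and c: "0 \<le> c" for c
  proof -
    have single: "AE w in M. D t w \<le> (c / 2) * exp (a * (T - t))" if t: "t \<in> {0..T}" for t
    \<comment> \<open>The constant \<open>C\<^sup>2 * T / 2\<close> collects the part of Young's
      inequality that does not grow with \<open>l\<close>.\<close>
    proof (rule exponential_step[OF I t D[OF t] M1 fin, of _ "C\<^sup>2 * T / 2"])
      show "AE w in M. \<forall>s\<in>{t..T}. \<forall>l>0. \<forall>q\<ge>0. qv Z t s w \<le> ennreal q \<longrightarrow>
         l * (D t w + (N s w - N t w)) \<le> l * (c / 2 * exp (a * (T - t)) + (if s = T then 0 else M1)) + l\<^sup>2 * q / 2 + C\<^sup>2 * T / 2"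
        using hyp bd DT H AE_space
      proof eventually_elim
        case (elim w)
        then obtain g where g: "set_integrable lborel {0..T} g"
          "AE r in lborel. r \<in> {0..T} \<longrightarrow> g r \<le> K * max 0 (D r w) + C * norm (Z r w)"
          "\<And>s t. 0 \<le> s \<Longrightarrow> s \<le> t \<Longrightarrow> t \<le> T \<Longrightarrow> D s w \<le> D t w + (LINT r:{s..t}|lborel. g r) - (N t w - N s w)"
          by blast
        show ?case
        proof (intro ballI allI impI)
          fix s l q :: real
          assume s: "s \<in> {t..T}" and l: "0 < l" and q: "0 \<le> q"
            and qle: "qv Z t s w \<le> ennreal q"
          have ts: "t \<le> s" "{t..s} \<subseteq> {0..T}" using s t by auto
          have Zm: "(\<lambda>r. (norm (Z r w))\<^sup>2 * indicator {t..s} r) \<in> borel_measurable lborel"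
          proof -
            have "(\<lambda>(s, w). (norm (Z s w))\<^sup>2) \<in> borel_measurable pred"
              using I(2) unfolding predictable_def split_beta' by measurable
            from pred_section_measurable[OF this, of w "{t..s}"] show ?thesis using elim ts by (simp add: mult.commute)
          qed
          have nn: "(\<integral>\<^sup>+ r. ennreal ((norm (Z r w))\<^sup>2 * indicator {t..s} r) \<partial>lborel) = qv Z t s w"
            unfolding qv_def by (intro nn_integral_cong) (auto simp: indicator_def)
          have Zi: "integrable lborel (\<lambda>r. (norm (Z r w))\<^sup>2 * indicator {t..s} r)"
          proof (rule integrableI_nonneg[OF Zm])
            show "(\<integral>\<^sup>+ r. ennreal ((norm (Z r w))\<^sup>2 * indicator {t..s} r) \<partial>lborel) < \<infinity>"
              unfolding nn using qle by (rule le_less_trans) simp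
          qed simp
          have Zint: "(LINT r|lborel. (norm (Z r w))\<^sup>2 * indicator {t..s} r) \<le> q"
            using qle q unfolding nn[symmetric] nn_integral_eq_integral[OF Zi, simplified]
            by (simp add: ennreal_le_iff)
          have Ei: "integrable lborel (\<lambda>r. indicator {t..s} r *\<^sub>R (a * exp (a * (T - r))))"
            using integral_exp_decreasing(1)[OF ts(1) a(1)] by (simp add: set_integrable_def)
          have gi: "integrable lborel (\<lambda>r. indicator {t..s} r *\<^sub>R g r)"
            using set_integrable_subset[OF g(1) _ ts(2)] by (simp add: set_integrable_def)
          have Ci: "integrable lborel (\<lambda>r. C\<^sup>2 / 2 * indicator {t..s} r)"
            by (intro integrable_mult_right integrable_real_indicator) (auto simp: emeasure_lborel_Icc_eq)
          have "(LINT r|lborel. l * (indicator {t..s} r *\<^sub>R g r))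
             \<le> (LINT r|lborel. (l * (c / 2)) * (indicator {t..s} r *\<^sub>R (a * exp (a * (T - r))))
                 + (l\<^sup>2 / 2) * ((norm (Z r w))\<^sup>2 * indicator {t..s} r) + C\<^sup>2 / 2 * indicator {t..s} r)"
          proof (rule integral_mono_AE)
            show "AE r in lborel. l * (indicator {t..s} r *\<^sub>R g r) \<le> (l * (c / 2)) * (indicator {t..s} r *\<^sub>R (a * exp (a * (T - r))))
                 + (l\<^sup>2 / 2) * ((norm (Z r w))\<^sup>2 * indicator {t..s} r) + C\<^sup>2 / 2 * indicator {t..s} r"
              using g(2)
            proof eventually_elim
              case (elim r)
              show ?case
              proof (cases "r \<in> {t..s}")
                case True
                then have r: "r \<in> {0..T}" using ts by auto
                have "K * max 0 (D r w) \<le> (a / 2) * (c * exp (a * (T - r)))"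
                proof (rule mult_mono)
                  show "max 0 (D r w) \<le> c * exp (a * (T - r))"
                    using \<open>\<forall>t\<in>{0..T}. D t w \<le> c * exp (a * (T - t))\<close> r c by auto
                qed (use a K in auto)
                then have "g r \<le> (a / 2) * (c * exp (a * (T - r))) + C * norm (Z r w)"
                  using elim r by auto
                then have "l * g r \<le> l * ((a / 2) * (c * exp (a * (T - r))) + C * norm (Z r w))"
                  using l by (intro mult_left_mono) auto
                moreover have "l * (C * norm (Z r w)) \<le> l\<^sup>2 / 2 * (norm (Z r w))\<^sup>2 + C\<^sup>2 / 2"
                  using zero_le_power2[of "l * norm (Z r w) - C"] by (simp add: power2_eq_square algebra_simps)
                ultimately show ?thesis using True by (simp add: algebra_simps)
              qed simp
            qed
          qed (intro Bochner_Integration.integrable_add integrable_mult_right Ei Zi Ci gi)+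
          also have "\<dots> = (l * (c / 2)) * (exp (a * (T - t)) - exp (a * (T - s)))
              + (l\<^sup>2 / 2) * (LINT r|lborel. (norm (Z r w))\<^sup>2 * indicator {t..s} r) + C\<^sup>2 / 2 * (s - t)"
          proof -
            have e: "(LINT r|lborel. indicator {t..s} r *\<^sub>R (a * exp (a * (T - r)))) = exp (a * (T - t)) - exp (a * (T - s))"
              using integral_exp_decreasing(2)[OF ts(1) a(1), of T] unfolding set_lebesgue_integral_def .
            have i: "(LINT r|lborel. indicator {t..s} r) = s - t" using ts(1) by simp
            note iA = integrable_mult_right[OF Ei, of "l * (c / 2)"] and iB = integrable_mult_right[OF Zi, of "l\<^sup>2 / 2"]
            show ?thesis
              unfolding Bochner_Integration.integral_add[OF Bochner_Integration.integrable_add[OF iA iB] Ci]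
                Bochner_Integration.integral_add[OF iA iB] integral_mult_right_zero e i ..
          qed
          also have "\<dots> \<le> (l * (c / 2)) * exp (a * (T - t)) + (l\<^sup>2 / 2) * q + C\<^sup>2 / 2 * T"
          proof (intro add_mono mult_left_mono Zint)
            show "s - t \<le> T" using s t by auto
          qed (use l c in auto)
          finally have 1: "l * (LINT r:{t..s}|lborel. g r) \<le> (l * (c / 2)) * exp (a * (T - t)) + (l\<^sup>2 / 2) * q + C\<^sup>2 / 2 * T"
            by (simp add: set_lebesgue_integral_def)
          have "D t w + (N s w - N t w) \<le> (if s = T then 0 else M1) + (LINT r:{t..s}|lborel. g r)"
          proof -
            have "D s w \<le> M0" using \<open>\<forall>t\<in>{0..T}. D t w \<le> M0\<close> s t by simp
            then have "D s w \<le> (if s = T then 0 else M1)" using \<open>D T w \<le> 0\<close> by (auto simp: M1_def)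
            then show ?thesis using g(3)[of t s] s t by simp
          qed
          then have "l * (D t w + (N s w - N t w)) \<le> l * ((if s = T then 0 else M1) + (LINT r:{t..s}|lborel. g r))"
            using l by (intro mult_left_mono) auto
          then show "l * (D t w + (N s w - N t w)) \<le> l * (c / 2 * exp (a * (T - t)) + (if s = T then 0 else M1)) + l\<^sup>2 * q / 2 + C\<^sup>2 * T / 2"
            using 1 by (simp add: algebra_simps)
        qed
      qed
    qed
    \<comment> \<open>The null set obtained for a single \<open>t\<close> depends on
      \<open>t\<close>; countably many grid times and right-continuity give all times at
      once.\<close>
    have "AE w in M. \<forall>n. \<forall>t\<in>dyadic_grid 0 T n. D t w \<le> (c / 2) * exp (a * (T - t))"
      using single subsetD[OF dyadic_grid_subset[OF less_imp_le[OF T_pos]]]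
      by (intro AE_all_countable[THEN iffD2] allI AE_finite_allI finite_dyadic_grid) blast
    then show ?thesis
      using rc
    proof eventually_elim
      case (elim w)
      show ?case
      proof
        fix t assume t: "t \<in> {0..T}"
        show "D t w \<le> c / 2 * exp (a * (T - t))"
        proof (rule right_continuous_le[OF _ _ _ t, of "\<lambda>t. D t w" "\<lambda>t. c / 2 * exp (a * (T - t))"])
          show "((\<lambda>t. c / 2 * exp (a * (T - t))) \<longlongrightarrow> c / 2 * exp (a * (T - t))) (at_right t)" for t
            by (intro tendsto_intros)
        qed (use elim in blast)+
      qed
    qed
  qed
  have "AE w in M. \<forall>t\<in>{0..T}. D t w \<le> (M1 / 2 ^ n) * exp (a * (T - t))" for n
  proof (induction n)
    case 0
    show ?case using bd
    proof eventually_elim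
      case (elim w)
      show ?case
      proof
        fix t assume t: "t \<in> {0..T}"
        have "D t w \<le> M1 * 1" using bspec[OF elim t] by (simp add: M1_def le_max_iff_disj)
        also have "\<dots> \<le> M1 * exp (a * (T - t))" using t a M1 by (intro mult_left_mono) auto
        finally show "D t w \<le> M1 / 2 ^ 0 * exp (a * (T - t))" by simp
      qed
    qed
  next
    case (Suc n)
    from half[OF Suc.IH] M1 show ?case by (simp add: mult.commute)
  qed
  then have "AE w in M. \<forall>n. \<forall>t\<in>{0..T}. D t w \<le> (M1 / 2 ^ n) * exp (a * (T - t))"
    by (simp add: AE_all_countable)
  then show ?thesis
  proof eventually_elim
    case (elim w)
    show ?case
    proof
      fix t assume t: "t \<in> {0..T}"
      have "(\<lambda>n. M1 * (1/2)^n * exp (a * (T - t))) \<longlonglongrightarrow> M1 * 0 * exp (a * (T - t))"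
        by (intro tendsto_intros LIMSEQ_power_zero) auto
      then have "(\<lambda>n. (M1 / 2 ^ n) * exp (a * (T - t))) \<longlonglongrightarrow> 0"
        by (simp add: power_one_over)
      from LIMSEQ_le_const[OF this] elim t show "D t w \<le> 0" by auto
    qed
  qed
qed

end

section \<open>Moments of Ito integrals with bounded quadratic variation\<close>

text \<open>Fatou's lemma gives the opposite inequality. Here the uniform second moment yields
  uniform integrability: in \<open>X \<le> min X a + X\<^sup>2 / a\<close> the truncated part passes
  to the limit by dominated convergence and the rest integrates to at most
  \<open>K / a\<close>.\<close>

lemma (in prob_space) nn_integral_limit_ge:
  assumes X: "\<And>n. X n \<in> borel_measurable M" and Y: "Y \<in> borel_measurable M"
    and lim: "AE w in M. (\<lambda>n. X n w) \<longlonglongrightarrow> (Y w :: real)"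
    and nn: "\<And>n w. 0 \<le> X n w"
    and sq: "\<And>n. (\<integral>\<^sup>+ w. ennreal ((X n w)\<^sup>2) \<partial>M) \<le> ennreal K" and K: "0 \<le> K"
    and p: "\<And>n. p \<le> (\<integral>\<^sup>+ w. ennreal (X n w) \<partial>M)"
  shows "p \<le> (\<integral>\<^sup>+ w. ennreal (Y w) \<partial>M)"
proof -
  have [measurable]: "X n \<in> borel_measurable M" "Y \<in> borel_measurable M" for n using X Y by auto
  have le: "p \<le> (\<integral>\<^sup>+ w. ennreal (Y w) \<partial>M) + ennreal (K / real (Suc a))" for a
  proof -
    let ?a = "real (Suc a)"
    have a: "0 < ?a" by simp
    have "p \<le> (\<integral>\<^sup>+ w. ennreal (min (X n w) ?a) \<partial>M) + ennreal (K / ?a)" for n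
    proof -
      have "p \<le> (\<integral>\<^sup>+ w. ennreal (min (X n w) ?a) + ennreal (1 / ?a) * ennreal ((X n w)\<^sup>2) \<partial>M)"
      proof (rule order_trans[OF p nn_integral_mono])
        fix w
        have "X n w \<le> min (X n w) ?a + 1 / ?a * (X n w)\<^sup>2"
        proof (cases "X n w \<le> ?a")
          case True then show ?thesis by simp
        next
          case False
          then have "X n w * ?a \<le> X n w * X n w" using nn by (intro mult_left_mono) auto
          then have "X n w \<le> 1 / ?a * (X n w)\<^sup>2" using a by (simp add: pos_le_divide_eq power2_eq_square del: of_nat_Suc)
          then show ?thesis using a False by (simp add: min_def del: of_nat_Suc)
        qed
        then have "ennreal (X n w) \<le> ennreal (min (X n w) ?a + 1 / ?a * (X n w)\<^sup>2)" by (rule ennreal_leI)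
        also have "\<dots> = ennreal (min (X n w) ?a) + ennreal (1 / ?a * (X n w)\<^sup>2)"
          using nn by (intro ennreal_plus) auto
        also have "ennreal (1 / ?a * (X n w)\<^sup>2) = ennreal (1 / ?a) * ennreal ((X n w)\<^sup>2)"
          by (intro ennreal_mult) auto
        finally show "ennreal (X n w) \<le> ennreal (min (X n w) ?a) + ennreal (1 / ?a) * ennreal ((X n w)\<^sup>2)" .
      qed
      also have "\<dots> = (\<integral>\<^sup>+ w. ennreal (min (X n w) ?a) \<partial>M) + ennreal (1 / ?a) * (\<integral>\<^sup>+ w. ennreal ((X n w)\<^sup>2) \<partial>M)"
        by (subst nn_integral_add) (auto simp: nn_integral_cmult simp del: of_nat_Suc)
      also have "\<dots> \<le> (\<integral>\<^sup>+ w. ennreal (min (X n w) ?a) \<partial>M) + ennreal (1 / ?a) * ennreal K"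
        by (intro add_left_mono mult_left_mono sq) auto
      also have "ennreal (1 / ?a) * ennreal K = ennreal (K / ?a)" using K by (simp add: ennreal_mult[symmetric] del: of_nat_Suc)
      finally show ?thesis .
    qed
    moreover have "(\<lambda>n. (\<integral>\<^sup>+ w. ennreal (min (X n w) ?a) \<partial>M) + ennreal (K / ?a)) \<longlonglongrightarrow> (\<integral>\<^sup>+ w. ennreal (min (Y w) ?a) \<partial>M) + ennreal (K / ?a)"
    proof (intro tendsto_add tendsto_const nn_integral_dominated_convergence[where w="\<lambda>_. ennreal ?a"])
      show "(\<integral>\<^sup>+ w. ennreal ?a \<partial>M) < \<infinity>" by (simp add: emeasure_space_1 del: of_nat_Suc)
      show "AE w in M. (\<lambda>n. ennreal (min (X n w) ?a)) \<longlonglongrightarrow> ennreal (min (Y w) ?a)"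
        using lim by eventually_elim (intro tendsto_ennrealI tendsto_min tendsto_const)
      show "AE w in M. ennreal (min (X n w) ?a) \<le> ennreal ?a" for n by (intro AE_I2 ennreal_leI) simp
    qed measurable
    ultimately have "p \<le> (\<integral>\<^sup>+ w. ennreal (min (Y w) ?a) \<partial>M) + ennreal (K / ?a)"
      by (intro LIMSEQ_le_const) auto
    also have "\<dots> \<le> (\<integral>\<^sup>+ w. ennreal (Y w) \<partial>M) + ennreal (K / ?a)"
      by (intro add_right_mono nn_integral_mono ennreal_leI) simp
    finally show ?thesis .
  qed
  have "(\<lambda>a. (\<integral>\<^sup>+ w. ennreal (Y w) \<partial>M) + ennreal (K / real (Suc a))) \<longlonglongrightarrow> (\<integral>\<^sup>+ w. ennreal (Y w) \<partial>M) + ennreal 0"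
  proof (intro tendsto_add tendsto_const tendsto_ennrealI)
    show "(\<lambda>a. K / real (Suc a)) \<longlonglongrightarrow> 0"
      using tendsto_mult[OF tendsto_const[of K] LIMSEQ_inverse_real_of_nat] by (simp add: divide_inverse)
  qed
  from LIMSEQ_le_const[OF this] le show ?thesis by simp
qed

text \<open>For \<open>y \<ge> 0\<close> the excess over 2 is
  \<open>exp (- y) * (exp y - 1)\<^sup>2\<close>, and \<open>exp y - 1 \<le> exp y * y\<close>. It
  extracts the second moment from the exponential identities for \<open>c\<close> and
  \<open>- c\<close>.\<close>

lemma exp_add_exp_minus_le: "exp x + exp (- x) \<le> 2 + x\<^sup>2 * exp \<bar>x :: real\<bar>"
proof -
  have pos: "exp y + exp (- y) \<le> 2 + y\<^sup>2 * exp y" if "0 \<le> y" for y :: real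
  proof -
    have "exp y - 1 = exp y * (1 - exp (- y))" by (simp add: algebra_simps exp_minus)
    also have "\<dots> \<le> exp y * y" using exp_ge_add_one_self[of "- y"] by (intro mult_left_mono) auto
    finally have "(exp y - 1)\<^sup>2 \<le> (exp y * y)\<^sup>2" using that by (intro power_mono) auto
    then have "exp (- y) * (exp y - 1)\<^sup>2 \<le> exp (- y) * (exp y * y)\<^sup>2" by (intro mult_left_mono) auto
    moreover have "exp (- y) * (exp y - 1)\<^sup>2 = exp y + exp (- y) - 2"
      by (simp add: power2_eq_square algebra_simps exp_add[symmetric])
    moreover have "exp (- y) * (exp y * y)\<^sup>2 = y\<^sup>2 * exp y"
    proof -
      have "exp (- y) * (exp y * y)\<^sup>2 = (exp (- y) * exp y) * (y\<^sup>2 * exp y)" by (simp add: power2_eq_square)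
      then show ?thesis by (simp add: exp_add[symmetric])
    qed
    ultimately show ?thesis by simp
  qed
  show ?thesis
  proof (cases "0 \<le> x")
    case True then show ?thesis using pos[of x] by simp
  next
    case False then show ?thesis using pos[of "- x"] by simp
  qed
qed

lemma exp_minus_le_quadratic: "0 \<le> q \<Longrightarrow> exp (- q) \<le> 1 - q + q\<^sup>2 / (2::real)"
proof -
  assume q: "0 \<le> q"
  have "(\<lambda>q. 1 - q + q\<^sup>2 / 2 - exp (- q)) 0 \<le> (\<lambda>q. 1 - q + q\<^sup>2 / 2 - exp (- q)) q"
  proof (rule DERIV_nonneg_imp_nondecreasing[OF q])
    fix x :: real
    have "((\<lambda>q. 1 - q + q\<^sup>2 / 2 - exp (- q)) has_real_derivative (- 1 + x + exp (- x))) (at x)"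
      by (auto intro!: derivative_eq_intros)
    moreover have "0 \<le> - 1 + x + exp (- x)" using exp_ge_add_one_self[of "- x"] by simp
    ultimately show "\<exists>y. ((\<lambda>q. 1 - q + q\<^sup>2 / 2 - exp (- q)) has_real_derivative y) (at x) \<and> 0 \<le> y" by blast
  qed
  then show ?thesis by simp
qed

context brownian_setup
begin

lemma qv_from_diff_le:
  assumes "predictable M T W X" "predictable M T W Y" "w \<in> space M" "0 < \<eta>" "0 \<le> t"
  shows "qv_from Y t w \<le> ennreal (1 + \<eta>) * qv_from X t w + ennreal (1 + 1 / \<eta>) * sqint (\<lambda>s w. X s w - Y s w) w"
  by (rule order_trans[OF qv_diff_le[OF assms order_refl] add_left_mono[OF mult_left_mono[OF qv_from_le[OF assms(5)]]]]) simp

text \<open>Truncation at \<open>2 * k + 1\<close> gives bounded energies without disturbing the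
  limit: once the approximation error is at most 1/2, the energy of the approximant is at most
  \<open>2 * k + 2 * (1/2)\<close>. Along a subsequence both the integral and the energy after
  \<open>t\<close> converge almost surely.\<close>

lemma bounded_approx:
  assumes I: "ito Z N" "predictable M T W Z" and t: "t \<in> {0..T}" and k: "0 \<le> k"
    and bd: "AE w in M. sqint Z w \<le> ennreal k"
  obtains m p g where "\<And>n. simple (m n) (p n) (g n)"
    "\<And>n w. sqv_inc (m n) (p n) (g n) t T w \<le> 2 * k + 1"
    "AE w in M. (\<lambda>n. sint_inc (m n) (p n) (g n) t T w) \<longlonglongrightarrow> N T w - N t w"
    "AE w in M. (\<lambda>n. sqv_inc (m n) (p n) (g n) t T w) \<longlonglongrightarrow> enn2real (qv_from Z t w)"
proof -
  obtain m p h where ap: "\<And>n. simple (m n) (p n) (h n)"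
    "tendsto_0_in_prob P (\<lambda>n. sqint (\<lambda>s w. sproc (m n) (p n) (h n) s w - Z s w))"
    "tendsto_0_in_prob P (\<lambda>n w. supdist (sint (m n) (p n) (h n)) N w)"
    using ito_approx[OF I(1)] by blast
  have tT: "t \<le> T" "0 \<le> t" using t by auto
  have k1: "0 \<le> 2 * k + 1" using k by simp
  obtain r where r: "AE w in P. (\<lambda>n. sqint (\<lambda>s w. sproc (m (r n)) (p (r n)) (h (r n)) s w - Z s w) w
      + supdist (sint (m (r n)) (p (r n)) (h (r n))) N w) \<longlonglongrightarrow> 0"
    using P.tip_subseq_AE[OF P.tip_add[OF ap(2,3)]] by blast
  define R where "R n g \<longleftrightarrow> simple (m (r n)) (p (r n)) g \<and>
    (\<forall>w. sqv_inc (m (r n)) (p (r n)) g t T w \<le> 2 * k + 1) \<and>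
    (\<forall>w i. sqv_inc (m (r n)) (p (r n)) (h (r n)) t T w \<le> 2 * k + 1 \<longrightarrow> i < m (r n) \<longrightarrow> g i w = h (r n) i w)" for n g
  have "\<exists>g. R n g" for n
  proof -
    obtain g where "simple (m (r n)) (p (r n)) g"
      "\<And>w. sqv_inc (m (r n)) (p (r n)) g t T w \<le> 2 * k + 1"
      "\<And>w i. sqv_inc (m (r n)) (p (r n)) (h (r n)) t T w \<le> 2 * k + 1 \<Longrightarrow> i < m (r n) \<Longrightarrow> g i w = h (r n) i w"
      by (rule simple_truncate[OF ap(1)[of "r n"] t k1]) (rule that)
    then show ?thesis unfolding R_def by (intro exI conjI allI impI)
  qed
  then obtain g where "\<And>n. R n (g n)" by metis
  then have g: "\<And>n. simple (m (r n)) (p (r n)) (g n)"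
    "\<And>n w. sqv_inc (m (r n)) (p (r n)) (g n) t T w \<le> 2 * k + 1"
    "\<And>n w i. sqv_inc (m (r n)) (p (r n)) (h (r n)) t T w \<le> 2 * k + 1 \<Longrightarrow> i < m (r n) \<Longrightarrow> g n i w = h (r n) i w"
    unfolding R_def by blast+
  define H where "H n = sproc (m (r n)) (p (r n)) (h (r n))" for n
  define J where "J n = sint (m (r n)) (p (r n)) (h (r n))" for n
  define Q where "Q n s = sqv (m (r n)) (p (r n)) (h (r n)) s" for n s
  have Hp: "predictable M T W (H n)" for n unfolding H_def by (rule simple_process_predictable[OF ap(1)])
  have HQ: "qv_from (H n) t w = ennreal (Q n T w - Q n t w)" for n w
    unfolding qv_def H_def Q_def by (rule nn_integral_simple[OF ap(1) tT(1)])
  have Q0: "0 \<le> Q n T w - Q n t w" for n w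
    unfolding Q_def using qv_mono[OF ap(1) tT(1), of "r n" w] by simp
  have main: "AE w in M. (\<forall>\<^sub>F n in sequentially. Q n T w - Q n t w \<le> 2 * k + 1) \<and>
    (\<lambda>n. J n T w - J n t w) \<longlonglongrightarrow> N T w - N t w \<and> (\<lambda>n. Q n T w - Q n t w) \<longlonglongrightarrow> enn2real (qv_from Z t w)"
    using r[unfolded AE_P] bd AE_space
  proof eventually_elim
    case (elim w)
    define D where "D n = sqint (\<lambda>s w. H n s w - Z s w) w" for n
    have sum0: "(\<lambda>n. D n + supdist (J n) N w) \<longlonglongrightarrow> 0" using elim(1) by (simp add: D_def H_def J_def)
    have D0: "D \<longlonglongrightarrow> 0" by (rule tendsto_sandwich[OF _ _ tendsto_const sum0]) (auto simp: add_increasing2)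
    have S0: "(\<lambda>n. supdist (J n) N w) \<longlonglongrightarrow> 0" by (rule tendsto_sandwich[OF _ _ tendsto_const sum0]) (auto simp: add_increasing)
    have Jl: "(\<lambda>n. J n u w) \<longlonglongrightarrow> N u w" if u: "u \<in> {0..T}" for u
    proof -
      have "(\<lambda>n. ennreal \<bar>J n u w - N u w\<bar>) \<longlonglongrightarrow> ennreal 0"
        using u by (intro tendsto_sandwich[OF _ _ tendsto_const S0[folded ennreal_0]]) (auto intro!: always_eventually SUP_upper)
      then have "(\<lambda>n. \<bar>J n u w - N u w\<bar>) \<longlonglongrightarrow> 0" by (subst (asm) tendsto_ennreal_iff) auto
      then show ?thesis by (simp add: tendsto_rabs_zero_iff LIM_zero_iff)
    qed
    have z: "qv_from Z t w \<le> ennreal k" using qv_from_le[OF tT(2)] elim(2) by (rule order_trans)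
    then obtain z where z: "qv_from Z t w = ennreal z" "0 \<le> z" "z \<le> k"
      using k by (cases "qv_from Z t w") (auto simp: ennreal_le_iff top_unique)
    have up: "Q n T w - Q n t w \<le> (1 + \<eta>) * z + (1 + 1 / \<eta>) * \<delta>" if "D n \<le> ennreal \<delta>" "0 < \<eta>" "0 \<le> \<delta>" for n \<eta> \<delta>
    proof -
      have "ennreal (Q n T w - Q n t w) \<le> ennreal (1 + \<eta>) * ennreal z + ennreal (1 + 1 / \<eta>) * D n"
        using qv_from_diff_le[OF I(2) Hp elim(3) that(2) tT(2), of n] unfolding HQ z(1) D_def
        by (simp only: sqint_minus_commute[of Z])
      also have "\<dots> \<le> ennreal (1 + \<eta>) * ennreal z + ennreal (1 + 1 / \<eta>) * ennreal \<delta>"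
        by (intro add_left_mono mult_left_mono that) auto
      also have "\<dots> = ennreal ((1 + \<eta>) * z + (1 + 1 / \<eta>) * \<delta>)" using that z by (intro ennreal_linear[symmetric]) auto
      finally show ?thesis using that z by (subst (asm) ennreal_le_iff) auto
    qed
    have lo: "z \<le> (1 + \<eta>) * (Q n T w - Q n t w) + (1 + 1 / \<eta>) * \<delta>" if "D n \<le> ennreal \<delta>" "0 < \<eta>" "0 \<le> \<delta>" for n \<eta> \<delta>
    proof -
      have "ennreal z \<le> ennreal (1 + \<eta>) * ennreal (Q n T w - Q n t w) + ennreal (1 + 1 / \<eta>) * D n"
        using qv_from_diff_le[OF Hp I(2) elim(3) that(2) tT(2), of n] unfolding HQ z(1) D_def .
      also have "\<dots> \<le> ennreal (1 + \<eta>) * ennreal (Q n T w - Q n t w) + ennreal (1 + 1 / \<eta>) * ennreal \<delta>"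
        by (intro add_left_mono mult_left_mono that) auto
      also have "\<dots> = ennreal ((1 + \<eta>) * (Q n T w - Q n t w) + (1 + 1 / \<eta>) * \<delta>)" using that Q0 by (intro ennreal_linear[symmetric]) auto
      finally show ?thesis using that Q0[of n w] by (subst (asm) ennreal_le_iff) auto
    qed
    have Dsmall: "\<forall>\<^sub>F n in sequentially. D n \<le> ennreal \<delta>" if "0 < \<delta>" for \<delta>
      using order_tendstoD(2)[OF D0, of "ennreal \<delta>"] that by (auto elim: eventually_mono)
    have "\<forall>\<^sub>F n in sequentially. D n \<le> ennreal (1/2)" by (rule Dsmall) simp
    then have ev: "\<forall>\<^sub>F n in sequentially. Q n T w - Q n t w \<le> 2 * k + 1"
    proof eventually_elim
      case (elim n)
      from up[OF elim, of 1] z show ?case by simp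
    qed
    have "(\<lambda>n. Q n T w - Q n t w) \<longlonglongrightarrow> z"
    proof (rule tendstoI)
      fix e :: real assume e: "0 < e"
      \<comment> \<open>The two error terms become \<open>e / 2\<close> and \<open>e / 4\<close>, as
        all energies involved are at most \<open>2 * (k + 1)\<close>.\<close>
      define \<eta> where "\<eta> = e / (4 * (k + 1))"
      have \<eta>: "0 < \<eta>" using e k by (simp add: \<eta>_def)
      define c where "c = 1 + 1 / \<eta>"
      have c: "0 < c" using \<eta> by (simp add: c_def add_pos_pos)
      define \<delta> where "\<delta> = e / (4 * c)"
      have "0 < \<delta>" "c * \<delta> = e / 4" using e c by (auto simp: \<delta>_def)
      then have \<delta>: "0 < \<delta>" "(1 + 1 / \<eta>) * \<delta> = e / 4" by (simp_all only: c_def)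
      show "\<forall>\<^sub>F n in sequentially. dist (Q n T w - Q n t w) z < e"
        using ev Dsmall[OF \<delta>(1)]
      proof eventually_elim
        case (elim n)
        define x where "x = Q n T w - Q n t w"
        have x: "x \<le> (1 + \<eta>) * z + e / 4" "z \<le> (1 + \<eta>) * x + e / 4" "x \<le> 2 * k + 1"
          using up[OF elim(2) \<eta>] lo[OF elim(2) \<eta>] \<delta> elim(1) by (auto simp: x_def)
        have "\<eta> * z \<le> \<eta> * (2 * (k + 1))" "\<eta> * x \<le> \<eta> * (2 * (k + 1))"
          using z k x(3) \<eta> by (auto intro!: mult_left_mono)
        moreover have "\<eta> * (2 * (k + 1)) = e / 2" using k by (simp add: \<eta>_def field_simps)
        ultimately have "x \<le> z + e / 2 + e / 4" "z \<le> x + e / 2 + e / 4" using x by (auto simp: algebra_simps)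
        then show ?case using e unfolding x_def[symmetric] by (simp add: dist_real_def abs_less_iff)
      qed
    qed
    then show ?case using ev Jl[of T] Jl[OF t] T_pos z by (auto intro!: tendsto_diff)
  qed
  have eqs: "sint (m (r n)) (p (r n)) (g n) u w = J n u w" "sqv (m (r n)) (p (r n)) (g n) u w = Q n u w"
    if "Q n T w - Q n t w \<le> 2 * k + 1" for n u w
    using g(3)[of n w] that unfolding J_def Q_def simple_integral_def sqv_def by (auto intro!: sum.cong)
  show thesis
  proof (rule that[of "\<lambda>n. m (r n)" "\<lambda>n. p (r n)" g, OF g(1) g(2)])
    show "AE w in M. (\<lambda>n. sint_inc (m (r n)) (p (r n)) (g n) t T w) \<longlonglongrightarrow> N T w - N t w"
      using main
    proof eventually_elim
      case (elim w)
      then have "\<forall>\<^sub>F n in sequentially. sint_inc (m (r n)) (p (r n)) (g n) t T w = J n T w - J n t w"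
        by (auto elim!: eventually_mono simp: eqs)
      with elim show ?case by (subst tendsto_cong) auto
    qed
    show "AE w in M. (\<lambda>n. sqv_inc (m (r n)) (p (r n)) (g n) t T w) \<longlonglongrightarrow> enn2real (qv_from Z t w)"
      using main
    proof eventually_elim
      case (elim w)
      then have "\<forall>\<^sub>F n in sequentially. sqv_inc (m (r n)) (p (r n)) (g n) t T w = Q n T w - Q n t w"
        by (auto elim!: eventually_mono simp: eqs)
      with elim show ?case by (subst tendsto_cong) auto
    qed
  qed
qed

text \<open>The identity for simple integrands passes to the limit: one inequality is Fatou's lemma,
  the other rests on the second moments bounded in \<open>sexp_square\<close>.\<close>

lemma exp_ito:
  assumes I: "ito Z N" "predictable M T W Z" and t: "t \<in> {0..T}" and k: "0 \<le> k"
    and bd: "AE w in M. sqint Z w \<le> ennreal k" and B: "B \<in> sets (F t)"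
  shows "(\<E> w. ennreal (indicator B w * exp (c * (N T w - N t w) - c\<^sup>2 * enn2real (qv_from Z t w) / 2))) = emeasure P B"
proof -
  obtain m p g where g: "\<And>n. simple (m n) (p n) (g n)"
    "\<And>n w. sqv_inc (m n) (p n) (g n) t T w \<le> 2 * k + 1"
    "AE w in M. (\<lambda>n. sint_inc (m n) (p n) (g n) t T w) \<longlonglongrightarrow> N T w - N t w"
    "AE w in M. (\<lambda>n. sqv_inc (m n) (p n) (g n) t T w) \<longlonglongrightarrow> enn2real (qv_from Z t w)"
    by (rule bounded_approx[OF I t k bd]) (rule that)
  have BP[measurable]: "B \<in> sets P" by (rule F_sub_P[OF B])
  define E where "E n = sexp (m n) (p n) (g n) t c" for n
  define Y where "Y w = indicator B w * exp (c * (N T w - N t w) - c\<^sup>2 * enn2real (qv_from Z t w) / 2)" for w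
  have E[measurable]: "E n \<in> borel_measurable P" for n unfolding E_def by (rule sexp_measurable[OF g(1) t])
  have Y[measurable]: "Y \<in> borel_measurable P"
  proof -
    have [measurable]: "N T \<in> borel_measurable P" "N t \<in> borel_measurable P" "qv_from Z t \<in> borel_measurable P"
      using t T_pos by (auto intro!: ito_P[OF I(1)] qv_from_measurable[OF I(2)])
    show ?thesis unfolding Y_def using BP by measurable
  qed
  have EB: "(\<E> w. ennreal (indicator B w * E n w)) = emeasure P B" for n
  proof -
    have "(\<E> w. indicator B w * ennreal (E n w)) = emeasure P B"
      unfolding E_def using exp_simple[OF g(1) t, of "indicator B" c n] B BP by simp
    moreover have "ennreal (indicator B w * E n w) = indicator B w * ennreal (E n w)" for w
      by (cases "w \<in> B") simp_all
    ultimately show ?thesis by simp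
  qed
  have lim: "AE w in P. (\<lambda>n. indicator B w * E n w) \<longlonglongrightarrow> Y w"
    unfolding AE_P using g(3,4)
  proof eventually_elim
    case (elim w)
    show ?case unfolding E_def Y_def by (intro tendsto_intros elim) simp
  qed
  have "(\<E> w. ennreal (Y w)) \<le> emeasure P B"
  proof -
    have "(\<E> w. ennreal (Y w)) = (\<E> w. liminf (\<lambda>n. ennreal (indicator B w * E n w)))"
    proof (rule nn_integral_cong_AE)
      show "AE w in P. ennreal (Y w) = liminf (\<lambda>n. ennreal (indicator B w * E n w))"
        using lim by eventually_elim (rule lim_imp_Liminf[symmetric], simp, rule tendsto_ennrealI)
    qed
    also have "\<dots> \<le> liminf (\<lambda>n. (\<E> w. ennreal (indicator B w * E n w)))"
      by (rule nn_integral_liminf) measurable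
    also have "\<dots> = emeasure P B" unfolding EB by (simp add: Liminf_const)
    finally show ?thesis .
  qed
  moreover have "emeasure P B \<le> (\<E> w. ennreal (Y w))"
  proof (rule P.nn_integral_limit_ge[OF _ Y lim])
    show "(\<lambda>w. indicator B w * E n w) \<in> borel_measurable P" for n using BP by measurable
    show "0 \<le> indicator B w * E n w" for n w by (simp add: E_def)
    show "emeasure P B \<le> (\<E> w. ennreal (indicator B w * E n w))" for n by (simp only: EB order_refl)
    show "0 \<le> exp (c\<^sup>2 * (2 * k + 1))" by simp
    fix n
    have "(\<E> w. ennreal ((indicator B w * E n w)\<^sup>2)) \<le> (\<E> w. ennreal ((E n w)\<^sup>2))"
      by (intro nn_integral_mono ennreal_leI) (simp add: indicator_def)
    also have "\<dots> \<le> ennreal (exp (c\<^sup>2 * (2 * k + 1)))"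
      unfolding E_def by (rule sexp_square[OF g(1) t g(2)])
    finally show "(\<E> w. ennreal ((indicator B w * E n w)\<^sup>2)) \<le> ennreal (exp (c\<^sup>2 * (2 * k + 1)))" .
  qed
  ultimately show ?thesis unfolding Y_def by (rule antisym)
qed

lemma indicator_integrable: "B \<in> sets (F t) \<Longrightarrow> integrable P f \<Longrightarrow> integrable P (\<lambda>w. indicator B w * f w :: real)"
  unfolding real_scaleR_def[symmetric] by (rule integrable_mult_indicator[OF F_sub_P])

text \<open>For bounded energy the moments of the increment after \<open>t\<close> are read off from
  \<open>exp_ito\<close> by expanding in powers of the parameter \<open>c\<close> near zero.\<close>

context
  fixes Z :: "real \<Rightarrow> 'a \<Rightarrow> real ^ 'd" and N :: "real \<Rightarrow> 'a \<Rightarrow> real" and k t :: real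
  assumes I: "ito Z N" "predictable M T W Z" and t: "t \<in> {0..T}" and k: "0 \<le> k"
    and bd: "AE w in M. sqint Z w \<le> ennreal k"
begin

private abbreviation "dN w \<equiv> N T w - N t w"
private abbreviation "q w \<equiv> enn2real (qv_from Z t w)"

private lemma q_bd: "AE w in P. q w \<le> k"
  unfolding AE_P using bd
proof eventually_elim
  case (elim w)
  have "qv_from Z t w \<le> ennreal k" using t by (intro order_trans[OF qv_from_le elim]) auto
  then show ?case using k by (intro enn2real_leI)
qed

private lemma meas [measurable]: "dN \<in> borel_measurable P" "q \<in> borel_measurable P"
proof -
  have [measurable]: "N T \<in> borel_measurable P" "N t \<in> borel_measurable P" "qv_from Z t \<in> borel_measurable P"
    using t T_pos by (auto intro!: ito_P[OF I(1)] qv_from_measurable[OF I(2)])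
  show "dN \<in> borel_measurable P" "q \<in> borel_measurable P" by measurable
qed

private lemma exp_integral:
  assumes B: "B \<in> sets (F t)"
  shows "integrable P (\<lambda>w. indicator B w * exp (c * dN w - c\<^sup>2 * q w / 2))"
    "(\<integral>w. indicator B w * exp (c * dN w - c\<^sup>2 * q w / 2) \<partial>P) = measure P B"
proof -
  have [measurable]: "B \<in> sets P" by (rule F_sub_P[OF B])
  have e: "(\<E> w. ennreal (indicator B w * exp (c * dN w - c\<^sup>2 * q w / 2))) = ennreal (measure P B)"
    using exp_ito[OF I t k bd B, of c] by (simp add: P.emeasure_eq_measure)
  show 1: "integrable P (\<lambda>w. indicator B w * exp (c * dN w - c\<^sup>2 * q w / 2))"
    by (rule integrableI_nonneg) (auto simp: e)
  show "(\<integral>w. indicator B w * exp (c * dN w - c\<^sup>2 * q w / 2) \<partial>P) = measure P B"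
    using e by (subst integral_eq_nn_integral) auto
qed

text \<open>Bound \<open>exp (2 * \<bar>x\<bar>)\<close> by
  \<open>exp (2 * x) + exp (- 2 * x)\<close> and use the identity with \<open>c = 2\<close> and
  \<open>c = -2\<close>; the compensator costs at most the factor
  \<open>exp (2 * k)\<close>.\<close>

private lemma exp_integrable: "integrable P (\<lambda>w. exp (2 * \<bar>dN w\<bar>))"
proof (rule Bochner_Integration.integrable_bound)
  have top: "space M \<in> sets (F t)" using sets.top[of "F t"] by simp
  let ?w = "\<lambda>w. exp (2 * k) * (indicator (space M) w * exp (2 * dN w - 2\<^sup>2 * q w / 2)
      + indicator (space M) w * exp ((-2) * dN w - (-2)\<^sup>2 * q w / 2))"
  show "integrable P ?w"
    by (intro integrable_mult_right Bochner_Integration.integrable_add exp_integral(1) top)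
  show "AE w in P. norm (exp (2 * \<bar>dN w\<bar>)) \<le> norm (?w w)"
    using q_bd AE_space
  proof eventually_elim
    case (elim w)
    have "exp (2 * \<bar>dN w\<bar>) \<le> exp (2 * dN w) + exp ((-2) * dN w)"
      by (cases "0 \<le> dN w") auto
    also have "\<dots> \<le> exp (2 * k) * exp (2 * dN w - 2\<^sup>2 * q w / 2) + exp (2 * k) * exp ((-2) * dN w - (-2)\<^sup>2 * q w / 2)"
      unfolding exp_add[symmetric] using elim(1) by (intro add_mono) auto
    also have "\<dots> = ?w w" using elim(2) by (simp add: distrib_left)
    finally show ?case by simp
  qed
qed measurable

lemma ito_increment_integrable:
  shows "integrable P dN" "integrable P (\<lambda>w. (dN w)\<^sup>2)" "integrable P (\<lambda>w. (dN w)\<^sup>2 * exp \<bar>dN w\<bar>)"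
proof -
  have bound: "\<bar>x\<bar> \<le> 2 * exp (2 * \<bar>x\<bar>)" "x\<^sup>2 \<le> 2 * exp (2 * \<bar>x\<bar>)" "x\<^sup>2 * exp \<bar>x\<bar> \<le> 2 * exp (2 * \<bar>x\<bar>)" for x :: real
  proof -
    have e: "x\<^sup>2 \<le> 2 * exp \<bar>x\<bar>" "\<bar>x\<bar> \<le> exp \<bar>x\<bar>"
      using exp_lower_Taylor_quadratic[of "\<bar>x\<bar>"] by (auto simp: field_simps) (smt (verit) abs_ge_zero zero_le_power2)
    have m: "exp \<bar>x\<bar> \<le> exp (2 * \<bar>x\<bar>)" by simp
    show "\<bar>x\<bar> \<le> 2 * exp (2 * \<bar>x\<bar>)" "x\<^sup>2 \<le> 2 * exp (2 * \<bar>x\<bar>)" using e m exp_gt_zero[of "2 * \<bar>x\<bar>"] by linarith+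
    have "x\<^sup>2 * exp \<bar>x\<bar> \<le> (2 * exp \<bar>x\<bar>) * exp \<bar>x\<bar>" by (intro mult_right_mono e) simp
    also have "\<dots> = 2 * exp (2 * \<bar>x\<bar>)" by (simp add: exp_add[symmetric])
    finally show "x\<^sup>2 * exp \<bar>x\<bar> \<le> 2 * exp (2 * \<bar>x\<bar>)" .
  qed
  have i: "integrable P (\<lambda>w. 2 * exp (2 * \<bar>dN w\<bar>))" by (intro integrable_mult_right exp_integrable)
  show "integrable P dN" "integrable P (\<lambda>w. (dN w)\<^sup>2)" "integrable P (\<lambda>w. (dN w)\<^sup>2 * exp \<bar>dN w\<bar>)"
    by (rule Bochner_Integration.integrable_bound[OF i]; use bound in \<open>auto intro!: AE_I2 simp: abs_mult\<close>)+
qed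

private lemma q_integrable: "integrable P q"
  by (rule P.integrable_const_bound[of _ k]) (use q_bd in \<open>auto elim!: eventually_mono\<close>)

text \<open>Insert \<open>1 + x \<le> exp x\<close> into the identity, cancel the measure of
  \<open>B\<close>, divide by \<open>c\<close> and let \<open>c\<close> tend to zero; the energy
  term is then of order \<open>c\<close>.\<close>

lemma ito_increment_mean:
  assumes B: "B \<in> sets (F t)"
  shows "(\<integral>w. indicator B w * dN w \<partial>P) \<le> 0"
proof -
  have [measurable]: "B \<in> sets P" by (rule F_sub_P[OF B])
  have sB: "B \<inter> space M = B" using sets.sets_into_space[OF B] by auto
  have iN: "integrable P (\<lambda>w. indicator B w * dN w)" and iq: "integrable P (\<lambda>w. indicator B w * q w)"
    and i1: "integrable P (\<lambda>w. indicator B w * 1 :: real)"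
    by (intro indicator_integrable[OF B] ito_increment_integrable q_integrable P.integrable_const)+
  have "(\<integral>w. indicator B w * dN w \<partial>P) \<le> c * k / 2" if c: "0 < c" for c
  proof -
    have "(\<integral>w. c * (indicator B w * dN w) - c\<^sup>2 / 2 * (indicator B w * q w) + indicator B w * 1 \<partial>P)
      \<le> (\<integral>w. indicator B w * exp (c * dN w - c\<^sup>2 * q w / 2) \<partial>P)"
    proof (rule integral_mono)
      show "c * (indicator B w * dN w) - c\<^sup>2 / 2 * (indicator B w * q w) + indicator B w * 1 \<le> indicator B w * exp (c * dN w - c\<^sup>2 * q w / 2)" for w
      proof -
        have "c * dN w - c\<^sup>2 * q w / 2 + 1 \<le> exp (c * dN w - c\<^sup>2 * q w / 2)"
          by (subst add.commute) (rule exp_ge_add_one_self)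
        then show ?thesis by (cases "w \<in> B") auto
      qed
    qed (intro Bochner_Integration.integrable_add Bochner_Integration.integrable_diff integrable_mult_right iN iq i1 exp_integral(1) B)+
    also have "\<dots> = measure P B" by (rule exp_integral(2)[OF B])
    also have "(\<integral>w. c * (indicator B w * dN w) - c\<^sup>2 / 2 * (indicator B w * q w) + indicator B w * 1 \<partial>P)
      = c * (\<integral>w. indicator B w * dN w \<partial>P) - c\<^sup>2 / 2 * (\<integral>w. indicator B w * q w \<partial>P) + measure P B"
      using iN iq i1 by (simp add: sB)
    finally have "c * (\<integral>w. indicator B w * dN w \<partial>P) \<le> c\<^sup>2 / 2 * (\<integral>w. indicator B w * q w \<partial>P)" by simp
    also have "(\<integral>w. indicator B w * q w \<partial>P) \<le> (\<integral>w. k \<partial>P)"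
    proof (rule integral_mono_AE[OF iq P.integrable_const])
      show "AE w in P. indicator B w * q w \<le> k"
        using q_bd by eventually_elim (use k in \<open>auto simp: indicator_def\<close>)
    qed
    also have "(\<integral>w. k \<partial>P) = k" using P.prob_space by simp
    finally have "c * (\<integral>w. indicator B w * dN w \<partial>P) \<le> c * (c * k / 2)"
      using c by (simp add: power2_eq_square mult_left_mono)
    then show ?thesis using c by simp
  qed
  note le = this
  show ?thesis
  proof (rule field_le_epsilon)
    fix e :: real assume e: "0 < e"
    have "(\<integral>w. indicator B w * dN w \<partial>P) \<le> (e / (k + 1)) * k / 2" using e k by (intro le) auto
    also have "\<dots> \<le> e" using e k by (simp add: field_simps)
    finally show "(\<integral>w. indicator B w * dN w \<partial>P) \<le> 0 + e" by simp
  qed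
qed

text \<open>One half of the conditional Ito isometry. Adding the identities for \<open>c\<close> and
  \<open>- c\<close> removes the first-order term; expanding to second order, dividing by
  \<open>c\<^sup>2\<close> and letting \<open>c\<close> tend to zero leaves the energy on one side
  and the second moment on the other.\<close>

private lemma isometry_integral:
  assumes B: "B \<in> sets (F t)"
  shows "(\<integral>w. indicator B w * q w \<partial>P) \<le> (\<integral>w. indicator B w * (dN w)\<^sup>2 \<partial>P)"
proof -
  have [measurable]: "B \<in> sets P" by (rule F_sub_P[OF B])
  have sB: "B \<inter> space M = B" using sets.sets_into_space[OF B] by auto
  have iq: "integrable P (\<lambda>w. indicator B w * q w)"
    and i1: "integrable P (\<lambda>w. indicator B w * 1 :: real)"
    and i3: "integrable P (\<lambda>w. indicator B w * ((dN w)\<^sup>2 * exp \<bar>dN w\<bar>))"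
    by (intro indicator_integrable[OF B] ito_increment_integrable q_integrable P.integrable_const)+
  have le: "(\<integral>w. indicator B w * q w \<partial>P) \<le> c\<^sup>2 * k\<^sup>2 / 4 + (\<integral>w. indicator B w * ((dN w)\<^sup>2 * exp (c * \<bar>dN w\<bar>)) \<partial>P)"
    if c: "0 < c" "c \<le> 1" for c
  proof -
    have i2: "integrable P (\<lambda>w. indicator B w * ((dN w)\<^sup>2 * exp (c * \<bar>dN w\<bar>)))"
    proof (rule Bochner_Integration.integrable_bound[OF i3])
      show "AE w in P. norm (indicator B w * ((dN w)\<^sup>2 * exp (c * \<bar>dN w\<bar>))) \<le> norm (indicator B w * ((dN w)\<^sup>2 * exp \<bar>dN w\<bar>))"
        using c by (intro AE_I2) (auto simp: indicator_def abs_mult intro!: mult_left_mono mult_left_le_one_le)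
    qed measurable
    have "2 * measure P B = (\<integral>w. indicator B w * exp (c * dN w - c\<^sup>2 * q w / 2) \<partial>P) + (\<integral>w. indicator B w * exp ((- c) * dN w - (- c)\<^sup>2 * q w / 2) \<partial>P)"
      unfolding exp_integral(2)[OF B] by simp
    also have "\<dots> = (\<integral>w. indicator B w * exp (c * dN w - c\<^sup>2 * q w / 2) + indicator B w * exp ((- c) * dN w - (- c)\<^sup>2 * q w / 2) \<partial>P)"
      by (intro Bochner_Integration.integral_add[symmetric] exp_integral(1) B)
    also have "\<dots> \<le> (\<integral>w. 2 * (indicator B w * 1) - c\<^sup>2 * (indicator B w * q w) + c^4 * k\<^sup>2 / 4 + c\<^sup>2 * (indicator B w * ((dN w)\<^sup>2 * exp (c * \<bar>dN w\<bar>))) \<partial>P)"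
    proof (rule integral_mono_AE)
      show "AE w in P. indicator B w * exp (c * dN w - c\<^sup>2 * q w / 2) + indicator B w * exp ((- c) * dN w - (- c)\<^sup>2 * q w / 2)
        \<le> 2 * (indicator B w * 1) - c\<^sup>2 * (indicator B w * q w) + c^4 * k\<^sup>2 / 4 + c\<^sup>2 * (indicator B w * ((dN w)\<^sup>2 * exp (c * \<bar>dN w\<bar>)))"
        using q_bd
      proof eventually_elim
        case (elim w)
        show ?case
        proof (cases "w \<in> B")
          case True
          define s where "s = c\<^sup>2 * q w / 2"
          define x where "x = c * dN w"
          have s: "0 \<le> s" by (simp add: s_def)
          have "exp (x - s) + exp (- x - s) = exp (- s) * (exp x + exp (- x))"
            by (simp add: distrib_left exp_add[symmetric])
          also have "\<dots> \<le> exp (- s) * (2 + x\<^sup>2 * exp \<bar>x\<bar>)" by (intro mult_left_mono exp_add_exp_minus_le) simp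
          also have "\<dots> = 2 * exp (- s) + exp (- s) * (x\<^sup>2 * exp \<bar>x\<bar>)" by (simp add: distrib_left)
          also have "\<dots> \<le> 2 * (1 - s + s\<^sup>2 / 2) + 1 * (x\<^sup>2 * exp \<bar>x\<bar>)"
            using s by (intro add_mono mult_left_mono mult_right_mono exp_minus_le_quadratic) auto
          also have "\<dots> = 2 - c\<^sup>2 * q w + s\<^sup>2 + c\<^sup>2 * ((dN w)\<^sup>2 * exp (c * \<bar>dN w\<bar>))"
          proof -
            have s2: "2 * (1 - s + s\<^sup>2 / 2) = 2 - c\<^sup>2 * q w + s\<^sup>2" by (simp add: s_def)
            have xx: "x\<^sup>2 = c\<^sup>2 * (dN w)\<^sup>2" by (simp add: x_def power_mult_distrib)
            have ax: "\<bar>x\<bar> = c * \<bar>dN w\<bar>" using c by (simp add: x_def abs_mult)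
            show ?thesis unfolding xx ax s2 by (simp only: mult.assoc mult_1)
          qed
          also have "s\<^sup>2 \<le> c^4 * k\<^sup>2 / 4"
          proof -
            have "(q w)\<^sup>2 \<le> k\<^sup>2" using elim by (intro power_mono) auto
            then have "c^4 * (q w)\<^sup>2 \<le> c^4 * k\<^sup>2" by (intro mult_left_mono) auto
            then show ?thesis by (simp add: s_def power_divide power_mult_distrib power_mult[symmetric])
          qed
          finally show ?thesis using True by (simp add: x_def s_def)
        qed (use k in simp)
      qed
    qed (intro Bochner_Integration.integrable_add Bochner_Integration.integrable_diff integrable_mult_right i1 iq i2 exp_integral(1) B P.integrable_const)+
    also have "\<dots> = 2 * measure P B - c\<^sup>2 * (\<integral>w. indicator B w * q w \<partial>P) + c^4 * k\<^sup>2 / 4 + c\<^sup>2 * (\<integral>w. indicator B w * ((dN w)\<^sup>2 * exp (c * \<bar>dN w\<bar>)) \<partial>P)"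
      using iq i1 i2 P.prob_space by (simp add: sB)
    finally have "c\<^sup>2 * (\<integral>w. indicator B w * q w \<partial>P) \<le> c\<^sup>2 * (c\<^sup>2 * k\<^sup>2 / 4 + (\<integral>w. indicator B w * ((dN w)\<^sup>2 * exp (c * \<bar>dN w\<bar>)) \<partial>P))"
      by (simp add: distrib_left power_add[symmetric] mult.assoc[symmetric])
    then show ?thesis using c by simp
  qed
  have l: "(\<lambda>n. 1 / real (Suc n)) \<longlonglongrightarrow> 0" using LIMSEQ_inverse_real_of_nat by (simp add: divide_inverse)
  have "(\<lambda>n. \<integral>w. indicator B w * ((dN w)\<^sup>2 * exp (1 / real (Suc n) * \<bar>dN w\<bar>)) \<partial>P) \<longlonglongrightarrow> (\<integral>w. indicator B w * ((dN w)\<^sup>2 * exp (0 * \<bar>dN w\<bar>)) \<partial>P)"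
  proof (rule integral_dominated_convergence[OF _ _ i3])
    show "AE w in P. (\<lambda>n. indicator B w * ((dN w)\<^sup>2 * exp (1 / real (Suc n) * \<bar>dN w\<bar>))) \<longlonglongrightarrow> indicator B w * ((dN w)\<^sup>2 * exp (0 * \<bar>dN w\<bar>))"
      by (intro AE_I2 tendsto_intros l)
    show "AE w in P. norm (indicator B w * ((dN w)\<^sup>2 * exp (1 / real (Suc n) * \<bar>dN w\<bar>))) \<le> indicator B w * ((dN w)\<^sup>2 * exp \<bar>dN w\<bar>)" for n
    proof (rule AE_I2)
      fix w
      have "1 / real (Suc n) * \<bar>dN w\<bar> \<le> 1 * \<bar>dN w\<bar>" by (rule mult_right_mono) auto
      then have "(dN w)\<^sup>2 * exp (1 / real (Suc n) * \<bar>dN w\<bar>) \<le> (dN w)\<^sup>2 * exp \<bar>dN w\<bar>" by (intro mult_left_mono) auto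
      then show "norm (indicator B w * ((dN w)\<^sup>2 * exp (1 / real (Suc n) * \<bar>dN w\<bar>))) \<le> indicator B w * ((dN w)\<^sup>2 * exp \<bar>dN w\<bar>)"
        by (cases "w \<in> B") (simp_all add: abs_mult del: of_nat_Suc)
    qed
  qed measurable
  then have "(\<lambda>n. (1 / real (Suc n))\<^sup>2 * k\<^sup>2 / 4 + (\<integral>w. indicator B w * ((dN w)\<^sup>2 * exp (1 / real (Suc n) * \<bar>dN w\<bar>)) \<partial>P))
     \<longlonglongrightarrow> 0\<^sup>2 * k\<^sup>2 / 4 + (\<integral>w. indicator B w * ((dN w)\<^sup>2 * exp (0 * \<bar>dN w\<bar>)) \<partial>P)"
    by (intro tendsto_add tendsto_divide tendsto_mult tendsto_power l tendsto_const) simp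
  from LIMSEQ_le_const[OF this] le[of "1 / real (Suc _)"]
  have "(\<integral>w. indicator B w * q w \<partial>P) \<le> 0\<^sup>2 * k\<^sup>2 / 4 + (\<integral>w. indicator B w * ((dN w)\<^sup>2 * exp (0 * \<bar>dN w\<bar>)) \<partial>P)"
    by (auto simp del: of_nat_Suc)
  then show ?thesis by simp
qed

lemma ito_increment_isometry:
  assumes B: "B \<in> sets (F t)"
  shows "(\<E> w. indicator B w * qv_from Z t w) \<le> (\<E> w. ennreal (indicator B w * (dN w)\<^sup>2))"
proof -
  have "(\<E> w. indicator B w * qv_from Z t w) = (\<E> w. ennreal (indicator B w * q w))"
  proof (rule nn_integral_cong_AE)
    show "AE w in P. indicator B w * qv_from Z t w = ennreal (indicator B w * q w)"
      unfolding AE_P using bd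
    proof eventually_elim
      case (elim w)
      have "qv_from Z t w \<le> ennreal k" using t by (intro order_trans[OF qv_from_le elim]) auto
      then have "qv_from Z t w < \<top>" by (rule le_less_trans) simp
      then show ?case by (cases "w \<in> B") simp_all
    qed
  qed
  also have "\<dots> = ennreal (\<integral>w. indicator B w * q w \<partial>P)"
    by (rule nn_integral_eq_integral[OF indicator_integrable[OF B q_integrable]]) simp
  also have "\<dots> \<le> ennreal (\<integral>w. indicator B w * (dN w)\<^sup>2 \<partial>P)"
    by (rule ennreal_leI[OF isometry_integral[OF B]])
  also have "\<dots> = (\<E> w. ennreal (indicator B w * (dN w)\<^sup>2))"
    by (rule nn_integral_eq_integral[OF indicator_integrable[OF B ito_increment_integrable(2)], symmetric]) simp
  finally show ?thesis .
qed

end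

end

text \<open>The square is a double integral over the plane; the half-planes \<open>u \<le> v\<close>
  and \<open>v \<le> u\<close> contribute the same amount, and counting the diagonal twice only
  enlarges the right-hand side.\<close>

lemma square_nn_integral_le:
  fixes b :: "real \<Rightarrow> ennreal"
  assumes [measurable]: "b \<in> borel_measurable lborel"
  shows "(\<integral>\<^sup>+ u. b u \<partial>lborel)\<^sup>2 \<le> 2 * (\<integral>\<^sup>+ u. b u * (\<integral>\<^sup>+ v. b v * indicator {u..} v \<partial>lborel) \<partial>lborel)"
proof -
  have i: "indicator {u..} v = (if u \<le> v then 1 else (0::ennreal))" for u v :: real by auto
  have "(\<integral>\<^sup>+ u. b u \<partial>lborel)\<^sup>2 = (\<integral>\<^sup>+ u. \<integral>\<^sup>+ v. b u * b v \<partial>lborel \<partial>lborel)"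
    by (simp add: power2_eq_square nn_integral_cmult nn_integral_multc)
  also have "\<dots> \<le> (\<integral>\<^sup>+ u. (\<integral>\<^sup>+ v. b u * (b v * indicator {u..} v) + b v * (b u * indicator {v..} u) \<partial>lborel) \<partial>lborel)"
    by (intro nn_integral_mono) (auto simp: indicator_def mult.commute)
  also have "\<dots> = (\<integral>\<^sup>+ u. (\<integral>\<^sup>+ v. b u * (b v * indicator {u..} v) \<partial>lborel) + (\<integral>\<^sup>+ v. b v * (b u * indicator {v..} u) \<partial>lborel) \<partial>lborel)"
    unfolding i by (intro nn_integral_cong nn_integral_add) measurable
  also have "\<dots> = (\<integral>\<^sup>+ u. \<integral>\<^sup>+ v. b u * (b v * indicator {u..} v) \<partial>lborel \<partial>lborel) + (\<integral>\<^sup>+ u. \<integral>\<^sup>+ v. b v * (b u * indicator {v..} u) \<partial>lborel \<partial>lborel)"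
    unfolding i by (intro nn_integral_add) measurable
  also have "(\<integral>\<^sup>+ u. \<integral>\<^sup>+ v. b v * (b u * indicator {v..} u) \<partial>lborel \<partial>lborel) = (\<integral>\<^sup>+ v. \<integral>\<^sup>+ u. b v * (b u * indicator {v..} u) \<partial>lborel \<partial>lborel)"
    unfolding i by (rule lborel_pair.Fubini') measurable
  also have "(\<integral>\<^sup>+ v. \<integral>\<^sup>+ u. b v * (b u * indicator {v..} u) \<partial>lborel \<partial>lborel) = (\<integral>\<^sup>+ u. b u * (\<integral>\<^sup>+ v. b v * indicator {u..} v \<partial>lborel) \<partial>lborel)"
    by (intro nn_integral_cong nn_integral_cmult) measurable
  finally show ?thesis by (simp add: mult_2)
qed

text \<open>Tested on the event where the conditional expectation exceeds \<open>c\<close>.\<close>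

lemma (in finite_measure_subalgebra) nn_cond_exp_le:
  assumes g: "g \<in> borel_measurable M" and c: "0 \<le> c"
    and le: "\<And>B. B \<in> sets F \<Longrightarrow> (\<integral>\<^sup>+ x. indicator B x * g x \<partial>M) \<le> ennreal c * emeasure M B"
  shows "AE x in M. nn_cond_exp M F g x \<le> ennreal c"
proof -
  define e where "e = nn_cond_exp M F g"
  have em: "e \<in> borel_measurable F" unfolding e_def by simp
  then have eM: "e \<in> borel_measurable M" by (rule measurable_from_subalg[OF subalg])
  define B where "B = {x\<in>space F. ennreal c < e x}"
  have B: "B \<in> sets F" unfolding B_def using em by measurable
  have BM: "B \<in> sets M" using B subalg by (auto simp: subalgebra_def)
  have "(\<integral>\<^sup>+ x. indicator B x * e x \<partial>M) = (\<integral>\<^sup>+ x. indicator B x * g x \<partial>M)"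
    unfolding e_def by (rule nn_cond_exp_intg[OF borel_measurable_indicator[OF B] g])
  also have "\<dots> \<le> ennreal c * emeasure M B" by (rule le[OF B])
  finally have le': "(\<integral>\<^sup>+ x. indicator B x * e x \<partial>M) \<le> ennreal c * emeasure M B" .
  have cB: "(\<integral>\<^sup>+ x. indicator B x * ennreal c \<partial>M) = ennreal c * emeasure M B"
    by (subst mult.commute) (rule nn_integral_cmult_indicator[OF BM])
  have fin: "ennreal c * emeasure M B < \<infinity>"
    unfolding emeasure_eq_measure ennreal_mult[OF c measure_nonneg, symmetric] by simp
  note m = borel_measurable_times_ennreal[OF borel_measurable_indicator[OF BM]]
  have "(\<integral>\<^sup>+ x. indicator B x * e x - indicator B x * ennreal c \<partial>M) = (\<integral>\<^sup>+ x. indicator B x * e x \<partial>M) - (\<integral>\<^sup>+ x. indicator B x * ennreal c \<partial>M)"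
  proof (rule nn_integral_diff[OF m[OF eM] m[OF borel_measurable_const]])
    show "(\<integral>\<^sup>+ x. indicator B x * ennreal c \<partial>M) \<noteq> \<infinity>" using fin unfolding cB by simp
    show "AE x in M. indicator B x * ennreal c \<le> indicator B x * e x" by (intro AE_I2) (simp add: indicator_def B_def less_imp_le)
  qed
  also have "\<dots> = 0" using le' fin unfolding cB by (simp add: diff_eq_0_iff_ennreal)
  finally have "AE x in M. indicator B x * e x - indicator B x * ennreal c = 0"
    by (subst (asm) nn_integral_0_iff_AE) (intro borel_measurable_minus_ennreal m eM borel_measurable_const)
  then show ?thesis
    using AE_space
  proof eventually_elim
    case (elim x)
    show ?case
    proof (rule ccontr)
      assume "\<not> nn_cond_exp M F g x \<le> ennreal c"
      then have "x \<in> B" "ennreal c < e x" using elim(2) subalg by (auto simp: B_def subalgebra_def e_def)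
      with elim(1) show False by (auto simp: diff_eq_0_iff_ennreal)
    qed
  qed
qed

section \<open>Conditional energy estimate\<close>

context brownian_setup
begin

abbreviation "energy_bound Z t B C \<equiv> (\<E> w. indicator B w * qv_from Z t w) \<le> ennreal C * emeasure P B"

text \<open>An energy inequality for potentials. The tail integral \<beta> of \<open>b\<close>
  differs from an Ito increment by at most \<open>L\<close>, and such increments have non-positive
  conditional mean, so \<beta> has conditional mean at most \<open>L\<close>. By
  \<open>square_nn_integral_le\<close> its conditional second moment is at most
  \<open>2 * L\<^sup>2\<close>, hence that of the Ito increment at most
  \<open>2 * (2 * L\<^sup>2) + 2 * L\<^sup>2\<close>, and the isometry turns this into a bound on
  the energy. The result depends on \<open>L\<close> alone, which makes it uniform over
  solutions.\<close>

lemma energy: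
  assumes I: "ito Z N" "predictable M T W Z" and k: "0 \<le> k" and bd: "AE w in M. sqint Z w \<le> ennreal k"
    and b: "(\<lambda>(s, w). b s w :: ennreal) \<in> borel_measurable pred" and L: "0 \<le> L"
    and H: "\<And>u. u \<in> {0..T} \<Longrightarrow> AE w in M. \<exists>r\<ge>0. (\<integral>\<^sup>+ s \<in> {u..T}. b s w \<partial>lborel) = ennreal r \<and> \<bar>r - (N T w - N u w)\<bar> \<le> L"
    and t: "t \<in> {0..T}" and B: "B \<in> sets (F t)"
  shows "energy_bound Z t B (6 * L\<^sup>2)"
proof -
  interpret pair_sigma_finite "lborel :: real measure" P
    by (rule pair_sigma_finite.intro) unfold_locales
  define \<beta> where "\<beta> u w = (\<integral>\<^sup>+ s \<in> {u..T}. b s w \<partial>lborel)" for u w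
  have \<beta>P[measurable]: "\<beta> u \<in> borel_measurable P" if "0 \<le> u" for u
    unfolding \<beta>_def by (rule measurable_F_P[OF nn_integral_adapted[OF b]]) (use that in auto)
  have mono_a: "(\<E> w. indicator A w * \<beta> u w) \<le> ennreal L * emeasure P A"
    if u: "u \<in> {0..T}" and A: "A \<in> sets (F u)" for u A
  proof -
    have [measurable]: "A \<in> sets P" by (rule F_sub_P[OF A])
    have [measurable]: "N T \<in> borel_measurable P" "N u \<in> borel_measurable P"
      using u T_pos by (auto intro!: ito_P[OF I(1)])
    have i1: "integrable P (\<lambda>w. indicator A w * (N T w - N u w))" and i2: "integrable P (\<lambda>w. indicator A w * L)"
      by (intro indicator_integrable[OF A] ito_increment_integrable(1)[OF I u k bd] P.integrable_const)+
    have ae: "AE w in P. indicator A w * \<beta> u w = ennreal (indicator A w * enn2real (\<beta> u w)) \<and>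
      indicator A w * enn2real (\<beta> u w) \<le> indicator A w * (N T w - N u w) + indicator A w * L"
      unfolding AE_P using H[OF u]
    proof eventually_elim
      case (elim w)
      then obtain r where "0 \<le> r" "\<beta> u w = ennreal r" "\<bar>r - (N T w - N u w)\<bar> \<le> L" by (auto simp: \<beta>_def)
      then show ?case by (cases "w \<in> A") auto
    qed
    have "(\<E> w. indicator A w * \<beta> u w) = (\<E> w. ennreal (indicator A w * enn2real (\<beta> u w)))"
      by (rule nn_integral_cong_AE, use ae in eventually_elim) blast
    also have "\<dots> \<le> (\<E> w. ennreal (indicator A w * (N T w - N u w) + indicator A w * L))"
      by (rule nn_integral_mono_AE, use ae in eventually_elim) (blast intro: ennreal_leI)
    also have "\<dots> = ennreal (\<integral>w. indicator A w * (N T w - N u w) + indicator A w * L \<partial>P)"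
    proof (rule nn_integral_eq_integral[OF Bochner_Integration.integrable_add[OF i1 i2]])
      show "AE w in P. 0 \<le> indicator A w * (N T w - N u w) + indicator A w * L"
        using ae
      proof eventually_elim
        case (elim w)
        have "0 \<le> indicator A w * enn2real (\<beta> u w)" by simp
        also note elim[THEN conjunct2]
        finally show ?case .
      qed
    qed
    also have "(\<integral>w. indicator A w * (N T w - N u w) + indicator A w * L \<partial>P) = (\<integral>w. indicator A w * (N T w - N u w) \<partial>P) + measure P A * L"
      using i1 i2 sets.sets_into_space[OF A] by (simp add: Int_absorb2)
    also have "\<dots> \<le> L * measure P A" using ito_increment_mean[OF I u k bd A] by simp
    finally show ?thesis using L by (simp add: P.emeasure_eq_measure ennreal_mult ennreal_leI)
  qed
  \<comment> \<open>From events to general weights known at time \<open>u\<close>; it is applied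
    with the weight \<open>indicator B w * b u w\<close>.\<close>
  have mono_b: "(\<E> w. X w * \<beta> u w) \<le> ennreal L * (\<E> w. X w)"
    if u: "u \<in> {0..T}" and X: "X \<in> borel_measurable (F u)" for u X
  proof -
    interpret S: finite_measure_subalgebra P "F u" by unfold_locales (rule sub_F)
    have \<beta>u: "\<beta> u \<in> borel_measurable P" using u by (intro \<beta>P) simp
    have "(\<E> w. X w * \<beta> u w) = (\<E> w. X w * nn_cond_exp P (F u) (\<beta> u) w)"
      by (rule S.nn_cond_exp_intg[OF X \<beta>u, symmetric])
    also have "\<dots> \<le> (\<E> w. X w * ennreal L)"
    proof (rule nn_integral_mono_AE)
      have "AE w in P. nn_cond_exp P (F u) (\<beta> u) w \<le> ennreal L" by (rule S.nn_cond_exp_le[OF \<beta>u L mono_a[OF u]])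
      then show "AE w in P. X w * nn_cond_exp P (F u) (\<beta> u) w \<le> X w * ennreal L" by eventually_elim (rule mult_left_mono, simp_all)
    qed
    also have "\<dots> = ennreal L * (\<E> w. X w)" by (subst mult.commute) (rule nn_integral_cmult[OF measurable_F_P[OF X]])
    finally show ?thesis .
  qed
  have tT: "0 \<le> t" "t \<le> T" using t by auto
  have BP[measurable]: "B \<in> sets P" by (rule F_sub_P[OF B])
  \<comment> \<open>The density \<open>b\<close> cut off to \<open>{t..T}\<close>, so that it is
    jointly measurable for all real times and its integral over the whole line is \<beta> at
    \<open>t\<close>.\<close>
  define bt where "bt s w = (if s \<in> {0..T} then b s w else 0) * indicator {t..T} s" for s w
  have btm: "(\<lambda>(s, w). bt s w) \<in> borel_measurable (lborel \<Otimes>\<^sub>M P)"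
  proof -
    have "(\<lambda>x. (case x of (s, w) \<Rightarrow> if s \<in> {0..T} then b s w else 0) * indicator {t..T} (fst x)) \<in> borel_measurable (lborel \<Otimes>\<^sub>M P)"
      using joint_measurable[OF b, of 0] by (intro borel_measurable_times_ennreal) auto
    then show ?thesis by (simp add: bt_def split_beta' cong: if_cong)
  qed
  have bts: "(\<lambda>s. bt s w) \<in> borel_measurable lborel" if "w \<in> space M" for w
    using measurable_Pair_compose_split[OF btm measurable_ident_sets[OF refl], of "\<lambda>_. w"] that by simp
  have bt_tail: "(\<integral>\<^sup>+ v. bt v w * indicator {u..} v \<partial>lborel) = \<beta> u w" if "u \<in> {t..T}" for u w
    unfolding bt_def \<beta>_def using that tT by (intro nn_integral_cong) (auto simp: indicator_def)
  have bt_all: "(\<integral>\<^sup>+ v. bt v w \<partial>lborel) = \<beta> t w" for w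
    unfolding bt_def \<beta>_def using tT by (intro nn_integral_cong) (auto simp: indicator_def)
  \<comment> \<open>Agrees with \<beta> on \<open>{t..T}\<close> by \<open>bt_tail\<close>; in this
    form it is jointly measurable in time and \<open>w\<close>, as Fubini's theorem
    requires.\<close>
  define \<gamma> where "\<gamma> u w = (\<integral>\<^sup>+ v. bt v w * indicator {u..} v \<partial>lborel)" for u w
  have \<gamma>m: "(\<lambda>(u, w). \<gamma> u w) \<in> borel_measurable (lborel \<Otimes>\<^sub>M P)"
  proof -
    let ?N = "((lborel :: real measure) \<Otimes>\<^sub>M P) \<Otimes>\<^sub>M (lborel :: real measure)"
    have i: "indicator {u..} v = (if u \<le> v then 1 else (0::ennreal))" for u v :: real by auto
    have 1: "(\<lambda>x. (\<lambda>(s, w). bt s w) (snd x, snd (fst x))) \<in> borel_measurable ?N"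
      by (rule measurable_compose[OF _ btm]) measurable
    have 2: "(\<lambda>x. if fst (fst x) \<le> snd x then 1 else (0::ennreal)) \<in> borel_measurable ?N"
    proof (rule measurable_If)
      have f: "(\<lambda>x. fst (fst x)) \<in> borel_measurable ?N"
        using measurable_compose[OF measurable_fst measurable_fst, of "lborel :: real measure" P "lborel :: real measure"] by simp
      have g: "snd \<in> borel_measurable ?N"
        using measurable_snd[of "lborel \<Otimes>\<^sub>M P" "lborel :: real measure"] by simp
      show "{x \<in> space ?N. fst (fst x) \<le> snd x} \<in> sets ?N"
        by (rule borel_measurable_le[OF f g])
    qed auto
    have "(\<lambda>x. bt (snd x) (snd (fst x)) * (if fst (fst x) \<le> snd x then 1 else 0)) \<in> borel_measurable ?N"
      using borel_measurable_times_ennreal[OF 1 2] by simp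
    then have "(\<lambda>(y, v). bt v (snd y) * indicator {fst y..} v) \<in> borel_measurable ?N"
      unfolding i by (simp add: split_beta')
    from lborel.borel_measurable_nn_integral[OF this]
    show ?thesis by (simp add: \<gamma>_def split_beta')
  qed
  have sq: "(\<E> w. indicator B w * (\<beta> t w)\<^sup>2) \<le> ennreal (2 * L\<^sup>2) * emeasure P B"
  proof -
    have "(\<E> w. indicator B w * (\<beta> t w)\<^sup>2) \<le> (\<E> w. indicator B w * (2 * (\<integral>\<^sup>+ u. bt u w * \<gamma> u w \<partial>lborel)))"
      using square_nn_integral_le[OF bts] unfolding bt_all \<gamma>_def
      by (intro nn_integral_mono mult_left_mono) auto
    also have "\<dots> = (\<E> w. \<integral>\<^sup>+ u. 2 * (indicator B w * bt u w * \<gamma> u w) \<partial>lborel)"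
    proof (rule nn_integral_cong)
      fix w assume "w \<in> space P"
      then have w: "w \<in> space M" by simp
      have [measurable]: "(\<lambda>u. bt u w) \<in> borel_measurable lborel" by (rule bts[OF w])
      have [measurable]: "(\<lambda>u. \<gamma> u w) \<in> borel_measurable lborel"
        using measurable_Pair_compose_split[OF \<gamma>m measurable_ident_sets[OF refl], of "\<lambda>_. w"] w by simp
      show "indicator B w * (2 * (\<integral>\<^sup>+ u. bt u w * \<gamma> u w \<partial>lborel)) = (\<integral>\<^sup>+ u. 2 * (indicator B w * bt u w * \<gamma> u w) \<partial>lborel)"
        by (simp add: mult.assoc nn_integral_cmult mult.left_commute)
    qed
    also have "\<dots> = (\<integral>\<^sup>+ u. (\<E> w. 2 * (indicator B w * bt u w * \<gamma> u w)) \<partial>lborel)"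
    proof (rule Fubini')
      have "(\<lambda>x. 2 * (indicator B (snd x) * (\<lambda>(s, w). bt s w) x * (\<lambda>(s, w). \<gamma> s w) x)) \<in> borel_measurable (lborel \<Otimes>\<^sub>M P)"
        using btm \<gamma>m by (intro borel_measurable_times_ennreal) auto
      then show "(\<lambda>(u, w). 2 * (indicator B w * bt u w * \<gamma> u w)) \<in> borel_measurable (lborel \<Otimes>\<^sub>M P)"
        by (simp add: split_beta')
    qed
    also have "\<dots> \<le> (\<integral>\<^sup>+ u. (\<E> w. 2 * ennreal L * (indicator B w * bt u w)) \<partial>lborel)"
    proof (rule nn_integral_mono)
      fix u :: real
      show "(\<E> w. 2 * (indicator B w * bt u w * \<gamma> u w)) \<le> (\<E> w. 2 * ennreal L * (indicator B w * bt u w))"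
      proof (cases "u \<in> {t..T}")
        case False then show ?thesis by (simp add: bt_def)
      next
        case True
        then have u: "u \<in> {0..T}" using tT by auto
        have bu: "bt u w = b u w" for w using True u by (simp add: bt_def)
        have X: "(\<lambda>w. indicator B w * b u w) \<in> borel_measurable (F u)"
        proof (rule borel_measurable_times_ennreal)
          show "b u \<in> borel_measurable (F u)" by (rule adapted[OF b u])
          have "B \<in> sets (F u)" using F_mono[of t u] B True by auto
          then show "indicator B \<in> borel_measurable (F u)" by simp
        qed
        have [measurable]: "(\<lambda>w. indicator B w * b u w) \<in> borel_measurable P" "\<beta> u \<in> borel_measurable P"
          using measurable_F_P[OF X] \<beta>P u by auto
        have "(\<E> w. 2 * (indicator B w * bt u w * \<gamma> u w)) = 2 * (\<E> w. (indicator B w * b u w) * \<beta> u w)"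
          unfolding bu \<gamma>_def bt_tail[OF True] by (rule nn_integral_cmult) measurable
        also have "\<dots> \<le> 2 * (ennreal L * (\<E> w. indicator B w * b u w))"
          by (intro mult_left_mono mono_b[OF u X]) auto
        also have "\<dots> = (\<E> w. 2 * ennreal L * (indicator B w * bt u w))"
          unfolding bu by (subst nn_integral_cmult) (auto simp: mult.assoc)
        finally show ?thesis .
      qed
    qed
    also have "\<dots> = (\<E> w. \<integral>\<^sup>+ u. 2 * ennreal L * (indicator B w * bt u w) \<partial>lborel)"
    proof (rule Fubini'[symmetric])
      have "(\<lambda>x. 2 * ennreal L * (indicator B (snd x) * (\<lambda>(s, w). bt s w) x)) \<in> borel_measurable (lborel \<Otimes>\<^sub>M P)"
        using btm by (intro borel_measurable_times_ennreal) auto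
      then show "(\<lambda>(u, w). 2 * ennreal L * (indicator B w * bt u w)) \<in> borel_measurable (lborel \<Otimes>\<^sub>M P)"
        by (simp add: split_beta')
    qed
    also have "\<dots> = (\<E> w. 2 * ennreal L * (indicator B w * \<beta> t w))"
    proof (rule nn_integral_cong)
      fix w assume "w \<in> space P"
      then have [measurable]: "(\<lambda>u. bt u w) \<in> borel_measurable lborel" using bts by simp
      show "(\<integral>\<^sup>+ u. 2 * ennreal L * (indicator B w * bt u w) \<partial>lborel) = 2 * ennreal L * (indicator B w * \<beta> t w)"
        unfolding bt_all[symmetric] by (simp add: nn_integral_cmult)
    qed
    also have "\<dots> = 2 * ennreal L * (\<E> w. indicator B w * \<beta> t w)"
      by (rule nn_integral_cmult) (intro borel_measurable_times_ennreal \<beta>P[OF tT(1)] borel_measurable_indicator BP)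
    also have "\<dots> \<le> 2 * ennreal L * (ennreal L * emeasure P B)"
      by (intro mult_left_mono mono_a t B) auto
    also have "\<dots> = ennreal (2 * L\<^sup>2) * emeasure P B"
      using L by (simp add: power2_eq_square ennreal_mult mult.assoc)
    finally show ?thesis .
  qed
  have "(\<E> w. indicator B w * qv_from Z t w) \<le> (\<E> w. ennreal (indicator B w * (N T w - N t w)\<^sup>2))"
    by (rule ito_increment_isometry[OF I t k bd B])
  also have "\<dots> \<le> (\<E> w. 2 * (indicator B w * (\<beta> t w)\<^sup>2) + ennreal (2 * L\<^sup>2) * indicator B w)"
  proof (rule nn_integral_mono_AE)
    show "AE w in P. ennreal (indicator B w * (N T w - N t w)\<^sup>2) \<le> 2 * (indicator B w * (\<beta> t w)\<^sup>2) + ennreal (2 * L\<^sup>2) * indicator B w"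
      unfolding AE_P using H[OF t]
    proof eventually_elim
      case (elim w)
      then obtain r where r: "0 \<le> r" "\<beta> t w = ennreal r" "\<bar>r - (N T w - N t w)\<bar> \<le> L" by (auto simp: \<beta>_def)
      have "\<bar>(N T w - N t w) - r\<bar> \<le> \<bar>L\<bar>" using r(3) L by linarith
      then have "((N T w - N t w) - r)\<^sup>2 \<le> L\<^sup>2" by (rule abs_le_square_iff[THEN iffD1])
      moreover have "(N T w - N t w)\<^sup>2 \<le> 2 * r\<^sup>2 + 2 * ((N T w - N t w) - r)\<^sup>2"
        using norm_add_sq_le[of r "(N T w - N t w) - r"] by simp
      ultimately have "(N T w - N t w)\<^sup>2 \<le> 2 * r\<^sup>2 + 2 * L\<^sup>2" by linarith
      then have "ennreal ((N T w - N t w)\<^sup>2) \<le> ennreal (2 * r\<^sup>2 + 2 * L\<^sup>2)" by (rule ennreal_leI)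
      also have "\<dots> = 2 * (ennreal r)\<^sup>2 + ennreal (2 * L\<^sup>2)"
        using r by (simp add: ennreal_mult power2_eq_square)
      finally show ?case unfolding r(2) by (cases "w \<in> B") auto
    qed
  qed
  also have "\<dots> = 2 * (\<E> w. indicator B w * (\<beta> t w)\<^sup>2) + ennreal (2 * L\<^sup>2) * emeasure P B"
    using \<beta>P[OF tT(1)] by (subst nn_integral_add) (auto simp: nn_integral_cmult)
  also have "\<dots> \<le> 2 * (ennreal (2 * L\<^sup>2) * emeasure P B) + ennreal (2 * L\<^sup>2) * emeasure P B"
    by (intro add_mono mult_left_mono sq) auto
  also have "\<dots> = ennreal (6 * L\<^sup>2) * emeasure P B"
    by (simp add: P.emeasure_eq_measure ennreal_mult[symmetric] ennreal_plus[symmetric] del: ennreal_plus)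
       (simp add: ennreal_numeral[symmetric] ennreal_mult[symmetric] ennreal_plus[symmetric] del: ennreal_numeral ennreal_plus)
  finally show ?thesis .
qed

end

section \<open>Backward equations\<close>

lemma tail_integral_continuous:
  fixes \<phi> :: "real \<Rightarrow> real"
  assumes "set_integrable lborel {0..T} \<phi>"
  shows "continuous_on {0..T} (\<lambda>t. LINT s:{t..T}|lborel. \<phi> s)"
proof -
  have "continuous_on {0..T} (\<lambda>t. integral {t..T} \<phi>)"
    using set_borel_integral_eq_integral(1)[OF assms] by (rule indefinite_integral_continuous_1')
  also have "?this \<longleftrightarrow> continuous_on {0..T} (\<lambda>t. LINT s:{t..T}|lborel. \<phi> s)"
  proof (rule continuous_on_cong[OF refl])
    fix t assume "t \<in> {0..T}"
    then have "set_integrable lborel {t..T} \<phi>" by (intro set_integrable_subset[OF assms]) auto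
    from set_borel_integral_eq_integral(2)[OF this]
    show "integral {t..T} \<phi> = (LINT s:{t..T}|lborel. \<phi> s)" by simp
  qed
  finally show ?thesis .
qed

lemma tail_integral_split:
  fixes \<phi> :: "real \<Rightarrow> real"
  assumes \<phi>: "set_integrable lborel {0..T} \<phi>" and st: "0 \<le> s" "s \<le> t" "t \<le> T"
  shows "(LINT r:{s..T}|lborel. \<phi> r) = (LINT r:{s..t}|lborel. \<phi> r) + (LINT r:{t..T}|lborel. \<phi> r)"
proof -
  have i: "set_integrable lborel {s..T} \<phi>" "set_integrable lborel {s..t} \<phi>" "set_integrable lborel {t..T} \<phi>"
    using st by (auto intro!: set_integrable_subset[OF \<phi>])
  have "integral {s..t} \<phi> + integral {t..T} \<phi> = integral {s..T} \<phi>"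
    by (rule Henstock_Kurzweil_Integration.integral_combine[OF st(2,3) set_borel_integral_eq_integral(1)[OF i(1)]])
  then show ?thesis using i by (simp add: set_borel_integral_eq_integral(2))
qed

lemma set_integrable_AE_cong:
  fixes \<phi> \<psi> :: "real \<Rightarrow> real"
  assumes "set_integrable lborel A \<phi>" "(\<lambda>r. indicator A r *\<^sub>R \<psi> r) \<in> borel_measurable lborel" "AE r in lborel. r \<in> A \<longrightarrow> \<phi> r = \<psi> r"
  shows "set_integrable lborel A \<psi>"
  unfolding set_integrable_def
proof (rule integrable_cong_AE_imp[OF assms(1)[unfolded set_integrable_def] assms(2)])
  show "AE r in lborel. indicator A r *\<^sub>R \<phi> r = indicator A r *\<^sub>R \<psi> r"
    using assms(3) by eventually_elim (auto simp: indicator_def)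
qed

text \<open>Let \<open>m\<close> be the maximum of
  \<open>\<bar>y s\<bar> * exp (- a * (T - s))\<close>. Where it is attained, the weighted integral
  term is at most \<open>m / 2\<close> because \<open>2 * K \<le> a\<close>, so
  \<open>m \<le> c + m / 2\<close>.\<close>

lemma backward_gronwall:
  fixes y :: "real \<Rightarrow> real"
  assumes y: "continuous_on {t..T} y" and tT: "t \<le> T" and c: "0 \<le> c" and K: "0 \<le> K"
    and le: "\<And>s. s \<in> {t..T} \<Longrightarrow> \<bar>y s\<bar> \<le> c + K * (LINT r:{s..T}|lborel. \<bar>y r\<bar>)"
  shows "\<bar>y t\<bar> \<le> 2 * c * exp ((2 * K + 1) * (T - t))"
proof -
  define a where "a = 2 * K + 1"
  have a: "0 < a" "2 * K \<le> a" using K by (auto simp: a_def)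
  have cont: "continuous_on {t..T} (\<lambda>s. \<bar>y s\<bar> * exp (- a * (T - s)))"
    by (intro continuous_intros y)
  obtain s where s: "s \<in> {t..T}" "\<And>r. r \<in> {t..T} \<Longrightarrow> \<bar>y r\<bar> * exp (- a * (T - r)) \<le> \<bar>y s\<bar> * exp (- a * (T - s))"
    using continuous_attains_sup[OF compact_Icc _ cont] tT by auto
  define m where "m = \<bar>y s\<bar> * exp (- a * (T - s))"
  have m0: "0 \<le> m" by (simp add: m_def)
  have ym: "\<bar>y r\<bar> \<le> m * exp (a * (T - r))" if "r \<in> {t..T}" for r
  proof -
    have "\<bar>y r\<bar> = (\<bar>y r\<bar> * exp (- a * (T - r))) * exp (a * (T - r))" by (simp add: exp_add[symmetric] mult.assoc)
    also have "\<dots> \<le> m * exp (a * (T - r))" unfolding m_def by (intro mult_right_mono s(2) that) simp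
    finally show ?thesis .
  qed
  have yi: "set_integrable lborel {s..T} (\<lambda>r. \<bar>y r\<bar>)"
    unfolding set_integrable_def using s
    by (intro borel_integrable_compact) (auto intro!: continuous_intros continuous_on_subset[OF y])
  have sT: "s \<le> T" using s by simp
  have "K * (LINT r:{s..T}|lborel. \<bar>y r\<bar>) \<le> m / 2 * exp (a * (T - s))"
  proof -
    have "(LINT r:{s..T}|lborel. K * \<bar>y r\<bar>) \<le> (LINT r:{s..T}|lborel. (m / 2) * (a * exp (a * (T - r))))"
    proof (rule set_integral_mono)
      show "set_integrable lborel {s..T} (\<lambda>r. K * \<bar>y r\<bar>)" using yi by (rule set_integrable_mult_right)
      show "set_integrable lborel {s..T} (\<lambda>r. (m / 2) * (a * exp (a * (T - r))))"
        by (intro set_integrable_mult_right integral_exp_decreasing a sT)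
      fix r assume "r \<in> {s..T}"
      then have r: "r \<in> {t..T}" using s by auto
      have "K * \<bar>y r\<bar> \<le> (a / 2) * (m * exp (a * (T - r)))"
        using ym[OF r] a K by (intro mult_mono) auto
      then show "K * \<bar>y r\<bar> \<le> (m / 2) * (a * exp (a * (T - r)))" by (simp add: algebra_simps)
    qed
    also have "\<dots> = m / 2 * (exp (a * (T - s)) - exp (a * (T - T)))"
      using integral_exp_decreasing(2)[OF sT a(1), of T] by simp
    also have "\<dots> \<le> m / 2 * exp (a * (T - s))" using m0 by (intro mult_left_mono) auto
    finally show ?thesis by simp
  qed
  with le[OF s(1)] have "\<bar>y s\<bar> \<le> c + m / 2 * exp (a * (T - s))" by linarith
  then have "\<bar>y s\<bar> * exp (- a * (T - s)) \<le> (c + m / 2 * exp (a * (T - s))) * exp (- a * (T - s))"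
    by (intro mult_right_mono) auto
  also have "\<dots> = c * exp (- a * (T - s)) + m / 2" by (simp add: distrib_right exp_add[symmetric] mult.assoc)
  also have "c * exp (- a * (T - s)) \<le> c * 1" using a s c by (intro mult_left_mono) auto
  finally have "m \<le> 2 * c" by (simp add: m_def)
  then have "m * exp (a * (T - t)) \<le> 2 * c * exp (a * (T - t))" by (intro mult_right_mono) auto
  moreover have "\<bar>y t\<bar> \<le> m * exp (a * (T - t))" using tT by (intro ym) auto
  ultimately show ?thesis unfolding a_def by linarith
qed

section \<open>Null sets in time and continuous versions\<close>

context brownian_setup
begin

lemma if_True_eq: "(if b then c else True) \<longleftrightarrow> (b \<longrightarrow> c)"
  by simp

text \<open>Fubini's theorem exchanges the quantifiers over times and paths. This allows
  modifications to be substituted under time integrals.\<close>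

lemma AE_time:
  assumes Q: "{x \<in> space pred. Q (fst x) (snd x)} \<in> sets pred"
    and ae: "\<And>s. s \<in> {0..T} \<Longrightarrow> AE w in M. Q s w"
  shows "AE w in M. AE s in lborel. s \<in> {0..T} \<longrightarrow> Q s w"
proof -
  interpret pair_sigma_finite "lborel :: real measure" P
    by (rule pair_sigma_finite.intro) unfold_locales
  have "(\<lambda>x. Q (fst x) (snd x)) \<in> measurable pred (count_space UNIV)"
    using Q unfolding pred_def .
  then have Q': "(\<lambda>(s, w). Q s w) \<in> measurable pred (count_space UNIV)"
    unfolding split_beta' .
  have "(\<lambda>(s, w). if s \<in> {0..T} then Q s w else True) \<in> measurable ((lborel :: real measure) \<Otimes>\<^sub>M P) (count_space UNIV)"
    by (rule joint_measurable[OF Q']) simp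
  then have "{x \<in> space ((lborel :: real measure) \<Otimes>\<^sub>M P). case x of (s, w) \<Rightarrow> if s \<in> {0..T} then Q s w else True} \<in> sets ((lborel :: real measure) \<Otimes>\<^sub>M P)"
    unfolding pred_def .
  then have "{x \<in> space ((lborel :: real measure) \<Otimes>\<^sub>M P). fst x \<in> {0..T} \<longrightarrow> Q (fst x) (snd x)} \<in> sets ((lborel :: real measure) \<Otimes>\<^sub>M P)"
    unfolding if_True_eq split_beta' .
  from AE_commute[OF this]
  have "(AE s in lborel. AE w in P. s \<in> {0..T} \<longrightarrow> Q s w) \<longleftrightarrow> (AE w in P. AE s in lborel. s \<in> {0..T} \<longrightarrow> Q s w)" .
  moreover have "AE s in lborel. AE w in P. s \<in> {0..T} \<longrightarrow> Q s w"
  proof (rule AE_I2)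
    fix s :: real
    show "AE w in P. s \<in> {0..T} \<longrightarrow> Q s w"
      using ae[of s] unfolding AE_P by (cases "s \<in> {0..T}") simp_all
  qed
  ultimately show ?thesis unfolding AE_P by blast
qed

lemma AE_time_eq:
  fixes X Y :: "real \<Rightarrow> 'a \<Rightarrow> real"
  assumes "predictable M T W X" "predictable M T W Y" "\<And>s. s \<in> {0..T} \<Longrightarrow> AE w in M. X s w = Y s w"
  shows "AE w in M. AE s in lborel. s \<in> {0..T} \<longrightarrow> X s w = Y s w"
proof (rule AE_time[OF _ assms(3)])
  show "{x \<in> space pred. X (fst x) (snd x) = Y (fst x) (snd x)} \<in> sets pred"
    using assms(1,2) unfolding predictable_def split_beta' by (rule borel_measurable_eq)
qed

lemma AE_time_norm:
  fixes Z :: "real \<Rightarrow> 'a \<Rightarrow> real ^ 'd"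
  assumes "predictable M T W Z" "\<And>s. s \<in> {0..T} \<Longrightarrow> AE w in M. norm (Z s w) \<le> C"
  shows "AE w in M. AE s in lborel. s \<in> {0..T} \<longrightarrow> norm (Z s w) \<le> C"
proof (rule AE_time[OF _ assms(2)])
  show "{x \<in> space pred. norm (Z (fst x) (snd x)) \<le> C} \<in> sets pred"
    by (rule borel_measurable_le[OF measurable_compose[OF assms(1)[unfolded predictable_def split_beta'] borel_measurable_norm] borel_measurable_const])
qed

lemma sqint_bound:
  assumes "AE s in lborel. s \<in> {0..T} \<longrightarrow> norm (Z s w) \<le> C"
  shows "sqint Z w \<le> ennreal (C\<^sup>2 * T)"
proof -
  have "sqint Z w \<le> (\<integral>\<^sup>+ s \<in> {0..T}. ennreal (C\<^sup>2) \<partial>lborel)"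
    unfolding qv_def
  proof (rule nn_integral_mono_AE)
    show "AE s in lborel. sqnorm (Z s w) * indicator {0..T} s \<le> ennreal (C\<^sup>2) * indicator {0..T} s"
      using assms
    proof eventually_elim
      case (elim s)
      show ?case
      proof (cases "s \<in> {0..T}")
        case True
        then have "(norm (Z s w))\<^sup>2 \<le> C\<^sup>2" using elim by (intro power_mono) auto
        then show ?thesis using True by (simp add: ennreal_leI)
      qed simp
    qed
  qed
  also have "\<dots> = ennreal (C\<^sup>2 * T)" using T_pos by (simp add: nn_integral_cmult_indicator ennreal_mult)
  finally show ?thesis .
qed

lemma pred_set_integrable:
  fixes \<phi> :: "real \<Rightarrow> 'a \<Rightarrow> real"
  assumes "(\<lambda>(s, w). \<phi> s w) \<in> borel_measurable pred" "w \<in> space M"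
    and fin: "(\<integral>\<^sup>+ s \<in> {0..T}. ennreal \<bar>\<phi> s w\<bar> \<partial>lborel) < \<infinity>"
  shows "set_integrable lborel {0..T} (\<lambda>s. \<phi> s w)"
  unfolding set_integrable_def
proof (rule integrableI_bounded)
  show "(\<lambda>s. indicator {0..T} s *\<^sub>R \<phi> s w) \<in> borel_measurable lborel"
    by (rule pred_section_measurable[OF assms(1,2)]) auto
  have "(\<integral>\<^sup>+ s. ennreal (norm (indicator {0..T} s *\<^sub>R \<phi> s w)) \<partial>lborel) = (\<integral>\<^sup>+ s \<in> {0..T}. ennreal \<bar>\<phi> s w\<bar> \<partial>lborel)"
    by (intro nn_integral_cong) (auto simp: indicator_def)
  then show "(\<integral>\<^sup>+ s. ennreal (norm (indicator {0..T} s *\<^sub>R \<phi> s w)) \<partial>lborel) < \<infinity>" using fin by simp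
qed

text \<open>The equation is postulated for each time with its own null set. Both sides are
  right-continuous in \<open>t\<close>, so one null set serves all times.\<close>

lemma supersolution_all_times:
  assumes S: "bsde_supersolution M T W f \<xi> Y Z A"
  obtains I where "ito Z I" "AE w in M. set_integrable lborel {0..T} (\<lambda>s. f s (sample_path T W w) (Y s w) (Z s w)) \<and>
    (\<forall>t\<in>{0..T}. Y t w = \<xi> w + (LINT s:{t..T}|lborel. f s (sample_path T W w) (Y s w) (Z s w))
       - (I T w - I t w) + A T w - A t w)"
proof -
  let ?\<phi> = "\<lambda>s w. f s (sample_path T W w) (Y s w) (Z s w)"
  obtain I where I: "ito Z I" and eq: "\<And>t. t \<in> {0..T} \<Longrightarrow> AE w in M. Y t w = \<xi> w + (LINT s:{t..T}|lborel. ?\<phi> s w) - (I T w - I t w) + A T w - A t w"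
    using S unfolding bsde_supersolution_def by blast
  have S': "driver T f" "predictable M T W Y" "predictable M T W Z" "AE w in M. rcll_on T (\<lambda>t. Y t w)"
    "AE w in M. rcll_on T (\<lambda>t. A t w)" "AE w in M. (\<integral>\<^sup>+ s \<in> {0..T}. ennreal \<bar>?\<phi> s w\<bar> \<partial>lborel) < \<infinity>"
    using S unfolding bsde_supersolution_def bsde_integrable_def by (auto elim!: eventually_mono)
  note \<phi>m = driver_pred[OF S'(1-3)]
  have "AE w in M. \<forall>n. \<forall>t\<in>dyadic_grid 0 T n. Y t w = \<xi> w + (LINT s:{t..T}|lborel. ?\<phi> s w) - (I T w - I t w) + A T w - A t w"
    using eq subsetD[OF dyadic_grid_subset[OF less_imp_le[OF T_pos]]]
    by (intro AE_all_countable[THEN iffD2] allI AE_finite_allI finite_dyadic_grid) blast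
  then have "AE w in M. set_integrable lborel {0..T} (\<lambda>s. ?\<phi> s w) \<and>
    (\<forall>t\<in>{0..T}. Y t w = \<xi> w + (LINT s:{t..T}|lborel. ?\<phi> s w) - (I T w - I t w) + A T w - A t w)"
    using S'(4-6) ito_cont[OF I] AE_space
  proof eventually_elim
    case (elim w)
    have si: "set_integrable lborel {0..T} (\<lambda>s. ?\<phi> s w)" by (rule pred_set_integrable[OF \<phi>m elim(6,4)])
    let ?h = "\<lambda>t. \<xi> w + (LINT s:{t..T}|lborel. ?\<phi> s w) - (I T w - I t w) + A T w - A t w"
    have rY: "((\<lambda>t. Y t w) \<longlongrightarrow> Y t w) (at_right t)" if "t \<in> {0..<T}" for t using elim(2) that by (auto simp: rcll_on_def)
    have rh: "(?h \<longlongrightarrow> ?h t) (at_right t)" if "t \<in> {0..<T}" for t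
    proof -
      have "((\<lambda>t. A t w) \<longlongrightarrow> A t w) (at_right t)" using elim(3) that by (auto simp: rcll_on_def)
      then show ?thesis
        by (intro tendsto_add tendsto_diff tendsto_const continuous_on_at_right[OF tail_integral_continuous[OF si] that] continuous_on_at_right[OF elim(5) that])
    qed
    have "Y t w = ?h t" if "t \<in> {0..T}" for t
    proof (rule antisym)
      show "Y t w \<le> ?h t" using elim(1) by (intro right_continuous_le[of T "\<lambda>t. Y t w" ?h, OF rY rh _ that]) auto
      show "?h t \<le> Y t w" using elim(1) by (intro right_continuous_le[of T ?h "\<lambda>t. Y t w", OF rh rY _ that]) auto
    qed
    then show ?case using si by blast
  qed
  then show thesis using that I by blast
qed

text \<open>\<open>Y\<close> is determined only up to modification, whereas the right-hand side of
  the equation has continuous paths almost surely and may be taken as the solution. By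
  \<open>AE_time_eq\<close> the time integral of the drift does not see the exchange.\<close>

lemma continuous_version:
  assumes S: "bsde_solution M T W f \<xi> Y Z"
  obtains V I where "predictable M T W V" "\<And>w. w \<in> space M \<Longrightarrow> continuous_on {0..T} (\<lambda>t. V t w)"
    "\<And>t. t \<in> {0..T} \<Longrightarrow> AE w in M. V t w = Y t w" "ito Z I"
    "AE w in M. set_integrable lborel {0..T} (\<lambda>s. f s (sample_path T W w) (V s w) (Z s w)) \<and>
    (\<forall>t\<in>{0..T}. V t w = \<xi> w + (LINT s:{t..T}|lborel. f s (sample_path T W w) (V s w) (Z s w)) - (I T w - I t w))"
proof -
  let ?\<phi> = "\<lambda>s w. f s (sample_path T W w) (Y s w) (Z s w)"
  obtain I where I: "ito Z I" and eq: "\<And>t. t \<in> {0..T} \<Longrightarrow> AE w in M. Y t w = \<xi> w + (LINT s:{t..T}|lborel. ?\<phi> s w) - (I T w - I t w)"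
    using S unfolding bsde_solution_def by blast
  have S': "driver T f" "predictable M T W Y" "predictable M T W Z"
    "AE w in M. (\<integral>\<^sup>+ s \<in> {0..T}. ennreal \<bar>?\<phi> s w\<bar> \<partial>lborel) < \<infinity>"
    using S unfolding bsde_solution_def bsde_integrable_def by (auto elim!: eventually_mono)
  note \<phi>m = driver_pred[OF S'(1-3)]
  have si: "AE w in M. set_integrable lborel {0..T} (\<lambda>s. ?\<phi> s w)"
    using S'(4) AE_space by eventually_elim (rule pred_set_integrable[OF \<phi>m])
  define V0 where "V0 t w = \<xi> w + (LINT s:{t..T}|lborel. ?\<phi> s w) - (I T w - I t w)" for t w
  \<comment> \<open>Zero on the null set of discontinuous paths, so that continuity holds for every
    \<open>w\<close> and \<open>predictable_continuous\<close> applies.\<close>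
  define V where "V t w = (if continuous_on {0..T} (\<lambda>t. V0 t w) then V0 t w else 0)" for t w
  have V0c: "AE w in M. continuous_on {0..T} (\<lambda>t. V0 t w)"
    using si ito_cont[OF I]
  proof eventually_elim
    case (elim w)
    show ?case unfolding V0_def
      by (intro continuous_on_add continuous_on_diff continuous_on_const tail_integral_continuous elim)
  qed
  have VV0: "AE w in M. \<forall>t. V t w = V0 t w" using V0c by eventually_elim (simp add: V_def)
  have VY: "AE w in M. V t w = Y t w" if "t \<in> {0..T}" for t
    using VV0 eq[OF that] by eventually_elim (simp add: V0_def)
  have Vc: "continuous_on {0..T} (\<lambda>t. V t w)" for w
    by (cases "continuous_on {0..T} (\<lambda>t. V0 t w)") (simp_all add: V_def)
  have Vp: "predictable M T W V"
  proof (rule predictable_continuous)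
    fix t assume t: "t \<in> {0..T}"
    have "Y t \<in> borel_measurable (F t)" by (rule adapted[OF S'(2)[unfolded predictable_def] t])
    then show "V t \<in> borel_measurable (F t)"
      by (rule F_AE_cong) (use VY[OF t] in \<open>auto elim: eventually_mono\<close>)
  qed (rule Vc)
  have "AE w in M. AE s in lborel. s \<in> {0..T} \<longrightarrow> V s w = Y s w" by (rule AE_time_eq[OF Vp S'(2) VY])
  then have "AE w in M. set_integrable lborel {0..T} (\<lambda>s. f s (sample_path T W w) (V s w) (Z s w)) \<and>
    (\<forall>t\<in>{0..T}. V t w = \<xi> w + (LINT s:{t..T}|lborel. f s (sample_path T W w) (V s w) (Z s w)) - (I T w - I t w))"
    using si VV0 AE_space
  proof eventually_elim
    case (elim w)
    let ?\<psi> = "\<lambda>s. f s (sample_path T W w) (V s w) (Z s w)"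
    have ae: "AE s in lborel. s \<in> {0..T} \<longrightarrow> ?\<phi> s w = ?\<psi> s" using elim(1) by eventually_elim auto
    have m: "(\<lambda>s. indicator A s *\<^sub>R ?\<psi> s) \<in> borel_measurable lborel" if "A \<in> sets borel" "A \<subseteq> {0..T}" for A
      by (rule pred_section_measurable[OF driver_pred[OF S'(1) Vp S'(3)] elim(4) that])
    have m': "(\<lambda>s. indicator A s *\<^sub>R ?\<phi> s w) \<in> borel_measurable lborel" if "A \<in> sets borel" "A \<subseteq> {0..T}" for A
      by (rule pred_section_measurable[OF \<phi>m elim(4) that])
    have "set_integrable lborel {0..T} ?\<psi>" by (rule set_integrable_AE_cong[OF elim(2) m ae]) auto
    moreover have "(LINT s:{t..T}|lborel. ?\<phi> s w) = (LINT s:{t..T}|lborel. ?\<psi> s)" if t: "t \<in> {0..T}" for t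
      unfolding set_lebesgue_integral_def
    proof (rule integral_cong_AE)
      show "AE s in lborel. indicator {t..T} s *\<^sub>R ?\<phi> s w = indicator {t..T} s *\<^sub>R ?\<psi> s"
        using ae by eventually_elim (use t in \<open>auto simp: indicator_def\<close>)
    qed (use m[of "{t..T}"] m'[of "{t..T}"] t in auto)
    ultimately show ?case using elim(3) by (auto simp: V0_def)
  qed
  from that[OF Vp _ _ I this] Vc VY show thesis by blast
qed

end

section \<open>Consequences of the conditions on the driver\<close>

locale bsde_setup = brownian_setup M T W
  for M :: "'a measure" and T :: real and W :: "real \<Rightarrow> 'a \<Rightarrow> real ^ 'd" +
  fixes f :: "'d driver" and K :: real
  assumes drv: "driver T f"
    and conv: "f1 T f" and f0_bounded: "f2 T f" and f_locally_lipschitz: "f4 T f" and f_below: "f5 T f"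
    and incr: "increasing_in_y T f"
    and K: "0 \<le> K"
    and lip: "\<And>t w y1 y2 z. t \<in> {0..T} \<Longrightarrow> w \<in> path_space T \<Longrightarrow> \<bar>f t w y1 z - f t w y2 z\<bar> \<le> K * \<bar>y1 - y2\<bar>"
begin

text \<open>A one-sided Lipschitz bound with \<open>z\<close> bounded but \<open>z'\<close>
  arbitrary. At distance up to one it is (f4) on the ball of radius \<open>a + 1\<close>. Farther
  out, take the point \<open>u\<close> of the segment at distance one from \<open>z\<close>: by
  convexity the slope from \<open>z\<close> to \<open>z'\<close> is at least that from
  \<open>z\<close> to \<open>u\<close>, which is at least \<open>- b\<close>.\<close>

lemma driver_subgradient_bound:
  assumes a: "0 \<le> a"
  obtains b where "0 \<le> b"
    "\<And>t w y z z'. t \<in> {0..T} \<Longrightarrow> w \<in> path_space T \<Longrightarrow> norm z \<le> a \<Longrightarrow> f t w y z \<le> f t w y z' + b * norm (z - z')"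
proof -
  obtain b where b: "0 \<le> b" "\<And>t w y z1 z2. t \<in> {0..T} \<Longrightarrow> w \<in> path_space T \<Longrightarrow> max (norm z1) (norm z2) \<le> a + 1 \<Longrightarrow>
      \<bar>f t w y z1 - f t w y z2\<bar> \<le> b * norm (z1 - z2)"
    using f_locally_lipschitz[unfolded f4_def, rule_format, of "a + 1"] a by auto
  have "f t w y z \<le> f t w y z' + b * norm (z - z')"
    if t: "t \<in> {0..T}" and w: "w \<in> path_space T" and z: "norm z \<le> a" for t w y z z'
  proof (cases "norm (z - z') \<le> 1")
    case True
    have "norm z' \<le> norm z + norm (z - z')" using norm_triangle_ineq4[of z "z - z'"] by simp
    then have "\<bar>f t w y z - f t w y z'\<bar> \<le> b * norm (z - z')" using True z by (intro b t w) simp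
    then show ?thesis by linarith
  next
    case False
    define l where "l = 1 / norm (z - z')"
    have l: "0 < l" "l \<le> 1" "l * norm (z - z') = 1" using False by (auto simp: l_def divide_simps)
    define u where "u = (1 - l) *\<^sub>R z + l *\<^sub>R z'"
    have zu: "z - u = l *\<^sub>R (z - z')" by (simp add: u_def algebra_simps)
    have nzu: "norm (z - u) = 1" unfolding zu using l by simp
    have "norm u \<le> norm z + norm (z - u)" using norm_triangle_ineq4[of z "z - u"] by simp
    then have "\<bar>f t w y z - f t w y u\<bar> \<le> b * norm (z - u)" using nzu z by (intro b t w) simp
    then have 1: "f t w y z \<le> f t w y u + b" using nzu by simp
    have "convex_on UNIV (f t w y)" using conv t w by (auto simp: f1_def)
    from convex_onD[OF this, of l z z'] l have 2: "f t w y u \<le> (1 - l) * f t w y z + l * f t w y z'" by (simp add: u_def)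
    have "l * f t w y z \<le> l * f t w y z' + b" using 1 2 by (simp add: algebra_simps)
    also have "\<dots> = l * (f t w y z' + b * norm (z - z'))" using l by (simp add: algebra_simps)
    finally show ?thesis using l by simp
  qed
  then show thesis using b(1) by (intro that)
qed

lemma driver_bounded_growth:
  assumes a: "0 \<le> a"
  obtains c where "0 \<le> c"
    "\<And>t w y z. t \<in> {0..T} \<Longrightarrow> w \<in> path_space T \<Longrightarrow> norm z \<le> a \<Longrightarrow> \<bar>f t w y z\<bar> \<le> c + K * \<bar>y\<bar>"
proof -
  obtain b where b: "0 \<le> b" "\<And>t w y z1 z2. t \<in> {0..T} \<Longrightarrow> w \<in> path_space T \<Longrightarrow> max (norm z1) (norm z2) \<le> a \<Longrightarrow>
      \<bar>f t w y z1 - f t w y z2\<bar> \<le> b * norm (z1 - z2)"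
    using f_locally_lipschitz[unfolded f4_def, rule_format, of a] a by auto
  obtain c0 where c0: "\<And>t w. t \<in> {0..T} \<Longrightarrow> w \<in> path_space T \<Longrightarrow> \<bar>f t w 0 0\<bar> \<le> c0"
    using f0_bounded unfolding f2_def bdd_above_def by fastforce
  have "\<bar>f t w y z\<bar> \<le> (\<bar>c0\<bar> + b * a) + K * \<bar>y\<bar>"
    if t: "t \<in> {0..T}" and w: "w \<in> path_space T" and z: "norm z \<le> a" for t w y z
  proof -
    have "\<bar>f t w 0 z - f t w 0 0\<bar> \<le> b * norm z" using b(2)[OF t w, of z 0 0] z a by simp
    also have "\<dots> \<le> b * a" using z b(1) by (intro mult_left_mono)
    finally have "\<bar>f t w 0 z - f t w 0 0\<bar> \<le> b * a" .
    moreover have "\<bar>f t w y z - f t w 0 z\<bar> \<le> K * \<bar>y\<bar>" using lip[OF t w, of y z 0] by simp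
    moreover have "\<bar>f t w 0 0\<bar> \<le> \<bar>c0\<bar>" using c0[OF t w] by linarith
    ultimately show ?thesis by linarith
  qed
  moreover have "0 \<le> \<bar>c0\<bar> + b * a" using b(1) a by simp
  ultimately show thesis by (intro that)
qed

lemma driver_lower_bound:
  assumes "0 \<le> c"
  obtains m where "0 \<le> m"
    "\<And>t w y z. t \<in> {0..T} \<Longrightarrow> w \<in> path_space T \<Longrightarrow> \<bar>y\<bar> \<le> c \<Longrightarrow> - m \<le> f t w y z"
proof -
  from f_below assms have "bdd_below ((\<lambda>(t, w, y, z). f t w y z) ` ({0..T} \<times> path_space T \<times> {-c..c} \<times> UNIV))"
    by (simp add: f5_def)
  then obtain m where m: "\<And>x. x \<in> {0..T} \<times> path_space T \<times> {-c..c} \<times> UNIV \<Longrightarrow> m \<le> (case x of (t, w, y, z) \<Rightarrow> f t w y z)"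
    unfolding bdd_below_def by blast
  have "- \<bar>m\<bar> \<le> f t w y z" if "t \<in> {0..T}" "w \<in> path_space T" "\<bar>y\<bar> \<le> c" for t w y z
    using m[of "(t, w, y, z)"] that by (auto simp: abs_le_iff)
  then show thesis by (intro that[of "\<bar>m\<bar>"]) auto
qed

lemma driver_continuous_z:
  assumes t: "t \<in> {0..T}" and w: "w \<in> path_space T" and zn: "zn \<longlonglongrightarrow> z"
  shows "(\<lambda>n. f t w y (zn n)) \<longlonglongrightarrow> f t w y z"
proof -
  obtain b where b: "0 \<le> b" "\<And>t w y z1 z2. t \<in> {0..T} \<Longrightarrow> w \<in> path_space T \<Longrightarrow> max (norm z1) (norm z2) \<le> norm z + 1 \<Longrightarrow>
      \<bar>f t w y z1 - f t w y z2\<bar> \<le> b * norm (z1 - z2)"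
    using f_locally_lipschitz[unfolded f4_def, rule_format, of "norm z + 1"] by auto
  have "(\<lambda>n. norm (zn n)) \<longlonglongrightarrow> norm z" using zn by (rule tendsto_norm)
  then have "eventually (\<lambda>n. norm (zn n) < norm z + 1) sequentially" by (rule order_tendstoD) simp
  then have ev: "eventually (\<lambda>n. norm (f t w y (zn n) - f t w y z) \<le> b * norm (zn n - z)) sequentially"
  proof eventually_elim
    case (elim n)
    then show ?case unfolding real_norm_def by (intro b t w) simp
  qed
  have "(\<lambda>n. b * norm (zn n - z)) \<longlonglongrightarrow> b * norm (z - z)" by (intro tendsto_intros zn)
  then have "(\<lambda>n. b * norm (zn n - z)) \<longlonglongrightarrow> 0" by simp
  from Lim_null_comparison[OF ev this] show ?thesis by (rule Lim_null[THEN iffD2])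
qed

section \<open>Continuous solutions with bounded integrand\<close>

abbreviation "drift Y Z s w \<equiv> f s (sample_path T W w) (Y s w) (Z s w)"

abbreviation "path_equation \<xi> V Z I w \<equiv> set_integrable lborel {0..T} (\<lambda>s. drift V Z s w) \<and>
  (\<forall>t\<in>{0..T}. V t w = \<xi> w + (LINT s:{t..T}|lborel. drift V Z s w) - (I T w - I t w))"

text \<open>A continuous version together with its Ito integral: the equation holds for all times
  outside one null set, and the bound on \<open>Z\<close> holds for almost every time, which
  suffices under time integrals. The bound may vary from one solution to the next.\<close>

definition regular_solution :: "('a \<Rightarrow> real) \<Rightarrow> (real \<Rightarrow> 'a \<Rightarrow> real) \<Rightarrow> (real \<Rightarrow> 'a \<Rightarrow> real ^ 'd) \<Rightarrow> (real \<Rightarrow> 'a \<Rightarrow> real) \<Rightarrow> bool" where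
  "regular_solution \<xi> V Z I \<longleftrightarrow>
     predictable M T W V \<and> predictable M T W Z \<and> ito Z I \<and>
     (\<forall>w\<in>space M. continuous_on {0..T} (\<lambda>t. V t w)) \<and>
     (\<exists>a\<ge>0. AE w in M. AE s in lborel. s \<in> {0..T} \<longrightarrow> norm (Z s w) \<le> a) \<and>
     (AE w in M. path_equation \<xi> V Z I w)"

lemma regular_solutionD:
  assumes "regular_solution \<xi> V Z I"
  shows "predictable M T W V" "predictable M T W Z" "ito Z I" "\<And>w. w \<in> space M \<Longrightarrow> continuous_on {0..T} (\<lambda>t. V t w)"
    "AE w in M. path_equation \<xi> V Z I w" "\<exists>a\<ge>0. AE w in M. AE s in lborel. s \<in> {0..T} \<longrightarrow> norm (Z s w) \<le> a"
  using assms unfolding regular_solution_def by auto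

lemma singleton_integral_zero: "(LINT s:{a}|lborel. (g s :: real)) = 0"
  unfolding set_lebesgue_integral_def
proof (rule integral_eq_zero_AE)
  show "AE s in lborel. indicator {a} s *\<^sub>R g s = 0"
    using AE_lborel_singleton[of a] by eventually_elim (simp add: indicator_def)
qed

lemma path_equation_terminal: "path_equation \<xi> V Z I w \<Longrightarrow> V T w = \<xi> w"
proof -
  assume "path_equation \<xi> V Z I w"
  then have "V T w = \<xi> w + (LINT s:{T..T}|lborel. drift V Z s w) - (I T w - I T w)"
    using T_pos by (elim conjE bspec) simp
  then show ?thesis by (simp add: singleton_integral_zero)
qed

lemma path_equation_increment:
  assumes e: "path_equation \<xi> V Z I w" and st: "0 \<le> s" "s \<le> t" "t \<le> T"
  shows "V s w = V t w + (LINT r:{s..t}|lborel. drift V Z r w) - (I t w - I s w)"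
proof -
  have "V s w = \<xi> w + (LINT r:{s..T}|lborel. drift V Z r w) - (I T w - I s w)"
    using st by (intro bspec[OF conjunct2[OF e]]) simp
  moreover have "V t w = \<xi> w + (LINT r:{t..T}|lborel. drift V Z r w) - (I T w - I t w)"
    using st by (intro bspec[OF conjunct2[OF e]]) simp
  moreover note tail_integral_split[OF conjunct1[OF e] st]
  ultimately show ?thesis by linarith
qed

lemma AE_all_times_le:
  fixes X :: "real \<Rightarrow> 'a \<Rightarrow> real"
  assumes rc: "AE w in M. \<forall>t\<in>{0..<T}. ((\<lambda>s. X s w) \<longlongrightarrow> X t w) (at_right t)"
    and le: "\<And>t. t \<in> {0..T} \<Longrightarrow> AE w in M. X t w \<le> C"
  shows "AE w in M. \<forall>t\<in>{0..T}. X t w \<le> C"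
proof -
  have "AE w in M. \<forall>n. \<forall>t\<in>dyadic_grid 0 T n. X t w \<le> C"
    using le subsetD[OF dyadic_grid_subset[OF less_imp_le[OF T_pos]]]
    by (intro AE_all_countable[THEN iffD2] allI AE_finite_allI finite_dyadic_grid) blast
  then show ?thesis using rc
  proof eventually_elim
    case (elim w)
    show ?case
    proof
      fix t assume t: "t \<in> {0..T}"
      show "X t w \<le> C"
        by (rule right_continuous_le[of T "\<lambda>t. X t w" "\<lambda>_. C", OF _ _ _ t]) (use elim in auto)
    qed
  qed
qed

text \<open>If the Ito integral moves by at most \<open>x\<close> after \<open>t\<close>, the path
  obeys a Gronwall estimate and \<open>\<bar>V t w\<bar> \<le> R\<close>. So where \<open>R\<close>
  is exceeded at \<open>t\<close> the integral must move by more than \<open>x\<close>, and the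
  Bernstein inequality on that event \<open>B\<close> gives
  \<open>measure P B \<le> 2 * exp (- 2) * measure P B\<close>, with a factor less than one. This
  bound depends on the one for \<open>Z\<close>; a uniform upper bound comes from
  \<open>regular_solution_upper_bound\<close>.\<close>

lemma regular_solution_bounded:
  assumes R: "regular_solution \<xi> V Z I" and \<xi>: "AE w in M. \<bar>\<xi> w\<bar> \<le> c"
  obtains C where "0 \<le> C" "AE w in M. \<forall>t\<in>{0..T}. \<bar>V t w\<bar> \<le> C"
proof -
  note Vp = regular_solutionD(1)[OF R] and Zp = regular_solutionD(2)[OF R] and I = regular_solutionD(3)[OF R]
    and Vc = regular_solutionD(4)[OF R] and eq = regular_solutionD(5)[OF R]
  obtain a where a: "0 \<le> a" "AE w in M. AE s in lborel. s \<in> {0..T} \<longrightarrow> norm (Z s w) \<le> a"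
    using regular_solutionD(6)[OF R] by blast
  obtain c1 where c1: "0 \<le> c1" "\<And>t w y z. t \<in> {0..T} \<Longrightarrow> w \<in> path_space T \<Longrightarrow> norm z \<le> a \<Longrightarrow> \<bar>f t w y z\<bar> \<le> c1 + K * \<bar>y\<bar>"
    using driver_bounded_growth[OF a(1)] by blast
  \<comment> \<open>Exceeds the largest possible energy \<open>a\<^sup>2 * T\<close>, so the second
    term of \<open>bernstein_ito\<close> vanishes.\<close>
  define \<delta> where "\<delta> = a\<^sup>2 * T + 1"
  have \<delta>: "0 < \<delta>" "a\<^sup>2 * T < \<delta>" using T_pos by (auto simp: \<delta>_def intro: add_nonneg_pos)
  \<comment> \<open>\<open>x\<^sup>2 = 64 * \<delta>\<close> makes the exponent
    \<open>- x\<^sup>2 / (32 * \<delta>)\<close> equal to -2.\<close>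
  define x where "x = sqrt (64 * \<delta>)"
  have x: "0 < x" "x\<^sup>2 = 64 * \<delta>" using \<delta> by (auto simp: x_def)
  \<comment> \<open>The increment of \<open>I\<close> from \<open>s\<close> to \<open>T\<close> is
    compared through time \<open>t\<close>, which costs \<open>2 * x\<close>.\<close>
  define R0 where "R0 = \<bar>c\<bar> + c1 * T + 2 * x"
  have R00: "0 \<le> R0" using c1 T_pos x by (simp add: R0_def)
  define R where "R = 2 * R0 * exp ((2 * K + 1) * T)"
  have R0: "0 \<le> R" using R00 by (simp add: R_def)
  have path: "AE w in M. \<forall>t\<in>{0..T}. (\<forall>s\<in>{t..T}. \<bar>I s w - I t w\<bar> \<le> x) \<longrightarrow> \<bar>V t w\<bar> \<le> R"
    using eq a(2) \<xi> AE_space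
  proof eventually_elim
    case (elim w)
    show ?case
    proof (intro ballI impI)
      fix t assume t: "t \<in> {0..T}" and Ix: "\<forall>s\<in>{t..T}. \<bar>I s w - I t w\<bar> \<le> x"
      have "\<bar>V t w\<bar> \<le> 2 * R0 * exp ((2 * K + 1) * (T - t))"
      proof (rule backward_gronwall[OF _ _ R00 K])
        show "continuous_on {t..T} (\<lambda>s. V s w)" using t by (intro continuous_on_subset[OF Vc[OF elim(4)]]) auto
        show "t \<le> T" using t by simp
        fix s assume s: "s \<in> {t..T}"
        then have s0: "s \<in> {0..T}" using t by auto
        have Vi: "set_integrable lborel {s..T} (\<lambda>r. \<bar>V r w\<bar>)"
          unfolding set_integrable_def
        proof (rule borel_integrable_compact)
          show "continuous_on {s..T} (\<lambda>r. \<bar>V r w\<bar>)"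
            using s0 by (intro continuous_on_rabs continuous_on_subset[OF Vc[OF elim(4)]]) auto
        qed simp
        have di: "set_integrable lborel {s..T} (\<lambda>r. drift V Z r w)"
          using s0 by (intro set_integrable_subset[OF conjunct1[OF elim(1)]]) auto
        have ci: "set_integrable lborel {s..T} (\<lambda>r. c1)"
          unfolding set_integrable_def by (intro borel_integrable_compact) auto
        have "\<bar>LINT r:{s..T}|lborel. drift V Z r w\<bar> \<le> (LINT r:{s..T}|lborel. \<bar>drift V Z r w\<bar>)"
          using set_integral_norm_bound[OF di] by simp
        also have "\<dots> \<le> (LINT r:{s..T}|lborel. c1 + K * \<bar>V r w\<bar>)"
        proof (rule set_integral_mono_AE)
          show "set_integrable lborel {s..T} (\<lambda>r. \<bar>drift V Z r w\<bar>)" using di by (rule set_integrable_abs)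
          show "set_integrable lborel {s..T} (\<lambda>r. c1 + K * \<bar>V r w\<bar>)"
            using Vi ci by (intro set_integral_add set_integrable_mult_right) auto
          show "AE r\<in>{s..T} in lborel. \<bar>drift V Z r w\<bar> \<le> c1 + K * \<bar>V r w\<bar>"
            using elim(2)
          proof eventually_elim
            case (elim r)
            then show ?case using s0 sample_path_in[OF \<open>w \<in> space M\<close>] by (intro impI c1) auto
          qed
        qed
        also have "\<dots> = (LINT r:{s..T}|lborel. c1) + (LINT r:{s..T}|lborel. K * \<bar>V r w\<bar>)"
          using Vi ci by (intro set_integral_add set_integrable_mult_right) auto
        also have "(LINT r:{s..T}|lborel. c1) = c1 * (T - s)" using s by (simp add: set_lebesgue_integral_def)
        also have "\<dots> \<le> c1 * T" using s0 c1 by (intro mult_left_mono) auto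
        finally have "\<bar>LINT r:{s..T}|lborel. drift V Z r w\<bar> \<le> c1 * T + K * (LINT r:{s..T}|lborel. \<bar>V r w\<bar>)" by simp
        moreover have "\<bar>I T w - I t w\<bar> \<le> x" "\<bar>I s w - I t w\<bar> \<le> x" using Ix s by auto
        moreover have "V s w = \<xi> w + (LINT s:{s..T}|lborel. drift V Z s w) - (I T w - I s w)"
          by (rule bspec[OF conjunct2[OF elim(1)] s0])
        ultimately show "\<bar>V s w\<bar> \<le> R0 + K * (LINT r:{s..T}|lborel. \<bar>V r w\<bar>)"
          unfolding R0_def using elim(3) by linarith
      qed
      also have "\<dots> \<le> R" unfolding R_def using t R00 K by (intro mult_left_mono) (auto intro!: mult_left_mono)
      finally show "\<bar>V t w\<bar> \<le> R" .
    qed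
  qed
  have single: "AE w in M. \<bar>V t w\<bar> \<le> R" if t: "t \<in> {0..T}" for t
  proof -
    define B where "B = {w \<in> space M. R < \<bar>V t w\<bar>}"
    have "V t \<in> borel_measurable (F t)" by (rule adapted[OF Vp[unfolded predictable_def] t])
    then have "{w \<in> space (F t). R < \<bar>V t w\<bar>} \<in> sets (F t)" by measurable
    then have B: "B \<in> sets (F t)" by (simp add: B_def)
    have "AE w in M. \<not> ennreal \<delta> < sqint Z w"
      using a(2)
    proof eventually_elim
      case (elim w)
      have "sqint Z w \<le> ennreal (a\<^sup>2 * T)" using elim by (rule sqint_bound)
      also have "\<dots> \<le> ennreal \<delta>" using \<delta> by (intro ennreal_leI) simp
      finally show ?case by simp
    qed
    then have "AE w in P. \<not> ennreal \<delta> < sqint Z w" unfolding AE_P .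
    then have null: "measure P {w\<in>space M. ennreal \<delta> < sqint Z w} = 0"
      using borel_measurable_less[OF borel_measurable_const sqint_measurable[OF Zp], of "ennreal \<delta>"]
      by (subst P.prob_eq_0) (auto elim: eventually_mono)
    have sub: "AE w in P. w \<in> B \<longrightarrow> w \<in> {w\<in>B. \<exists>s\<in>{t..T}. x < \<bar>I s w - I t w\<bar>}"
      unfolding AE_P using path
    proof eventually_elim
      case (elim w)
      then show ?case using t by (auto simp: B_def not_le[symmetric])
    qed
    have ev: "{w\<in>B. \<exists>s\<in>{t..T}. x < \<bar>I s w - I t w\<bar>} \<in> sets P"
    proof -
      have "{w\<in>space M. \<exists>s\<in>{t..T}. x < \<bar>I s w - I t w\<bar>} \<in> sets P"
      proof (rule ex_event)
        fix s assume "s \<in> {t..T}"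
        then show "(\<lambda>w. \<bar>I s w - I t w\<bar>) \<in> borel_measurable P"
          using t by (intro borel_measurable_abs borel_measurable_diff ito_P[OF I]) auto
      next
        show "AE w in M. continuous_on {t..T} (\<lambda>s. \<bar>I s w - I t w\<bar>)"
          using ito_cont[OF I]
        proof eventually_elim
          case (elim w)
          show ?case using t by (intro continuous_intros continuous_on_subset[OF elim]) auto
        qed
      qed (use t in auto)
      from sets.Int[OF F_sub_P[OF B] this] show ?thesis
        by (rule back_subst[of "\<lambda>A. A \<in> sets P"]) (auto simp: B_def)
    qed
    have "measure P B \<le> measure P {w\<in>B. \<exists>s\<in>{t..T}. x < \<bar>I s w - I t w\<bar>}"
      by (rule P.finite_measure_mono_AE[OF sub ev])
    also have "\<dots> \<le> 2 * exp (- x\<^sup>2 / (32 * \<delta>)) * measure P B" using bernstein_ito[OF I Zp t B \<delta>(1) x(1)] null by simp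
    also have "\<dots> = (2 * exp (- 2)) * measure P B" using x \<delta> by simp
    finally have "measure P B \<le> (2 * exp (- 2)) * measure P B" .
    moreover have "2 * exp (- 2) < (1 :: real)"
    proof -
      have "1 + 2 \<le> exp (2 :: real)" by (rule exp_ge_add_one_self)
      then show ?thesis by (simp add: exp_minus divide_simps)
    qed
    ultimately have "(1 - 2 * exp (- 2)) * measure P B \<le> 0" "0 < 1 - 2 * exp (- 2 :: real)" by (simp_all add: left_diff_distrib)
    then have "measure P B = 0" using measure_nonneg[of P B] by (simp add: mult_le_0_iff)
    then have "AE w in P. w \<notin> B" using P.prob_eq_0[OF F_sub_P[OF B]] by simp
    then show ?thesis unfolding AE_P using AE_space by eventually_elim (simp add: B_def not_less)
  qed
  have "AE w in M. \<forall>t\<in>{0..T}. \<bar>V t w\<bar> \<le> R"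
  proof (rule AE_all_times_le[OF _ single])
    show "AE w in M. \<forall>t\<in>{0..<T}. ((\<lambda>s. \<bar>V s w\<bar>) \<longlongrightarrow> \<bar>V t w\<bar>) (at_right t)"
      using AE_space
      by eventually_elim (intro ballI tendsto_rabs continuous_on_at_right[where T=T] Vc)
  qed
  with R0 show thesis by (intro that)
qed

text \<open>\<open>X\<close> need only satisfy the inequality of a supersolution in increments, with
  a density \<phi> above its drift; supersolutions, other solutions and deterministic barriers all
  qualify. The difference of drifts is split at \<open>drift X Z\<close>: monotonicity and the
  Lipschitz condition in \<open>y\<close> handle the first part,
  \<open>driver_subgradient_bound\<close> the second, for which a bound on \<open>Z\<close>
  suffices.\<close>

lemma regular_solution_compare:
  assumes R: "regular_solution \<xi> V Z I" and \<xi>: "AE w in M. \<bar>\<xi> w\<bar> \<le> c" "AE w in M. \<xi> w \<le> X T w"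
    and I': "ito Z' I'" "predictable M T W Z'" "AE w in M. sqint Z' w < \<infinity>"
    and X: "\<And>t. t \<in> {0..T} \<Longrightarrow> X t \<in> borel_measurable (F t)" "AE w in M. \<forall>t\<in>{0..T}. - C \<le> X t w"
      "AE w in M. \<forall>t\<in>{0..<T}. ((\<lambda>s. X s w) \<longlongrightarrow> X t w) (at_right t)"
    and H: "AE w in M. set_integrable lborel {0..T} (\<lambda>r. \<phi> r w) \<and>
      (\<forall>r\<in>{0..T}. drift X Z' r w \<le> \<phi> r w) \<and>
      (\<forall>s t. 0 \<le> s \<longrightarrow> s \<le> t \<longrightarrow> t \<le> T \<longrightarrow> X t w + (LINT r:{s..t}|lborel. \<phi> r w) - (I' t w - I' s w) \<le> X s w)"
  shows "AE w in M. \<forall>t\<in>{0..T}. V t w \<le> X t w"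
proof -
  note Vp = regular_solutionD(1)[OF R] and Zp = regular_solutionD(2)[OF R] and I = regular_solutionD(3)[OF R]
    and Vc = regular_solutionD(4)[OF R] and eq = regular_solutionD(5)[OF R]
  obtain a where a: "0 \<le> a" "AE w in M. AE s in lborel. s \<in> {0..T} \<longrightarrow> norm (Z s w) \<le> a"
    using regular_solutionD(6)[OF R] by blast
  obtain C0 where C0: "AE w in M. \<forall>t\<in>{0..T}. \<bar>V t w\<bar> \<le> C0"
    using regular_solution_bounded[OF R \<xi>(1)] by blast
  obtain b where b: "0 \<le> b"
    "\<And>t w y z z'. t \<in> {0..T} \<Longrightarrow> w \<in> path_space T \<Longrightarrow> norm z \<le> a \<Longrightarrow> f t w y z \<le> f t w y z' + b * norm (z - z')"
    using driver_subgradient_bound[OF a(1)] by blast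
  have "AE w in M. \<forall>t\<in>{0..T}. V t w - X t w \<le> 0"
  proof (rule comparison[OF ito_diff[OF I Zp I'(1,2)] predictable_diff[OF Zp I'(2)] _ K b(1)])
    show "AE w in M. sqint (\<lambda>t w. Z t w - Z' t w) w < \<infinity>"
      using a(2) I'(3) AE_space
    proof eventually_elim
      case (elim w)
      have "sqint (\<lambda>t w. Z t w + - 1 *\<^sub>R Z' t w) w \<le> 2 * sqint Z w + 2 * sqint (\<lambda>t w. - 1 *\<^sub>R Z' t w) w"
        by (rule sqint_add_le[OF Zp predictable_scale[OF I'(2)] elim(3)])
      moreover have "sqint (\<lambda>t w. - 1 *\<^sub>R Z' t w) w = sqint Z' w" by (simp add: qv_def)
      moreover have "sqint Z w \<le> ennreal (a\<^sup>2 * T)" using elim(1) by (rule sqint_bound)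
      then have "sqint Z w < \<infinity>" by (rule le_less_trans) simp
      ultimately show ?case using elim(2) by (auto intro: le_less_trans simp: ennreal_mult_less_top)
    qed
    show "(\<lambda>w. V t w - X t w) \<in> borel_measurable (F t)" if "t \<in> {0..T}" for t
      by (intro borel_measurable_diff X(1) that adapted[OF Vp[unfolded predictable_def]])
    show "AE w in M. \<forall>t\<in>{0..T}. V t w - X t w \<le> C0 + C"
      using C0 X(2)
    proof eventually_elim
      case (elim w)
      show ?case
      proof
        fix t assume "t \<in> {0..T}"
        with elim have "\<bar>V t w\<bar> \<le> C0" "- C \<le> X t w" by blast+
        then show "V t w - X t w \<le> C0 + C" by linarith
      qed
    qed
    show "AE w in M. \<forall>t\<in>{0..<T}. ((\<lambda>s. V s w - X s w) \<longlongrightarrow> V t w - X t w) (at_right t)"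
      using X(3) AE_space
    proof eventually_elim
      case (elim w)
      show ?case
        by (intro ballI tendsto_diff) (simp_all only: continuous_on_at_right[OF Vc[OF elim(2)]] bspec[OF elim(1)])
    qed
    show "AE w in M. V T w - X T w \<le> 0"
      using eq \<xi>(2)
    proof eventually_elim
      case (elim w)
      show ?case using path_equation_terminal[where \<xi>=\<xi> and V=V and Z=Z and I=I and w=w, OF elim(1)] elim(2) by simp
    qed
    show "AE w in M. \<exists>g. set_integrable lborel {0..T} g \<and>
      (AE r in lborel. r \<in> {0..T} \<longrightarrow> g r \<le> K * max 0 (V r w - X r w) + b * norm (Z r w - Z' r w)) \<and>
      (\<forall>s t. 0 \<le> s \<longrightarrow> s \<le> t \<longrightarrow> t \<le> T \<longrightarrow> V s w - X s w \<le> V t w - X t w + (LINT r:{s..t}|lborel. g r) - (I t w - I' t w - (I s w - I' s w)))"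
      using eq H a(2) AE_space
    proof eventually_elim
      case (elim w)
      note w = sample_path_in[OF elim(4)]
      have i: "set_integrable lborel {0..T} (\<lambda>s. drift V Z s w)" "set_integrable lborel {0..T} (\<lambda>s. \<phi> s w)" using elim(1,2) by blast+
      show ?case
      proof (intro exI[of _ "\<lambda>r. drift V Z r w - \<phi> r w"] conjI allI impI)
        show "set_integrable lborel {0..T} (\<lambda>r. drift V Z r w - \<phi> r w)" by (rule set_integral_diff(1)[OF i])
        show "AE r in lborel. r \<in> {0..T} \<longrightarrow> drift V Z r w - \<phi> r w \<le> K * max 0 (V r w - X r w) + b * norm (Z r w - Z' r w)"
          using elim(3)
        proof eventually_elim
          case (elim r)
          show ?case
          proof
            assume r: "r \<in> {0..T}"
            have "drift X Z' r w \<le> \<phi> r w" using \<open>_ \<and> _ \<and> _\<close> r by blast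
            moreover have "drift X Z r w \<le> drift X Z' r w + b * norm (Z r w - Z' r w)"
              using elim r by (intro b(2) w) auto
            \<comment> \<open>Where \<open>V \<le> X\<close>, monotonicity in \<open>y\<close>
              leaves no error at all; hence the positive part in \<open>comparison\<close>.\<close>
            moreover have "drift V Z r w \<le> drift X Z r w + K * max 0 (V r w - X r w)"
            proof (cases "V r w \<le> X r w")
              case True
              then have "drift V Z r w \<le> drift X Z r w"
                using incr r w by (auto simp: increasing_in_y_def mono_def)
              then show ?thesis using True by simp
            next
              case False
              have "\<bar>drift V Z r w - drift X Z r w\<bar> \<le> K * \<bar>V r w - X r w\<bar>" by (rule lip[OF r w])
              then show ?thesis using False by simp
            qed
            ultimately show "drift V Z r w - \<phi> r w \<le> K * max 0 (V r w - X r w) + b * norm (Z r w - Z' r w)" by linarith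
          qed
        qed
        fix s t assume st: "0 \<le> s" "s \<le> t" "t \<le> T"
        note path_equation_increment[where \<xi>=\<xi> and V=V and Z=Z and I=I and w=w, OF elim(1) st]
        moreover have "X t w + (LINT r:{s..t}|lborel. \<phi> r w) - (I' t w - I' s w) \<le> X s w" using elim(2) st by blast
        moreover have "(LINT r:{s..t}|lborel. drift V Z r w - \<phi> r w) = (LINT r:{s..t}|lborel. drift V Z r w) - (LINT r:{s..t}|lborel. \<phi> r w)"
        proof (rule set_integral_diff(2))
          show "set_integrable lborel {s..t} (\<lambda>s. drift V Z s w)" using st by (intro set_integrable_subset[OF i(1)]) auto
          show "set_integrable lborel {s..t} (\<lambda>s. \<phi> s w)" using st by (intro set_integrable_subset[OF i(2)]) auto
        qed
        ultimately show "V s w - X s w \<le> V t w - X t w + (LINT r:{s..t}|lborel. drift V Z r w - \<phi> r w) - (I t w - I' t w - (I s w - I' s w))"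
          by linarith
      qed
    qed
  qed
  then show ?thesis by eventually_elim simp
qed

lemma solution_regular:
  assumes S: "bsde_solution M T W f \<xi> Y Z" and Z: "bounded_process M T Z"
  obtains V I where "regular_solution \<xi> V Z I" "\<And>t. t \<in> {0..T} \<Longrightarrow> AE w in M. V t w = Y t w"
proof -
  obtain V I where VI: "predictable M T W V" "\<And>w. w \<in> space M \<Longrightarrow> continuous_on {0..T} (\<lambda>t. V t w)"
    "\<And>t. t \<in> {0..T} \<Longrightarrow> AE w in M. V t w = Y t w" "ito Z I"
    "AE w in M. path_equation \<xi> V Z I w"
    by (rule continuous_version[OF S]) (rule that)
  have Zp: "predictable M T W Z" using S unfolding bsde_solution_def by blast
  obtain a where a: "\<And>t. t \<in> {0..T} \<Longrightarrow> AE w in M. norm (Z t w) \<le> a" using Z unfolding bounded_process_def by blast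
  have "AE w in M. AE s in lborel. s \<in> {0..T} \<longrightarrow> norm (Z s w) \<le> a" by (rule AE_time_norm[OF Zp a])
  then have "AE w in M. AE s in lborel. s \<in> {0..T} \<longrightarrow> norm (Z s w) \<le> \<bar>a\<bar>"
  proof eventually_elim
    case (elim w)
    then show ?case by eventually_elim auto
  qed
  then have "regular_solution \<xi> V Z I"
    unfolding regular_solution_def by (intro conjI ballI VI Zp exI[of _ "\<bar>a\<bar>"]) simp_all
  then show thesis by (rule that[OF _ VI(3)])
qed

text \<open>As \<open>A'\<close> is increasing, the equation becomes an inequality for increments,
  with the drift of \<open>f'\<close> as the density that dominates the drift of
  \<open>f\<close>.\<close>

lemma regular_solution_le_supersolution:
  assumes R: "regular_solution \<xi> V Z I" and \<xi>: "AE w in M. \<bar>\<xi> w\<bar> \<le> c" "AE w in M. \<xi> w \<le> \<xi>' w"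
    and f': "\<And>t w y z. t \<in> {0..T} \<Longrightarrow> w \<in> path_space T \<Longrightarrow> f t w y z \<le> f' t w y z"
    and S: "bsde_supersolution M T W f' \<xi>' Y' Z' A'" and bd: "bounded_process M T Y'"
  shows "AE w in M. \<forall>t\<in>{0..T}. V t w \<le> Y' t w"
proof -
  let ?d = "\<lambda>s w. f' s (sample_path T W w) (Y' s w) (Z' s w)"
  obtain I' where I': "ito Z' I'" "AE w in M. set_integrable lborel {0..T} (\<lambda>s. ?d s w) \<and>
    (\<forall>t\<in>{0..T}. Y' t w = \<xi>' w + (LINT s:{t..T}|lborel. ?d s w) - (I' T w - I' t w) + A' T w - A' t w)"
    by (rule supersolution_all_times[OF S]) (rule that)
  have S': "predictable M T W Y'" "predictable M T W Z'" "AE w in M. rcll_on T (\<lambda>t. Y' t w)"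
    "AE w in M. mono_on {0..T} (\<lambda>t. A' t w)" "AE w in M. sqint Z' w < \<infinity>"
    using S unfolding bsde_supersolution_def bsde_integrable_def qv_def by (auto elim!: eventually_mono)
  have rc: "AE w in M. \<forall>t\<in>{0..<T}. ((\<lambda>s. Y' s w) \<longlongrightarrow> Y' t w) (at_right t)"
    using S'(3) by eventually_elim (simp add: rcll_on_def)
  obtain C where C: "\<And>t. t \<in> {0..T} \<Longrightarrow> AE w in M. norm (Y' t w) \<le> C" using bd unfolding bounded_process_def by blast
  show ?thesis
  proof (rule regular_solution_compare[OF R \<xi>(1) _ I'(1) S'(2,5) adapted[OF S'(1)[unfolded predictable_def]] _ rc])
    show "AE w in M. \<xi> w \<le> Y' T w"
      using I'(2) \<xi>(2)
    proof eventually_elim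
      case (elim w)
      have "Y' T w = \<xi>' w + (LINT s:{T..T}|lborel. ?d s w) - (I' T w - I' T w) + A' T w - A' T w"
        using T_pos by (intro bspec[OF conjunct2[OF elim(1)]]) simp
      then show ?case using elim(2) by (simp add: singleton_integral_zero)
    qed
    have "AE w in M. \<forall>t\<in>{0..T}. \<bar>Y' t w\<bar> \<le> C"
    proof (rule AE_all_times_le)
      show "AE w in M. \<forall>t\<in>{0..<T}. ((\<lambda>s. \<bar>Y' s w\<bar>) \<longlongrightarrow> \<bar>Y' t w\<bar>) (at_right t)"
        using rc by eventually_elim (intro ballI tendsto_rabs, rule bspec)
      show "AE w in M. \<bar>Y' t w\<bar> \<le> C" if "t \<in> {0..T}" for t using C[OF that] by simp
    qed
    then show "AE w in M. \<forall>t\<in>{0..T}. - C \<le> Y' t w"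
      by eventually_elim (auto simp: abs_le_iff)
    show "AE w in M. set_integrable lborel {0..T} (\<lambda>r. ?d r w) \<and>
      (\<forall>r\<in>{0..T}. drift Y' Z' r w \<le> ?d r w) \<and>
      (\<forall>s t. 0 \<le> s \<longrightarrow> s \<le> t \<longrightarrow> t \<le> T \<longrightarrow> Y' t w + (LINT r:{s..t}|lborel. ?d r w) - (I' t w - I' s w) \<le> Y' s w)"
      using I'(2) S'(4) AE_space
    proof eventually_elim
      case (elim w)
      have i: "set_integrable lborel {0..T} (\<lambda>r. ?d r w)" using elim(1) by blast
      have "Y' t w + (LINT r:{s..t}|lborel. ?d r w) - (I' t w - I' s w) \<le> Y' s w" if st: "0 \<le> s" "s \<le> t" "t \<le> T" for s t
      proof -
        have "Y' s w = \<xi>' w + (LINT s:{s..T}|lborel. ?d s w) - (I' T w - I' s w) + A' T w - A' s w"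
          using st by (intro bspec[OF conjunct2[OF elim(1)]]) simp
        moreover have "Y' t w = \<xi>' w + (LINT s:{t..T}|lborel. ?d s w) - (I' T w - I' t w) + A' T w - A' t w"
          using st by (intro bspec[OF conjunct2[OF elim(1)]]) simp
        moreover have "A' s w \<le> A' t w" using elim(2) st by (auto simp: mono_on_def)
        moreover note tail_integral_split[OF i st]
        ultimately show ?thesis by linarith
      qed
      then show ?case using i f' sample_path_in[OF elim(3)] by blast
    qed
  qed
qed

lemma regular_solution_mono:
  assumes R: "regular_solution \<xi> V Z I" and \<xi>: "AE w in M. \<bar>\<xi> w\<bar> \<le> c" "AE w in M. \<xi> w \<le> \<xi>' w"
    and R': "regular_solution \<xi>' V' Z' I'" and \<xi>': "AE w in M. \<bar>\<xi>' w\<bar> \<le> c'"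
  shows "AE w in M. \<forall>t\<in>{0..T}. V t w \<le> V' t w"
proof -
  note Vp = regular_solutionD(1)[OF R'] and Zp = regular_solutionD(2)[OF R'] and I' = regular_solutionD(3)[OF R']
    and Vc = regular_solutionD(4)[OF R'] and eq = regular_solutionD(5)[OF R']
  obtain a where a: "0 \<le> a" "AE w in M. AE s in lborel. s \<in> {0..T} \<longrightarrow> norm (Z' s w) \<le> a"
    using regular_solutionD(6)[OF R'] by blast
  obtain C where C: "AE w in M. \<forall>t\<in>{0..T}. \<bar>V' t w\<bar> \<le> C"
    using regular_solution_bounded[OF R' \<xi>'] by blast
  show ?thesis
  proof (rule regular_solution_compare[OF R \<xi>(1) _ I' Zp _ adapted[OF Vp[unfolded predictable_def]]])
    show "AE w in M. \<xi> w \<le> V' T w"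
      using eq \<xi>(2)
    proof eventually_elim
      case (elim w)
      show ?case using path_equation_terminal[where \<xi>=\<xi>' and V=V' and Z=Z' and I=I' and w=w, OF elim(1)] elim(2) by simp
    qed
    show "AE w in M. sqint Z' w < \<infinity>"
      using a(2) by eventually_elim (rule le_less_trans[OF sqint_bound], auto)
    show "AE w in M. \<forall>t\<in>{0..T}. - C \<le> V' t w"
      using C by eventually_elim (auto simp: abs_le_iff)
    show "AE w in M. \<forall>t\<in>{0..<T}. ((\<lambda>s. V' s w) \<longlongrightarrow> V' t w) (at_right t)"
      using AE_space by eventually_elim (intro ballI continuous_on_at_right[where T=T] Vc)
    show "AE w in M. set_integrable lborel {0..T} (\<lambda>r. drift V' Z' r w) \<and>
      (\<forall>r\<in>{0..T}. drift V' Z' r w \<le> drift V' Z' r w) \<and>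
      (\<forall>s t. 0 \<le> s \<longrightarrow> s \<le> t \<longrightarrow> t \<le> T \<longrightarrow> V' t w + (LINT r:{s..t}|lborel. drift V' Z' r w) - (I' t w - I' s w) \<le> V' s w)"
      using eq
    proof eventually_elim
      case (elim w)
      have "V' t w + (LINT r:{s..t}|lborel. drift V' Z' r w) - (I' t w - I' s w) \<le> V' s w" if st: "0 \<le> s" "s \<le> t" "t \<le> T" for s t
        using path_equation_increment[where \<xi>=\<xi>' and V=V' and Z=Z' and I=I' and w=w, OF elim st] by simp
      then show ?case using elim by blast
    qed
  qed
qed

text \<open>A bound independent of the solution, by comparison with the deterministic barrier
  \<open>u t = a * exp (k * (T - t))\<close> and zero integrand: since
  \<open>c0 \<le> a \<le> u\<close>, one has \<open>c0 + K * u \<le> (K + 1) * u\<close>, which is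
  minus the derivative of \<open>u\<close>.\<close>

lemma regular_solution_upper_bound:
  obtains C where "\<And>\<xi> V Z I. regular_solution \<xi> V Z I \<Longrightarrow> AE w in M. \<bar>\<xi> w\<bar> \<le> c \<Longrightarrow> AE w in M. \<forall>t\<in>{0..T}. V t w \<le> C"
proof -
  obtain c0 where c0: "0 \<le> c0" "\<And>t w y z. t \<in> {0..T} \<Longrightarrow> w \<in> path_space T \<Longrightarrow> norm z \<le> 0 \<Longrightarrow> \<bar>f t w y z\<bar> \<le> c0 + K * \<bar>y\<bar>"
    using driver_bounded_growth[of 0] by auto
  define k where "k = K + 1"
  define a where "a = \<bar>c\<bar> + c0"
  have k: "0 < k" and a: "0 \<le> a" using K c0(1) by (auto simp: k_def a_def)
  define u where "u t = a * exp (k * (T - t))" for t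
  have ua: "a \<le> u t" if "t \<le> T" for t
    using mult_left_mono[of 1 "exp (k * (T - t))" a] that k a by (simp add: u_def)
  show thesis
  proof (rule that)
    fix \<xi> V Z I assume R: "regular_solution \<xi> V Z I" and \<xi>: "AE w in M. \<bar>\<xi> w\<bar> \<le> c"
    have "AE w in M. \<forall>t\<in>{0..T}. V t w \<le> u t"
    proof (rule regular_solution_compare[OF R \<xi> _ ito_zero predictable_const])
      show "AE w in M. \<xi> w \<le> u T" using \<xi> by eventually_elim (use c0(1) in \<open>auto simp: u_def a_def\<close>)
      show "AE w in M. sqint (\<lambda>t w. 0) w < \<infinity>" by (simp add: qv_def)
      show "(\<lambda>w. u t) \<in> borel_measurable (F t)" for t by simp
      show "AE w in M. \<forall>t\<in>{0..T}. - 0 \<le> u t" using a by (simp add: u_def)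
      show "AE w in M. \<forall>t\<in>{0..<T}. (u \<longlongrightarrow> u t) (at_right t)"
        unfolding u_def by (intro AE_I2 ballI continuous_on_at_right continuous_intros) auto
      show "AE w in M. set_integrable lborel {0..T} (\<lambda>r. a * (k * exp (k * (T - r)))) \<and>
        (\<forall>r\<in>{0..T}. drift (\<lambda>t w. u t) (\<lambda>t w. 0) r w \<le> a * (k * exp (k * (T - r)))) \<and>
        (\<forall>s t. 0 \<le> s \<longrightarrow> s \<le> t \<longrightarrow> t \<le> T \<longrightarrow> u t + (LINT r:{s..t}|lborel. a * (k * exp (k * (T - r)))) - (0 - 0) \<le> u s)"
        using AE_space
      proof eventually_elim
        case (elim w)
        have "set_integrable lborel {0..T} (\<lambda>r. a * (k * exp (k * (T - r))))"
          by (intro set_integrable_mult_right integral_exp_decreasing k less_imp_le[OF T_pos])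
        moreover have "drift (\<lambda>t w. u t) (\<lambda>t w. 0) r w \<le> a * (k * exp (k * (T - r)))" if r: "r \<in> {0..T}" for r
        proof -
          have "\<bar>f r (sample_path T W w) (u r) 0\<bar> \<le> c0 + K * \<bar>u r\<bar>"
            by (rule c0(2)[OF r sample_path_in[OF elim]]) simp
          moreover have "c0 \<le> u r" "0 \<le> u r" using ua[of r] r a by (auto simp: a_def)
          ultimately have "f r (sample_path T W w) (u r) 0 \<le> k * u r" by (simp add: k_def distrib_right)
          then show ?thesis by (simp add: u_def mult.left_commute)
        qed
        moreover have "u t + (LINT r:{s..t}|lborel. a * (k * exp (k * (T - r)))) - (0 - 0) \<le> u s" if "0 \<le> s" "s \<le> t" "t \<le> T" for s t
          using integral_exp_decreasing(2)[OF that(2) k, of T] by (simp add: u_def right_diff_distrib)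
        ultimately show ?case by blast
      qed
    qed
    then show "AE w in M. \<forall>t\<in>{0..T}. V t w \<le> a * exp (k * T)"
    proof eventually_elim
      case (elim w)
      show ?case
      proof
        fix t assume t: "t \<in> {0..T}"
        have "V t w \<le> u t" using elim t by blast
        also have "\<dots> \<le> a * exp (k * T)" unfolding u_def using t k a by (intro mult_left_mono) auto
        finally show "V t w \<le> a * exp (k * T)" .
      qed
    qed
  qed
qed

text \<open>Apply \<open>energy\<close> with density \<open>drift V Z s w + m\<close>. Its tail
  integral minus the Ito increment is \<open>V u w - V T w + m * (T - u)\<close>, hence
  \<open>L = 2 * c + m * T\<close>. The constant involves the bound on \<open>V\<close> and the
  lower bound of the driver, but not the bound on \<open>Z\<close>, so it is uniform over the
  approximating solutions.\<close>

lemma regular_solution_energy: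
  assumes c: "0 \<le> c"
  obtains C where "0 \<le> C" "\<And>\<xi> V Z I t B. regular_solution \<xi> V Z I \<Longrightarrow> AE w in M. \<forall>t\<in>{0..T}. \<bar>V t w\<bar> \<le> c \<Longrightarrow>
    t \<in> {0..T} \<Longrightarrow> B \<in> sets (F t) \<Longrightarrow> energy_bound Z t B C"
proof -
  obtain m where m: "0 \<le> m" "\<And>t w y z. t \<in> {0..T} \<Longrightarrow> w \<in> path_space T \<Longrightarrow> \<bar>y\<bar> \<le> c \<Longrightarrow> - m \<le> f t w y z"
    using driver_lower_bound[OF c] by blast
  define L where "L = 2 * c + m * T"
  have L: "0 \<le> L" using c m T_pos by (simp add: L_def)
  show thesis
  proof (rule that[of "6 * L\<^sup>2"])
    fix \<xi> V Z I t B assume R: "regular_solution \<xi> V Z I" and V: "AE w in M. \<forall>t\<in>{0..T}. \<bar>V t w\<bar> \<le> c"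
      and t: "t \<in> {0..T}" and B: "B \<in> sets (F t)"
    note Vp = regular_solutionD(1)[OF R] and Zp = regular_solutionD(2)[OF R] and I = regular_solutionD(3)[OF R] and eq = regular_solutionD(5)[OF R]
    obtain a where a: "0 \<le> a" "AE w in M. AE s in lborel. s \<in> {0..T} \<longrightarrow> norm (Z s w) \<le> a"
      using regular_solutionD(6)[OF R] by blast
    show "(\<E> w. indicator B w * qv_from Z t w) \<le> ennreal (6 * L\<^sup>2) * emeasure P B"
    proof (rule energy[OF I Zp _ _ _ L _ t B, where k="a\<^sup>2 * T" and b="\<lambda>s w. ennreal (drift V Z s w + m)"])
      show "0 \<le> a\<^sup>2 * T" using T_pos by simp
      show "AE w in M. sqint Z w \<le> ennreal (a\<^sup>2 * T)" using a(2) by eventually_elim (rule sqint_bound)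
      show "(\<lambda>(s, w). ennreal (drift V Z s w + m)) \<in> borel_measurable pred"
        using driver_pred[OF drv Vp Zp] unfolding split_beta'
        by (intro measurable_compose[OF _ measurable_ennreal] borel_measurable_add borel_measurable_const)
      fix u assume u: "u \<in> {0..T}"
      show "AE w in M. \<exists>r\<ge>0. (\<integral>\<^sup>+ s \<in> {u..T}. ennreal (drift V Z s w + m) \<partial>lborel) = ennreal r \<and> \<bar>r - (I T w - I u w)\<bar> \<le> L"
        using eq V AE_space
      proof eventually_elim
        case (elim w)
        have i: "set_integrable lborel {u..T} (\<lambda>s. drift V Z s w)"
          using u by (intro set_integrable_subset[OF conjunct1[OF elim(1)]]) auto
        have im: "set_integrable lborel {u..T} (\<lambda>s. m)"
          unfolding set_integrable_def by (intro borel_integrable_compact) auto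
        have nn: "0 \<le> drift V Z s w + m" if "s \<in> {u..T}" for s
        proof -
          have "s \<in> {0..T}" using that u by auto
          then have "- m \<le> drift V Z s w" using elim(2) by (intro m sample_path_in elim(3)) blast+
          then show ?thesis by linarith
        qed
        define r where "r = (LINT s:{u..T}|lborel. drift V Z s w + m)"
        have "(\<integral>\<^sup>+ s \<in> {u..T}. ennreal (drift V Z s w + m) \<partial>lborel) = (\<integral>\<^sup>+ s. ennreal (indicator {u..T} s *\<^sub>R (drift V Z s w + m)) \<partial>lborel)"
          by (intro nn_integral_cong) (auto simp: indicator_def)
        also have "\<dots> = ennreal r"
          unfolding r_def set_lebesgue_integral_def
        proof (rule nn_integral_eq_integral)
          show "integrable lborel (\<lambda>s. indicator {u..T} s *\<^sub>R (drift V Z s w + m))"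
            using set_integral_add(1)[OF i im] by (simp only: set_integrable_def)
          show "AE s in lborel. 0 \<le> indicator {u..T} s *\<^sub>R (drift V Z s w + m)"
            using nn by (intro AE_I2) (auto simp: indicator_def)
        qed
        finally have e1: "(\<integral>\<^sup>+ s \<in> {u..T}. ennreal (drift V Z s w + m) \<partial>lborel) = ennreal r" .
        have r0: "0 \<le> r" unfolding r_def set_lebesgue_integral_def
          using nn by (intro integral_nonneg_AE AE_I2) (auto simp: indicator_def)
        have "r = (LINT s:{u..T}|lborel. drift V Z s w) + (LINT s:{u..T}|lborel. m)"
          unfolding r_def by (rule set_integral_add(2)[OF i im])
        moreover have "(LINT s:{u..T}|lborel. m) = m * (T - u)" using u by (simp add: set_lebesgue_integral_def)
        moreover have "0 \<le> m * (T - u)" "m * (T - u) \<le> m * T" using u m(1) by (auto intro: mult_left_mono)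
        moreover have "V u w = V T w + (LINT s:{u..T}|lborel. drift V Z s w) - (I T w - I u w)"
          using u by (intro path_equation_increment[where \<xi>=\<xi> and V=V and Z=Z and I=I and w=w, OF elim(1)]) auto
        moreover have "\<bar>V T w\<bar> \<le> c" "\<bar>V u w\<bar> \<le> c" using elim(2) u T_pos by auto
        ultimately have "\<bar>r - (I T w - I u w)\<bar> \<le> L" unfolding L_def by linarith
        with e1 r0 show ?case by blast
      qed
    qed
  qed simp
qed

end

section \<open>Square integrable limits of convex combinations\<close>

lemma geometric_increments_converge:
  fixes x :: "nat \<Rightarrow> 'b::banach"
  assumes d: "\<And>n. norm (x (Suc n) - x n) \<le> s * (1/2) ^ n"
  shows "convergent x" "norm (x n - lim x) \<le> 2 * s * (1/2) ^ n"
proof -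
  have s: "0 \<le> s" using d[of 0] norm_ge_zero[of "x (Suc 0) - x 0"] by (simp del: norm_ge_zero)
  have "summable (\<lambda>n. s * (1/2 :: real) ^ n)" by (intro summable_mult summable_geometric) simp
  then have "summable (\<lambda>n. x (Suc n) - x n)" by (rule summable_comparison_test'[where N=0]) (rule d)
  then have "convergent (\<lambda>n. \<Sum>k<n. x (Suc k) - x k)" by (rule summable_iff_convergent[THEN iffD1])
  then have "convergent (\<lambda>n. x n - x 0)" by (simp only: sum_lessThan_telescope)
  from convergent_add[OF this convergent_const[of "x 0"]] show c: "convergent x" by simp
  have le: "norm (x (n + m) - x n) \<le> 2 * s * (1/2) ^ n - 2 * s * (1/2) ^ (n + m)" for m
  proof (induction m)
    case (Suc m)
    have "norm (x (n + Suc m) - x n) \<le> norm (x (Suc (n + m)) - x (n + m)) + norm (x (n + m) - x n)"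
      using norm_triangle_ineq[of "x (Suc (n + m)) - x (n + m)" "x (n + m) - x n"] by simp
    also have "\<dots> \<le> s * (1/2) ^ (n + m) + (2 * s * (1/2) ^ n - 2 * s * (1/2) ^ (n + m))"
      by (intro add_mono d Suc.IH)
    finally show ?case by simp
  qed simp
  have "(\<lambda>m. norm (x n - x (m + n))) \<longlonglongrightarrow> norm (x n - lim x)"
    using c by (intro tendsto_intros LIMSEQ_ignore_initial_segment) (simp add: convergent_LIMSEQ_iff)
  moreover have "norm (x n - x (m + n)) \<le> 2 * s * (1/2) ^ n" for m
    using le[of m] s by (simp add: norm_minus_commute add.commute) (smt (verit) zero_le_power mult_nonneg_nonneg zero_le_divide_1_iff)
  ultimately show "norm (x n - lim x) \<le> 2 * s * (1/2) ^ n"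
    by (intro LIMSEQ_le_const2) auto
qed

text \<open>Weighted with \<open>4 ^ n\<close>, the squared increments still have integrals at most
  \<open>(1/2) ^ n\<close>, and their sum \<open>S\<close> controls all increments at once: where
  \<open>S\<close> is finite, the increments decay geometrically.\<close>

lemma fast_L2_limit:
  fixes x :: "nat \<Rightarrow> 'c \<Rightarrow> 'b::{banach, second_countable_topology}"
  assumes x: "\<And>n. x n \<in> borel_measurable N"
    and d: "\<And>n. (\<integral>\<^sup>+ w. sqnorm (x (Suc n) w - x n w) \<partial>N) \<le> ennreal ((1/8) ^ n)"
  obtains S :: "'c \<Rightarrow> ennreal" where "S \<in> borel_measurable N" "(\<integral>\<^sup>+ w. S w \<partial>N) < \<infinity>"
    "\<And>w. S w < \<infinity> \<Longrightarrow> convergent (\<lambda>n. x n w)"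
    "\<And>w n. S w < \<infinity> \<Longrightarrow> sqnorm (x n w - lim (\<lambda>n. x n w)) \<le> ennreal (4 * (1/4) ^ n) * S w"
proof -
  define S where "S w = (\<Sum>n. ennreal (4 ^ n) * sqnorm (x (Suc n) w - x n w))" for w
  have dm: "(\<lambda>w. sqnorm (x (Suc n) w - x n w)) \<in> borel_measurable N" for n
    using x by measurable
  have Sm: "S \<in> borel_measurable N" unfolding S_def using dm by measurable
  have "(\<integral>\<^sup>+ w. S w \<partial>N) = (\<Sum>n. ennreal (4 ^ n) * (\<integral>\<^sup>+ w. sqnorm (x (Suc n) w - x n w) \<partial>N))"
    unfolding S_def using dm by (subst nn_integral_suminf) (auto intro!: suminf_cong nn_integral_cmult)
  also have "\<dots> \<le> (\<Sum>n. ennreal (4 ^ n) * ennreal ((1/8) ^ n))" by (intro suminf_le mult_left_mono d) auto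
  also have "\<dots> = (\<Sum>n. ennreal ((1/2) ^ n))"
    by (intro suminf_cong) (simp add: ennreal_mult[symmetric] power_mult_distrib[symmetric])
  also have "\<dots> = ennreal (\<Sum>n. (1/2) ^ n)" by (intro suminf_ennreal2) (auto intro: summable_geometric)
  also have "\<dots> < \<infinity>" by simp
  finally have Sf: "(\<integral>\<^sup>+ w. S w \<partial>N) < \<infinity>" .
  have four: "(2 ^ n)\<^sup>2 = (4 :: real) ^ n" "((1/2) ^ n)\<^sup>2 = (1/4 :: real) ^ n" for n
    by (simp_all add: power2_eq_square power_mult_distrib[symmetric])
  have inc: "norm (x (Suc n) w - x n w) \<le> sqrt (enn2real (S w)) * (1/2) ^ n" if S: "S w < \<infinity>" for n w
  proof -
    have "ennreal (4 ^ n) * sqnorm (x (Suc n) w - x n w) \<le> S w"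
      unfolding S_def using sum_le_suminf[of "\<lambda>n. ennreal (4 ^ n) * sqnorm (x (Suc n) w - x n w)" "{n}"] by simp
    also have "S w = ennreal (enn2real (S w))" using S by simp
    finally have "(2 ^ n * norm (x (Suc n) w - x n w))\<^sup>2 \<le> enn2real (S w)"
      using four by (simp add: ennreal_mult[symmetric] power_mult_distrib)
    then have "2 ^ n * norm (x (Suc n) w - x n w) \<le> sqrt (enn2real (S w))" by (rule real_le_rsqrt)
    then show ?thesis by (simp add: field_simps power_one_over)
  qed
  show thesis
  proof (rule that[OF Sm Sf])
    fix w assume S: "S w < \<infinity>"
    show "convergent (\<lambda>n. x n w)" by (rule geometric_increments_converge(1)[OF inc[OF S]])
    fix n
    have "(norm (x n w - lim (\<lambda>n. x n w)))\<^sup>2 \<le> (2 * sqrt (enn2real (S w)) * (1/2) ^ n)\<^sup>2"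
      by (intro power_mono geometric_increments_converge(2)[OF inc[OF S]]) simp
    also have "\<dots> = 4 * (1/4) ^ n * enn2real (S w)"
      by (simp only: power_mult_distrib four) simp
    finally have "sqnorm (x n w - lim (\<lambda>n. x n w)) \<le> ennreal (4 * (1/4) ^ n * enn2real (S w))"
      by (rule ennreal_leI)
    also have "\<dots> = ennreal (4 * (1/4) ^ n) * S w" using S by (simp add: ennreal_mult)
    finally show "sqnorm (x n w - lim (\<lambda>n. x n w)) \<le> ennreal (4 * (1/4) ^ n) * S w" .
  qed
qed

text \<open>The infimum \<open>a n\<close> of the squared norms over \<open>H n\<close> increases to
  a finite limit \<open>L\<close>. Two nearly minimal elements taken far enough out have a midpoint
  with squared norm still at least \<open>a j\<close>, so the parallelogram law makes their distance
  small. The choice \<open>k n \<ge> n\<close> keeps \<open>x n\<close> in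
  \<open>H n\<close>.\<close>

lemma midpoint_L2_selection:
  fixes H :: "nat \<Rightarrow> ('c \<Rightarrow> 'b::{real_inner, second_countable_topology}) set"
  assumes m: "\<And>n x. x \<in> H n \<Longrightarrow> x \<in> borel_measurable N"
    and bd: "\<And>n x. x \<in> H n \<Longrightarrow> (\<integral>\<^sup>+ w. sqnorm (x w) \<partial>N) \<le> ennreal C"
    and ne: "\<And>n. H n \<noteq> {}" and dec: "\<And>n. H (Suc n) \<subseteq> H n"
    and mid: "\<And>n x y. x \<in> H n \<Longrightarrow> y \<in> H n \<Longrightarrow> (\<lambda>w. (1/2) *\<^sub>R (x w + y w)) \<in> H n"
  obtains x where "\<And>n. x n \<in> H n"
    "\<And>n. (\<integral>\<^sup>+ w. sqnorm (x (Suc n) w - x n w) \<partial>N) \<le> ennreal ((1/8) ^ n)"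
proof -
  define q where "q x = (\<integral>\<^sup>+ w. sqnorm (x w) \<partial>N)" for x :: "'c \<Rightarrow> 'b"
  have H_mono: "H n \<subseteq> H k" if "k \<le> n" for k n using lift_Suc_antimono_le[of H, OF dec that] .
  define a where "a n = (INF x\<in>H n. enn2real (q x))" for n
  have bdd: "bdd_below ((\<lambda>x. enn2real (q x)) ` H n)" for n by (intro bdd_belowI[of _ 0]) auto
  have fin: "q x = ennreal (enn2real (q x))" if "x \<in> H n" for n x
    using le_less_trans[OF bd[OF that] ennreal_less_top] by (simp add: q_def)
  have a_le: "a n \<le> enn2real (q x)" if "x \<in> H n" for n x unfolding a_def by (rule cINF_lower[OF bdd that])
  have a_mono: "incseq a"
    unfolding a_def incseq_def using H_mono by (intro allI impI cINF_superset_mono ne bdd) auto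
  have "a n \<le> \<bar>C\<bar>" for n
  proof -
    obtain x where x: "x \<in> H n" using ne by blast
    have "enn2real (q x) \<le> enn2real (ennreal \<bar>C\<bar>)"
      using bd[OF x] by (intro enn2real_mono) (auto simp: q_def intro: order_trans ennreal_leI)
    then show ?thesis using a_le[OF x] by simp
  qed
  then obtain L where L: "a \<longlonglongrightarrow> L" "\<And>n. a n \<le> L" using incseq_convergent[OF a_mono] by blast
  \<comment> \<open>The parallelogram law loses a factor 8: it bounds the squared distance by
    \<open>8 * e n\<close>.\<close>
  define e where "e n = (1/8 :: real) ^ n / 8" for n
  have e: "0 < e n" "e (Suc n) \<le> e n" for n by (auto simp: e_def)
  have "\<exists>k x. n \<le> k \<and> L - e n < a k \<and> x \<in> H k \<and> enn2real (q x) < L + e n" for n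
  proof -
    have "\<forall>\<^sub>F k in sequentially. L - e n < a k" using L(1) e by (intro order_tendstoD(1)) auto
    then obtain k0 where k0: "\<And>k. k0 \<le> k \<Longrightarrow> L - e n < a k" unfolding eventually_sequentially by blast
    define k where "k = max k0 n"
    have "a k < L + e n" using L(2)[of k] e[of n] by linarith
    then obtain x where "x \<in> H k" "enn2real (q x) < L + e n" unfolding a_def using cINF_less_iff[OF ne bdd] by blast
    then show ?thesis using k0[of k] by (intro exI[of _ k] exI[of _ x]) (simp add: k_def)
  qed
  then obtain k x where kx: "\<And>n. n \<le> k n" "\<And>n. L - e n < a (k n)" "\<And>n. x n \<in> H (k n)" "\<And>n. enn2real (q (x n)) < L + e n" by metis
  have "(\<integral>\<^sup>+ w. sqnorm (x (Suc n) w - x n w) \<partial>N) \<le> ennreal ((1/8) ^ n)" for n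
  proof -
    define j where "j = min (k n) (k (Suc n))"
    let ?x = "x (Suc n)" and ?y = "x n"
    let ?m = "\<lambda>w. (1/2) *\<^sub>R (?x w + ?y w)"
    have j: "?x \<in> H j" "?y \<in> H j" using subsetD[OF H_mono kx(3)] by (auto simp: j_def)
    note mj = mid[OF j]
    have xm: "?x \<in> borel_measurable N" "?y \<in> borel_measurable N" "?m \<in> borel_measurable N" using m[OF j(1)] m[OF j(2)] m[OF mj] by auto
    have aj: "L - e n < a j" using kx(2)[of n] kx(2)[of "Suc n"] e[of n] by (auto simp: j_def min_def)
    have par: "(norm (u - v))\<^sup>2 + 4 * (norm ((1/2) *\<^sub>R (u + v)))\<^sup>2 = 2 * (norm u)\<^sup>2 + 2 * (norm v)\<^sup>2" for u v :: 'b
    proof -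
      have "4 * (norm ((1/2) *\<^sub>R (u + v)))\<^sup>2 = (norm (u + v))\<^sup>2" by (simp add: power_divide)
      then show ?thesis
        by (simp add: power2_norm_eq_inner inner_add_left inner_add_right inner_diff_left inner_diff_right inner_commute)
    qed
    let ?D = "\<integral>\<^sup>+ w. sqnorm (?x w - ?y w) \<partial>N"
    have "?D + 4 * q ?m = (\<integral>\<^sup>+ w. sqnorm (?x w - ?y w) + 4 * sqnorm (?m w) \<partial>N)"
      unfolding q_def using xm by (subst nn_integral_cmult[symmetric], measurable, subst nn_integral_add, measurable)
    also have "\<dots> = (\<integral>\<^sup>+ w. 2 * sqnorm (?x w) + 2 * sqnorm (?y w) \<partial>N)"
    proof (rule nn_integral_cong)
      fix w
      have "sqnorm (?x w - ?y w) + 4 * sqnorm (?m w) = ennreal ((norm (?x w - ?y w))\<^sup>2 + 4 * (norm (?m w))\<^sup>2)"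
        by (subst ennreal_plus) (auto simp: ennreal_mult'')
      also have "\<dots> = 2 * sqnorm (?x w) + 2 * sqnorm (?y w)"
        unfolding par by (subst ennreal_plus) (auto simp: ennreal_mult'')
      finally show "sqnorm (?x w - ?y w) + 4 * sqnorm (?m w) = \<dots>" .
    qed
    also have "\<dots> = 2 * q ?x + 2 * q ?y"
      unfolding q_def using xm by (subst nn_integral_add, measurable, subst (1 2) nn_integral_cmult, measurable)
    also have "\<dots> = ennreal (2 * enn2real (q ?x) + 2 * enn2real (q ?y))"
      by (subst fin[OF j(1)], subst fin[OF j(2)]) (simp add: ennreal_plus ennreal_mult'')
    also have "\<dots> \<le> ennreal (4 * L + 4 * e n)"
      using kx(4)[of n] kx(4)[of "Suc n"] e(2)[of n] by (intro ennreal_leI) linarith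
    finally have "?D + ennreal (4 * a j) \<le> ennreal (4 * L + 4 * e n)"
    proof (rule order_trans[rotated])
      have "ennreal (4 * a j) \<le> ennreal (4 * enn2real (q ?m))" using a_le[OF mj] by (intro ennreal_leI) simp
      also have "\<dots> = 4 * q ?m" by (subst (2) fin[OF mj]) (simp add: ennreal_mult'')
      finally show "?D + ennreal (4 * a j) \<le> ?D + 4 * q ?m" by (rule add_left_mono)
    qed
    moreover have "ennreal (4 * L + 4 * e n) \<le> ennreal (8 * e n) + ennreal (4 * a j)"
      using aj e(1)[of n] by (cases "0 \<le> a j") (auto simp: ennreal_plus[symmetric] ennreal_neg simp del: ennreal_plus intro!: ennreal_leI)
    ultimately have "?D + ennreal (4 * a j) \<le> ennreal (8 * e n) + ennreal (4 * a j)" by (rule order_trans)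
    then have "?D \<le> ennreal (8 * e n)" by (simp add: ennreal_add_left_cancel_le add.commute)
    then show ?thesis by (simp add: e_def)
  qed
  then show thesis by (rule that[OF subsetD[OF H_mono[OF kx(1)] kx(3)]])
qed

context brownian_setup
begin

text \<open>The selection takes place among square integrable functions on the product of time and
  \<open>P\<close>. The predicate \<open>R n\<close> may hide further data in existential
  quantifiers, and midpoints are the only convex combinations it has to admit.\<close>

lemma L2_selection:
  assumes p: "\<And>n z. R n z \<Longrightarrow> predictable M T W z"
    and bd: "\<And>n z. R n z \<Longrightarrow> (\<E> w. sqint z w) \<le> ennreal C"
    and ne: "\<And>n. \<exists>z. R n z" and dec: "\<And>n z. R (Suc n) z \<Longrightarrow> R n z"
    and mid: "\<And>n z z'. R n z \<Longrightarrow> R n z' \<Longrightarrow> R n (\<lambda>s w. (1/2) *\<^sub>R (z s w + z' s w))"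
  obtains z Z where "\<And>n. R n (z n)" "predictable M T W Z"
    "tendsto_0_in_prob P (\<lambda>n. sqint (\<lambda>s w. z n s w - Z s w))"
    "AE w in M. AE s in lborel. s \<in> {0..T} \<longrightarrow> (\<lambda>n. z n s w) \<longlonglongrightarrow> Z s w"
proof -
  interpret pair_sigma_finite "lborel :: real measure" P
    by (rule pair_sigma_finite.intro) unfold_locales
  let ?N = "(lborel :: real measure) \<Otimes>\<^sub>M P"
  \<comment> \<open>Extension by zero, since predictability concerns times in \<open>{0..T}\<close>
    only.\<close>
  define ext where "ext z x = (if fst x \<in> {0..T} then z (fst x) (snd x) else 0)" for z :: "real \<Rightarrow> 'a \<Rightarrow> real ^ 'd" and x
  have extm: "ext z \<in> borel_measurable ?N" if "R n z" for n z
    using joint_measurable[OF p[OF that, unfolded predictable_def], of 0] unfolding ext_def split_beta' by simp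
  have sq: "(\<integral>\<^sup>+ x. sqnorm (ext z x) \<partial>?N) = (\<E> w. sqint z w)" if "R n z" for n z
  proof -
    have "(\<lambda>x. sqnorm (ext z x)) \<in> borel_measurable ?N" using extm[OF that] by measurable
    from nn_integral_snd[OF this]
    have "(\<integral>\<^sup>+ x. sqnorm (ext z x) \<partial>?N) = (\<E> w. (\<integral>\<^sup>+ s. sqnorm (ext z (s, w)) \<partial>lborel))" by simp
    also have "(\<lambda>w. \<integral>\<^sup>+ s. sqnorm (ext z (s, w)) \<partial>lborel) = sqint z"
      unfolding qv_def ext_def by (intro ext nn_integral_cong) (simp add: indicator_def)
    finally show ?thesis .
  qed
  obtain x where x: "\<And>n. x n \<in> ext ` {z. R n z}"
    and fast: "\<And>n. (\<integral>\<^sup>+ w. sqnorm (x (Suc n) w - x n w) \<partial>?N) \<le> ennreal ((1/8) ^ n)"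
  proof (rule midpoint_L2_selection[of "\<lambda>n. ext ` {z. R n z}" ?N C])
    show "x \<in> borel_measurable ?N" if "x \<in> ext ` {z. R n z}" for n x using that extm by auto
    show "(\<integral>\<^sup>+ w. sqnorm (x w) \<partial>?N) \<le> ennreal C" if "x \<in> ext ` {z. R n z}" for n x
      using that sq bd by auto
    show "ext ` {z. R n z} \<noteq> {}" for n using ne[of n] by auto
    show "ext ` {z. R (Suc n) z} \<subseteq> ext ` {z. R n z}" for n using dec by auto
    show "(\<lambda>w. (1/2) *\<^sub>R (x w + y w)) \<in> ext ` {z. R n z}" if xy: "x \<in> ext ` {z. R n z}" "y \<in> ext ` {z. R n z}" for n x y
    proof -
      obtain z z' where z: "R n z" "R n z'" "x = ext z" "y = ext z'" using xy by auto
      have "(\<lambda>w. (1/2) *\<^sub>R (x w + y w)) = ext (\<lambda>s w. (1/2) *\<^sub>R (z s w + z' s w))"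
        unfolding z ext_def by (rule HOL.ext) simp
      then show ?thesis using mid[OF z(1,2)] by auto
    qed
  qed (rule that)
  from x have "\<forall>n. \<exists>z. R n z \<and> x n = ext z" by auto
  then obtain z where z: "\<And>n. R n (z n)" "\<And>n. x n = ext (z n)" by metis
  have xm: "x n \<in> borel_measurable ?N" for n unfolding z(2) by (rule extm[OF z(1)])
  obtain S where S: "S \<in> borel_measurable ?N" "(\<integral>\<^sup>+ w. S w \<partial>?N) < \<infinity>"
    "\<And>w. S w < \<infinity> \<Longrightarrow> convergent (\<lambda>n. x n w)"
    "\<And>w n. S w < \<infinity> \<Longrightarrow> sqnorm (x n w - lim (\<lambda>n. x n w)) \<le> ennreal (4 * (1/4) ^ n) * S w"
    by (rule fast_L2_limit[OF xm fast]) (rule that)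
  \<comment> \<open>A limit at every point and not an equivalence class, so that predictability is
    inherited.\<close>
  define Z where "Z s w = lim (\<lambda>n. z n s w)" for s w
  have Zp: "predictable M T W Z"
    unfolding predictable_def Z_def split_beta'
    by (intro borel_measurable_lim_metric) (use p[OF z(1)] in \<open>simp add: predictable_def split_beta'\<close>)
  have xz: "x n (s, w) = z n s w" if "s \<in> {0..T}" for n s w using that by (simp add: z(2) ext_def)
  have "(\<E> w. (\<integral>\<^sup>+ s. S (s, w) \<partial>lborel)) \<noteq> \<infinity>" using nn_integral_snd[OF S(1)] S(2) by simp
  moreover have "(\<lambda>w. \<integral>\<^sup>+ s. S (s, w) \<partial>lborel) \<in> borel_measurable P" by (rule lborel.borel_measurable_nn_integral[OF measurable_pair_swap[OF S(1)]])
  ultimately have "AE w in P. (\<integral>\<^sup>+ s. S (s, w) \<partial>lborel) \<noteq> \<infinity>" by (intro nn_integral_PInf_AE)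
  then have good: "AE w in M. (AE s in lborel. S (s, w) < \<infinity>) \<and> (\<integral>\<^sup>+ s. S (s, w) \<partial>lborel) < \<infinity>"
    unfolding AE_P using AE_space
  proof eventually_elim
    case (elim w)
    have "(\<lambda>s. S (s, w)) \<in> borel_measurable lborel" using measurable_compose[OF measurable_Pair2'[of w P lborel] S(1)] elim(2) by simp
    from nn_integral_PInf_AE[OF this] elim(1) show ?case by (simp add: less_top)
  qed
  show thesis
  proof (rule that[OF z(1) Zp])
    show "AE w in M. AE s in lborel. s \<in> {0..T} \<longrightarrow> (\<lambda>n. z n s w) \<longlonglongrightarrow> Z s w"
      using good
    proof eventually_elim
      case (elim w)
      from conjunct1[OF elim] show ?case
      proof eventually_elim
        case (elim s)
        show ?case
        proof
          assume s: "s \<in> {0..T}"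
          from S(3)[OF elim] show "(\<lambda>n. z n s w) \<longlonglongrightarrow> Z s w"
            unfolding xz[OF s] Z_def by (rule convergent_LIMSEQ_iff[THEN iffD1])
        qed
      qed
    qed
    show "tendsto_0_in_prob P (\<lambda>n. sqint (\<lambda>s w. z n s w - Z s w))"
    proof (rule P.tip_AE)
      show "sqint (\<lambda>s w. z n s w - Z s w) \<in> borel_measurable P" for n
        by (intro sqint_measurable predictable_diff p[OF z(1)] Zp)
      show "AE w in P. (\<lambda>n. sqint (\<lambda>s w. z n s w - Z s w) w) \<longlonglongrightarrow> 0"
        unfolding AE_P using good AE_space
      proof eventually_elim
        case (elim w)
        define J where "J = (\<integral>\<^sup>+ s. S (s, w) \<partial>lborel)"
        have sm: "(\<lambda>s. S (s, w)) \<in> borel_measurable lborel" using measurable_compose[OF measurable_Pair2'[of w P lborel] S(1)] elim(2) by simp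
        have le: "sqint (\<lambda>s w. z n s w - Z s w) w \<le> ennreal (4 * (1/4) ^ n) * J" for n
        proof -
          have "sqint (\<lambda>s w. z n s w - Z s w) w \<le> (\<integral>\<^sup>+ s. ennreal (4 * (1/4) ^ n) * S (s, w) \<partial>lborel)"
            unfolding qv_def
          proof (rule nn_integral_mono_AE)
            show "AE s in lborel. sqnorm (z n s w - Z s w) * indicator {0..T} s \<le> ennreal (4 * (1/4) ^ n) * S (s, w)"
              using conjunct1[OF elim(1)]
            proof eventually_elim
              case (elim s)
              show ?case
              proof (cases "s \<in> {0..T}")
                case True
                from S(4)[OF elim, of n] show ?thesis unfolding xz[OF True] Z_def using True by simp
              qed simp
            qed
          qed
          also have "\<dots> = ennreal (4 * (1/4) ^ n) * J" unfolding J_def by (rule nn_integral_cmult[OF sm])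
          finally show ?thesis .
        qed
        have J: "J = ennreal (enn2real J)" using elim(1) by (simp add: J_def)
        have "(\<lambda>n. 4 * (1/4) ^ n * enn2real J) \<longlonglongrightarrow> 4 * 0 * enn2real J" by (intro tendsto_intros LIMSEQ_power_zero) simp
        then have "(\<lambda>n. ennreal (4 * (1/4) ^ n * enn2real J)) \<longlonglongrightarrow> ennreal 0" by (intro tendsto_ennrealI) simp
        then have "(\<lambda>n. ennreal (4 * (1/4) ^ n) * J) \<longlonglongrightarrow> 0" by (subst J) (simp add: ennreal_mult)
        then show ?case by (rule tendsto_sandwich[OF _ _ tendsto_const, rotated 2]) (simp_all add: le)
      qed
    qed
  qed
qed

end

section \<open>Passage to the limit\<close>

text \<open>Fatou's lemma under majorants that vary with \<open>n\<close> and need not converge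
  pointwise; only their integrals converge.\<close>

lemma integral_fatou_le:
  fixes g :: "'c \<Rightarrow> real"
  assumes \<phi>: "\<And>n. integrable N (\<phi> n)" "(\<lambda>n. integral\<^sup>L N (\<phi> n)) \<longlonglongrightarrow> l"
    and m: "\<And>n. gn n \<in> borel_measurable N" "g \<in> borel_measurable N"
    and gn: "\<And>n x. 0 \<le> gn n x" "\<And>n. AE x in N. gn n x \<le> \<phi> n x"
    and lim: "AE x in N. (\<lambda>n. gn n x) \<longlonglongrightarrow> g x"
  shows "integrable N g" "integral\<^sup>L N g \<le> l"
proof -
  have int: "(\<integral>\<^sup>+ x. ennreal (gn n x) \<partial>N) \<le> ennreal (integral\<^sup>L N (\<phi> n))" for n
  proof -
    have "(\<integral>\<^sup>+ x. ennreal (gn n x) \<partial>N) \<le> (\<integral>\<^sup>+ x. ennreal (\<phi> n x) \<partial>N)"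
      using gn(2)[of n] by (intro nn_integral_mono_AE) (auto elim!: eventually_mono intro: ennreal_leI)
    also have "\<dots> = ennreal (integral\<^sup>L N (\<phi> n))"
    proof (rule nn_integral_eq_integral[OF \<phi>(1)])
      show "AE x in N. 0 \<le> \<phi> n x" using gn(2)[of n] by eventually_elim (rule order_trans[OF gn(1)])
    qed
    finally show ?thesis .
  qed
  have g0: "AE x in N. 0 \<le> g x" using lim by eventually_elim (rule LIMSEQ_le_const, auto simp: gn(1))
  have "(\<integral>\<^sup>+ x. ennreal (g x) \<partial>N) = (\<integral>\<^sup>+ x. liminf (\<lambda>n. ennreal (gn n x)) \<partial>N)"
  proof (rule nn_integral_cong_AE)
    show "AE x in N. ennreal (g x) = liminf (\<lambda>n. ennreal (gn n x))"
      using lim by eventually_elim (rule lim_imp_Liminf[symmetric], auto intro: tendsto_ennrealI)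
  qed
  also have "\<dots> \<le> liminf (\<lambda>n. \<integral>\<^sup>+ x. ennreal (gn n x) \<partial>N)"
    using m(1) by (intro nn_integral_liminf) measurable
  also have "\<dots> \<le> liminf (\<lambda>n. ennreal (integral\<^sup>L N (\<phi> n)))" by (intro Liminf_mono always_eventually allI int)
  also have "\<dots> = ennreal l" by (intro lim_imp_Liminf tendsto_ennrealI \<phi>) simp
  finally have le: "(\<integral>\<^sup>+ x. ennreal (g x) \<partial>N) \<le> ennreal l" .
  have l0: "0 \<le> l"
  proof (rule LIMSEQ_le_const[OF \<phi>(2)], intro exI allI impI)
    show "0 \<le> integral\<^sup>L N (\<phi> n)" for n
    proof (rule integral_nonneg_AE)
      show "AE x in N. 0 \<le> \<phi> n x" using gn(2)[of n] by eventually_elim (rule order_trans[OF gn(1)])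
    qed
  qed
  show i: "integrable N g"
    using le_less_trans[OF le ennreal_less_top] by (intro integrableI_nonneg m g0) simp
  show "integral\<^sup>L N g \<le> l"
    using le l0 unfolding nn_integral_eq_integral[OF i g0] by simp
qed

text \<open>Approaching \<open>t\<close> from the right, \<open>Y\<close> cannot drop, because it
  lies above a continuous \<open>V n\<close> with \<open>V n t\<close> close to \<open>Y t\<close>,
  and cannot jump up, because \<open>Y - h\<close> decreases. From the left, the increasing function
  \<open>h - Y\<close> converges to its supremum.\<close>

lemma rcll_on_increasing_limit:
  fixes Y h :: "real \<Rightarrow> real"
  assumes V: "\<And>n. continuous_on {0..T} (V n)" "\<And>n t. t \<in> {0..T} \<Longrightarrow> V n t \<le> Y t" "\<And>t. t \<in> {0..T} \<Longrightarrow> (\<lambda>n. V n t) \<longlonglongrightarrow> Y t"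
    and h: "continuous_on {0..T} h"
    and dec: "\<And>s t. 0 \<le> s \<Longrightarrow> s \<le> t \<Longrightarrow> t \<le> T \<Longrightarrow> Y t - h t \<le> Y s - h s"
  shows "rcll_on T Y"
  unfolding rcll_on_def
proof (intro conjI ballI)
  fix t assume t: "t \<in> {0..<T}"
  have near: "\<forall>\<^sub>F s in at_right t. s \<in> {t<..<T}" using t by (intro eventually_at_right_real) simp
  show "(Y \<longlongrightarrow> Y t) (at_right t)"
  proof (rule order_tendstoI)
    fix a assume "a < Y t"
    then have "\<forall>\<^sub>F n in sequentially. a < V n t" using V(3)[of t] t by (intro order_tendstoD(1)) auto
    from eventually_happens'[OF sequentially_bot this] obtain n where n: "a < V n t" ..
    have "(V n \<longlongrightarrow> V n t) (at_right t)" by (rule continuous_on_at_right[OF V(1) t])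
    then have "\<forall>\<^sub>F s in at_right t. a < V n s" using n by (rule order_tendstoD(1))
    then show "\<forall>\<^sub>F s in at_right t. a < Y s"
      using near
    proof eventually_elim
      case (elim s)
      have "V n s \<le> Y s" using elim t by (intro V) auto
      then show ?case using elim by linarith
    qed
  next
    fix a assume a: "Y t < a"
    have "((\<lambda>s. Y t - h t + h s) \<longlongrightarrow> Y t - h t + h t) (at_right t)"
      by (intro tendsto_add tendsto_const continuous_on_at_right[OF h t])
    then have "\<forall>\<^sub>F s in at_right t. Y t - h t + h s < a" using a by (intro order_tendstoD(2)) auto
    then show "\<forall>\<^sub>F s in at_right t. Y s < a"
      using near
    proof eventually_elim
      case (elim s)
      have "Y s - h s \<le> Y t - h t" using elim t by (intro dec) auto
      then show ?case using elim by linarith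
    qed
  qed
next
  fix t assume t: "t \<in> {0<..T}"
  define B where "B s = h s - Y s" for s
  have B: "B s \<le> B r" if "0 \<le> s" "s \<le> r" "r \<le> T" for s r using dec[OF that] by (simp add: B_def)
  define l where "l = Sup (B ` {0..<t})"
  have bdd: "bdd_above (B ` {0..<t})" using t by (intro bdd_aboveI[of _ "B t"]) (auto intro!: B)
  have ne: "B ` {0..<t} \<noteq> {}" using t by auto
  have near: "\<forall>\<^sub>F s in at_left t. s \<in> {u<..<t}" if "u < t" for u using that by (rule eventually_at_left_real)
  have Bl: "(B \<longlongrightarrow> l) (at_left t)"
  proof (rule increasing_tendsto)
    have "\<forall>\<^sub>F s in at_left t. s \<in> {0<..<t}" using t by (intro near) simp
    then show "\<forall>\<^sub>F s in at_left t. B s \<le> l"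
    proof eventually_elim
      case (elim s)
      then show ?case unfolding l_def by (intro cSup_upper bdd) auto
    qed
    fix x assume "x < l"
    then obtain u where u: "u \<in> {0..<t}" "x < B u" unfolding l_def less_cSup_iff[OF ne bdd] by auto
    then have "\<forall>\<^sub>F s in at_left t. s \<in> {u<..<t}" by (intro near) simp
    then show "\<forall>\<^sub>F s in at_left t. x < B s"
    proof eventually_elim
      case (elim s)
      have "B u \<le> B s" using elim u t by (intro B) auto
      then show ?case using u by linarith
    qed
  qed
  have "(h \<longlongrightarrow> h t) (at t within {0..T})" using h t by (auto simp: continuous_on_def)
  then have "(h \<longlongrightarrow> h t) (at t within {0..t})" using t by (elim tendsto_within_subset) auto
  then have "(h \<longlongrightarrow> h t) (at_left t)" using t by (simp add: at_within_Icc_at_left)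
  from tendsto_diff[OF this Bl] have "(Y \<longlongrightarrow> h t - l) (at_left t)" by (simp add: B_def)
  then show "\<exists>l. (Y \<longlongrightarrow> l) (at_left t)" ..
qed

lemma rcll_on_diff_continuous:
  assumes "rcll_on T x" "continuous_on {0..T} h"
  shows "rcll_on T (\<lambda>t. h t - x t)"
  unfolding rcll_on_def
proof (intro conjI ballI)
  fix t assume t: "t \<in> {0..<T}"
  then have "(x \<longlongrightarrow> x t) (at_right t)" using assms(1) by (auto simp: rcll_on_def)
  then show "((\<lambda>t. h t - x t) \<longlongrightarrow> h t - x t) (at_right t)"
    by (intro tendsto_diff continuous_on_at_right[OF assms(2) t])
next
  fix t assume t: "t \<in> {0<..T}"
  then obtain l where l: "(x \<longlongrightarrow> l) (at_left t)" using assms(1) unfolding rcll_on_def by blast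
  have "(h \<longlongrightarrow> h t) (at t within {0..T})" using assms(2) t by (auto simp: continuous_on_def)
  then have "(h \<longlongrightarrow> h t) (at t within {0..t})" using t by (elim tendsto_within_subset) auto
  then have "(h \<longlongrightarrow> h t) (at_left t)" using t by (simp add: at_within_Icc_at_left)
  from tendsto_diff[OF this l] show "\<exists>l. ((\<lambda>t. h t - x t) \<longlongrightarrow> l) (at_left t)" by blast
qed

section \<open>Increasing limit of solutions with uniform bounds\<close>

locale bsde_limit = bsde_setup M T W f K
  for M :: "'a measure" and T and W :: "real \<Rightarrow> 'a \<Rightarrow> real ^ 'd" and f K +
  fixes \<xi>n :: "nat \<Rightarrow> 'a \<Rightarrow> real" and \<xi> :: "'a \<Rightarrow> real" and V :: "nat \<Rightarrow> real \<Rightarrow> 'a \<Rightarrow> real"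
    and Zn :: "nat \<Rightarrow> real \<Rightarrow> 'a \<Rightarrow> real ^ 'd" and In :: "nat \<Rightarrow> real \<Rightarrow> 'a \<Rightarrow> real"
    and Y :: "real \<Rightarrow> 'a \<Rightarrow> real" and C E m :: real
  assumes regular: "\<And>n. regular_solution (\<xi>n n) (V n) (Zn n) (In n)"
    and \<xi>_measurable: "\<xi> \<in> borel_measurable (F T)"
    and \<xi>_limit: "AE w in M. (\<lambda>n. \<xi>n n w) \<longlonglongrightarrow> \<xi> w"
    and Yp: "predictable M T W Y"
    and V_limit: "AE w in M. \<forall>t\<in>{0..T}. incseq (\<lambda>n. V n t w) \<and> (\<lambda>n. V n t w) \<longlonglongrightarrow> Y t w \<and> (\<forall>n. \<bar>V n t w\<bar> \<le> C)"
    and E: "0 \<le> E" "\<And>n t B. t \<in> {0..T} \<Longrightarrow> B \<in> sets (F t) \<Longrightarrow> energy_bound (Zn n) t B E"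
    and m: "0 \<le> m" "\<And>t w y z. t \<in> {0..T} \<Longrightarrow> w \<in> path_space T \<Longrightarrow> \<bar>y\<bar> \<le> C \<Longrightarrow> - m \<le> f t w y z"
begin

lemma Vp: "predictable M T W (V n)" and Znp: "predictable M T W (Zn n)" and In: "ito (Zn n) (In n)"
  and V_continuous: "w \<in> space M \<Longrightarrow> continuous_on {0..T} (\<lambda>t. V n t w)"
  using regular[of n] by (auto simp: regular_solution_def)

lemma V_equation: "AE w in M. path_equation (\<xi>n n) (V n) (Zn n) (In n) w"
  by (rule regular_solutionD(5)[OF regular])

lemma V_le_Y: "AE w in M. \<forall>n. \<forall>t\<in>{0..T}. V n t w \<le> Y t w"
  using V_limit by eventually_elim (auto intro: incseq_le)

lemma Y_bounded: "AE w in M. \<forall>t\<in>{0..T}. \<bar>Y t w\<bar> \<le> C"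
  using V_limit
proof eventually_elim
  case (elim w)
  show ?case
  proof
    fix t assume "t \<in> {0..T}"
    with elim have "(\<lambda>n. V n t w) \<longlonglongrightarrow> Y t w" "\<forall>n. \<bar>V n t w\<bar> \<le> C" by blast+
    then show "\<bar>Y t w\<bar> \<le> C" by (intro LIMSEQ_le_const2[OF tendsto_rabs]) auto
  qed
qed

text \<open>\<open>v\<close> and \<phi> stand for the same convex combination of the
  \<open>V k\<close> and of their drifts. The last inequality comes from the Lipschitz bound
  \<open>drift Y (Zn k) \<le> drift (V k) (Zn k) + K * (Y - V k)\<close> and
  \<open>V n \<le> V k\<close>; with all drifts taken at the common argument \<open>Y\<close>,
  convexity in \<open>z\<close> preserves it.\<close>

abbreviation "approximant_path n z i v \<phi> w \<equiv> set_integrable lborel {0..T} (\<lambda>r. \<phi> r w) \<and>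
      (\<forall>s t. 0 \<le> s \<longrightarrow> s \<le> t \<longrightarrow> t \<le> T \<longrightarrow> v s w = v t w + (LINT r:{s..t}|lborel. \<phi> r w) - (i t w - i s w)) \<and>
      (\<forall>r\<in>{0..T}. V n r w \<le> v r w \<and> v r w \<le> Y r w \<and> drift Y z r w \<le> \<phi> r w + K * (Y r w - V n r w))"

text \<open>The properties of a convex combination of the \<open>Zn k\<close> with \<open>k \<ge> n\<close> that survive in the limit.\<close>

definition approximant :: "nat \<Rightarrow> (real \<Rightarrow> 'a \<Rightarrow> real ^ 'd) \<Rightarrow> (real \<Rightarrow> 'a \<Rightarrow> real) \<Rightarrow> (real \<Rightarrow> 'a \<Rightarrow> real) \<Rightarrow> (real \<Rightarrow> 'a \<Rightarrow> real) \<Rightarrow> bool" where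
  "approximant n z i v \<phi> \<longleftrightarrow> predictable M T W z \<and> ito z i \<and>
    (\<forall>t\<in>{0..T}. \<forall>B\<in>sets (F t). energy_bound z t B E) \<and>
    (AE w in M. approximant_path n z i v \<phi> w)"

lemma approximant_self: "approximant n (Zn n) (In n) (V n) (drift (V n) (Zn n))"
  unfolding approximant_def
proof (intro conjI ballI Znp In E(2))
  show "AE w in M. approximant_path n (Zn n) (In n) (V n) (drift (V n) (Zn n)) w"
    using V_equation[of n] V_le_Y AE_space
  proof eventually_elim
    case (elim w)
    have "V n s w = V n t w + (LINT r:{s..t}|lborel. drift (V n) (Zn n) r w) - (In n t w - In n s w)"
      if st: "0 \<le> s" "s \<le> t" "t \<le> T" for s t
      by (rule path_equation_increment[where \<xi>="\<xi>n n" and V="V n" and Z="Zn n" and I="In n" and w=w, OF elim(1) st])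
    moreover have "V n r w \<le> V n r w \<and> V n r w \<le> Y r w \<and> drift Y (Zn n) r w \<le> drift (V n) (Zn n) r w + K * (Y r w - V n r w)"
      if r: "r \<in> {0..T}" for r
    proof -
      have le: "V n r w \<le> Y r w" using elim(2) r by blast
      have "\<bar>drift Y (Zn n) r w - drift (V n) (Zn n) r w\<bar> \<le> K * \<bar>Y r w - V n r w\<bar>"
        by (rule lip[OF r sample_path_in[OF elim(3)]])
      then show ?thesis using le by simp
    qed
    ultimately show ?case using elim(1) by blast
  qed
qed

text \<open>\<open>V n\<close> increases in \<open>n\<close>, so passing to a smaller index weakens
  both bounds that contain it.\<close>

lemma approximant_Suc:
  assumes "approximant (Suc n) z i v \<phi>"
  shows "approximant n z i v \<phi>"
proof -
  from assms have "AE w in M. approximant_path (Suc n) z i v \<phi> w"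
    unfolding approximant_def by blast
  then have "AE w in M. approximant_path n z i v \<phi> w"
    using V_limit
  proof eventually_elim
    case (elim w)
    have "V n r w \<le> v r w \<and> v r w \<le> Y r w \<and> drift Y z r w \<le> \<phi> r w + K * (Y r w - V n r w)" if r: "r \<in> {0..T}" for r
    proof -
      have "V n r w \<le> V (Suc n) r w" using elim(2) r by (auto simp: incseq_Suc_iff)
      moreover from this have "K * (Y r w - V (Suc n) r w) \<le> K * (Y r w - V n r w)" using K by (intro mult_left_mono) auto
      moreover have "V (Suc n) r w \<le> v r w \<and> v r w \<le> Y r w \<and> drift Y z r w \<le> \<phi> r w + K * (Y r w - V (Suc n) r w)"
        using elim(1) r by blast
      ultimately show ?thesis by linarith
    qed
    with elim(1) show ?case by blast
  qed
  with assms show ?thesis unfolding approximant_def by blast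
qed

lemma qv_from_midpoint:
  assumes x: "predictable M T W x" and y: "predictable M T W y" and t: "0 \<le> t" and w: "w \<in> space M"
  shows "qv_from (\<lambda>s w. (1/2) *\<^sub>R (x s w + y s w)) t w \<le> ennreal (1/2) * qv_from x t w + ennreal (1/2) * qv_from y t w"
proof (rule qv_le_linear[OF x y w t])
  show "(norm ((1/2) *\<^sub>R (x s w + y s w)))\<^sup>2 \<le> 1/2 * (norm (x s w))\<^sup>2 + 1/2 * (norm (y s w))\<^sup>2" for s
    using norm_add_sq_le[of "x s w" "y s w"] by (simp add: power_divide)
qed simp_all

lemma approximant_midpoint:
  assumes 1: "approximant n z i v \<phi>" and 2: "approximant n z' i' v' \<phi>'"
  shows "approximant n (\<lambda>s w. (1/2) *\<^sub>R (z s w + z' s w)) (\<lambda>s w. 1/2 * (i s w + i' s w))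
    (\<lambda>s w. 1/2 * (v s w + v' s w)) (\<lambda>s w. 1/2 * (\<phi> s w + \<phi>' s w))"
  unfolding approximant_def
proof (intro conjI ballI)
  from 1 have p: "predictable M T W z" and i: "ito z i" and q: "\<And>t B. t \<in> {0..T} \<Longrightarrow> B \<in> sets (F t) \<Longrightarrow> energy_bound z t B E"
    and a: "AE w in M. approximant_path n z i v \<phi> w"
    unfolding approximant_def by blast+
  from 2 have p': "predictable M T W z'" and i': "ito z' i'" and q': "\<And>t B. t \<in> {0..T} \<Longrightarrow> B \<in> sets (F t) \<Longrightarrow> (\<E> w. indicator B w * qv_from z' t w) \<le> ennreal E * emeasure P B"
    and a': "AE w in M. approximant_path n z' i' v' \<phi>' w"
    unfolding approximant_def by blast+
  show "predictable M T W (\<lambda>s w. (1/2) *\<^sub>R (z s w + z' s w))" by (intro predictable_scale predictable_add p p')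
  show "ito (\<lambda>s w. (1/2) *\<^sub>R (z s w + z' s w)) (\<lambda>s w. 1/2 * (i s w + i' s w))"
    using ito_linear[OF i p i' p', of "1/2" "1/2"] by (simp only: scaleR_right_distrib distrib_left)
  show "(\<E> w. indicator B w * qv_from (\<lambda>s w. (1/2) *\<^sub>R (z s w + z' s w)) t w) \<le> ennreal E * emeasure P B"
    if t: "t \<in> {0..T}" and B: "B \<in> sets (F t)" for t B
  proof -
    have t0: "0 \<le> t" using t by simp
    have qm: "(\<lambda>w. indicator B w * qv_from u t w) \<in> borel_measurable P" if "predictable M T W u" for u
      using qv_from_measurable[OF that t0] F_sub_P[OF B] by measurable
    have "(\<E> w. indicator B w * qv_from (\<lambda>s w. (1/2) *\<^sub>R (z s w + z' s w)) t w)
      \<le> (\<E> w. ennreal (1/2) * (indicator B w * qv_from z t w) + ennreal (1/2) * (indicator B w * qv_from z' t w))"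
    proof (rule nn_integral_mono)
      fix w assume "w \<in> space P"
      then show "indicator B w * qv_from (\<lambda>s w. (1/2) *\<^sub>R (z s w + z' s w)) t w
        \<le> ennreal (1/2) * (indicator B w * qv_from z t w) + ennreal (1/2) * (indicator B w * qv_from z' t w)"
        using qv_from_midpoint[OF p p' t0, of w] by (simp split: split_indicator)
    qed
    also have "\<dots> = ennreal (1/2) * (\<E> w. indicator B w * qv_from z t w) + ennreal (1/2) * (\<E> w. indicator B w * qv_from z' t w)"
      by (subst nn_integral_add) (use qm[OF p] qm[OF p'] in \<open>auto simp: nn_integral_cmult\<close>)
    also have "\<dots> \<le> ennreal (1/2) * (ennreal E * emeasure P B) + ennreal (1/2) * (ennreal E * emeasure P B)"
      by (intro add_mono mult_left_mono q q' t B) auto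
    also have "\<dots> = (ennreal (1/2) + ennreal (1/2)) * (ennreal E * emeasure P B)" by (simp only: distrib_right)
    also have "ennreal (1/2) + ennreal (1/2) = 1" by (subst ennreal_plus[symmetric]) auto
    finally show ?thesis by simp
  qed
  show "AE w in M. approximant_path n (\<lambda>s w. (1/2) *\<^sub>R (z s w + z' s w)) (\<lambda>s w. 1/2 * (i s w + i' s w))
    (\<lambda>s w. 1/2 * (v s w + v' s w)) (\<lambda>s w. 1/2 * (\<phi> s w + \<phi>' s w)) w"
    using a a' AE_space
  proof eventually_elim
    case (elim w)
    have si: "set_integrable lborel {0..T} (\<lambda>r. \<phi> r w)" "set_integrable lborel {0..T} (\<lambda>r. \<phi>' r w)" using elim(1,2) by blast+
    have "set_integrable lborel {0..T} (\<lambda>r. 1/2 * (\<phi> r w + \<phi>' r w))" by (intro set_integrable_mult_right set_integral_add(1) si)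
    moreover have "1/2 * (v s w + v' s w) = 1/2 * (v t w + v' t w) + (LINT r:{s..t}|lborel. 1/2 * (\<phi> r w + \<phi>' r w)) - (1/2 * (i t w + i' t w) - 1/2 * (i s w + i' s w))"
      if st: "0 \<le> s" "s \<le> t" "t \<le> T" for s t
    proof -
      have "set_integrable lborel {s..t} (\<lambda>r. \<phi> r w)" "set_integrable lborel {s..t} (\<lambda>r. \<phi>' r w)"
        using st by (auto intro: set_integrable_subset[OF si(1)] set_integrable_subset[OF si(2)])
      then have e1: "(LINT r:{s..t}|lborel. 1/2 * (\<phi> r w + \<phi>' r w)) = 1/2 * ((LINT r:{s..t}|lborel. \<phi> r w) + (LINT r:{s..t}|lborel. \<phi>' r w))"
        by (subst set_integral_mult_right, subst set_integral_add(2)) auto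
      have e2: "v s w = v t w + (LINT r:{s..t}|lborel. \<phi> r w) - (i t w - i s w)" using elim(1) st by blast
      have e3: "v' s w = v' t w + (LINT r:{s..t}|lborel. \<phi>' r w) - (i' t w - i' s w)" using elim(2) st by blast
      show ?thesis unfolding e1 e2 e3 by (simp add: field_simps)
    qed
    moreover have "V n r w \<le> 1/2 * (v r w + v' r w) \<and> 1/2 * (v r w + v' r w) \<le> Y r w \<and>
        f r (sample_path T W w) (Y r w) ((1/2) *\<^sub>R (z r w + z' r w)) \<le> 1/2 * (\<phi> r w + \<phi>' r w) + K * (Y r w - V n r w)"
      if r: "r \<in> {0..T}" for r
    proof -
      have "convex_on UNIV (f r (sample_path T W w) (Y r w))" using conv r sample_path_in[OF elim(3)] by (auto simp: f1_def)
      from convex_onD[OF this, of "1/2" "z r w" "z' r w"]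
      have "f r (sample_path T W w) (Y r w) ((1/2) *\<^sub>R (z r w + z' r w)) \<le> 1/2 * drift Y z r w + 1/2 * drift Y z' r w"
        by (simp add: scaleR_add_right)
      moreover have "V n r w \<le> v r w \<and> v r w \<le> Y r w \<and> drift Y z r w \<le> \<phi> r w + K * (Y r w - V n r w)" using elim(1) r by blast
      moreover have "V n r w \<le> v' r w \<and> v' r w \<le> Y r w \<and> drift Y z' r w \<le> \<phi>' r w + K * (Y r w - V n r w)" using elim(2) r by blast
      ultimately show ?thesis by (simp add: field_simps)
    qed
    ultimately show ?case by blast
  qed
qed

text \<open>The integrals of \<open>\<phi> n\<close> are determined by \<open>v n\<close> and
  \<open>i n\<close>, which converge along the subsequence, although \<open>\<phi> n\<close> itself
  need not. Adding \<open>m\<close> makes the drifts at \<open>Y\<close> non-negative, and they are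
  dominated by \<open>\<phi> n + m\<close> up to \<open>K * (Y - V n)\<close>, which vanishes in the
  limit. Fatou's lemma then gives the inequality for increments.\<close>

lemma limit_drift_bound:
  assumes w: "w \<in> space M" and Zp: "predictable M T W Z" and zp: "\<And>n. predictable M T W (z n)"
    and lim: "\<And>t. t \<in> {0..T} \<Longrightarrow> (\<lambda>n. V n t w) \<longlonglongrightarrow> Y t w" and VC: "\<And>n t. t \<in> {0..T} \<Longrightarrow> \<bar>V n t w\<bar> \<le> C"
    and YC: "\<And>t. t \<in> {0..T} \<Longrightarrow> \<bar>Y t w\<bar> \<le> C"
    and zlim: "AE s in lborel. s \<in> {0..T} \<longrightarrow> (\<lambda>n. z n s w) \<longlonglongrightarrow> Z s w"
    and \<phi>: "\<And>n. set_integrable lborel {0..T} (\<phi> n)"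
    and v: "\<And>n s t. 0 \<le> s \<Longrightarrow> s \<le> t \<Longrightarrow> t \<le> T \<Longrightarrow> v n s = v n t + (LINT r:{s..t}|lborel. \<phi> n r) - (i n t - i n s)"
    and le: "\<And>n r. r \<in> {0..T} \<Longrightarrow> V n r w \<le> v n r \<and> v n r \<le> Y r w \<and> drift Y (z n) r w \<le> \<phi> n r + K * (Y r w - V n r w)"
    and i: "\<And>t. t \<in> {0..T} \<Longrightarrow> (\<lambda>n. i (r n) t) \<longlonglongrightarrow> I t" and r: "strict_mono r"
    and st: "0 \<le> s" "s \<le> t" "t \<le> T"
  shows "set_integrable lborel {s..t} (\<lambda>q. drift Y Z q w)"
    and "Y t w + (LINT q:{s..t}|lborel. drift Y Z q w) - (I t - I s) \<le> Y s w"
proof -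
  note sp = sample_path_in[OF w]
  have A: "{s..t} \<in> sets borel" "{s..t} \<subseteq> {0..T}" using st by auto
  have Vr: "(\<lambda>n. V (r n) u w) \<longlonglongrightarrow> Y u w" if "u \<in> {0..T}" for u
    using LIMSEQ_subseq_LIMSEQ[OF lim[OF that] r] by (simp add: o_def)
  \<comment> \<open>Squeezed between \<open>V\<close> and \<open>Y\<close>, so the convex
    combinations inherit the limit.\<close>
  have vr: "(\<lambda>n. v (r n) u) \<longlonglongrightarrow> Y u w" if "u \<in> {0..T}" for u
    by (rule tendsto_sandwich[OF _ _ Vr[OF that] tendsto_const]) (simp_all add: le[OF that])
  define d where "d n q = indicator {s..t} q *\<^sub>R (Y q w - V (r n) q w)" for n q
  have ci: "integrable lborel (\<lambda>q. indicator {s..t} q *\<^sub>R c)" for c :: real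
    by (rule borel_integrable_compact) auto
  have dm: "d n \<in> borel_measurable lborel" for n
    using borel_measurable_diff[OF pred_section_measurable[OF Yp[unfolded predictable_def] w A] pred_section_measurable[OF Vp[unfolded predictable_def, of "r n"] w A]]
    unfolding d_def by (simp add: right_diff_distrib)
  have db: "AE q in lborel. norm (d n q) \<le> indicator {s..t} q *\<^sub>R (2 * C)" for n
  proof (rule AE_I2)
    fix q
    show "norm (d n q) \<le> indicator {s..t} q *\<^sub>R (2 * C)"
    proof (cases "q \<in> {s..t}")
      case True
      then have "q \<in> {0..T}" using A by auto
      then have "\<bar>Y q w\<bar> \<le> C" "\<bar>V (r n) q w\<bar> \<le> C" using YC VC by auto
      then have "\<bar>Y q w - V (r n) q w\<bar> \<le> 2 * C" by linarith
      then show ?thesis using True by (simp add: d_def)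
    qed (simp add: d_def)
  qed
  have dl: "AE q in lborel. (\<lambda>n. d n q) \<longlonglongrightarrow> 0"
  proof (rule AE_I2)
    fix q
    show "(\<lambda>n. d n q) \<longlonglongrightarrow> 0"
    proof (cases "q \<in> {s..t}")
      case True
      then have q: "q \<in> {0..T}" using A by auto
      have "(\<lambda>n. Y q w - V (r n) q w) \<longlonglongrightarrow> Y q w - Y q w" by (intro tendsto_intros Vr q)
      then show ?thesis using True by (simp add: d_def)
    qed (simp add: d_def)
  qed
  have di: "integrable lborel (d n)" for n
    by (rule integrable_dominated_convergence2[OF borel_measurable_const dm ci dl db])
  have dI: "(\<lambda>n. integral\<^sup>L lborel (d n)) \<longlonglongrightarrow> 0"
    using integral_dominated_convergence[OF borel_measurable_const dm ci dl db] by simp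
  have \<phi>i: "integrable lborel (\<lambda>q. indicator {s..t} q *\<^sub>R \<phi> n q)" for n
    using set_integrable_subset[OF \<phi> _ A(2), of n] by (simp add: set_integrable_def)
  \<comment> \<open>Majorant of the drift at \<open>Y\<close> plus \<open>m\<close>; its integral is
    explicit in quantities whose limits are known.\<close>
  define \<psi> where "\<psi> n q = indicator {s..t} q *\<^sub>R \<phi> (r n) q + K * d n q + indicator {s..t} q *\<^sub>R m" for n q
  have \<psi>: "integrable lborel (\<psi> n)" for n unfolding \<psi>_def by (intro Bochner_Integration.integrable_add integrable_mult_right \<phi>i di ci)
  have \<psi>I: "integral\<^sup>L lborel (\<psi> n) = (v (r n) s - v (r n) t + (i (r n) t - i (r n) s)) + K * integral\<^sup>L lborel (d n) + m * (t - s)" for n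
  proof -
    have "integral\<^sup>L lborel (\<psi> n) = integral\<^sup>L lborel (\<lambda>q. indicator {s..t} q *\<^sub>R \<phi> (r n) q) + integral\<^sup>L lborel (\<lambda>q. K * d n q) + integral\<^sup>L lborel (\<lambda>q. indicator {s..t} q *\<^sub>R m)"
      unfolding \<psi>_def using \<phi>i di ci
      by (subst Bochner_Integration.integral_add, (intro Bochner_Integration.integrable_add integrable_mult_right; simp), simp,
          subst Bochner_Integration.integral_add, simp, (intro integrable_mult_right; simp), simp)
    moreover have "integral\<^sup>L lborel (\<lambda>q. indicator {s..t} q *\<^sub>R \<phi> (r n) q) = v (r n) s - v (r n) t + (i (r n) t - i (r n) s)"
      using v[OF st, of "r n"] by (simp add: set_lebesgue_integral_def)
    moreover have "integral\<^sup>L lborel (\<lambda>q. indicator {s..t} q *\<^sub>R m) = m * (t - s)" using st by simp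
    moreover have "integral\<^sup>L lborel (\<lambda>q. K * d n q) = K * integral\<^sup>L lborel (d n)" by simp
    ultimately show ?thesis by simp
  qed
  define l where "l = (Y s w - Y t w + (I t - I s)) + K * 0 + m * (t - s)"
  have \<psi>l: "(\<lambda>n. integral\<^sup>L lborel (\<psi> n)) \<longlonglongrightarrow> l"
    unfolding \<psi>I l_def using st by (intro tendsto_intros vr i dI) auto
  define gn where "gn n q = indicator {s..t} q *\<^sub>R drift Y (z (r n)) q w + indicator {s..t} q *\<^sub>R m" for n q
  define g where "g q = indicator {s..t} q *\<^sub>R drift Y Z q w + indicator {s..t} q *\<^sub>R m" for q
  have gnm: "gn n \<in> borel_measurable lborel" for n
    unfolding gn_def
    by (intro borel_measurable_add borel_measurable_integrable[OF ci] pred_section_measurable[OF driver_pred[OF drv Yp zp] w A])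
  have gm: "g \<in> borel_measurable lborel"
    unfolding g_def
    by (intro borel_measurable_add borel_measurable_integrable[OF ci] pred_section_measurable[OF driver_pred[OF drv Yp Zp] w A])
  have gn0: "0 \<le> gn n q" for n q
  proof (cases "q \<in> {s..t}")
    case True
    then have q: "q \<in> {0..T}" using A by auto
    have "- m \<le> drift Y (z (r n)) q w" by (intro m(2) q sp YC)
    then show ?thesis using True by (simp add: gn_def)
  qed (simp add: gn_def)
  have gn\<psi>: "AE q in lborel. gn n q \<le> \<psi> n q" for n
  proof (rule AE_I2)
    fix q
    show "gn n q \<le> \<psi> n q"
    proof (cases "q \<in> {s..t}")
      case True
      then have q: "q \<in> {0..T}" using A by auto
      have "V (r n) q w \<le> v (r n) q \<and> v (r n) q \<le> Y q w \<and> drift Y (z (r n)) q w \<le> \<phi> (r n) q + K * (Y q w - V (r n) q w)" by (rule le[OF q])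
      then show ?thesis using True by (simp add: gn_def \<psi>_def d_def)
    qed (simp add: gn_def \<psi>_def d_def)
  qed
  have gl: "AE q in lborel. (\<lambda>n. gn n q) \<longlonglongrightarrow> g q"
    using zlim
  proof eventually_elim
    case (elim q)
    show ?case
    proof (cases "q \<in> {s..t}")
      case True
      then have q: "q \<in> {0..T}" using A by auto
      have "(\<lambda>n. z (r n) q w) \<longlonglongrightarrow> Z q w" using LIMSEQ_subseq_LIMSEQ[OF elim[rule_format, OF q] r] by (simp add: o_def)
      from driver_continuous_z[OF q sp this] show ?thesis unfolding gn_def g_def by (intro tendsto_intros)
    qed (simp add: gn_def g_def)
  qed
  have gi: "integrable lborel g" and gI: "integral\<^sup>L lborel g \<le> l"
    by (rule integral_fatou_le[OF \<psi> \<psi>l gnm gm gn0 gn\<psi> gl])+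
  have "integrable lborel (\<lambda>q. g q - indicator {s..t} q *\<^sub>R m)" by (intro Bochner_Integration.integrable_diff gi ci)
  then have fi: "integrable lborel (\<lambda>q. indicator {s..t} q *\<^sub>R drift Y Z q w)" by (simp add: g_def)
  then show "set_integrable lborel {s..t} (\<lambda>q. drift Y Z q w)" by (simp add: set_integrable_def)
  have "integral\<^sup>L lborel g = (LINT q:{s..t}|lborel. drift Y Z q w) + m * (t - s)"
    unfolding g_def set_lebesgue_integral_def using fi ci[of m] st by (subst Bochner_Integration.integral_add) auto
  with gI show "Y t w + (LINT q:{s..t}|lborel. drift Y Z q w) - (I t - I s) \<le> Y s w"
    by (simp add: l_def)
qed

text \<open>The selection runs over integrands of approximants, with integral, process and drift
  hidden in existential quantifiers. The energy bound for each \<open>t\<close> and \<open>B\<close>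
  survives by Fatou's lemma, applied in time and then under \<open>P\<close>.\<close>

lemma limit_integrand:
  obtains Z I where "predictable M T W Z" "ito Z I"
    "\<And>t B. t \<in> {0..T} \<Longrightarrow> B \<in> sets (F t) \<Longrightarrow> energy_bound Z t B E"
    "AE w in M. \<forall>s t. 0 \<le> s \<longrightarrow> s \<le> t \<longrightarrow> t \<le> T \<longrightarrow> set_integrable lborel {s..t} (\<lambda>q. drift Y Z q w) \<and>
      Y t w + (LINT q:{s..t}|lborel. drift Y Z q w) - (I t w - I s w) \<le> Y s w"
proof -
  obtain z Z where z: "\<And>n. \<exists>i v \<phi>. approximant n (z n) i v \<phi>" and Zp: "predictable M T W Z"
    and zZ: "tendsto_0_in_prob P (\<lambda>n. sqint (\<lambda>s w. z n s w - Z s w))"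
    and zlim: "AE w in M. AE s in lborel. s \<in> {0..T} \<longrightarrow> (\<lambda>n. z n s w) \<longlonglongrightarrow> Z s w"
  proof (rule L2_selection[of "\<lambda>n z. \<exists>i v \<phi>. approximant n z i v \<phi>" E])
    show "predictable M T W z" if "\<exists>i v \<phi>. approximant n z i v \<phi>" for n z
      using that unfolding approximant_def by blast
    show "(\<E> w. sqint z w) \<le> ennreal E" if "\<exists>i v \<phi>. approximant n z i v \<phi>" for n z
    proof -
      have "(\<E> w. indicator (space M) w * qv_from z 0 w) \<le> ennreal E * emeasure P (space M)"
        using that T_pos sets.top[of "F 0"] unfolding approximant_def by (auto simp del: emeasure_completion)
      also have "emeasure P (space M) = 1" using P.emeasure_space_1 by simp
      also have "(\<E> w. indicator (space M) w * qv_from z 0 w) = (\<E> w. sqint z w)"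
        by (intro nn_integral_cong) (simp add: qv_def)
      finally show ?thesis by simp
    qed
    show "\<exists>z i v \<phi>. approximant n z i v \<phi>" for n using approximant_self by blast
    show "\<exists>i v \<phi>. approximant n z i v \<phi>" if "\<exists>i v \<phi>. approximant (Suc n) z i v \<phi>" for n z using that approximant_Suc by blast
    show "\<exists>i v \<phi>. approximant n (\<lambda>s w. (1/2) *\<^sub>R (z s w + z' s w)) i v \<phi>"
      if "\<exists>i v \<phi>. approximant n z i v \<phi>" "\<exists>i v \<phi>. approximant n z' i v \<phi>" for n z z'
      using that approximant_midpoint by blast
  qed (rule that)
  from z have "\<exists>i v \<phi>. \<forall>n. approximant n (z n) (i n) (v n) (\<phi> n)" by metis
  then obtain i v \<phi> where a: "\<And>n. approximant n (z n) (i n) (v n) (\<phi> n)" by blast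
  have zp: "\<And>n. predictable M T W (z n)" and ii: "\<And>n. ito (z n) (i n)"
    and q: "\<And>n t B. t \<in> {0..T} \<Longrightarrow> B \<in> sets (F t) \<Longrightarrow> energy_bound (z n) t B E"
    and ae: "\<And>n. AE w in M. approximant_path n (z n) (i n) (v n) (\<phi> n) w"
    using a unfolding approximant_def by blast+
  obtain I where I: "ito Z I" "tendsto_0_in_prob P (\<lambda>n w. supdist (i n) I w)"
    by (rule ito_closed[OF ii zp Zp zZ]) (rule that)
  obtain r where r: "strict_mono r" "AE w in P. (\<lambda>n. supdist (i (r n)) I w) \<longlonglongrightarrow> 0"
    by (rule P.tip_subseq_AE[OF I(2)]) (rule that)
  have ae': "AE w in M. \<forall>n. approximant_path n (z n) (i n) (v n) (\<phi> n) w"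
    unfolding AE_all_countable using ae by blast
  show thesis
  proof (rule that[OF Zp I(1)])
    show "AE w in M. \<forall>s t. 0 \<le> s \<longrightarrow> s \<le> t \<longrightarrow> t \<le> T \<longrightarrow> set_integrable lborel {s..t} (\<lambda>q. drift Y Z q w) \<and>
      Y t w + (LINT q:{s..t}|lborel. drift Y Z q w) - (I t w - I s w) \<le> Y s w"
      using ae' r(2)[unfolded AE_P] zlim V_limit Y_bounded AE_space
    proof eventually_elim
      case (elim w)
      have il: "(\<lambda>n. i (r n) t w) \<longlonglongrightarrow> I t w" if t: "t \<in> {0..T}" for t
      proof -
        have "(\<lambda>n. ennreal \<bar>i (r n) t w - I t w\<bar>) \<longlonglongrightarrow> 0"
          by (rule tendsto_sandwich[OF _ _ tendsto_const elim(2)]) (use t in \<open>auto intro!: always_eventually SUP_upper\<close>)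
        then have "(\<lambda>n. \<bar>i (r n) t w - I t w\<bar>) \<longlonglongrightarrow> 0" by (subst (asm) ennreal_tendsto_0_iff) auto
        then show ?thesis by (simp add: tendsto_rabs_zero_iff LIM_zero_iff)
      qed
      have e1: "\<And>n. set_integrable lborel {0..T} (\<lambda>r. \<phi> n r w)"
        and e2: "\<And>n s t. 0 \<le> s \<Longrightarrow> s \<le> t \<Longrightarrow> t \<le> T \<Longrightarrow> v n s w = v n t w + (LINT r:{s..t}|lborel. \<phi> n r w) - (i n t w - i n s w)"
        and e3: "\<And>n r. r \<in> {0..T} \<Longrightarrow> V n r w \<le> v n r w \<and> v n r w \<le> Y r w \<and> drift Y (z n) r w \<le> \<phi> n r w + K * (Y r w - V n r w)"
        using elim(1) by blast+
      have e4: "\<And>t. t \<in> {0..T} \<Longrightarrow> (\<lambda>n. V n t w) \<longlonglongrightarrow> Y t w" "\<And>n t. t \<in> {0..T} \<Longrightarrow> \<bar>V n t w\<bar> \<le> C" "\<And>t. t \<in> {0..T} \<Longrightarrow> \<bar>Y t w\<bar> \<le> C"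
        using elim(4,5) by blast+
      note res = limit_drift_bound[where v="\<lambda>n s. v n s w" and \<phi>="\<lambda>n s. \<phi> n s w" and i="\<lambda>n s. i n s w" and I="\<lambda>s. I s w" and r=r,
          OF elim(6) Zp zp e4 elim(3) e1 e2 e3 il r(1)]
      show ?case by (intro allI impI conjI res)
    qed
    fix t B assume t: "t \<in> {0..T}" and B: "B \<in> sets (F t)"
    then have t0: "0 \<le> t" by simp
    have qm: "(\<lambda>w. indicator B w * qv_from u t w) \<in> borel_measurable P" if "predictable M T W u" for u
      using qv_from_measurable[OF that t0] F_sub_P[OF B] by measurable
    have le: "AE w in M. qv_from Z t w \<le> liminf (\<lambda>n. qv_from (z n) t w)"
      using zlim AE_space
    proof eventually_elim
      case (elim w)
      have m: "(\<lambda>s. sqnorm (z n s w) * indicator {t..T} s) \<in> borel_measurable lborel" for n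
        using t0 by (intro section_norm2[OF zp elim(2)]) auto
      have "qv_from Z t w = (\<integral>\<^sup>+ s. liminf (\<lambda>n. sqnorm (z n s w) * indicator {t..T} s) \<partial>lborel)"
        unfolding qv_def
      proof (rule nn_integral_cong_AE)
        show "AE s in lborel. sqnorm (Z s w) * indicator {t..T} s = liminf (\<lambda>n. sqnorm (z n s w) * indicator {t..T} s)"
          using elim(1)
        proof eventually_elim
          case (elim s)
          show ?case
          proof (cases "s \<in> {t..T}")
            case True
            then have "(\<lambda>n. z n s w) \<longlonglongrightarrow> Z s w" using elim t by auto
            then have "(\<lambda>n. sqnorm (z n s w)) \<longlonglongrightarrow> sqnorm (Z s w)" by (intro tendsto_ennrealI tendsto_intros)
            from lim_imp_Liminf[OF _ this] show ?thesis using True by simp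
          qed (simp add: Liminf_const)
        qed
      qed
      also have "\<dots> \<le> liminf (\<lambda>n. \<integral>\<^sup>+ s. sqnorm (z n s w) * indicator {t..T} s \<partial>lborel)"
        by (rule nn_integral_liminf[OF m])
      finally show ?case by (simp add: qv_def)
    qed
    have "(\<E> w. indicator B w * qv_from Z t w) \<le> (\<E> w. liminf (\<lambda>n. indicator B w * qv_from (z n) t w))"
    proof (rule nn_integral_mono_AE)
      show "AE w in P. indicator B w * qv_from Z t w \<le> liminf (\<lambda>n. indicator B w * qv_from (z n) t w)"
        unfolding AE_P using le
      proof eventually_elim
        case (elim w)
        then show ?case by (cases "w \<in> B") simp_all
      qed
    qed
    also have "\<dots> \<le> liminf (\<lambda>n. (\<E> w. indicator B w * qv_from (z n) t w))"
      by (rule nn_integral_liminf[OF qm[OF zp]])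
    also have "\<dots> \<le> liminf (\<lambda>n. ennreal E * emeasure P B)" by (intro Liminf_mono always_eventually allI q t B)
    also have "\<dots> = ennreal E * emeasure P B" by (simp add: Liminf_const del: emeasure_completion)
    finally show "energy_bound Z t B E" .
  qed
qed

end

section \<open>From deterministic times to stopping times\<close>

context brownian_setup
begin

text \<open>The stopping time is approximated from above by the first point of a uniform grid.\<close>

lemma energy_stopping_time:
  assumes Zp: "predictable M T W Z"
    and en: "\<And>t B. t \<in> {0..T} \<Longrightarrow> B \<in> sets (F t) \<Longrightarrow> energy_bound Z t B E"
    and \<tau>: "stopping_time F \<tau>" "\<tau> \<in> space M \<rightarrow> {0..T}"
  shows "(\<lambda>w. qv_from Z (\<tau> w) w) \<in> borel_measurable P"
    and "\<And>B. B \<in> sets (filtration.pre_sigma (space M) F \<tau>) \<Longrightarrow>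
      (\<E> w. indicator B w * qv_from Z (\<tau> w) w) \<le> ennreal E * emeasure P B"
proof -
  interpret filt: filtration "space M" F by (rule filtration_aug_filtration)
  define g where "g n k = T * real k / real (Suc n)" for n k :: nat
  \<comment> \<open>Index of the first grid point not before \<tau>. Where the index is
    \<open>k\<close> the time is deterministic, and intersecting this cell with \<open>B\<close>
    gives an event of \<open>F (g n k)\<close>, to which the energy bound applies.\<close>
  define \<kappa> where "\<kappa> n w = (LEAST k. \<tau> w \<le> g n k)" for n w
  have g: "g n k \<in> {0..T}" if "k \<le> Suc n" for n k
    using that T_pos by (auto simp: g_def divide_simps intro!: mult_left_mono)
  have gT: "g n (Suc n) = T" for n by (simp add: g_def)
  have ex: "\<tau> w \<le> g n (Suc n)" if "w \<in> space M" for n w using \<tau>(2) that by (auto simp: gT)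
  have \<kappa>: "\<tau> w \<le> g n (\<kappa> n w)" "\<kappa> n w \<le> Suc n" if "w \<in> space M" for n w
    unfolding \<kappa>_def by (rule LeastI[of "\<lambda>k. \<tau> w \<le> g n k", OF ex[OF that]]) (rule Least_le[of "\<lambda>k. \<tau> w \<le> g n k", OF ex[OF that]])
  have \<kappa>_iff: "\<kappa> n w = k \<longleftrightarrow> \<tau> w \<le> g n k \<and> (\<forall>j<k. \<not> \<tau> w \<le> g n j)" if "w \<in> space M" for n k w
  proof
    assume k: "\<kappa> n w = k"
    show "\<tau> w \<le> g n k \<and> (\<forall>j<k. \<not> \<tau> w \<le> g n j)"
    proof (intro conjI allI impI)
      show "\<tau> w \<le> g n k" using \<kappa>(1)[OF that, of n] k by simp
      fix j assume "j < k"
      then have "j < (LEAST k. \<tau> w \<le> g n k)" using k by (simp only: \<kappa>_def)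
      then show "\<not> \<tau> w \<le> g n j" by (rule not_less_Least)
    qed
  next
    assume "\<tau> w \<le> g n k \<and> (\<forall>j<k. \<not> \<tau> w \<le> g n j)"
    then show "\<kappa> n w = k" unfolding \<kappa>_def by (intro Least_equality) (blast, meson not_less)
  qed
  have \<kappa>_le: "g n (\<kappa> n w) \<le> \<tau> w + T / real (Suc n)" if w: "w \<in> space M" for n w
  proof (cases "\<kappa> n w")
    case 0
    moreover have "0 \<le> \<tau> w" using \<tau>(2) w by auto
    ultimately show ?thesis using T_pos by (simp add: g_def)
  next
    case (Suc j)
    then have "\<not> \<tau> w \<le> g n j" using \<kappa>_iff[OF w, of n "Suc j"] by auto
    moreover have "g n (Suc j) = g n j + T / real (Suc n)" by (simp add: g_def add_divide_distrib[symmetric] distrib_left add.commute)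
    ultimately show ?thesis using Suc by simp
  qed
  have \<kappa>_lim: "(\<lambda>n. g n (\<kappa> n w)) \<longlonglongrightarrow> \<tau> w" if w: "w \<in> space M" for w
  proof (rule tendsto_sandwich[OF _ _ tendsto_const])
    have "(\<lambda>n. \<tau> w + T / real (Suc n)) \<longlonglongrightarrow> \<tau> w + 0"
      by (intro tendsto_add tendsto_const LIMSEQ_Suc[OF lim_const_over_n])
    then show "(\<lambda>n. \<tau> w + T / real (Suc n)) \<longlonglongrightarrow> \<tau> w" by simp
  qed (intro always_eventually allI \<kappa> \<kappa>_le w)+
  define Q where "Q n w = qv_from Z (g n (\<kappa> n w)) w" for n w
  \<comment> \<open>Approximation of \<tau> from above shortens the intervals, so the energies stay
    below the one from \<tau>; Fatou's lemma gives the other inequality, the single time \<tau>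
    being negligible.\<close>
  have Qlim: "qv_from Z (\<tau> w) w = liminf (\<lambda>n. Q n w)" if w: "w \<in> space M" for w
  proof (rule antisym)
    have \<tau>0: "0 \<le> \<tau> w" using \<tau>(2) w by auto
    have "qv_from Z (\<tau> w) w = (\<integral>\<^sup>+ s. liminf (\<lambda>n. sqnorm (Z s w) * indicator {g n (\<kappa> n w)..T} s) \<partial>lborel)"
      unfolding qv_def
    proof (rule nn_integral_cong_AE)
      show "AE s in lborel. sqnorm (Z s w) * indicator {\<tau> w..T} s = liminf (\<lambda>n. sqnorm (Z s w) * indicator {g n (\<kappa> n w)..T} s)"
        using AE_lborel_singleton[of "\<tau> w"]
      proof eventually_elim
        case (elim s)
        have "\<forall>\<^sub>F n in sequentially. (s \<in> {g n (\<kappa> n w)..T}) = (s \<in> {\<tau> w..T})"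
        proof (cases "\<tau> w < s")
          case True
          from order_tendstoD(2)[OF \<kappa>_lim[OF w] this] show ?thesis
            by eventually_elim (use True in auto)
        next
          case False
          then have "s < \<tau> w" using elim by simp
          then have "s < g n (\<kappa> n w)" for n using \<kappa>(1)[OF w, of n] by linarith
          then show ?thesis using \<open>s < \<tau> w\<close> by (intro always_eventually allI) (simp add: not_le)
        qed
        then have "\<forall>\<^sub>F n in sequentially. sqnorm (Z s w) * indicator {g n (\<kappa> n w)..T} s = sqnorm (Z s w) * indicator {\<tau> w..T} s"
          by eventually_elim (simp add: indicator_def)
        from lim_imp_Liminf[OF _ tendsto_eventually[OF this]] show ?case by simp
      qed
    qed
    also have "\<dots> \<le> liminf (\<lambda>n. Q n w)"
      unfolding Q_def qv_def
    proof (rule nn_integral_liminf)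
      fix n
      have "0 \<le> g n (\<kappa> n w)" using \<kappa>(1)[OF w, of n] \<tau>0 by linarith
      then show "(\<lambda>s. sqnorm (Z s w) * indicator {g n (\<kappa> n w)..T} s) \<in> borel_measurable lborel"
        by (intro section_norm2[OF Zp w]) auto
    qed
    finally show "qv_from Z (\<tau> w) w \<le> liminf (\<lambda>n. Q n w)" .
    have "Q n w \<le> qv_from Z (\<tau> w) w" for n
      unfolding Q_def qv_def
    proof (intro nn_integral_mono mult_left_mono)
      fix s show "indicator {g n (\<kappa> n w)..T} s \<le> (indicator {\<tau> w..T} s :: ennreal)"
        using \<kappa>(1)[OF w, of n] by (auto simp: indicator_def)
    qed simp
    then have "liminf (\<lambda>n. Q n w) \<le> liminf (\<lambda>n. qv_from Z (\<tau> w) w)" by (intro Liminf_mono always_eventually allI)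
    then show "liminf (\<lambda>n. Q n w) \<le> qv_from Z (\<tau> w) w" by (simp add: Liminf_const)
  qed
  let ?C = "\<lambda>B n k. B \<inter> {w\<in>space M. \<kappa> n w = k}"
  have cell: "?C B n k \<in> sets (F (g n k))" if B: "B \<in> sets (filt.pre_sigma \<tau>)" for B n k
  proof -
    have BM: "B \<subseteq> space M" using sets.sets_into_space[OF B] by (simp add: filt.space_pre_sigma)
    have "{w\<in>B. \<tau> w \<le> g n j} \<in> sets (F (g n k))" if "j \<le> k" for j
    proof -
      have "{w\<in>B. \<tau> w \<le> g n j} \<in> sets (F (g n j))" by (rule filt.sets_pre_sigmaD[OF \<tau>(1) B])
      moreover have "g n j \<le> g n k" using that T_pos by (auto simp: g_def divide_simps)
      ultimately show ?thesis using F_mono by blast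
    qed
    then have "{w\<in>B. \<tau> w \<le> g n k} - (\<Union>j<k. {w\<in>B. \<tau> w \<le> g n j}) \<in> sets (F (g n k))"
      by (intro sets.Diff sets.finite_UN) auto
    also have "{w\<in>B. \<tau> w \<le> g n k} - (\<Union>j<k. {w\<in>B. \<tau> w \<le> g n j}) = ?C B n k"
      using BM \<kappa>_iff by blast
    finally show ?thesis .
  qed
  have Q_sum: "indicator B w * Q n w = (\<Sum>k\<le>Suc n. indicator (?C B n k) w * qv_from Z (g n k) w)" if "w \<in> space M" for w n B
  proof -
    have "(\<Sum>k\<le>Suc n. indicator (?C B n k) w * qv_from Z (g n k) w) = (\<Sum>k\<le>Suc n. if k = \<kappa> n w then indicator B w * Q n w else 0)"
      using that by (intro sum.cong) (auto simp: indicator_def Q_def)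
    then show ?thesis using \<kappa>(2)[OF that, of n] by simp
  qed
  have cell_m: "(\<lambda>w. indicator (?C B n k) w * qv_from Z (g n k) w) \<in> borel_measurable P"
    if "B \<in> sets (filt.pre_sigma \<tau>)" "k \<le> Suc n" for B n k
    using g[OF that(2)]
    by (intro borel_measurable_times_ennreal borel_measurable_indicator F_sub_P[OF cell[OF that(1)]] qv_from_measurable[OF Zp]) simp
  have Qm: "(\<lambda>w. indicator B w * Q n w) \<in> borel_measurable P" if "B \<in> sets (filt.pre_sigma \<tau>)" for B n
  proof -
    have "(\<lambda>w. \<Sum>k\<le>Suc n. indicator (?C B n k) w * qv_from Z (g n k) w) \<in> borel_measurable P"
      by (intro borel_measurable_sum cell_m that) simp
    then show ?thesis by (rule measurable_cong[THEN iffD1, rotated]) (simp add: Q_sum)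
  qed
  have top: "space M \<in> sets (filt.pre_sigma \<tau>)" using sets.top[of "filt.pre_sigma \<tau>"] by (simp add: filt.space_pre_sigma)
  have "Q n \<in> borel_measurable P" for n
    using Qm[OF top, of n] by (rule measurable_cong[THEN iffD1, rotated]) simp
  then have "(\<lambda>w. liminf (\<lambda>n. Q n w)) \<in> borel_measurable P" by (rule borel_measurable_liminf)
  then show "(\<lambda>w. qv_from Z (\<tau> w) w) \<in> borel_measurable P"
    by (rule measurable_cong[THEN iffD1, rotated]) (simp add: Qlim)
  fix B assume B: "B \<in> sets (filt.pre_sigma \<tau>)"
  have BM: "B \<subseteq> space M" using sets.sets_into_space[OF B] by (simp add: filt.space_pre_sigma)
  have le: "(\<E> w. indicator B w * Q n w) \<le> ennreal E * emeasure P B" for n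
  proof -
    have "(\<E> w. indicator B w * Q n w) = (\<E> w. (\<Sum>k\<le>Suc n. indicator (?C B n k) w * qv_from Z (g n k) w))"
      by (intro nn_integral_cong Q_sum) simp
    also have "\<dots> = (\<Sum>k\<le>Suc n. (\<E> w. indicator (?C B n k) w * qv_from Z (g n k) w))"
      by (intro nn_integral_sum cell_m B) simp
    also have "\<dots> \<le> (\<Sum>k\<le>Suc n. ennreal E * emeasure P (?C B n k))"
      by (intro sum_mono en g cell B) simp
    also have "\<dots> = ennreal E * (\<Sum>k\<le>Suc n. emeasure P (?C B n k))" by (simp only: sum_distrib_left)
    also have "(\<Sum>k\<le>Suc n. emeasure P (?C B n k)) = emeasure P (\<Union>k\<le>Suc n. ?C B n k)"
      using F_sub_P[OF cell[OF B]] by (intro sum_emeasure) (auto simp: disjoint_family_on_def)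
    also have "(\<Union>k\<le>Suc n. ?C B n k) = B" using BM \<kappa>(2) by blast
    finally show ?thesis .
  qed
  have "(\<E> w. indicator B w * qv_from Z (\<tau> w) w) = (\<E> w. liminf (\<lambda>n. indicator B w * Q n w))"
  proof (rule nn_integral_cong)
    fix w assume "w \<in> space P"
    then show "indicator B w * qv_from Z (\<tau> w) w = liminf (\<lambda>n. indicator B w * Q n w)"
      using Qlim[of w] by (cases "w \<in> B") (simp_all add: Liminf_const)
  qed
  also have "\<dots> \<le> liminf (\<lambda>n. (\<E> w. indicator B w * Q n w))" by (rule nn_integral_liminf[OF Qm[OF B]])
  also have "\<dots> \<le> liminf (\<lambda>n. ennreal E * emeasure P B)" by (intro Liminf_mono always_eventually allI le)
  finally show "(\<E> w. indicator B w * qv_from Z (\<tau> w) w) \<le> ennreal E * emeasure P B" by (simp add: Liminf_const)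
qed

text \<open>The bound tested on all events of the \<sigma>-algebra at \<tau> is a bound on the
  conditional expectation by \<open>nn_cond_exp_le\<close>.\<close>

lemma energy_imp_BMO:
  assumes Zp: "predictable M T W Z" and E: "0 \<le> E"
    and en: "\<And>t B. t \<in> {0..T} \<Longrightarrow> B \<in> sets (F t) \<Longrightarrow> energy_bound Z t B E"
  shows "BMO_process M T W Z"
  unfolding BMO_process_def
proof (intro conjI Zp exI[of _ E] E allI impI)
  fix \<tau> assume "stopping_time F \<tau> \<and> \<tau> \<in> space M \<rightarrow> {0..T}"
  then have \<tau>: "stopping_time F \<tau>" "\<tau> \<in> space M \<rightarrow> {0..T}" by auto
  let ?G = "filtration.pre_sigma (space M) F \<tau>"
  have Wm: "\<And>t. t \<in> {0..T} \<Longrightarrow> W t \<in> borel_measurable M" using bm by (auto simp: brownian_motion_def)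
  interpret S: finite_measure_subalgebra P ?G
    by unfold_locales (rule subalgebra_pre_sigma_aug_filtration[OF Wm \<tau>])
  have "AE w in P. nn_cond_exp P ?G (\<lambda>w. qv_from Z (\<tau> w) w) w \<le> ennreal E"
    by (rule S.nn_cond_exp_le[OF energy_stopping_time(1)[OF Zp en \<tau>] E energy_stopping_time(2)[OF Zp en \<tau>]])
  then show "AE w in M. nn_cond_exp P ?G (\<lambda>w. \<integral>\<^sup>+ s \<in> {\<tau> w..T}. sqnorm (Z s w) \<partial>lborel) w \<le> ennreal E"
    unfolding AE_P qv_def .
qed

end

section \<open>The limiting supersolution\<close>

context bsde_limit
begin

lemma V_terminal: "AE w in M. V n T w = \<xi>n n w"
  using V_equation[of n] by eventually_elim (rule path_equation_terminal)

lemma Y_terminal: "AE w in M. Y T w = \<xi> w"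
proof -
  have "AE w in M. \<forall>n. V n T w = \<xi>n n w" using V_terminal by (simp add: AE_all_countable)
  then show ?thesis using V_limit \<xi>_limit
  proof eventually_elim
    case (elim w)
    have "T \<in> {0..T}" using T_pos by simp
    with elim(2) have "(\<lambda>n. V n T w) \<longlonglongrightarrow> Y T w" by blast
    then show ?case using elim(1,3) by (simp add: LIMSEQ_unique)
  qed
qed

text \<open>\<open>A\<close> is defined so that the equation holds, and it increases by the
  inequality for increments from \<open>limit_integrand\<close>. It is predictable as a continuous
  adapted process minus \<open>Y\<close>.\<close>

lemma limit_supersolution:
  obtains Z A where "bsde_supersolution M T W f \<xi> Y Z A" "BMO_process M T W Z"
proof -
  obtain Z I where Zp: "predictable M T W Z" and I: "ito Z I"
    and en: "\<And>t B. t \<in> {0..T} \<Longrightarrow> B \<in> sets (F t) \<Longrightarrow> energy_bound Z t B E"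
    and dec: "AE w in M. \<forall>s t. 0 \<le> s \<longrightarrow> s \<le> t \<longrightarrow> t \<le> T \<longrightarrow> set_integrable lborel {s..t} (\<lambda>q. drift Y Z q w) \<and>
      Y t w + (LINT q:{s..t}|lborel. drift Y Z q w) - (I t w - I s w) \<le> Y s w"
    by (rule limit_integrand) (rule that)
  note dm = driver_pred[OF drv Yp Zp]
  define J0 where "J0 t w = I t w - (LINT q:{0..t}|lborel. drift Y Z q w)" for t w
  \<comment> \<open>Zero on the null set of discontinuous paths; then \<open>Y 0 w + J t w\<close>
    is continuous in \<open>t\<close> for every \<open>w\<close> and
    \<open>predictable_continuous\<close> applies.\<close>
  define J where "J t w = (if continuous_on {0..T} (\<lambda>t. J0 t w) then J0 t w else 0)" for t w
  define A where "A t w = (Y 0 w + J t w) - Y t w" for t w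
  have si: "AE w in M. set_integrable lborel {0..T} (\<lambda>q. drift Y Z q w)"
    using dec by eventually_elim (use T_pos in auto)
  have head: "(LINT q:{0..t}|lborel. drift Y Z q w) = (LINT q:{0..T}|lborel. drift Y Z q w) - (LINT q:{t..T}|lborel. drift Y Z q w)"
    if "set_integrable lborel {0..T} (\<lambda>q. drift Y Z q w)" "t \<in> {0..T}" for t w
    using tail_integral_split[OF that(1), of 0 t] that(2) by simp
  have J0c: "AE w in M. continuous_on {0..T} (\<lambda>t. J0 t w)"
    using si ito_cont[OF I]
  proof eventually_elim
    case (elim w)
    have "continuous_on {0..T} (\<lambda>t. I t w - ((LINT q:{0..T}|lborel. drift Y Z q w) - (LINT q:{t..T}|lborel. drift Y Z q w)))"
      by (intro continuous_on_diff continuous_on_const elim(2) tail_integral_continuous[OF elim(1)])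
    then show ?case
      by (rule continuous_on_cong[OF refl, THEN iffD1, rotated]) (simp only: J0_def head[OF elim(1)])
  qed
  have JJ0: "AE w in M. \<forall>t. J t w = J0 t w" using J0c by eventually_elim (simp add: J_def)
  have Jc: "continuous_on {0..T} (\<lambda>t. J t w)" for w
    by (cases "continuous_on {0..T} (\<lambda>t. J0 t w)") (simp_all add: J_def)
  have Jm: "J t \<in> borel_measurable (F t)" if t: "t \<in> {0..T}" for t
  proof (rule F_AE_cong)
    show "J0 t \<in> borel_measurable (F t)"
      unfolding J0_def using t by (intro borel_measurable_diff ito_meas[OF I] lebesgue_integral_adapted[OF dm]) auto
    show "AE w in M. J0 t w = J t w" using JJ0 by eventually_elim simp
  qed
  have Y0m: "Y 0 \<in> borel_measurable (F t)" if t: "t \<in> {0..T}" for t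
    using T_pos t by (intro measurable_F_mono[OF adapted[OF Yp[unfolded predictable_def]]]) auto
  have Ap: "predictable M T W A"
    unfolding A_def
  proof (rule predictable_diff[OF predictable_continuous Yp])
    show "(\<lambda>w. Y 0 w + J t w) \<in> borel_measurable (F t)" if "t \<in> {0..T}" for t
      by (intro borel_measurable_add Y0m Jm that)
    show "continuous_on {0..T} (\<lambda>t. Y 0 w + J t w)" for w by (intro continuous_on_add continuous_on_const Jc)
  qed
  have Yr: "AE w in M. rcll_on T (\<lambda>t. Y t w)"
    using dec V_limit V_le_Y Y_bounded ito_cont[OF I] AE_space
  proof eventually_elim
    case (elim w)
    note w = sample_path_in[OF elim(6)]
    show ?case
    \<comment> \<open>As the drift is at least \<open>- m\<close>, subtracting
      \<open>I t w + m * t\<close> from \<open>Y t w\<close> leaves a decreasing function.\<close>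
    proof (rule rcll_on_increasing_limit[where V="\<lambda>n t. V n t w" and h="\<lambda>t. I t w + m * t"])
      show "continuous_on {0..T} (\<lambda>t. V n t w)" for n by (rule V_continuous[OF elim(6)])
      show "V n t w \<le> Y t w" if "t \<in> {0..T}" for n t using elim(3) that by blast
      show "(\<lambda>n. V n t w) \<longlonglongrightarrow> Y t w" if "t \<in> {0..T}" for t using elim(2) that by blast
      show "continuous_on {0..T} (\<lambda>t. I t w + m * t)" by (intro continuous_on_add elim(5) continuous_intros)
      fix s t assume st: "0 \<le> s" "s \<le> t" "t \<le> T"
      then have si: "set_integrable lborel {s..t} (\<lambda>q. drift Y Z q w)"
        and le: "Y t w + (LINT q:{s..t}|lborel. drift Y Z q w) - (I t w - I s w) \<le> Y s w" using elim(1) by blast+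
      have ci: "set_integrable lborel {s..t} (\<lambda>q. - m)"
        unfolding set_integrable_def by (intro borel_integrable_compact) auto
      have "(LINT q:{s..t}|lborel. - m) \<le> (LINT q:{s..t}|lborel. drift Y Z q w)"
      proof (rule set_integral_mono[OF ci si])
        fix q assume "q \<in> {s..t}"
        then have q: "q \<in> {0..T}" using st by auto
        show "- m \<le> drift Y Z q w" using elim(4) q by (intro m(2) q w) blast
      qed
      moreover have "(LINT q:{s..t}|lborel. - m) = - m * (t - s)" using st by (simp add: set_lebesgue_integral_def)
      ultimately show "Y t w - (I t w + m * t) \<le> Y s w - (I s w + m * s)" using le by (simp add: algebra_simps)
    qed
  qed
  have Aprop: "AE w in M. mono_on {0..T} (\<lambda>t. A t w) \<and> rcll_on T (\<lambda>t. A t w) \<and> A 0 w = 0"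
    using Yr dec si JJ0 ito_0[OF I]
  proof eventually_elim
    case (elim w)
    have "A s w \<le> A t w" if st: "s \<in> {0..T}" "t \<in> {0..T}" "s \<le> t" for s t
    proof -
      have "Y t w + (LINT q:{s..t}|lborel. drift Y Z q w) - (I t w - I s w) \<le> Y s w" using elim(2) st by auto
      moreover have "(LINT q:{s..T}|lborel. drift Y Z q w) = (LINT q:{s..t}|lborel. drift Y Z q w) + (LINT q:{t..T}|lborel. drift Y Z q w)"
        using st by (intro tail_integral_split[OF elim(3)]) auto
      ultimately show ?thesis
        using elim(4) head[OF elim(3) st(1)] head[OF elim(3) st(2)] unfolding A_def J0_def by simp
    qed
    moreover have "rcll_on T (\<lambda>t. A t w)"
      unfolding A_def by (intro rcll_on_diff_continuous[OF elim(1)] continuous_on_add continuous_on_const Jc)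
    moreover have "A 0 w = 0" using elim(4,5) by (simp add: A_def J0_def singleton_integral_zero)
    ultimately show ?case by (auto simp: mono_on_def)
  qed
  have int: "bsde_integrable M T W f Y Z"
    unfolding bsde_integrable_def
  proof
    show "AE w in M. (\<integral>\<^sup>+ s \<in> {0..T}. ennreal \<bar>drift Y Z s w\<bar> \<partial>lborel) < \<infinity>"
      using si
    proof eventually_elim
      case (elim w)
      have "(\<integral>\<^sup>+ s. ennreal (norm (indicator {0..T} s *\<^sub>R drift Y Z s w)) \<partial>lborel) < \<infinity>"
        using elim unfolding set_integrable_def integrable_iff_bounded by blast
      also have "(\<integral>\<^sup>+ s. ennreal (norm (indicator {0..T} s *\<^sub>R drift Y Z s w)) \<partial>lborel) = (\<integral>\<^sup>+ s \<in> {0..T}. ennreal \<bar>drift Y Z s w\<bar> \<partial>lborel)"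
        by (intro nn_integral_cong) (simp add: indicator_def)
      finally show ?case .
    qed
    have "(\<E> w. indicator (space M) w * qv_from Z 0 w) \<le> ennreal E * emeasure P (space M)"
      using T_pos sets.top[of "F 0"] by (intro en) auto
    also have "\<dots> < \<infinity>" using P.emeasure_space_1 by simp
    also have "(\<E> w. indicator (space M) w * qv_from Z 0 w) = (\<E> w. sqint Z w)"
      by (intro nn_integral_cong) (simp add: qv_def)
    finally have "AE w in P. sqint Z w \<noteq> \<infinity>" by (intro nn_integral_PInf_AE sqint_measurable[OF Zp]) simp
    then show "AE w in M. (\<integral>\<^sup>+ s \<in> {0..T}. sqnorm (Z s w) \<partial>lborel) < \<infinity>"
      unfolding AE_P qv_def by eventually_elim (simp add: less_top)
  qed
  have eq: "AE w in M. Y t w = \<xi> w + (LINT s:{t..T}|lborel. drift Y Z s w) - (I T w - I t w) + A T w - A t w"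
    if t: "t \<in> {0..T}" for t
    using Y_terminal si JJ0
  proof eventually_elim
    case (elim w)
    then show ?case using head[OF elim(2) t] by (simp add: A_def J0_def)
  qed
  have "bsde_supersolution M T W f \<xi> Y Z A"
    unfolding bsde_supersolution_def
    by (intro conjI exI[of _ I] ballI eq drv \<xi>_measurable Yp Zp Ap Yr Aprop int I)
  then show thesis by (rule that[OF _ energy_imp_BMO[OF Zp E(1) en]])
qed

text \<open>Comparison holds for each \<open>V n\<close>, because
  \<open>\<xi>n n \<le> \<xi> \<le> \<xi>'\<close>, and passes to the limit.\<close>

lemma limit_comparison:
  assumes c: "\<And>n. AE w in M. \<bar>\<xi>n n w\<bar> \<le> c" and le: "\<And>n. AE w in M. \<xi>n n w \<le> \<xi> w"
  shows "bounded_comparison_from_above M T W f \<xi> Y"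
  unfolding bounded_comparison_from_above_def
proof (intro allI impI ballI)
  fix f' \<xi>' Y' Z' A' t
  assume H: "(\<forall>t\<in>{0..T}. \<forall>w\<in>path_space T. \<forall>y z. f t w y z \<le> f' t w y z) \<and> (AE w in M. \<xi> w \<le> \<xi>' w) \<and>
    bsde_supersolution M T W f' \<xi>' Y' Z' A' \<and> bounded_process M T Y'" and t: "t \<in> {0..T}"
  then have S: "bsde_supersolution M T W f' \<xi>' Y' Z' A'" "bounded_process M T Y'"
    and f': "\<And>t w y z. t \<in> {0..T} \<Longrightarrow> w \<in> path_space T \<Longrightarrow> f t w y z \<le> f' t w y z" by blast+
  have "AE w in M. \<forall>t\<in>{0..T}. V n t w \<le> Y' t w" for n
  proof (rule regular_solution_le_supersolution[OF regular c _ f' S])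
    show "AE w in M. \<xi>n n w \<le> \<xi>' w" using le[of n] conjunct1[OF conjunct2[OF H]] by eventually_elim (rule order_trans)
  qed
  then have "AE w in M. \<forall>n. \<forall>t\<in>{0..T}. V n t w \<le> Y' t w" by (simp add: AE_all_countable)
  then show "AE w in M. Y t w \<le> Y' t w"
    using V_limit
  proof eventually_elim
    case (elim w)
    then have "(\<lambda>n. V n t w) \<longlonglongrightarrow> Y t w" "\<And>n. V n t w \<le> Y' t w" using t by blast+
    then show ?case by (intro LIMSEQ_le_const2) auto
  qed
qed

end

text \<open>The limit is formed from continuous versions of the \<open>Yn\<close>, which agree with
  them almost surely at each fixed time.\<close>

theorem theorem2p7:
  fixes M :: "'a measure"
    and T :: real
    and W :: "real \<Rightarrow> 'a \<Rightarrow> real ^ 'd"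
    and f :: "'d driver"
    and \<phi>n :: "nat \<Rightarrow> (real \<Rightarrow> real ^ 'd) \<Rightarrow> real"
    and \<phi> :: "(real \<Rightarrow> real ^ 'd) \<Rightarrow> real"
    and Yn :: "nat \<Rightarrow> real \<Rightarrow> 'a \<Rightarrow> real"
    and Zn :: "nat \<Rightarrow> real \<Rightarrow> 'a \<Rightarrow> real ^ 'd"
  assumes "prob_space M" and "0 < T" and "brownian_motion M T W"
    and "driver T f"
    and "f1 T f" and "f2 T f" and "f3 T f" and "f4 T f" and "f5 T f"
    and "increasing_in_y T f"
    and "\<And>n. bounded (\<phi>n n ` path_space T)"
    and "\<And>n. lipschitz_functional T (\<phi>n n)"
    and "bounded (\<phi> ` path_space T)"
    and "\<And>w. w \<in> path_space T \<Longrightarrow> incseq (\<lambda>n. \<phi>n n w) \<and> (\<lambda>n. \<phi>n n w) \<longlonglongrightarrow> \<phi> w"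
    and "\<And>n. bsde_solution M T W f (\<lambda>\<omega>. \<phi>n n (sample_path T W \<omega>)) (Yn n) (Zn n)"
    and "\<And>n. bounded_process M T (Zn n)"
  shows "\<exists>Y Z A.
    bsde_supersolution M T W f (\<lambda>\<omega>. \<phi> (sample_path T W \<omega>)) Y Z A \<and>
    bounded_comparison_from_above M T W f (\<lambda>\<omega>. \<phi> (sample_path T W \<omega>)) Y \<and>
    bounded_process M T Y \<and>
    BMO_process M T W Z \<and>
    (\<forall>t\<in>{0..T}. AE \<omega> in M. incseq (\<lambda>n. Yn n t \<omega>) \<and> (\<lambda>n. Yn n t \<omega>) \<longlonglongrightarrow> Y t \<omega>)"
proof -
  obtain K where K: "0 \<le> K" "\<And>t w1 w2 y1 y2 z. t \<in> {0..T} \<Longrightarrow> w1 \<in> path_space T \<Longrightarrow> w2 \<in> path_space T \<Longrightarrow>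
      \<bar>f t w1 y1 z - f t w2 y2 z\<bar> \<le> K * ((\<Squnion>s\<in>{0..t}. norm (w1 s - w2 s)) + \<bar>y1 - y2\<bar>)"
    using \<open>f3 T f\<close> unfolding f3_def by blast
  \<comment> \<open>For equal paths the supremum in (f3) vanishes.\<close>
  have lip: "\<bar>f t w y1 z - f t w y2 z\<bar> \<le> K * \<bar>y1 - y2\<bar>" if "t \<in> {0..T}" "w \<in> path_space T" for t w y1 y2 z
    using K(2)[OF that(1,2,2), of y1 z y2] that(1) by simp
  interpret bsde_setup M T W f K
    by (intro bsde_setup.intro brownian_setup.intro bsde_setup_axioms.intro brownian_setup_axioms.intro assms K(1) lip)
  define \<xi>n where "\<xi>n n w = \<phi>n n (sample_path T W w)" for n w
  define \<xi> where "\<xi> w = \<phi> (sample_path T W w)" for w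
  have sol: "bsde_solution M T W f (\<xi>n n) (Yn n) (Zn n)" for n using assms(15) by (simp add: \<xi>n_def[abs_def])
  have \<xi>_inc: "incseq (\<lambda>n. \<xi>n n w)" "(\<lambda>n. \<xi>n n w) \<longlonglongrightarrow> \<xi> w" if "w \<in> space M" for w
    using assms(14)[OF sample_path_in[OF that]] by (simp_all add: \<xi>n_def \<xi>_def)
  have \<xi>_le: "\<xi>n n w \<le> \<xi> w" if "w \<in> space M" for n w using incseq_le[OF \<xi>_inc[OF that]] .
  obtain c1 where c1: "\<And>w. w \<in> path_space T \<Longrightarrow> \<bar>\<phi> w\<bar> \<le> c1" using assms(13) by (auto simp: bounded_iff)
  obtain c0 where c0: "\<And>w. w \<in> path_space T \<Longrightarrow> \<bar>\<phi>n 0 w\<bar> \<le> c0" using assms(11)[of 0] by (auto simp: bounded_iff)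
  define c where "c = max c0 c1"
  have \<xi>_bound: "AE w in M. \<bar>\<xi>n n w\<bar> \<le> c" for n
    using AE_space
  proof eventually_elim
    case (elim w)
    have "\<xi>n 0 w \<le> \<xi>n n w" using \<xi>_inc(1)[OF elim] by (simp add: incseq_def)
    moreover have "\<bar>\<xi>n 0 w\<bar> \<le> c0" "\<bar>\<xi> w\<bar> \<le> c1" using c0 c1 sample_path_in[OF elim] by (simp_all add: \<xi>n_def \<xi>_def)
    ultimately show ?case using \<xi>_le[OF elim, of n] unfolding c_def by linarith
  qed
  have \<xi>m: "\<xi> \<in> borel_measurable (F T)"
  proof (rule borel_measurable_LIMSEQ_real)
    show "(\<lambda>n. \<xi>n n w) \<longlonglongrightarrow> \<xi> w" if "w \<in> space (F T)" for w using that \<xi>_inc(2) by simp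
    show "\<xi>n n \<in> borel_measurable (F T)" for n using sol[of n] by (simp add: bsde_solution_def)
  qed
  have "\<exists>V I. regular_solution (\<xi>n n) V (Zn n) I \<and> (\<forall>t\<in>{0..T}. AE w in M. V t w = Yn n t w)" for n
    by (rule solution_regular[OF sol[of n] assms(16)[of n]]) blast
  then obtain V I where R: "\<And>n. regular_solution (\<xi>n n) (V n) (Zn n) (I n)"
    and VY: "\<And>n t. t \<in> {0..T} \<Longrightarrow> AE w in M. V n t w = Yn n t w" by metis
  have "AE w in M. \<forall>t\<in>{0..T}. V n t w \<le> V (Suc n) t w" for n
  proof (rule regular_solution_mono[OF R \<xi>_bound _ R \<xi>_bound])
    show "AE w in M. \<xi>n n w \<le> \<xi>n (Suc n) w"
      using AE_space by eventually_elim (use \<xi>_inc(1) in \<open>simp add: incseq_Suc_iff\<close>)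
  qed
  then have mono: "AE w in M. \<forall>n. \<forall>t\<in>{0..T}. V n t w \<le> V (Suc n) t w" by (simp add: AE_all_countable)
  obtain C1 where C1: "\<And>\<xi> V Z I. regular_solution \<xi> V Z I \<Longrightarrow> AE w in M. \<bar>\<xi> w\<bar> \<le> c \<Longrightarrow> AE w in M. \<forall>t\<in>{0..T}. V t w \<le> C1"
    by (rule regular_solution_upper_bound) (rule that)
  have "AE w in M. \<forall>t\<in>{0..T}. V n t w \<le> C1" for n by (rule C1[OF R \<xi>_bound])
  then have upper: "AE w in M. \<forall>n. \<forall>t\<in>{0..T}. V n t w \<le> C1" by (simp add: AE_all_countable)
  \<comment> \<open>This bound on \<open>V 0\<close> depends on the bound of its own integrand, but
    by monotonicity in \<open>n\<close> the lower bound it gives serves all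
    \<open>n\<close>.\<close>
  obtain C0 where C0: "AE w in M. \<forall>t\<in>{0..T}. \<bar>V 0 t w\<bar> \<le> C0" by (rule regular_solution_bounded[OF R \<xi>_bound])
  define C where "C = \<bar>C0\<bar> + \<bar>C1\<bar>"
  have C: "0 \<le> C" by (simp add: C_def)
  \<comment> \<open>A limit at every point, so that \<open>Y\<close> is predictable; it is the
    increasing limit outside one null set common to all times.\<close>
  define Y where "Y t w = lim (\<lambda>n. V n t w)" for t w
  have Yp: "predictable M T W Y"
    unfolding predictable_def Y_def split_beta'
    by (intro borel_measurable_lim_metric) (use R in \<open>simp add: regular_solution_def predictable_def split_beta'\<close>)
  have V_limit: "AE w in M. \<forall>t\<in>{0..T}. incseq (\<lambda>n. V n t w) \<and> (\<lambda>n. V n t w) \<longlonglongrightarrow> Y t w \<and> (\<forall>n. \<bar>V n t w\<bar> \<le> C)"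
    using mono upper C0
  proof eventually_elim
    case (elim w)
    show ?case
    proof
      fix t assume t: "t \<in> {0..T}"
      have inc: "incseq (\<lambda>n. V n t w)" using elim(1) t by (simp add: incseq_Suc_iff)
      have up: "V n t w \<le> C1" for n using elim(2) t by blast
      obtain l where "(\<lambda>n. V n t w) \<longlonglongrightarrow> l" using incseq_convergent[OF inc, of C1] up by blast
      then have "(\<lambda>n. V n t w) \<longlonglongrightarrow> Y t w" unfolding Y_def by (simp add: limI)
      moreover have "\<bar>V n t w\<bar> \<le> C" for n
      proof -
        have "V 0 t w \<le> V n t w" using inc by (simp add: incseq_def)
        moreover have "\<bar>V 0 t w\<bar> \<le> C0" using elim(3) t by blast
        ultimately show ?thesis using up[of n] unfolding C_def by linarith
      qed
      ultimately show "incseq (\<lambda>n. V n t w) \<and> (\<lambda>n. V n t w) \<longlonglongrightarrow> Y t w \<and> (\<forall>n. \<bar>V n t w\<bar> \<le> C)" using inc by blast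
    qed
  qed
  obtain E where E: "0 \<le> E" "\<And>\<xi> V Z I t B. regular_solution \<xi> V Z I \<Longrightarrow> AE w in M. \<forall>t\<in>{0..T}. \<bar>V t w\<bar> \<le> C \<Longrightarrow>
    t \<in> {0..T} \<Longrightarrow> B \<in> sets (F t) \<Longrightarrow> energy_bound Z t B E"
    by (rule regular_solution_energy[OF C]) (rule that)
  obtain m where m: "0 \<le> m" "\<And>t w y z. t \<in> {0..T} \<Longrightarrow> w \<in> path_space T \<Longrightarrow> \<bar>y\<bar> \<le> C \<Longrightarrow> - m \<le> f t w y z"
    by (rule driver_lower_bound[OF C]) (rule that)
  have V_bound: "AE w in M. \<forall>t\<in>{0..T}. \<bar>V n t w\<bar> \<le> C" for n using V_limit by eventually_elim blast
  interpret L: bsde_limit M T W f K \<xi>n \<xi> V Zn I Y C E m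
  proof
    show "AE w in M. (\<lambda>n. \<xi>n n w) \<longlonglongrightarrow> \<xi> w" using AE_space by eventually_elim (rule \<xi>_inc)
    show "energy_bound (Zn n) t B E" if "t \<in> {0..T}" "B \<in> sets (F t)" for n t B
      by (rule E(2)[OF R V_bound that])
  qed (fact R \<xi>m Yp V_limit E(1) m)+
  obtain Z A where ZA: "bsde_supersolution M T W f \<xi> Y Z A" "BMO_process M T W Z" by (rule L.limit_supersolution)
  have cmp: "bounded_comparison_from_above M T W f \<xi> Y"
  proof (rule L.limit_comparison[OF \<xi>_bound])
    show "AE w in M. \<xi>n n w \<le> \<xi> w" for n using AE_space by eventually_elim (rule \<xi>_le)
  qed
  have bdd: "bounded_process M T Y"
    unfolding bounded_process_def
  proof (intro exI[of _ C] ballI)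
    fix t assume "t \<in> {0..T}"
    with L.Y_bounded show "AE w in M. norm (Y t w) \<le> C" by (auto elim!: eventually_mono)
  qed
  have conv: "AE w in M. incseq (\<lambda>n. Yn n t w) \<and> (\<lambda>n. Yn n t w) \<longlonglongrightarrow> Y t w" if t: "t \<in> {0..T}" for t
  proof -
    have "AE w in M. \<forall>n. V n t w = Yn n t w" using VY[OF t] by (simp add: AE_all_countable)
    then show ?thesis using V_limit
    proof eventually_elim
      case (elim w)
      then have "incseq (\<lambda>n. V n t w) \<and> (\<lambda>n. V n t w) \<longlonglongrightarrow> Y t w" using t by blast
      then show ?case using elim(1) by simp
    qed
  qed
  from ZA cmp bdd conv show ?thesis unfolding \<xi>_def[abs_def] by blast
qed

end
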